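(* Let $(E,w)$ be a finite vertex weighted graph, $\mathsf{k}$ a field, and $P$ a finitely generated projective generator for the category of left $L_{\mathsf{k}}(E,w)$-modules. Then there exist a positive integer $n$ and a hair extension $(E^+,w^+)$ of $(E,w)$ such that $$\mathbb{M}_n\big(\mathrm{End}_{L_{\mathsf{k}}(E,w)}(P)\big)\;\cong\; L_{\mathsf{k}}(E^+,w^+)$$ as $\mathsf{k}$-algebras.
   Context: A (directed) graph is a quadruple $E=(E^0,E^1,s,r)$ with sets $E^0$ (vertices) and $E^1$ (edges) and maps $s,r:E^1\to E^0$ (source, range). It is finite if $E^0,E^1$ are finite, and row-finite if each vertex emits finitely many edges ($s^{-1}(v)$ is finite for all $v$). A vertex is a sink if it emits no edges; it is regular if it is not a sink and emits only finitely many edges; $E^0_{\mathrm{reg}}$ is the set of regular vertices. A weighted graph is a pair $(E,w)$ with $E$ a graph and $w:E^1\to\mathbb{N}^+$ a map ($\mathbb{N}^+$ = positive integers). It is finite (row-finite) if $E$ is. For $v\in E^0_{\mathrm{reg}}$ set $w(v):=\max\{w(e): e\in s^{-1}(v)\}$. A row-finite weighted graph is a vertex weighted graph if for every $v\in E^0_{\mathrm{reg}}$ one has $w(e)=w(e')$ for all $e,e'\in s^{-1}(v)$. For a row-finite weighted graph $(E,w)$ and a field $\mathsf{k}$, the weighted Leavitt path algebra $L_{\mathsf{k}}(E,w)$ is the (associative) $\mathsf{k}$-algebra generated by $\{v,e_i,e_i^*: v\in E^0, e\in E^1, 1\le i\le w(e)\}$ subject to the relations (i) $uv=\delta_{uv}u$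 for $u,v\in E^0$; (ii) $s(e)e_i=e_i=e_ir(e)$ and $r(e)e_i^*=e_i^*=e_i^*s(e)$ for $e\in E^1$, $1\le i\le w(e)$; (iii) $\sum_{e\in s^{-1}(v)}e_ie_j^*=\delta_{ij}v$ for $v\in E^0_{\mathrm{reg}}$, $1\le i,j\le w(v)$; (iv) $\sum_{1\le i\le w(v)}e_i^*f_i=\delta_{ef}r(e)$ for $v\in E^0_{\mathrm{reg}}$, $e,f\in s^{-1}(v)$; where in (iii),(iv) $e_i$ and $e_i^*$ are set to be zero whenever $i>w(e)$. If $(E,w)$ is finite, $L_{\mathsf{k}}(E,w)$ is unital with identity $\sum_{v\in E^0}v$. Hair extension: let $(E,w)$ be a finite weighted graph with $E^0=\{v_1,\dots,v_t\}$ and let $n_1,\dots,n_t$ be positive integers. The hair extension $(E^+(n_1,\dots,n_t),w^+)$ of $(E,w)$ is obtained from $(E,w)$ by adding, for each $i$, new vertices $v_i^1,\dots,v_i^{n_i-1}$ and new edges $e_i^1,\dots,e_i^{n_i-1}$, with $s(e_i^j)=v_i^j$ and $r(e_i^j)=v_i^{j-1}$, where $v_i^0:=v_i$ (nothing is added at $v_i$ if $n_i=1$); $w^+$ extends $w$ with $w^+(e_i^j)=1$ for all $1\le i\le t$, $1\le j\le n_i-1$. A hair extension of $(E,w)$ is any such weighted graph, for some choice of positive integers $n_1,\dots,n_t$. $\mathbb{M}_n(R)$ denotes the ring of $n\times n$ matrices over $R$. *)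

theory Defs
  imports
    "Graph_Theory.Digraph"
    "HOL-Algebra.QuotRing"
    "HOL-Algebra.Module"
    "HOL-Library.Poly_Mapping"
    "Jordan_Normal_Form.Matrix"
begin

section \<open>Weighted graphs\<close>

definition row_finite :: "('v, 'e) pre_digraph \<Rightarrow> bool" where
  "row_finite E \<longleftrightarrow> (\<forall>v\<in>verts E. finite (out_arcs E v))"

definition regular_verts :: "('v, 'e) pre_digraph \<Rightarrow> 'v set" where
  "regular_verts E = {v \<in> verts E. out_arcs E v \<noteq> {} \<and> finite (out_arcs E v)}"

locale weighted_graph = wf_digraph E
  for E :: "('v, 'e) pre_digraph" and w :: "'e \<Rightarrow> nat" +
  assumes weight_pos: "e \<in> arcs E \<Longrightarrow> 1 \<le> w e"

definition vertex_weight :: "('v, 'e) pre_digraph \<Rightarrow> ('e \<Rightarrow> nat) \<Rightarrow> 'v \<Rightarrow> nat" where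
  "vertex_weight E w v = Max (w ` out_arcs E v)"

locale vertex_weighted_graph = weighted_graph +
  assumes row_finite: "row_finite E"
    and weight_const:
      "v \<in> regular_verts E \<Longrightarrow> e \<in> out_arcs E v \<Longrightarrow> e' \<in> out_arcs E v \<Longrightarrow> w e = w e'"

text \<open>
  The vertex \<open>(v, 0)\<close> is the old vertex \<open>v\<close>; for \<open>0 < j < h v\<close> the pair \<open>(v, j)\<close> is the
  \<open>j\<close>-th hair vertex at \<open>v\<close>, and \<open>Inr (v, j)\<close> is the edge from it to \<open>(v, j - 1)\<close>.
\<close>

definition hair_graph ::
    "('v, 'e) pre_digraph \<Rightarrow> ('v \<Rightarrow> nat) \<Rightarrow> ('v \<times> nat, 'e + 'v \<times> nat) pre_digraph" where
  "hair_graph E h =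
    \<lparr>verts = {(v, j). v \<in> verts E \<and> j < h v},
     arcs = Inl ` arcs E \<union> Inr ` {(v, j). v \<in> verts E \<and> 1 \<le> j \<and> j < h v},
     tail = case_sum (\<lambda>e. (tail E e, 0)) (\<lambda>(v, j). (v, j)),
     head = case_sum (\<lambda>e. (head E e, 0)) (\<lambda>(v, j). (v, j - 1))\<rparr>"

definition hair_weight :: "('e \<Rightarrow> nat) \<Rightarrow> ('e + 'v \<times> nat \<Rightarrow> nat)" where
  "hair_weight w = case_sum w (\<lambda>_. 1)"

definition hair_extension ::
    "('v, 'e) pre_digraph \<Rightarrow> ('e \<Rightarrow> nat) \<Rightarrow>
     ('v \<times> nat, 'e + 'v \<times> nat) pre_digraph \<Rightarrow> ('e + 'v \<times> nat \<Rightarrow> nat) \<Rightarrow> bool" where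
  "hair_extension E w E' w' \<longleftrightarrow>
    (\<exists>h. (\<forall>v\<in>verts E. 0 < h v) \<and> E' = hair_graph E h \<and> w' = hair_weight w)"


section \<open>Weighted Leavitt path algebras\<close>

text \<open>
  The free monoid, written additively so that finitely supported functions on it with values in
  \<open>'k\<close> carry the convolution product of the free algebra.
\<close>

datatype 'g fmon = FMon (letters: "'g list")

instantiation fmon :: (type) monoid_add
begin

definition zero_fmon :: "'g fmon" where "zero_fmon = FMon []"

definition plus_fmon :: "'g fmon \<Rightarrow> 'g fmon \<Rightarrow> 'g fmon" where
  "plus_fmon x y = FMon (letters x @ letters y)"

instance
  by standard (simp_all add: zero_fmon_def plus_fmon_def)

end

definition free_algebra :: "'g set \<Rightarrow> ('g fmon \<Rightarrow>\<^sub>0 'k::field) ring" where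
  "free_algebra X =
    \<lparr>carrier = {p. \<forall>m\<in>Poly_Mapping.keys p. set (letters m) \<subseteq> X},
     monoid.mult = (*), one = 1, zero = 0, add = (+)\<rparr>"

text \<open>The free associative algebra without identity: no constant term.\<close>

definition augmentation :: "'g set \<Rightarrow> ('g fmon \<Rightarrow>\<^sub>0 'k::field) set" where
  "augmentation X = {p \<in> carrier (free_algebra X). Poly_Mapping.lookup p 0 = 0}"

datatype ('v, 'e) wgen = Vtx 'v | Edge 'e nat | Ghost 'e nat

definition wgens :: "('v, 'e) pre_digraph \<Rightarrow> ('e \<Rightarrow> nat) \<Rightarrow> ('v, 'e) wgen set" where
  "wgens E w = {Vtx v | v. v \<in> verts E} \<union>
    {Edge e i | e i. e \<in> arcs E \<and> 1 \<le> i \<and> i \<le> w e} \<union>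
    {Ghost e i | e i. e \<in> arcs E \<and> 1 \<le> i \<and> i \<le> w e}"

definition gen :: "'g \<Rightarrow> 'g fmon \<Rightarrow>\<^sub>0 'k::field" where
  "gen g = Poly_Mapping.single (FMon [g]) 1"

definition vtx :: "'v \<Rightarrow> ('v, 'e) wgen fmon \<Rightarrow>\<^sub>0 'k::field" where
  "vtx v = gen (Vtx v)"

definition edge :: "('e \<Rightarrow> nat) \<Rightarrow> 'e \<Rightarrow> nat \<Rightarrow> ('v, 'e) wgen fmon \<Rightarrow>\<^sub>0 'k::field" where
  "edge w e i = (if i \<le> w e then gen (Edge e i) else 0)"

definition ghost :: "('e \<Rightarrow> nat) \<Rightarrow> 'e \<Rightarrow> nat \<Rightarrow> ('v, 'e) wgen fmon \<Rightarrow>\<^sub>0 'k::field" where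
  "ghost w e i = (if i \<le> w e then gen (Ghost e i) else 0)"

inductive_set wlp_relators ::
    "('v, 'e) pre_digraph \<Rightarrow> ('e \<Rightarrow> nat) \<Rightarrow> (('v, 'e) wgen fmon \<Rightarrow>\<^sub>0 'k::field) set"
  for E :: "('v, 'e) pre_digraph" and w :: "'e \<Rightarrow> nat" where
  vtx_vtx: "u \<in> verts E \<Longrightarrow> v \<in> verts E \<Longrightarrow>
    vtx u * vtx v - (if u = v then vtx u else 0) \<in> wlp_relators E w"
| tail_edge: "e \<in> arcs E \<Longrightarrow> 1 \<le> i \<Longrightarrow> i \<le> w e \<Longrightarrow>
    vtx (tail E e) * edge w e i - edge w e i \<in> wlp_relators E w"
| edge_head: "e \<in> arcs E \<Longrightarrow> 1 \<le> i \<Longrightarrow> i \<le> w e \<Longrightarrow>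
    edge w e i * vtx (head E e) - edge w e i \<in> wlp_relators E w"
| head_ghost: "e \<in> arcs E \<Longrightarrow> 1 \<le> i \<Longrightarrow> i \<le> w e \<Longrightarrow>
    vtx (head E e) * ghost w e i - ghost w e i \<in> wlp_relators E w"
| ghost_tail: "e \<in> arcs E \<Longrightarrow> 1 \<le> i \<Longrightarrow> i \<le> w e \<Longrightarrow>
    ghost w e i * vtx (tail E e) - ghost w e i \<in> wlp_relators E w"
| edge_ghost: "v \<in> regular_verts E \<Longrightarrow>
    1 \<le> i \<Longrightarrow> i \<le> vertex_weight E w v \<Longrightarrow> 1 \<le> j \<Longrightarrow> j \<le> vertex_weight E w v \<Longrightarrow>
    (\<Sum>e\<in>out_arcs E v. edge w e i * ghost w e j) - (if i = j then vtx v else 0)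
      \<in> wlp_relators E w"
| ghost_edge: "v \<in> regular_verts E \<Longrightarrow> e \<in> out_arcs E v \<Longrightarrow> f \<in> out_arcs E v \<Longrightarrow>
    (\<Sum>i=1..vertex_weight E w v. ghost w e i * edge w f i) - (if e = f then vtx (head E e) else 0)
      \<in> wlp_relators E w"

definition wlp_ideal ::
    "('v, 'e) pre_digraph \<Rightarrow> ('e \<Rightarrow> nat) \<Rightarrow> (('v, 'e) wgen fmon \<Rightarrow>\<^sub>0 'k::field) set" where
  "wlp_ideal E w = genideal (free_algebra (wgens E w)) (wlp_relators E w)"

type_synonym ('k, 'v, 'e) wlp = "(('v, 'e) wgen fmon \<Rightarrow>\<^sub>0 'k) set"

text \<open>
  The relators have no constant term, so the ideal they generate in the free algebra with identity
  is also the ideal (and \<open>'k\<close>-subspace) they generate in the free algebra without identity.  The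
  generated algebra is hence the image of the augmentation ideal in the quotient.  The record
  field \<open>one\<close> is the sum of the vertices, and is meaningful only if there are finitely many of them.
\<close>

definition wlpa ::
    "('v, 'e) pre_digraph \<Rightarrow> ('e \<Rightarrow> nat) \<Rightarrow> ('k::field, ('k, 'v, 'e) wlp) module" where
  "wlpa E w =
    (let F = free_algebra (wgens E w); J = wlp_ideal E w; Q = F Quot J in
     \<lparr>carrier = (\<lambda>p. J +>\<^bsub>F\<^esub> p) ` augmentation (wgens E w),
      monoid.mult = monoid.mult Q,
      one = J +>\<^bsub>F\<^esub> (\<Sum>v\<in>verts E. vtx v),
      zero = zero Q,
      add = add Q,
      smult = (\<lambda>c x. (J +>\<^bsub>F\<^esub> Poly_Mapping.single 0 c) \<otimes>\<^bsub>Q\<^esub> x)\<rparr>)"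


text \<open>
  For a graph with finitely many vertices the sum of the vertices is indeed an identity, see
  \<open>ring_wlpa\<close> below.
\<close>

lemma free_algebra_simps [simp]:
  "monoid.mult (free_algebra X) = (*)" "one (free_algebra X) = 1"
  "zero (free_algebra X) = 0" "add (free_algebra X) = (+)"
  by (simp_all add: free_algebra_def)

lemma mem_free_algebra:
  "p \<in> carrier (free_algebra X) \<longleftrightarrow> (\<forall>m\<in>Poly_Mapping.keys p. set (letters m) \<subseteq> X)"
  by (simp add: free_algebra_def)

lemma free_algebra_closed:
  assumes "p \<in> carrier (free_algebra X)" and "q \<in> carrier (free_algebra X)"
  shows "p + q \<in> carrier (free_algebra X)" "p * q \<in> carrier (free_algebra X)"
    "- p \<in> carrier (free_algebra X)" "p - q \<in> carrier (free_algebra X)"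
proof -
  have keys: "Poly_Mapping.keys (- p) \<subseteq> Poly_Mapping.keys p \<union> Poly_Mapping.keys q"
    "Poly_Mapping.keys (p - q) \<subseteq> Poly_Mapping.keys p \<union> Poly_Mapping.keys q"
    "Poly_Mapping.keys (p + q) \<subseteq> Poly_Mapping.keys p \<union> Poly_Mapping.keys q"
    by (auto simp: in_keys_iff lookup_minus lookup_add)
  have all: "\<forall>m \<in> Poly_Mapping.keys p \<union> Poly_Mapping.keys q. set (letters m) \<subseteq> X"
    using assms unfolding mem_free_algebra by blast
  show "- p \<in> carrier (free_algebra X)" "p - q \<in> carrier (free_algebra X)"
    "p + q \<in> carrier (free_algebra X)"
    unfolding mem_free_algebra using keys all by blast+
  show "p * q \<in> carrier (free_algebra X)"
    unfolding mem_free_algebra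
  proof
    fix m assume "m \<in> Poly_Mapping.keys (p * q)"
    then obtain a b where "m = a + b" "a \<in> Poly_Mapping.keys p" "b \<in> Poly_Mapping.keys q"
      using keys_mult[of p q] by blast
    then show "set (letters m) \<subseteq> X" using assms by (auto simp: mem_free_algebra plus_fmon_def)
  qed
qed

lemma free_algebra_0_1: "0 \<in> carrier (free_algebra X)" "1 \<in> carrier (free_algebra X)"
  by (auto simp: mem_free_algebra zero_fmon_def)

lemma ring_free_algebra: "ring (free_algebra X)"
proof (rule ringI)
  show "abelian_group (free_algebra X)"
  proof (rule abelian_groupI)
    fix p assume p: "p \<in> carrier (free_algebra X)"
    show "\<exists>q\<in>carrier (free_algebra X). q \<oplus>\<^bsub>free_algebra X\<^esub> p = \<zero>\<^bsub>free_algebra X\<^esub>"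
      by (rule bexI[of _ "- p"]) (simp_all add: free_algebra_closed(3)[OF p p])
  qed (auto simp: free_algebra_closed free_algebra_0_1 add_ac)
  show "Group.monoid (free_algebra X)"
    by (rule monoidI) (auto simp: free_algebra_closed free_algebra_0_1 mult.assoc)
qed (simp_all add: distrib_left distrib_right)

lemma ideal_augmentation:
  fixes X :: "'g set"
  shows "ideal (augmentation X :: ('g fmon \<Rightarrow>\<^sub>0 'k::field) set) (free_algebra X)"
proof -
  interpret ring "free_algebra X :: ('g fmon \<Rightarrow>\<^sub>0 'k) ring" by (rule ring_free_algebra)
  have inv: "\<ominus>\<^bsub>free_algebra X\<^esub> p = - p" if "p \<in> carrier (free_algebra X)" for p :: "'g fmon \<Rightarrow>\<^sub>0 'k"
    using free_algebra_closed(3)[OF that that] that by (intro minus_equality) simp_all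
  have mem: "p \<in> augmentation X \<longleftrightarrow> p \<in> carrier (free_algebra X) \<and> 0 \<notin> Poly_Mapping.keys p"
    for p :: "'g fmon \<Rightarrow>\<^sub>0 'k"
    by (simp add: augmentation_def in_keys_iff)
  have *: "0 \<notin> Poly_Mapping.keys (p * q)" if "0 \<notin> Poly_Mapping.keys p \<or> 0 \<notin> Poly_Mapping.keys q"
    for p q :: "'g fmon \<Rightarrow>\<^sub>0 'k"
  proof
    assume "0 \<in> Poly_Mapping.keys (p * q)"
    then obtain a b where "0 = a + b" "a \<in> Poly_Mapping.keys p" "b \<in> Poly_Mapping.keys q"
      using keys_mult[of p q] by blast
    moreover have "a = 0 \<and> b = 0"
    proof -
      have "letters (a + b) = []" using \<open>0 = a + b\<close> by (metis fmon.sel zero_fmon_def)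
      then show ?thesis by (auto simp: plus_fmon_def zero_fmon_def intro: fmon.expand)
    qed
    ultimately show False using that by auto
  qed
  show ?thesis
  proof (rule idealI)
    show "ring (free_algebra X :: ('g fmon \<Rightarrow>\<^sub>0 'k) ring)" by (rule ring_free_algebra)
    show "subgroup (augmentation X) (add_monoid (free_algebra X :: ('g fmon \<Rightarrow>\<^sub>0 'k) ring))"
    proof
      fix x :: "'g fmon \<Rightarrow>\<^sub>0 'k" assume "x \<in> augmentation X"
      moreover from this have "\<ominus>\<^bsub>free_algebra X\<^esub> x = - x" by (intro inv) (simp add: mem)
      ultimately show "inv\<^bsub>add_monoid (free_algebra X)\<^esub> x \<in> augmentation X"
        unfolding a_inv_def[symmetric]
        using free_algebra_closed(3)[of x X x] by (simp add: augmentation_def)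
    qed (auto simp: augmentation_def free_algebra_closed free_algebra_0_1 lookup_add)
  qed (use * in \<open>auto simp: mem free_algebra_closed\<close>)
qed

lemma gen_mem: "g \<in> X \<Longrightarrow> gen g \<in> augmentation X"
  by (auto simp: gen_def augmentation_def mem_free_algebra lookup_single zero_fmon_def when_def)

lemma augmentation_closed:
  "p \<in> augmentation X \<Longrightarrow> q \<in> augmentation X \<Longrightarrow> p + q \<in> augmentation X"
  "p \<in> augmentation X \<Longrightarrow> q \<in> augmentation X \<Longrightarrow> p - q \<in> augmentation X"
  "p \<in> augmentation X \<Longrightarrow> q \<in> augmentation X \<Longrightarrow> p * q \<in> augmentation X"
  "0 \<in> augmentation X"
proof -
  show "p \<in> augmentation X \<Longrightarrow> q \<in> augmentation X \<Longrightarrow> p * q \<in> augmentation X"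
    using ideal.I_l_closed[OF ideal_augmentation[of X], of q p] by (simp add: augmentation_def)
qed (simp_all add: augmentation_def free_algebra_closed lookup_add lookup_minus free_algebra_0_1)

lemma augmentation_sum:
  "(\<And>x. x \<in> A \<Longrightarrow> f x \<in> augmentation X) \<Longrightarrow> sum f A \<in> augmentation X"
  by (induction A rule: infinite_finite_induct) (auto intro: augmentation_closed)

context
  fixes E :: "('v, 'e) pre_digraph" and w :: "'e \<Rightarrow> nat"
  assumes wf: "wf_digraph E"
begin

interpretation wf_digraph E by (rule wf)

lemma vtx_mem: "v \<in> verts E \<Longrightarrow> vtx v \<in> augmentation (wgens E w)"
  unfolding vtx_def by (rule gen_mem) (simp add: wgens_def)

lemma edge_mem: "e \<in> arcs E \<Longrightarrow> 1 \<le> i \<Longrightarrow> edge w e i \<in> augmentation (wgens E w)"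
  unfolding edge_def by (auto intro!: gen_mem augmentation_closed simp: wgens_def)

lemma ghost_mem: "e \<in> arcs E \<Longrightarrow> 1 \<le> i \<Longrightarrow> ghost w e i \<in> augmentation (wgens E w)"
  unfolding ghost_def by (auto intro!: gen_mem augmentation_closed simp: wgens_def)

lemma relators_mem: "wlp_relators E w \<subseteq> augmentation (wgens E w)"
proof
  fix p assume "p \<in> wlp_relators E w"
  then show "p \<in> augmentation (wgens E w)"
  proof cases
    case (edge_ghost v i j)
    then show ?thesis
      by (auto simp: regular_verts_def
        intro!: augmentation_closed(2,3,4) augmentation_sum vtx_mem edge_mem ghost_mem)
  next
    case (ghost_edge v e f)
    then show ?thesis
      by (auto simp: regular_verts_def
        intro!: augmentation_closed(2,3,4) augmentation_sum vtx_mem edge_mem ghost_mem)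
  qed (auto intro!: augmentation_closed(2,3,4) vtx_mem edge_mem ghost_mem)
qed

lemma ideal_wlp: "ideal (wlp_ideal E w) (free_algebra (wgens E w))"
  unfolding wlp_ideal_def
  by (rule ring.genideal_ideal[OF ring_free_algebra])
    (use relators_mem in \<open>auto simp: augmentation_def\<close>)

lemma wlp_ideal_mem:
  "p \<in> wlp_relators E w \<Longrightarrow> p \<in> wlp_ideal E w"
  "p \<in> wlp_ideal E w \<Longrightarrow> q \<in> wlp_ideal E w \<Longrightarrow> p + q \<in> wlp_ideal E w"
  "p \<in> wlp_ideal E w \<Longrightarrow> q \<in> carrier (free_algebra (wgens E w)) \<Longrightarrow> p * q \<in> wlp_ideal E w"
  "p \<in> wlp_ideal E w \<Longrightarrow> q \<in> carrier (free_algebra (wgens E w)) \<Longrightarrow> q * p \<in> wlp_ideal E w"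
  "0 \<in> wlp_ideal E w"
proof -
  interpret J: ideal "wlp_ideal E w" "free_algebra (wgens E w)" by (rule ideal_wlp)
  show "p \<in> wlp_relators E w \<Longrightarrow> p \<in> wlp_ideal E w"
    using ring.genideal_self[OF ring_free_algebra, of "wlp_relators E w"] relators_mem
    unfolding wlp_ideal_def augmentation_def by blast
  show "p \<in> wlp_ideal E w \<Longrightarrow> q \<in> wlp_ideal E w \<Longrightarrow> p + q \<in> wlp_ideal E w"
    using additive_subgroup.a_closed[OF J.is_additive_subgroup, of p q] by simp
  show "p \<in> wlp_ideal E w \<Longrightarrow> q \<in> carrier (free_algebra (wgens E w)) \<Longrightarrow> p * q \<in> wlp_ideal E w"
    "p \<in> wlp_ideal E w \<Longrightarrow> q \<in> carrier (free_algebra (wgens E w)) \<Longrightarrow> q * p \<in> wlp_ideal E w"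
    using J.I_l_closed J.I_r_closed by simp_all
  show "0 \<in> wlp_ideal E w" using additive_subgroup.zero_closed[OF J.is_additive_subgroup] by simp
qed

lemma wlp_ideal_sum:
  "(\<And>x. x \<in> A \<Longrightarrow> f x \<in> wlp_ideal E w) \<Longrightarrow> sum f A \<in> wlp_ideal E w"
  by (induction A rule: infinite_finite_induct) (auto intro: wlp_ideal_mem)

abbreviation (input) "one_rep \<equiv> \<Sum>v\<in>verts E. vtx v"

lemma gen_ends:
  assumes "g \<in> wgens E w"
  shows "\<exists>s\<in>verts E. vtx s * gen g - gen g \<in> wlp_ideal E w"
    and "\<exists>t\<in>verts E. gen g * vtx t - gen g \<in> wlp_ideal E w"
proof -
  consider v where "g = Vtx v" "v \<in> verts E"
    | e i where "g = Edge e i" "e \<in> arcs E" "1 \<le> i" "i \<le> w e"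
    | e i where "g = Ghost e i" "e \<in> arcs E" "1 \<le> i" "i \<le> w e"
    using assms by (auto simp: wgens_def)
  then have "(\<exists>s\<in>verts E. vtx s * gen g - gen g \<in> wlp_ideal E w) \<and>
    (\<exists>t\<in>verts E. gen g * vtx t - gen g \<in> wlp_ideal E w)"
  proof cases
    case 1
    then have "vtx v * gen g - gen g \<in> wlp_ideal E w" "gen g * vtx v - gen g \<in> wlp_ideal E w"
      using wlp_ideal_mem(1)[OF wlp_relators.vtx_vtx[OF 1(2) 1(2)]] by (simp_all add: vtx_def)
    then show ?thesis using 1(2) by blast
  next
    case 2
    have "vtx (tail E e) * gen g - gen g \<in> wlp_ideal E w" "gen g * vtx (head E e) - gen g \<in> wlp_ideal E w"
      using wlp_ideal_mem(1)[OF wlp_relators.tail_edge[of e E i w, OF 2(2-4)]]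
        wlp_ideal_mem(1)[OF wlp_relators.edge_head[of e E i w, OF 2(2-4)]] 2 by (simp_all add: edge_def)
    then show ?thesis using tail_in_verts[OF 2(2)] head_in_verts[OF 2(2)] by blast
  next
    case 3
    have "vtx (head E e) * gen g - gen g \<in> wlp_ideal E w" "gen g * vtx (tail E e) - gen g \<in> wlp_ideal E w"
      using wlp_ideal_mem(1)[OF wlp_relators.head_ghost[of e E i w, OF 3(2-4)]]
        wlp_ideal_mem(1)[OF wlp_relators.ghost_tail[of e E i w, OF 3(2-4)]] 3 by (simp_all add: ghost_def)
    then show ?thesis using tail_in_verts[OF 3(2)] head_in_verts[OF 3(2)] by blast
  qed
  then show "\<exists>s\<in>verts E. vtx s * gen g - gen g \<in> wlp_ideal E w"
    "\<exists>t\<in>verts E. gen g * vtx t - gen g \<in> wlp_ideal E w" by blast+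
qed

lemma one_rep_vtx:
  assumes "finite (verts E)" "v \<in> verts E"
  shows "one_rep * vtx v - vtx v \<in> wlp_ideal E w" "vtx v * one_rep - vtx v \<in> wlp_ideal E w"
proof -
  have "one_rep * vtx v - vtx v = (\<Sum>u\<in>verts E. vtx u * vtx v - (if u = v then vtx u else 0))"
    using assms by (simp add: sum_subtractf sum_distrib_right)
  also have "\<dots> \<in> wlp_ideal E w"
    by (intro wlp_ideal_sum wlp_ideal_mem(1) wlp_relators.intros(1) assms)
  finally show "one_rep * vtx v - vtx v \<in> wlp_ideal E w" .
  have "vtx v * one_rep - vtx v = (\<Sum>u\<in>verts E. vtx v * vtx u - (if v = u then vtx v else 0))"
    using assms by (simp add: sum_subtractf sum_distrib_left)
  also have "\<dots> \<in> wlp_ideal E w"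
    by (intro wlp_ideal_sum wlp_ideal_mem(1) wlp_relators.intros(1) assms)
  finally show "vtx v * one_rep - vtx v \<in> wlp_ideal E w" .
qed

lemma one_rep_mem: "one_rep \<in> augmentation (wgens E w)"
  by (intro augmentation_sum vtx_mem)

lemma augD: "p \<in> augmentation X \<Longrightarrow> p \<in> carrier (free_algebra X)"
  by (simp add: augmentation_def)

lemma one_rep_gen:
  fixes g :: "('v, 'e) wgen"
  defines "x \<equiv> gen g :: ('v, 'e) wgen fmon \<Rightarrow>\<^sub>0 'k::field"
  assumes fin: "finite (verts E)" and g: "g \<in> wgens E w"
  shows "one_rep * x - x \<in> wlp_ideal E w" "x * one_rep - x \<in> wlp_ideal E w"
proof -
  have xc: "x \<in> carrier (free_algebra (wgens E w))"
    unfolding x_def by (rule augD[OF gen_mem[OF g]])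
  note oc = augD[OF one_rep_mem]
  note mc = free_algebra_closed(3)[OF oc oc]
  obtain s where s: "s \<in> verts E" "vtx s * x - x \<in> wlp_ideal E w"
    using gen_ends(1)[OF g] unfolding x_def by blast
  have "one_rep * x - x =
      (- one_rep) * (vtx s * x - x) + ((one_rep * vtx s - vtx s) * x + (vtx s * x - x))"
    by (simp add: algebra_simps)
  also have "\<dots> \<in> wlp_ideal E w"
    by (rule wlp_ideal_mem(2)[OF wlp_ideal_mem(4)[OF s(2) mc]
        wlp_ideal_mem(2)[OF wlp_ideal_mem(3)[OF one_rep_vtx(1)[OF fin s(1)] xc] s(2)]])
  finally show "one_rep * x - x \<in> wlp_ideal E w" .
  obtain t where t: "t \<in> verts E" "x * vtx t - x \<in> wlp_ideal E w"
    using gen_ends(2)[OF g] unfolding x_def by blast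
  have "x * one_rep - x =
      (x * vtx t - x) * (- one_rep) + (x * (vtx t * one_rep - vtx t) + (x * vtx t - x))"
    by (simp add: algebra_simps)
  also have "\<dots> \<in> wlp_ideal E w"
    by (rule wlp_ideal_mem(2)[OF wlp_ideal_mem(3)[OF t(2) mc]
        wlp_ideal_mem(2)[OF wlp_ideal_mem(4)[OF one_rep_vtx(2)[OF fin t(1)] xc] t(2)]])
  finally show "x * one_rep - x \<in> wlp_ideal E w" .
qed

lemma poly_mapping_sum_singles:
  "p = (\<Sum>m\<in>Poly_Mapping.keys p. Poly_Mapping.single m (Poly_Mapping.lookup p m))"
  by (rule poly_mapping_eqI)
    (auto simp: lookup_sum lookup_single when_def not_in_keys_iff_lookup_eq_zero sum.delta)

lemma one_rep_id:
  assumes fin: "finite (verts E)" and p: "p \<in> augmentation (wgens E w)"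
  shows "one_rep * p - p \<in> wlp_ideal E w" "p * one_rep - p \<in> wlp_ideal E w"
proof -
  let ?S = "\<lambda>m. Poly_Mapping.single m (Poly_Mapping.lookup p m)"
  have key: "one_rep * ?S m - ?S m \<in> wlp_ideal E w \<and> ?S m * one_rep - ?S m \<in> wlp_ideal E w"
    if m: "m \<in> Poly_Mapping.keys p" for m
  proof -
    define c where "c = Poly_Mapping.lookup p m"
    have sub: "set (letters m) \<subseteq> wgens E w" using p m by (auto simp: augmentation_def mem_free_algebra)
    have "m \<noteq> 0" using p m by (auto simp: augmentation_def in_keys_iff)
    then have "letters m \<noteq> []" by (cases m) (auto simp: zero_fmon_def)
    then obtain g gs hs h where gh: "letters m = g # gs" "letters m = hs @ [h]"
      by (metis list.exhaust rev_exhaust)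
    have m1: "FMon [g] + FMon gs = m" "FMon hs + FMon [h] = m"
      by (simp_all add: plus_fmon_def gh(1)[symmetric] gh(2)[symmetric])
    have S: "?S m = gen g * Poly_Mapping.single (FMon gs) c"
      "?S m = Poly_Mapping.single (FMon hs) c * gen h"
      by (simp_all add: gen_def mult_single m1 c_def)
    have "g \<in> wgens E w" "h \<in> wgens E w" "set gs \<subseteq> wgens E w" "set hs \<subseteq> wgens E w"
      using sub[unfolded gh(1)] sub[unfolded gh(2)] by simp_all
    then have gh_mem: "g \<in> wgens E w" "h \<in> wgens E w"
      and "Poly_Mapping.single (FMon gs) c \<in> carrier (free_algebra (wgens E w))"
      "Poly_Mapping.single (FMon hs) c \<in> carrier (free_algebra (wgens E w))"
      by (auto simp: mem_free_algebra)
    then have "(one_rep * gen g - gen g) * Poly_Mapping.single (FMon gs) c \<in> wlp_ideal E w"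
      "Poly_Mapping.single (FMon hs) c * (gen h * one_rep - gen h) \<in> wlp_ideal E w"
      using wlp_ideal_mem(3)[OF one_rep_gen(1)[OF fin gh_mem(1)]]
        wlp_ideal_mem(4)[OF one_rep_gen(2)[OF fin gh_mem(2)]] by blast+
    moreover have "one_rep * ?S m - ?S m = (one_rep * gen g - gen g) * Poly_Mapping.single (FMon gs) c"
      unfolding S(1) by (simp add: algebra_simps)
    moreover have "?S m * one_rep - ?S m = Poly_Mapping.single (FMon hs) c * (gen h * one_rep - gen h)"
      unfolding S(2) by (simp add: algebra_simps)
    ultimately show ?thesis by simp
  qed
  have left: "one_rep * p - p = (\<Sum>m\<in>Poly_Mapping.keys p. one_rep * ?S m - ?S m)"
    by (simp add: sum_subtractf sum_distrib_left[symmetric] poly_mapping_sum_singles[symmetric])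
  show "one_rep * p - p \<in> wlp_ideal E w"
    unfolding left by (rule wlp_ideal_sum) (rule key[THEN conjunct1])
  have right: "p * one_rep - p = (\<Sum>m\<in>Poly_Mapping.keys p. ?S m * one_rep - ?S m)"
    by (simp add: sum_subtractf sum_distrib_right[symmetric] poly_mapping_sum_singles[symmetric])
  show "p * one_rep - p \<in> wlp_ideal E w"
    unfolding right by (rule wlp_ideal_sum) (rule key[THEN conjunct2])
qed

lemma ring_wlpa:
  assumes fin: "finite (verts E)"
  shows "ring (wlpa E w :: ('k::field, ('k, 'v, 'e) wlp) module)"
proof -
  let ?F = "free_algebra (wgens E w) :: (('v, 'e) wgen fmon \<Rightarrow>\<^sub>0 'k) ring"
  let ?J = "wlp_ideal E w :: (('v, 'e) wgen fmon \<Rightarrow>\<^sub>0 'k) set"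
  let ?A = "augmentation (wgens E w) :: (('v, 'e) wgen fmon \<Rightarrow>\<^sub>0 'k) set"
  let ?q = "\<lambda>p. ?J +>\<^bsub>?F\<^esub> p"
  let ?L = "wlpa E w :: ('k::field, ('k, 'v, 'e) wlp) module"
  interpret J: ideal ?J ?F by (rule ideal_wlp)
  note AD = augD[of _ "wgens E w"]
  have car: "carrier ?L = ?q ` ?A" and one: "\<one>\<^bsub>?L\<^esub> = ?q one_rep" and zero: "\<zero>\<^bsub>?L\<^esub> = ?q 0"
    using J.a_rcos_const[OF additive_subgroup.zero_closed[OF J.is_additive_subgroup]]
    by (simp_all add: wlpa_def Let_def FactRing_def)
  have mult: "?q p \<otimes>\<^bsub>?L\<^esub> ?q r = ?q (p * r)" and add: "?q p \<oplus>\<^bsub>?L\<^esub> ?q r = ?q (p + r)"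
    if "p \<in> ?A" "r \<in> ?A" for p r
    using J.rcoset_mult_add[OF AD[OF that(1)] AD[OF that(2)]] J.a_rcos_sum[OF AD[OF that(1)] AD[OF that(2)]]
    by (simp_all add: wlpa_def Let_def FactRing_def)
  have eq: "?q p = ?q r" if "p \<in> ?A" "r \<in> ?A" "p - r \<in> ?J" for p r
  proof -
    have "p \<in> ?q r"
      unfolding a_r_coset_def r_coset_def using that(3) by (auto intro!: bexI[of _ "p - r"])
    then show ?thesis using J.a_repr_independence'[OF _ AD[OF that(2)]] by metis
  qed
  note cl = augmentation_closed
  show ?thesis
  proof (rule ringI)
    show "abelian_group ?L"
    proof (rule abelian_groupI)
      fix x assume "x \<in> carrier ?L"
      then obtain p where p: "p \<in> ?A" "x = ?q p" by (auto simp: car)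
      then have "- p \<in> ?A" using cl(2)[OF cl(4) p(1)] by simp
      then show "\<exists>y\<in>carrier ?L. y \<oplus>\<^bsub>?L\<^esub> x = \<zero>\<^bsub>?L\<^esub>"
        using p by (intro bexI[of _ "?q (- p)"]) (auto simp: car add zero)
    qed (auto simp: car add zero cl add_ac)
    show "Group.monoid ?L"
    proof (rule monoidI)
      fix x assume "x \<in> carrier ?L"
      then obtain p where p: "p \<in> ?A" "x = ?q p" by (auto simp: car)
      show "\<one>\<^bsub>?L\<^esub> \<otimes>\<^bsub>?L\<^esub> x = x" "x \<otimes>\<^bsub>?L\<^esub> \<one>\<^bsub>?L\<^esub> = x"
        unfolding p(2) one mult[OF p(1) one_rep_mem] mult[OF one_rep_mem p(1)]
        by (intro eq cl one_rep_mem p one_rep_id fin)+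
    qed (auto simp: car mult one cl mult.assoc one_rep_mem)
  qed (auto simp: car mult add cl algebra_simps)
qed

end


section \<open>Left modules\<close>

locale left_module = R?: ring R + M?: abelian_group M
  for R (structure) and M (structure) +
  assumes smult_closed [simp, intro]:
      "a \<in> carrier R \<Longrightarrow> x \<in> carrier M \<Longrightarrow> a \<odot>\<^bsub>M\<^esub> x \<in> carrier M"
    and smult_l_distr:
      "a \<in> carrier R \<Longrightarrow> b \<in> carrier R \<Longrightarrow> x \<in> carrier M \<Longrightarrow>
       (a \<oplus> b) \<odot>\<^bsub>M\<^esub> x = a \<odot>\<^bsub>M\<^esub> x \<oplus>\<^bsub>M\<^esub> b \<odot>\<^bsub>M\<^esub> x"
    and smult_r_distr:
      "a \<in> carrier R \<Longrightarrow> x \<in> carrier M \<Longrightarrow> y \<in> carrier M \<Longrightarrow>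
       a \<odot>\<^bsub>M\<^esub> (x \<oplus>\<^bsub>M\<^esub> y) = a \<odot>\<^bsub>M\<^esub> x \<oplus>\<^bsub>M\<^esub> a \<odot>\<^bsub>M\<^esub> y"
    and smult_assoc:
      "a \<in> carrier R \<Longrightarrow> b \<in> carrier R \<Longrightarrow> x \<in> carrier M \<Longrightarrow>
       (a \<otimes> b) \<odot>\<^bsub>M\<^esub> x = a \<odot>\<^bsub>M\<^esub> (b \<odot>\<^bsub>M\<^esub> x)"
    and smult_one [simp]: "x \<in> carrier M \<Longrightarrow> \<one> \<odot>\<^bsub>M\<^esub> x = x"

definition left_hom ::
    "('r, 'c) ring_scheme \<Rightarrow> ('r, 'm, 'd) module_scheme \<Rightarrow> ('r, 'n, 'f) module_scheme \<Rightarrow> ('m \<Rightarrow> 'n) set"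
where
  "left_hom R M N = {f \<in> carrier M \<rightarrow> carrier N.
     (\<forall>x\<in>carrier M. \<forall>y\<in>carrier M. f (x \<oplus>\<^bsub>M\<^esub> y) = f x \<oplus>\<^bsub>N\<^esub> f y) \<and>
     (\<forall>a\<in>carrier R. \<forall>x\<in>carrier M. f (a \<odot>\<^bsub>M\<^esub> x) = a \<odot>\<^bsub>N\<^esub> f x)}"

definition fin_gen_module :: "('r, 'c) ring_scheme \<Rightarrow> ('r, 'p) module \<Rightarrow> bool" where
  "fin_gen_module R P \<longleftrightarrow> left_module R P \<and>
    (\<exists>S. finite S \<and> S \<subseteq> carrier P \<and>
      (\<forall>x\<in>carrier P. \<exists>a\<in>S \<rightarrow> carrier R. x = (\<Oplus>\<^bsub>P\<^esub>s\<in>S. a s \<odot>\<^bsub>P\<^esub> s)))"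

text \<open>
  Being projective or a generator quantifies over all modules, hence over all types.  A formula can
  only quantify over modules on fixed types, and the types below are large enough: the free module
  on the set \<open>P\<close> lives on \<open>'p \<Rightarrow> 'r\<close>, and every cyclic module is isomorphic to one
  whose elements are cosets of a left ideal.  The lemmas \<open>projective_module_lift\<close> and
  \<open>generator_module_separates\<close> derive the two properties for modules on arbitrary types.
\<close>

definition projective_module :: "('r, 'c) ring_scheme \<Rightarrow> ('r, 'p) module \<Rightarrow> bool" where
  "projective_module R P \<longleftrightarrow> left_module R P \<and>
    (\<forall>(M :: ('r, 'p \<Rightarrow> 'r) module) (N :: ('r, 'p) module) g f.
      left_module R M \<and> left_module R N \<and>
      g \<in> left_hom R M N \<and> g ` carrier M = carrier N \<and> f \<in> left_hom R P N \<longrightarrow>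
      (\<exists>h\<in>left_hom R P M. \<forall>x\<in>carrier P. g (h x) = f x))"

text \<open>\<open>P\<close> is a generator iff the functor \<open>Hom(P, _)\<close> is faithful.\<close>

definition generator_module :: "('r, 'c) ring_scheme \<Rightarrow> ('r, 'p) module \<Rightarrow> bool" where
  "generator_module R P \<longleftrightarrow> left_module R P \<and>
    (\<forall>(M :: ('r, 'r set) module) (N :: ('r, 'r set) module) f g.
      left_module R M \<and> left_module R N \<and> f \<in> left_hom R M N \<and> g \<in> left_hom R M N \<and>
      (\<exists>x\<in>carrier M. f x \<noteq> g x) \<longrightarrow>
      (\<exists>h\<in>left_hom R P M. \<exists>x\<in>carrier P. f (h x) \<noteq> g (h x)))"

lemma left_homD:
  assumes "f \<in> left_hom R M N"
  shows "x \<in> carrier M \<Longrightarrow> f x \<in> carrier N"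
    and "x \<in> carrier M \<Longrightarrow> y \<in> carrier M \<Longrightarrow> f (x \<oplus>\<^bsub>M\<^esub> y) = f x \<oplus>\<^bsub>N\<^esub> f y"
    and "a \<in> carrier R \<Longrightarrow> x \<in> carrier M \<Longrightarrow> f (a \<odot>\<^bsub>M\<^esub> x) = a \<odot>\<^bsub>N\<^esub> f x"
  using assms by (auto simp: left_hom_def)

lemma left_homI:
  assumes "\<And>x. x \<in> carrier M \<Longrightarrow> f x \<in> carrier N"
    and "\<And>x y. x \<in> carrier M \<Longrightarrow> y \<in> carrier M \<Longrightarrow> f (x \<oplus>\<^bsub>M\<^esub> y) = f x \<oplus>\<^bsub>N\<^esub> f y"
    and "\<And>a x. a \<in> carrier R \<Longrightarrow> x \<in> carrier M \<Longrightarrow> f (a \<odot>\<^bsub>M\<^esub> x) = a \<odot>\<^bsub>N\<^esub> f x"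
  shows "f \<in> left_hom R M N"
  using assms by (auto simp: left_hom_def)

lemma left_hom_comp:
  assumes "f \<in> left_hom R M N" and "g \<in> left_hom R N K"
  shows "(\<lambda>x. g (f x)) \<in> left_hom R M K"
  using assms by (auto simp: left_hom_def Pi_iff)

lemma (in left_module) smult_r_null [simp]:
  "a \<in> carrier R \<Longrightarrow> a \<odot>\<^bsub>M\<^esub> \<zero>\<^bsub>M\<^esub> = \<zero>\<^bsub>M\<^esub>"
  using smult_r_distr[of a "\<zero>\<^bsub>M\<^esub>" "\<zero>\<^bsub>M\<^esub>"]
  by (metis M.add.r_cancel_one M.l_zero M.zero_closed smult_closed)

lemma (in left_module) smult_l_null [simp]:
  "x \<in> carrier M \<Longrightarrow> \<zero> \<odot>\<^bsub>M\<^esub> x = \<zero>\<^bsub>M\<^esub>"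
  using smult_l_distr[of "\<zero>" "\<zero>" x]
  by (metis M.add.r_cancel_one R.l_zero R.zero_closed smult_closed)

lemma (in left_module) smult_finsum:
  assumes "finite A" and "a \<in> carrier R" and "m \<in> A \<rightarrow> carrier M"
  shows "a \<odot>\<^bsub>M\<^esub> (\<Oplus>\<^bsub>M\<^esub>x\<in>A. m x) = (\<Oplus>\<^bsub>M\<^esub>x\<in>A. a \<odot>\<^bsub>M\<^esub> m x)"
  using assms(1,3)
proof (induction A)
  case (insert x A)
  have "m \<in> A \<rightarrow> carrier M" "m x \<in> carrier M" using insert by auto
  moreover from this have "(\<lambda>x. a \<odot>\<^bsub>M\<^esub> m x) \<in> A \<rightarrow> carrier M" using assms(2) by auto
  ultimately show ?case using insert assms(2) by (simp add: M.finsum_insert smult_r_distr)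
qed (use assms in simp)

lemma (in left_module) left_moduleI_carrier:
  assumes "carrier N \<noteq> {}" "\<And>x. x \<in> carrier N \<Longrightarrow> f x \<in> carrier M" 
  assumes "inj_on f (carrier N)" "\<zero>\<^bsub>N\<^esub> \<in> carrier N" "f \<zero>\<^bsub>N\<^esub> = \<zero>\<^bsub>M\<^esub>"
    and add: "\<And>x y. x \<in> carrier N \<Longrightarrow> y \<in> carrier N \<Longrightarrow> x \<oplus>\<^bsub>N\<^esub> y \<in> carrier N \<and> f (x \<oplus>\<^bsub>N\<^esub> y) = f x \<oplus>\<^bsub>M\<^esub> f y"
    and sm: "\<And>a x. a \<in> carrier R \<Longrightarrow> x \<in> carrier N \<Longrightarrow> a \<odot>\<^bsub>N\<^esub> x \<in> carrier N \<and> f (a \<odot>\<^bsub>N\<^esub> x) = a \<odot>\<^bsub>M\<^esub> f x"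
  shows "left_module R N"
proof -
  note eqI = inj_onD[OF assms(3)]
  have "abelian_group N"
  proof (rule abelian_groupI)
    fix x y z assume "x \<in> carrier N" "y \<in> carrier N" "z \<in> carrier N"
    then show "x \<oplus>\<^bsub>N\<^esub> y \<oplus>\<^bsub>N\<^esub> z = x \<oplus>\<^bsub>N\<^esub> (y \<oplus>\<^bsub>N\<^esub> z)"
      by (intro eqI) (auto simp: add assms M.a_assoc)
  next
    fix x y assume "x \<in> carrier N" "y \<in> carrier N"
    then show "x \<oplus>\<^bsub>N\<^esub> y = y \<oplus>\<^bsub>N\<^esub> x"
      by (intro eqI) (auto simp: add assms M.a_comm)
  next
    fix x assume x: "x \<in> carrier N"
    then show "\<zero>\<^bsub>N\<^esub> \<oplus>\<^bsub>N\<^esub> x = x"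
      by (intro eqI) (auto simp: add assms)
    have neg: "\<ominus> \<one> \<in> carrier R" by simp
    have "(\<ominus> \<one> \<oplus> \<one>) \<odot>\<^bsub>M\<^esub> f x = \<zero>\<^bsub>M\<^esub>"
      using x assms(2)[OF x] by (simp add: R.l_neg)
    then have "\<ominus> \<one> \<odot>\<^bsub>M\<^esub> f x \<oplus>\<^bsub>M\<^esub> f x = \<zero>\<^bsub>M\<^esub>"
      using smult_l_distr[OF neg R.one_closed assms(2)[OF x]] assms(2)[OF x] by simp
    then have "(\<ominus> \<one> \<odot>\<^bsub>N\<^esub> x) \<oplus>\<^bsub>N\<^esub> x = \<zero>\<^bsub>N\<^esub>"
      using x neg by (intro eqI) (auto simp: add sm assms)
    then show "\<exists>y\<in>carrier N. y \<oplus>\<^bsub>N\<^esub> x = \<zero>\<^bsub>N\<^esub>" using sm[OF neg x] by blast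
  qed (use assms add in auto)
  then show ?thesis
    by (intro left_module.intro left_module_axioms.intro eqI)
       (auto simp: add sm assms smult_l_distr smult_r_distr smult_assoc intro: R.ring_axioms)
qed

definition free_module :: "('r, 'c) ring_scheme \<Rightarrow> 'p set \<Rightarrow> ('r, 'p \<Rightarrow> 'r) module" where
  "free_module R X = 
    \<lparr>carrier = {c. (\<forall>x\<in>X. c x \<in> carrier R) \<and> (\<forall>x. x \<notin> X \<longrightarrow> c x = \<zero>\<^bsub>R\<^esub>) \<and> finite {x. c x \<noteq> \<zero>\<^bsub>R\<^esub>}},
     monoid.mult = undefined, one = undefined,
     zero = (\<lambda>_. \<zero>\<^bsub>R\<^esub>),
     add = (\<lambda>c d x. c x \<oplus>\<^bsub>R\<^esub> d x),
     smult = (\<lambda>a c x. a \<otimes>\<^bsub>R\<^esub> c x)\<rparr>"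

lemma (in ring) free_module_in: "c \<in> carrier (free_module R X) \<Longrightarrow> c x \<in> carrier R"
  by (cases "x \<in> X") (auto simp: free_module_def)

lemma (in ring) free_module:
  "left_module R (free_module R X)"
proof -
  have clos: "c \<oplus>\<^bsub>free_module R X\<^esub> d \<in> carrier (free_module R X)"
    if "c \<in> carrier (free_module R X)" "d \<in> carrier (free_module R X)" for c d
  proof -
    have "finite ({x. c x \<noteq> \<zero>} \<union> {x. d x \<noteq> \<zero>})" using that by (auto simp: free_module_def)
    then have "finite {x. c x \<oplus> d x \<noteq> \<zero>}" by (rule rev_finite_subset) auto
    then show ?thesis using that by (auto simp: free_module_def)
  qed
  have closs: "a \<odot>\<^bsub>free_module R X\<^esub> d \<in> carrier (free_module R X)"
    if "a \<in> carrier R" "d \<in> carrier (free_module R X)" for a d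
  proof -
    have "finite {x. d x \<noteq> \<zero>}" using that by (auto simp: free_module_def)
    then have "finite {x. a \<otimes> d x \<noteq> \<zero>}" by (rule rev_finite_subset) (use that in auto)
    then show ?thesis using that by (auto simp: free_module_def)
  qed
  let ?F = "free_module R X"
  have app: "(c \<oplus>\<^bsub>?F\<^esub> d) x = c x \<oplus> d x" "(a \<odot>\<^bsub>?F\<^esub> c) x = a \<otimes> c x" "\<zero>\<^bsub>?F\<^esub> x = \<zero>"
    for a c d x by (simp_all add: free_module_def)
  have z: "\<zero>\<^bsub>?F\<^esub> \<in> carrier ?F" by (simp add: free_module_def)
  note inR = free_module_in[where X = X]
  have "abelian_group ?F"
  proof (rule abelian_groupI)
    fix c assume c: "c \<in> carrier ?F"
    then have "\<ominus> \<one> \<odot>\<^bsub>?F\<^esub> c \<in> carrier ?F" by (intro closs) auto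
    moreover have "(\<ominus> \<one> \<odot>\<^bsub>?F\<^esub> c) \<oplus>\<^bsub>?F\<^esub> c = \<zero>\<^bsub>?F\<^esub>"
      by (rule ext) (simp add: app inR[OF c] l_minus l_neg)
    ultimately show "\<exists>d\<in>carrier ?F. d \<oplus>\<^bsub>?F\<^esub> c = \<zero>\<^bsub>?F\<^esub>" by blast
    show "\<zero>\<^bsub>?F\<^esub> \<oplus>\<^bsub>?F\<^esub> c = c" by (rule ext) (simp add: app inR[OF c])
  next
    fix c d e assume c: "c \<in> carrier ?F" "d \<in> carrier ?F" "e \<in> carrier ?F"
    show "c \<oplus>\<^bsub>?F\<^esub> d \<oplus>\<^bsub>?F\<^esub> e = c \<oplus>\<^bsub>?F\<^esub> (d \<oplus>\<^bsub>?F\<^esub> e)"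
      by (rule ext) (simp add: app c[THEN inR] a_assoc)
  next
    fix c d assume c: "c \<in> carrier ?F" "d \<in> carrier ?F"
    show "c \<oplus>\<^bsub>?F\<^esub> d = d \<oplus>\<^bsub>?F\<^esub> c"
      by (rule ext) (simp add: app c[THEN inR] a_comm)
  qed (auto intro: clos z)
  moreover have "(a \<oplus> b) \<odot>\<^bsub>?F\<^esub> c = a \<odot>\<^bsub>?F\<^esub> c \<oplus>\<^bsub>?F\<^esub> b \<odot>\<^bsub>?F\<^esub> c"
    if "a \<in> carrier R" "b \<in> carrier R" "c \<in> carrier ?F" for a b c
    by (rule ext) (simp add: app that inR l_distr)
  moreover have "a \<odot>\<^bsub>?F\<^esub> (b \<oplus>\<^bsub>?F\<^esub> c) = a \<odot>\<^bsub>?F\<^esub> b \<oplus>\<^bsub>?F\<^esub> a \<odot>\<^bsub>?F\<^esub> c"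
    if "a \<in> carrier R" "b \<in> carrier ?F" "c \<in> carrier ?F" for a b c
    by (rule ext) (simp add: app that inR r_distr)
  moreover have "(a \<otimes> b) \<odot>\<^bsub>?F\<^esub> c = a \<odot>\<^bsub>?F\<^esub> (b \<odot>\<^bsub>?F\<^esub> c)"
    if "a \<in> carrier R" "b \<in> carrier R" "c \<in> carrier ?F" for a b c
    by (rule ext) (simp add: app that inR m_assoc)
  moreover have "\<one> \<odot>\<^bsub>?F\<^esub> c = c" if "c \<in> carrier ?F" for c
    by (rule ext) (simp add: app that inR)
  ultimately show ?thesis
    by (intro left_module.intro left_module_axioms.intro ring_axioms closs)
qed

lemma (in left_module) free_module_eval:
  assumes m: "m \<in> X \<rightarrow> carrier M"
  shows "(\<lambda>c. \<Oplus>\<^bsub>M\<^esub>x\<in>{x. c x \<noteq> \<zero>}. c x \<odot>\<^bsub>M\<^esub> m x) \<in> left_hom R (free_module R X) M"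
    (is "?e \<in> left_hom R ?F M")
proof -
  have ext: "?e c = (\<Oplus>\<^bsub>M\<^esub>x\<in>A. c x \<odot>\<^bsub>M\<^esub> m x)"
    if "c \<in> carrier ?F" "finite A" "{x. c x \<noteq> \<zero>} \<subseteq> A" "A \<subseteq> X" for c A
    using that m by (intro M.add.finprod_mono_neutral_cong_left) (auto simp: free_module_def Pi_iff subset_iff)
  have sup: "finite {x. c x \<noteq> \<zero>}" "{x. c x \<noteq> \<zero>} \<subseteq> X" if "c \<in> carrier ?F" for c
    using that by (auto simp: free_module_def)
  have pi: "(\<lambda>x. c x \<odot>\<^bsub>M\<^esub> m x) \<in> A \<rightarrow> carrier M" if "c \<in> carrier ?F" "A \<subseteq> X" for c A
    using that m by (auto simp: free_module_def)
  interpret F: left_module R ?F by (rule R.free_module)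
  show ?thesis
  proof (rule left_homI)
    fix c assume c: "c \<in> carrier ?F"
    show "?e c \<in> carrier M" by (intro M.finsum_closed pi c sup)
  next
    fix c d assume c: "c \<in> carrier ?F" and d: "d \<in> carrier ?F"
    let ?A = "{x. c x \<noteq> \<zero>} \<union> {x. d x \<noteq> \<zero>}"
    have A: "finite ?A" "?A \<subseteq> X" using sup[OF c] sup[OF d] by auto
    have cd: "c \<oplus>\<^bsub>?F\<^esub> d \<in> carrier ?F" using c d by simp
    have "?e (c \<oplus>\<^bsub>?F\<^esub> d) = (\<Oplus>\<^bsub>M\<^esub>x\<in>?A. (c \<oplus>\<^bsub>?F\<^esub> d) x \<odot>\<^bsub>M\<^esub> m x)"
      using A by (intro ext cd) (auto simp: free_module_def)
    also have "\<dots> = (\<Oplus>\<^bsub>M\<^esub>x\<in>?A. c x \<odot>\<^bsub>M\<^esub> m x \<oplus>\<^bsub>M\<^esub> d x \<odot>\<^bsub>M\<^esub> m x)"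
    proof (rule M.finsum_cong'[OF refl])
      show "(\<lambda>x. c x \<odot>\<^bsub>M\<^esub> m x \<oplus>\<^bsub>M\<^esub> d x \<odot>\<^bsub>M\<^esub> m x) \<in> ?A \<rightarrow> carrier M"
        using pi[OF c A(2)] pi[OF d A(2)] by auto
      fix x assume "x \<in> ?A"
      then have "m x \<in> carrier M" using A m by auto
      then show "(c \<oplus>\<^bsub>?F\<^esub> d) x \<odot>\<^bsub>M\<^esub> m x = c x \<odot>\<^bsub>M\<^esub> m x \<oplus>\<^bsub>M\<^esub> d x \<odot>\<^bsub>M\<^esub> m x"
        using smult_l_distr R.free_module_in[OF c, of x] R.free_module_in[OF d, of x]
        by (simp add: free_module_def)
    qed
    also have "\<dots> = (\<Oplus>\<^bsub>M\<^esub>x\<in>?A. c x \<odot>\<^bsub>M\<^esub> m x) \<oplus>\<^bsub>M\<^esub> (\<Oplus>\<^bsub>M\<^esub>x\<in>?A. d x \<odot>\<^bsub>M\<^esub> m x)"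
      using pi[OF c A(2)] pi[OF d A(2)] by (rule M.finsum_addf)
    also have "\<dots> = ?e c \<oplus>\<^bsub>M\<^esub> ?e d"
      using ext[OF c A(1) _ A(2)] ext[OF d A(1) _ A(2)] by simp
    finally show "?e (c \<oplus>\<^bsub>?F\<^esub> d) = ?e c \<oplus>\<^bsub>M\<^esub> ?e d" .
  next
    fix a c assume a: "a \<in> carrier R" and c: "c \<in> carrier ?F"
    let ?A = "{x. c x \<noteq> \<zero>}"
    have A: "finite ?A" "?A \<subseteq> X" using sup[OF c] by auto
    have ac: "a \<odot>\<^bsub>?F\<^esub> c \<in> carrier ?F" using a c by simp
    have "?e (a \<odot>\<^bsub>?F\<^esub> c) = (\<Oplus>\<^bsub>M\<^esub>x\<in>?A. (a \<odot>\<^bsub>?F\<^esub> c) x \<odot>\<^bsub>M\<^esub> m x)"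
      using A a by (intro ext ac) (auto simp: free_module_def)
    also have "\<dots> = (\<Oplus>\<^bsub>M\<^esub>x\<in>?A. a \<odot>\<^bsub>M\<^esub> (c x \<odot>\<^bsub>M\<^esub> m x))"
    proof (rule M.finsum_cong'[OF refl])
      show "(\<lambda>x. a \<odot>\<^bsub>M\<^esub> (c x \<odot>\<^bsub>M\<^esub> m x)) \<in> ?A \<rightarrow> carrier M"
        using pi[OF c A(2)] a by auto
      fix x assume "x \<in> ?A"
      then have "m x \<in> carrier M" using A m by auto
      then show "(a \<odot>\<^bsub>?F\<^esub> c) x \<odot>\<^bsub>M\<^esub> m x = a \<odot>\<^bsub>M\<^esub> (c x \<odot>\<^bsub>M\<^esub> m x)"
        using smult_assoc[OF a] R.free_module_in[OF c, of x]
        by (simp add: free_module_def)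
    qed
    also have "\<dots> = a \<odot>\<^bsub>M\<^esub> ?e c"
      using smult_finsum[OF A(1) a pi[OF c A(2)]] by simp
    finally show "?e (a \<odot>\<^bsub>?F\<^esub> c) = a \<odot>\<^bsub>M\<^esub> ?e c" .
  qed
qed

lemma left_hom_zero:
  assumes "left_module R M" "left_module R N" "f \<in> left_hom R M N"
  shows "f \<zero>\<^bsub>M\<^esub> = \<zero>\<^bsub>N\<^esub>"
proof -
  interpret M: left_module R M by fact
  interpret N: left_module R N by fact
  have "f (\<zero>\<^bsub>M\<^esub> \<oplus>\<^bsub>M\<^esub> \<zero>\<^bsub>M\<^esub>) = f \<zero>\<^bsub>M\<^esub> \<oplus>\<^bsub>N\<^esub> f \<zero>\<^bsub>M\<^esub>"
    by (rule left_homD[OF assms(3)]) auto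
  then show ?thesis
    using left_homD(1)[OF assms(3), of "\<zero>\<^bsub>M\<^esub>"] by (metis M.M.l_zero M.M.zero_closed N.M.add.r_cancel_one)
qed

lemma left_hom_finsum:
  assumes "left_module R M" "left_module R N" "f \<in> left_hom R M N" "finite A" "m \<in> A \<rightarrow> carrier M"
  shows "f (\<Oplus>\<^bsub>M\<^esub>x\<in>A. m x) = (\<Oplus>\<^bsub>N\<^esub>x\<in>A. f (m x))"
proof -
  interpret M: left_module R M by fact
  interpret N: left_module R N by fact
  show ?thesis using assms(4,5)
  proof (induction A)
    case empty
    then show ?case using left_hom_zero[OF assms(1-3)] by simp
  next
    case (insert x A)
    then have *: "m \<in> A \<rightarrow> carrier M" "m x \<in> carrier M" by auto
    moreover have "(\<lambda>x. f (m x)) \<in> A \<rightarrow> carrier N" "f (m x) \<in> carrier N"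
      using * left_homD(1)[OF assms(3)] by auto
    ultimately show ?case using insert left_homD(2)[OF assms(3)] by simp
  qed
qed

lemma projective_module_lift:
  fixes R :: "('r, 'c) ring_scheme" and P :: "('r, 'p) module"
    and M :: "('r, 'm) module" and N :: "('r, 'n) module"
  assumes P: "projective_module R P" and M: "left_module R M" and N: "left_module R N"
    and g: "g \<in> left_hom R M N" "g ` carrier M = carrier N" and f: "f \<in> left_hom R P N"
  shows "\<exists>h\<in>left_hom R P M. \<forall>x\<in>carrier P. g (h x) = f x"
proof -
  interpret P: left_module R P using P by (simp add: projective_module_def)
  interpret M: left_module R M by fact
  interpret N: left_module R N by fact
  let ?F = "free_module R (carrier P)"
  let ?e = "\<lambda>c. \<Oplus>\<^bsub>P\<^esub>x\<in>{x. c x \<noteq> \<zero>\<^bsub>R\<^esub>}. c x \<odot>\<^bsub>P\<^esub> x"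
  have e: "?e \<in> left_hom R ?F P" by (rule P.free_module_eval) auto
  have "p \<in> ?e ` carrier ?F" if p: "p \<in> carrier P" for p
  proof (cases "\<one>\<^bsub>R\<^esub> = \<zero>\<^bsub>R\<^esub>")
    case True
    then have "p = \<zero>\<^bsub>P\<^esub>" using P.smult_one[OF p] P.smult_l_null[OF p] by simp
    then have e0: "?e (\<lambda>_. \<zero>\<^bsub>R\<^esub>) = p" by simp
    have "(\<lambda>_. \<zero>\<^bsub>R\<^esub>) \<in> carrier ?F" by (simp add: free_module_def)
    then have "?e (\<lambda>_. \<zero>\<^bsub>R\<^esub>) \<in> ?e ` carrier ?F" by (intro imageI)
    then show ?thesis unfolding e0 .
  next
    case False
    let ?c = "\<lambda>x. if x = p then \<one>\<^bsub>R\<^esub> else \<zero>\<^bsub>R\<^esub>"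
    have "{x. ?c x \<noteq> \<zero>\<^bsub>R\<^esub>} = {p}" using False by auto
    then have e1: "?e ?c = p" using p by simp
    have "?c \<in> carrier ?F" using p by (simp add: free_module_def)
    then have "?e ?c \<in> ?e ` carrier ?F" by (intro imageI)
    then show ?thesis unfolding e1 .
  qed
  then have surj: "?e ` carrier ?F = carrier P"
    by (intro equalityI subsetI image_subsetI left_homD(1)[OF e])
  have id: "(\<lambda>x. x) \<in> left_hom R P P" by (rule left_homI) auto
  have "\<exists>h\<in>left_hom R P ?F. \<forall>x\<in>carrier P. ?e (h x) = x"
    by (rule P[unfolded projective_module_def, THEN conjunct2, rule_format, of ?F P ?e "\<lambda>x. x"])
       (intro conjI P.R.free_module P.left_module_axioms e surj id)
  then obtain s where s: "s \<in> left_hom R P ?F" "\<And>x. x \<in> carrier P \<Longrightarrow> ?e (s x) = x"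
    by (elim bexE) (rule that, assumption, erule bspec)
  have "\<exists>m. m \<in> carrier M \<and> g m = f x" if "x \<in> carrier P" for x
    using left_homD(1)[OF f that] g(2) by (metis imageE)
  then obtain m where m: "\<And>x. x \<in> carrier P \<Longrightarrow> m x \<in> carrier M \<and> g (m x) = f x" by metis
  let ?h = "\<lambda>c. \<Oplus>\<^bsub>M\<^esub>x\<in>{x. c x \<noteq> \<zero>\<^bsub>R\<^esub>}. c x \<odot>\<^bsub>M\<^esub> m x"
  have h: "?h \<in> left_hom R ?F M" by (rule M.free_module_eval) (use m in auto)
  have "g (?h (s x)) = f x" if x: "x \<in> carrier P" for x
  proof -
    let ?c = "s x"
    let ?A = "{y. ?c y \<noteq> \<zero>\<^bsub>R\<^esub>}"
    have c: "?c \<in> carrier ?F" using left_homD(1)[OF s(1) x] .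
    then have A: "finite ?A" "?A \<subseteq> carrier P" by (auto simp: free_module_def)
    have cR: "?c y \<in> carrier R" for y using P.R.free_module_in[OF c] .
    have P_pi: "(\<lambda>y. ?c y \<odot>\<^bsub>P\<^esub> y) \<in> ?A \<rightarrow> carrier P"
      and M_pi: "(\<lambda>y. ?c y \<odot>\<^bsub>M\<^esub> m y) \<in> ?A \<rightarrow> carrier M"
      using A(2) cR m by (auto intro!: Pi_I P.smult_closed M.smult_closed)
    have "g (?h ?c) = (\<Oplus>\<^bsub>N\<^esub>y\<in>?A. g (?c y \<odot>\<^bsub>M\<^esub> m y))"
      by (rule left_hom_finsum[OF M N g(1) A(1) M_pi])
    also have "\<dots> = (\<Oplus>\<^bsub>N\<^esub>y\<in>?A. f (?c y \<odot>\<^bsub>P\<^esub> y))"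
    proof (rule N.M.finsum_cong'[OF refl])
      show "(\<lambda>y. f (?c y \<odot>\<^bsub>P\<^esub> y)) \<in> ?A \<rightarrow> carrier N"
        using P_pi left_homD(1)[OF f] by (intro Pi_I) (simp add: Pi_iff)
      fix y assume "y \<in> ?A"
      then have y: "y \<in> carrier P" using A(2) by blast
      show "g (?c y \<odot>\<^bsub>M\<^esub> m y) = f (?c y \<odot>\<^bsub>P\<^esub> y)"
        using left_homD(3)[OF g(1) cR] left_homD(3)[OF f cR y] m[OF y] by simp
    qed
    also have "\<dots> = f (?e ?c)"
      by (rule left_hom_finsum[OF P.left_module_axioms N f A(1) P_pi, symmetric])
    also have "\<dots> = f x" unfolding s(2)[OF x] ..
    finally show ?thesis .
  qed
  then show ?thesis by (intro bexI[OF _ left_hom_comp[OF s(1) h]] ballI)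
qed

text \<open>
  A copy of the cyclic module \<open>R y\<close>: the element \<open>m\<close> becomes the coset \<open>{a. a y = m}\<close> of the
  annihilator of \<open>y\<close>.
\<close>

definition cyc :: "('r, 'c) ring_scheme \<Rightarrow> ('r, 'm, 'd) module_scheme \<Rightarrow> 'm \<Rightarrow> 'm \<Rightarrow> 'r set" where
  "cyc R M y m = {a \<in> carrier R. a \<odot>\<^bsub>M\<^esub> y = m}"

definition uncyc :: "('r, 'm, 'd) module_scheme \<Rightarrow> 'm \<Rightarrow> 'r set \<Rightarrow> 'm" where
  "uncyc M y A = (SOME a. a \<in> A) \<odot>\<^bsub>M\<^esub> y"

definition cyclic_copy :: "('r, 'c) ring_scheme \<Rightarrow> ('r, 'm, 'd) module_scheme \<Rightarrow> 'm \<Rightarrow> ('r, 'r set) module" where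
  "cyclic_copy R M y =
    \<lparr>carrier = (\<lambda>a. cyc R M y (a \<odot>\<^bsub>M\<^esub> y)) ` carrier R,
     monoid.mult = undefined, one = undefined,
     zero = cyc R M y \<zero>\<^bsub>M\<^esub>,
     add = (\<lambda>A B. cyc R M y (uncyc M y A \<oplus>\<^bsub>M\<^esub> uncyc M y B)),
     smult = (\<lambda>a A. cyc R M y (a \<odot>\<^bsub>M\<^esub> uncyc M y A))\<rparr>"

lemma uncyc_cyc:
  assumes "a \<in> carrier R"
  shows "uncyc M y (cyc R M y (a \<odot>\<^bsub>M\<^esub> y)) = a \<odot>\<^bsub>M\<^esub> y"
proof -
  let ?A = "cyc R M y (a \<odot>\<^bsub>M\<^esub> y)"
  have "a \<in> ?A" using assms by (simp add: cyc_def)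
  then have "(SOME a. a \<in> ?A) \<in> ?A" by (rule someI)
  then show ?thesis by (simp add: cyc_def uncyc_def)
qed

lemma (in left_module) cyclic_copy:
  assumes y: "y \<in> carrier M"
  shows "left_module R (cyclic_copy R M y)"
    and "uncyc M y \<in> left_hom R (cyclic_copy R M y) M"
    and "inj_on (uncyc M y) (carrier (cyclic_copy R M y))"
    and "uncyc M y ` carrier (cyclic_copy R M y) = (\<lambda>a. a \<odot>\<^bsub>M\<^esub> y) ` carrier R"
proof -
  let ?C = "cyclic_copy R M y"
  have un: "uncyc M y A \<in> carrier M" "\<exists>a\<in>carrier R. uncyc M y A = a \<odot>\<^bsub>M\<^esub> y"
    if "A \<in> carrier ?C" for A
    using that y by (auto simp: cyclic_copy_def uncyc_cyc)
  show inj: "inj_on (uncyc M y) (carrier ?C)"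
    by (rule inj_onI) (auto simp: cyclic_copy_def uncyc_cyc)
  show "uncyc M y ` carrier ?C = (\<lambda>a. a \<odot>\<^bsub>M\<^esub> y) ` carrier R"
    by (auto simp: cyclic_copy_def uncyc_cyc image_image)
  have Ccar: "carrier ?C = (\<lambda>a. cyc R M y (a \<odot>\<^bsub>M\<^esub> y)) ` carrier R"
    by (simp add: cyclic_copy_def)
  have z: "\<zero>\<^bsub>?C\<^esub> = cyc R M y (\<zero> \<odot>\<^bsub>M\<^esub> y)" using y by (simp add: cyclic_copy_def)
  have z': "\<zero>\<^bsub>?C\<^esub> \<in> carrier ?C" unfolding Ccar z by (rule imageI) simp
  have uz: "uncyc M y \<zero>\<^bsub>?C\<^esub> = \<zero>\<^bsub>M\<^esub>"
    unfolding z using y by (subst uncyc_cyc) auto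
  have add: "A \<oplus>\<^bsub>?C\<^esub> B \<in> carrier ?C \<and> uncyc M y (A \<oplus>\<^bsub>?C\<^esub> B) = uncyc M y A \<oplus>\<^bsub>M\<^esub> uncyc M y B"
    if A: "A \<in> carrier ?C" and B: "B \<in> carrier ?C" for A B
  proof -
    obtain a b where ab: "a \<in> carrier R" "b \<in> carrier R" 
      "uncyc M y A = a \<odot>\<^bsub>M\<^esub> y" "uncyc M y B = b \<odot>\<^bsub>M\<^esub> y" using un(2)[OF A] un(2)[OF B] by blast
    then have eq: "A \<oplus>\<^bsub>?C\<^esub> B = cyc R M y ((a \<oplus> b) \<odot>\<^bsub>M\<^esub> y)"
      using y by (simp add: cyclic_copy_def smult_l_distr)
    have in_R: "a \<oplus> b \<in> carrier R" using ab by simp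
    have "uncyc M y (A \<oplus>\<^bsub>?C\<^esub> B) = uncyc M y A \<oplus>\<^bsub>M\<^esub> uncyc M y B"
      unfolding eq uncyc_cyc[OF in_R] using ab y by (simp add: smult_l_distr)
    moreover have "A \<oplus>\<^bsub>?C\<^esub> B \<in> carrier ?C" unfolding eq Ccar using in_R by (rule imageI)
    ultimately show ?thesis by blast
  qed
  have sm: "b \<odot>\<^bsub>?C\<^esub> A \<in> carrier ?C \<and> uncyc M y (b \<odot>\<^bsub>?C\<^esub> A) = b \<odot>\<^bsub>M\<^esub> uncyc M y A"
    if b: "b \<in> carrier R" and A: "A \<in> carrier ?C" for A b
  proof -
    obtain a where ab: "a \<in> carrier R" 
      "uncyc M y A = a \<odot>\<^bsub>M\<^esub> y" using un(2)[OF A] by blast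
    then have eq: "b \<odot>\<^bsub>?C\<^esub> A = cyc R M y ((b \<otimes> a) \<odot>\<^bsub>M\<^esub> y)"
      using y b by (simp add: cyclic_copy_def smult_assoc)
    have in_R: "b \<otimes> a \<in> carrier R" using ab b by simp
    have "uncyc M y (b \<odot>\<^bsub>?C\<^esub> A) = b \<odot>\<^bsub>M\<^esub> uncyc M y A"
      unfolding eq uncyc_cyc[OF in_R] using ab y b by (simp add: smult_assoc)
    moreover have "b \<odot>\<^bsub>?C\<^esub> A \<in> carrier ?C" unfolding eq Ccar using in_R by (rule imageI)
    ultimately show ?thesis by blast
  qed
  show "left_module R ?C"
    by (rule left_moduleI_carrier[OF _ un(1) inj z' uz add sm]) (use z' in auto)
  show "uncyc M y \<in> left_hom R ?C M"
    using un(1) add sm by (intro left_homI) auto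
qed

lemma generator_module_separates:
  fixes R :: "('r, 'c) ring_scheme" and P :: "('r, 'p) module"
    and M :: "('r, 'm) module" and N :: "('r, 'n) module"
  assumes P: "generator_module R P" and M: "left_module R M" and N: "left_module R N"
    and f: "f \<in> left_hom R M N" and g: "g \<in> left_hom R M N"
    and "\<exists>x\<in>carrier M. f x \<noteq> g x"
  shows "\<exists>h\<in>left_hom R P M. \<exists>x\<in>carrier P. f (h x) \<noteq> g (h x)"
proof -
  interpret M: left_module R M by fact
  interpret N: left_module R N by fact
  obtain x where x: "x \<in> carrier M" "f x \<noteq> g x" using assms by blast
  define k where "k = (\<lambda>u. f u \<ominus>\<^bsub>N\<^esub> g u)"
  note fD = left_homD[OF f] and gD = left_homD[OF g]
  have k: "k \<in> left_hom R M N"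
  proof (rule left_homI)
    fix a u assume a: "a \<in> carrier R" and u: "u \<in> carrier M"
    have "a \<odot>\<^bsub>N\<^esub> (\<ominus>\<^bsub>N\<^esub> g u) \<oplus>\<^bsub>N\<^esub> a \<odot>\<^bsub>N\<^esub> g u = \<zero>\<^bsub>N\<^esub>"
      using a fD(1)[OF u] gD(1)[OF u] by (simp add: N.smult_r_distr[symmetric] N.M.l_neg)
    then have "a \<odot>\<^bsub>N\<^esub> (\<ominus>\<^bsub>N\<^esub> g u) = \<ominus>\<^bsub>N\<^esub> (a \<odot>\<^bsub>N\<^esub> g u)"
      using a gD(1)[OF u] by (intro N.M.minus_equality[symmetric]) auto
    then show "k (a \<odot>\<^bsub>M\<^esub> u) = a \<odot>\<^bsub>N\<^esub> k u"
      using a u fD gD by (simp add: k_def a_minus_def N.smult_r_distr)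
  next
    fix u v assume "u \<in> carrier M" "v \<in> carrier M"
    then show "k (u \<oplus>\<^bsub>M\<^esub> v) = k u \<oplus>\<^bsub>N\<^esub> k v"
      using fD gD by (simp add: k_def a_minus_def N.M.minus_add N.M.a_ac)
  qed (use fD gD in \<open>auto simp: k_def\<close>)
  have kz: "k u = \<zero>\<^bsub>N\<^esub> \<longleftrightarrow> f u = g u" if "u \<in> carrier M" for u
    using fD(1)[OF that] gD(1)[OF that] unfolding k_def a_minus_def
    by (metis N.M.minus_equality N.M.minus_minus N.M.r_neg N.M.a_inv_closed)
  have kx: "k x \<in> carrier N" "k x \<noteq> \<zero>\<^bsub>N\<^esub>" using left_homD(1)[OF k x(1)] kz[OF x(1)] x(2) by auto
  let ?C = "cyclic_copy R M x" and ?D = "cyclic_copy R N (k x)"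
  note C = M.cyclic_copy[OF x(1)] and D = N.cyclic_copy[OF kx(1)]
  interpret D: left_module R ?D by (rule D)
  have ex: "\<exists>B. B \<in> carrier ?D \<and> uncyc N (k x) B = k (uncyc M x A)" if A: "A \<in> carrier ?C" for A
  proof -
    obtain a where "a \<in> carrier R" "uncyc M x A = a \<odot>\<^bsub>M\<^esub> x" using C(4) A by blast
    then have "k (uncyc M x A) \<in> uncyc N (k x) ` carrier ?D"
      using D(4) left_homD(3)[OF k _ x(1)] by auto
    then show ?thesis by auto
  qed
  then obtain q where q: "\<And>A. A \<in> carrier ?C \<Longrightarrow> q A \<in> carrier ?D \<and> uncyc N (k x) (q A) = k (uncyc M x A)"
    by metis
  interpret C: left_module R ?C by (rule C)
  have uC: "\<And>A. A \<in> carrier ?C \<Longrightarrow> uncyc M x A \<in> carrier M" by (rule left_homD[OF C(2)])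
  have qhom: "q \<in> left_hom R ?C ?D"
    by (rule left_homI; (rule inj_onD[OF D(3)])?)
       (use q uC left_homD[OF k] left_homD[OF C(2)] left_homD[OF D(2)] in auto)
  have zhom: "(\<lambda>_. \<zero>\<^bsub>?D\<^esub>) \<in> left_hom R ?C ?D"
    by (rule left_homI) auto
  obtain X where X: "X \<in> carrier ?C" "uncyc M x X = x"
  proof -
    have "x \<in> (\<lambda>a. a \<odot>\<^bsub>M\<^esub> x) ` carrier R"
      by (rule image_eqI[of _ _ "\<one>\<^bsub>R\<^esub>"]) (use x in auto)
    then show ?thesis using that C(4) by (metis imageE)
  qed
  have uz: "uncyc N (k x) \<zero>\<^bsub>?D\<^esub> = \<zero>\<^bsub>N\<^esub>" by (rule left_hom_zero[OF D(1) N D(2)])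
  have "q X \<noteq> \<zero>\<^bsub>?D\<^esub>" using q[OF X(1)] X(2) kx uz by auto
  then have "\<exists>A\<in>carrier ?C. q A \<noteq> \<zero>\<^bsub>?D\<^esub>" using X(1) by blast
  then have "\<exists>h\<in>left_hom R P ?C. \<exists>p\<in>carrier P. q (h p) \<noteq> \<zero>\<^bsub>?D\<^esub>"
    by (intro P[unfolded generator_module_def, THEN conjunct2, rule_format, of ?C ?D q "\<lambda>_. \<zero>\<^bsub>?D\<^esub>"]
        conjI C(1) D(1) qhom zhom)
  then obtain h p where h: "h \<in> left_hom R P ?C" and p: "p \<in> carrier P" "q (h p) \<noteq> \<zero>\<^bsub>?D\<^esub>"
    by blast
  have hp: "h p \<in> carrier ?C" using left_homD(1)[OF h p(1)] .
  then have "k (uncyc M x (h p)) \<noteq> \<zero>\<^bsub>N\<^esub>"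
    using q[OF hp] p(2) inj_onD[OF D(3), of "q (h p)" "\<zero>\<^bsub>?D\<^esub>"] uz by auto
  then have "f (uncyc M x (h p)) \<noteq> g (uncyc M x (h p))" using kz[OF uC[OF hp]] by simp
  then have "\<exists>u\<in>carrier P. f (uncyc M x (h u)) \<noteq> g (uncyc M x (h u))" using p(1) by (rule bexI)
  then show ?thesis by (rule bexI[OF _ left_hom_comp[OF h C(2)]])
qed


section \<open>Algebras over the ground field\<close>

text \<open>
  Endomorphisms are written on the left of their arguments and composed accordingly.  The field
  acts on a module over a unital algebra \<open>A\<close> through the scalar multiples of the identity of \<open>A\<close>.
\<close>

definition end_algebra ::
    "('k, 'a) module \<Rightarrow> ('a, 'p) module \<Rightarrow> ('k, 'p \<Rightarrow> 'p) module" where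
  "end_algebra A P =
    \<lparr>carrier = left_hom A P P \<inter> extensional (carrier P),
     monoid.mult = compose (carrier P),
     one = (\<lambda>x\<in>carrier P. x),
     zero = (\<lambda>x\<in>carrier P. \<zero>\<^bsub>P\<^esub>),
     add = (\<lambda>f g. \<lambda>x\<in>carrier P. f x \<oplus>\<^bsub>P\<^esub> g x),
     smult = (\<lambda>c f. \<lambda>x\<in>carrier P. (c \<odot>\<^bsub>A\<^esub> \<one>\<^bsub>A\<^esub>) \<odot>\<^bsub>P\<^esub> f x)\<rparr>"

definition mat_algebra :: "nat \<Rightarrow> ('k, 'a) module \<Rightarrow> ('k, 'a mat) module" where
  "mat_algebra n A =
    \<lparr>carrier = {X \<in> carrier_mat n n. elements_mat X \<subseteq> carrier A},
     monoid.mult = (\<lambda>X Y. mat n n (\<lambda>(i, j). \<Oplus>\<^bsub>A\<^esub>l\<in>{..<n}. X $$ (i, l) \<otimes>\<^bsub>A\<^esub> Y $$ (l, j))),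
     one = mat n n (\<lambda>(i, j). if i = j then \<one>\<^bsub>A\<^esub> else \<zero>\<^bsub>A\<^esub>),
     zero = mat n n (\<lambda>_. \<zero>\<^bsub>A\<^esub>),
     add = (\<lambda>X Y. mat n n (\<lambda>(i, j). X $$ (i, j) \<oplus>\<^bsub>A\<^esub> Y $$ (i, j))),
     smult = (\<lambda>c. map_mat (smult A c))\<rparr>"

definition algebra_isomorphic :: "('k, 'a) module \<Rightarrow> ('k, 'b) module \<Rightarrow> bool" where
  "algebra_isomorphic A B \<longleftrightarrow>
    (\<exists>\<phi>\<in>ring_iso A B. \<forall>c. \<forall>x\<in>carrier A. \<phi> (c \<odot>\<^bsub>A\<^esub> x) = c \<odot>\<^bsub>B\<^esub> \<phi> x)"

end

theory Submission
  imports Defs "HOL-Library.Nat_Bijection"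
begin

text \<open>
  The algebra \<open>A = L(E, w)\<close> acts on a free module with an explicit basis of normal words, the direct
  sum of countably many copies of the modules \<open>A u\<close>, where \<open>u\<close> ranges over the vertices.  At a regular
  vertex the relations say that the letters give mutually inverse isomorphisms between two direct sums
  of vertex components.  Filtering a submodule by leading words, one finds that a new leading word is
  either a free generator or comes from an element of the graph of such an isomorphism, whose two
  sides enter together.  Hence every submodule is again a direct sum of modules \<open>A u\<close>.

  If \<open>P\<close> is a finitely generated projective generator, then some power \<open>P\<^sup>n\<close> is a direct summand of the
  free module that contains every \<open>A u\<close>.  So \<open>P\<^sup>n\<close> is the direct sum of \<open>h u\<close> copies of each \<open>A u\<close> with
  \<open>1 \<le> h u\<close>, and its endomorphism algebra consists of the matrices over \<open>A\<close> with entries in the spaces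
  \<open>u A v\<close>, indexed by the vertices of the hair extension \<open>E\<^sup>+\<close> with hairs of length \<open>h u - 1\<close>.  Up to
  the involution of \<open>A\<close> this is \<open>L(E\<^sup>+, w\<^sup>+)\<close>, because the paths along the hairs are matrix units.
\<close>

section \<open>Linear maps between spaces of finitely supported functions\<close>

text \<open>Constancy of the weight makes the letters at a regular vertex two full matrices, with
  rows and columns given by the indices and the outgoing edges. The matrix relations say exactly
  that they are inverse to each other, and solving each relation for one term yields normal words.

  The obstacle is that a letter may also shorten a word, so the leading word of
  \<open>lam t s x\<close> is not determined by that of \<open>x\<close>. The remedy is to study
  points of the graph of a block isomorphism, all coordinates at once: when such a point brings new
  words into the filtration, its leading part is a multiple of a whole family of words
  \<open>(t, s) b\<close>, where \<open>t\<close> runs through one side. A numbering of type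
  \<omega> turns the arguments into inductions over natural numbers.

  The number \<open>n\<close> counts the homomorphisms from \<open>P\<close> used to reach the
  identity of the algebra, since in general only a power of \<open>P\<close> maps onto the regular
  module. Hair edges have weight one, so such an edge and its ghost are inverse to each other
  between the two end vertices.\<close>

definition pscale :: "'k::field \<Rightarrow> ('a \<Rightarrow>\<^sub>0 'k) \<Rightarrow> 'a \<Rightarrow>\<^sub>0 'k" where
  "pscale c x = Poly_Mapping.map ((*) c) x"

lemma lookup_pscale [simp]: "Poly_Mapping.lookup (pscale c x) a = c * Poly_Mapping.lookup x a"
  unfolding pscale_def by (transfer) (auto simp: when_def)

lemma pscale_simps [simp]:
  "pscale 0 x = 0" "pscale 1 x = x" "pscale c 0 = 0" "pscale (- 1) x = - x"
  "pscale c (Poly_Mapping.single a d) = Poly_Mapping.single a (c * d)"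
  "pscale c (pscale d x) = pscale (c * d) x"
  by (auto intro!: poly_mapping_eqI simp: lookup_single when_def)

lemma pscale_add: "pscale c (x + y) = pscale c x + pscale c y" "pscale (c + d) x = pscale c x + pscale d x"
  by (auto intro!: poly_mapping_eqI simp: lookup_add algebra_simps)

lemma pscale_diff: "pscale c (x - y) = pscale c x - pscale c y" "pscale c (- x) = - pscale c x"
  by (rule poly_mapping_eqI, simp add: lookup_minus right_diff_distrib)+

lemma pscale_sum: "pscale c (\<Sum>i\<in>I. f i) = (\<Sum>i\<in>I. pscale c (f i))"
  by (induction I rule: infinite_finite_induct) (auto simp: pscale_add)

lemma keys_pscale: "Poly_Mapping.keys (pscale c x) \<subseteq> Poly_Mapping.keys x"
  by (auto simp: in_keys_iff)

definition plinear :: "(('a \<Rightarrow>\<^sub>0 'k::field) \<Rightarrow> ('b \<Rightarrow>\<^sub>0 'k)) \<Rightarrow> bool" where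
  "plinear f \<longleftrightarrow> (\<forall>x y. f (x + y) = f x + f y) \<and> (\<forall>c x. f (pscale c x) = pscale c (f x))"

lemma plinearI:
  "(\<And>x y. f (x + y) = f x + f y) \<Longrightarrow> (\<And>c x. f (pscale c x) = pscale c (f x)) \<Longrightarrow> plinear f"
  by (simp add: plinear_def)

lemma plinearD:
  assumes "plinear f"
  shows "f (x + y) = f x + f y"
    and plinear_scale: "f (pscale c x) = pscale c (f x)"
    and "f 0 = 0"
    and "f (- x) = - f x"
    and "f (x - y) = f x - f y"
    and plinear_sum: "f (\<Sum>i\<in>I. g i) = (\<Sum>i\<in>I. f (g i))"
proof -
  show add: "f (x + y) = f x + f y" and scale: "f (pscale c x) = pscale c (f x)" for x y c
    using assms by (simp_all add: plinear_def)
  show zero: "f 0 = 0" using scale[of 0 0] by simp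
  show um: "f (- x) = - f x" for x using scale[of "- 1" x] by simp
  show "f (x - y) = f x - f y" using add[of x "- y"] um by simp
  show "f (\<Sum>i\<in>I. g i) = (\<Sum>i\<in>I. f (g i))"
    by (induction I rule: infinite_finite_induct) (auto simp: zero add)
qed

lemma plinear_intros:
  "plinear (\<lambda>x. x)" "plinear (\<lambda>x. 0)"
  "plinear f \<Longrightarrow> plinear g \<Longrightarrow> plinear (\<lambda>x. f x + g x)"
  "plinear f \<Longrightarrow> plinear g \<Longrightarrow> plinear (\<lambda>x. f x - g x)"
  "plinear f \<Longrightarrow> plinear (\<lambda>x. pscale c (f x))"
  "plinear (\<lambda>x. pscale (Poly_Mapping.lookup x a) y)"
  by (auto simp: plinear_def pscale_add pscale_diff lookup_add algebra_simps)

lemma plinear_comp: "plinear h \<Longrightarrow> plinear f \<Longrightarrow> plinear (\<lambda>x. h (f x))"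
  by (simp add: plinear_def)

lemma plinear_sum_fun: "(\<And>i. i \<in> I \<Longrightarrow> plinear (f i)) \<Longrightarrow> plinear (\<lambda>x. \<Sum>i\<in>I. f i x)"
  by (induction I rule: infinite_finite_induct) (auto intro!: plinear_intros)

text \<open>A scalar acts as a monomial at the neutral word, so the first equation is associativity.
  The second one needs this monomial to be central in a noncommutative algebra, which is checked on
  monomials.\<close>

lemma mult_pscale:
  fixes p q :: "'a::monoid_add \<Rightarrow>\<^sub>0 'k::field"
  shows "pscale c p * q = pscale c (p * q)" "p * pscale c q = pscale c (p * q)"
proof -
  have c: "pscale c p = Poly_Mapping.single 0 c * p" for p :: "'a \<Rightarrow>\<^sub>0 'k"
    by (simp add: pscale_def mult_map_scale_conv_mult)
  show "pscale c p * q = pscale c (p * q)" by (simp add: c mult.assoc)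
  have s: "p = (\<Sum>m\<in>Poly_Mapping.keys p. Poly_Mapping.single m (Poly_Mapping.lookup p m))" for p :: "'a \<Rightarrow>\<^sub>0 'k"
    by (rule poly_mapping_eqI)
      (auto simp: lookup_sum lookup_single when_def not_in_keys_iff_lookup_eq_zero sum.delta)
  have "p * Poly_Mapping.single 0 c = Poly_Mapping.single 0 c * p"
    by (subst (1 2) s[of p]) (simp add: sum_distrib_left sum_distrib_right mult_single mult.commute)
  then show "p * pscale c q = pscale c (p * q)" by (simp add: c mult.assoc[symmetric])
qed

lemma plinear_mult:
  fixes p :: "'a::monoid_add \<Rightarrow>\<^sub>0 'k::field"
  shows "plinear (\<lambda>q. p * q)" "plinear (\<lambda>q. q * p)"
  by (auto intro!: plinearI simp: algebra_simps mult_pscale)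

definition pext :: "('a \<Rightarrow> ('b \<Rightarrow>\<^sub>0 'k::field)) \<Rightarrow> ('a \<Rightarrow>\<^sub>0 'k) \<Rightarrow> 'b \<Rightarrow>\<^sub>0 'k" where
  "pext \<phi> x = (\<Sum>a\<in>Poly_Mapping.keys x. pscale (Poly_Mapping.lookup x a) (\<phi> a))"

lemma pext_superset:
  "finite A \<Longrightarrow> Poly_Mapping.keys x \<subseteq> A \<Longrightarrow>
    pext \<phi> x = (\<Sum>a\<in>A. pscale (Poly_Mapping.lookup x a) (\<phi> a))"
  unfolding pext_def by (intro sum.mono_neutral_left) (auto simp: in_keys_iff)

lemma plinear_pext:
  fixes \<phi> :: "'a \<Rightarrow> ('b \<Rightarrow>\<^sub>0 'k::field)"
  shows "plinear (pext \<phi>)"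
proof (rule plinearI)
  fix x y :: "'a \<Rightarrow>\<^sub>0 'k" and c
  let ?A = "Poly_Mapping.keys x \<union> Poly_Mapping.keys y"
  show "pext \<phi> (x + y) = pext \<phi> x + pext \<phi> y"
    using Poly_Mapping.keys_add[of x y]
    by (simp add: pext_superset[of ?A] lookup_add pscale_add sum.distrib)
  show "pext \<phi> (pscale c x) = pscale c (pext \<phi> x)"
    by (simp add: pext_superset[of "Poly_Mapping.keys x"] keys_pscale pscale_sum)
qed

lemma pext_single [simp]: "pext \<phi> (Poly_Mapping.single a c) = pscale c (\<phi> a)"
  by (simp add: pext_superset[of "{a}"])

lemma plinear_eq_pext:
  assumes "plinear f"
  shows "f x = pext (\<lambda>a. f (Poly_Mapping.single a 1)) x"
proof -
  have "x = (\<Sum>a\<in>Poly_Mapping.keys x. pscale (Poly_Mapping.lookup x a) (Poly_Mapping.single a 1))"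
    by (rule poly_mapping_eqI)
      (auto simp: lookup_sum lookup_single when_def not_in_keys_iff_lookup_eq_zero sum.delta)
  then have "f x = (\<Sum>a\<in>Poly_Mapping.keys x. f (pscale (Poly_Mapping.lookup x a) (Poly_Mapping.single a 1)))"
    by (subst plinear_sum[OF assms, symmetric]) simp
  then show ?thesis by (simp only: plinear_scale[OF assms] pext_def)
qed

text \<open>Reduces a membership to basis elements. \<open>Z\<close> is any subspace, so the lemma
  serves vertex components, ideals and submodules alike.\<close>

lemma plinear_mem:
  assumes f: "plinear f"
    and Z: "0 \<in> Z" "\<And>x y. x \<in> Z \<Longrightarrow> y \<in> Z \<Longrightarrow> x + y \<in> Z" "\<And>c x. x \<in> Z \<Longrightarrow> pscale c x \<in> Z"
    and keys: "\<And>a. a \<in> Poly_Mapping.keys x \<Longrightarrow> f (Poly_Mapping.single a 1) \<in> Z"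
  shows "f x \<in> Z"
proof -
  have "(\<Sum>a\<in>A. pscale (Poly_Mapping.lookup x a) (f (Poly_Mapping.single a 1))) \<in> Z"
    if "A \<subseteq> Poly_Mapping.keys x" for A
    using that by (induction A rule: infinite_finite_induct) (auto intro: Z keys)
  then show ?thesis by (subst plinear_eq_pext[OF f]) (simp add: pext_def)
qed

lemma plinear_eq_on:
  assumes "plinear f" "plinear g"
    and "\<And>a. a \<in> Poly_Mapping.keys x \<Longrightarrow> f (Poly_Mapping.single a 1) = g (Poly_Mapping.single a 1)"
  shows "f x = g x"
  using assms(3) by (subst plinear_eq_pext[OF assms(1)], subst plinear_eq_pext[OF assms(2)])
    (simp add: pext_def)

lemma lookup_pext:
  "Poly_Mapping.lookup (pext \<phi> x) b =
    (\<Sum>a\<in>Poly_Mapping.keys x. Poly_Mapping.lookup x a * Poly_Mapping.lookup (\<phi> a) b)"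
  by (simp add: pext_def lookup_sum)


section \<open>The action of a free algebra\<close>

text \<open>Each letter acts by a given map and a word by their composite, leftmost letter
  outermost, so that for linear letters the product of the free algebra becomes composition.\<close>

definition act :: "('g \<Rightarrow> ('a \<Rightarrow>\<^sub>0 'k::field) \<Rightarrow> ('a \<Rightarrow>\<^sub>0 'k)) \<Rightarrow> ('g fmon \<Rightarrow>\<^sub>0 'k) \<Rightarrow>
    ('a \<Rightarrow>\<^sub>0 'k) \<Rightarrow> ('a \<Rightarrow>\<^sub>0 'k)" where
  "act \<tau> p x = pext (\<lambda>m. foldr \<tau> (letters m) x) p"

lemma plinear_act_left: "plinear (\<lambda>p. act \<tau> p x)"
  unfolding act_def by (rule plinear_pext)

lemma plinear_foldr: "(\<And>g. plinear (\<tau> g)) \<Longrightarrow> plinear (foldr \<tau> l)"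
  by (induction l) (auto simp: plinear_def)

lemma plinear_act: "(\<And>g. plinear (\<tau> g)) \<Longrightarrow> plinear (act \<tau> p)"
  unfolding act_def pext_def by (intro plinear_sum_fun plinear_intros(5) plinear_foldr)

lemma act_single: "act \<tau> (Poly_Mapping.single m c) x = pscale c (foldr \<tau> (letters m) x)"
  by (simp add: act_def)

lemma act_gen [simp]: "act \<tau> (gen g) x = \<tau> g x"
  by (simp add: gen_def act_single)

lemma act_1 [simp]: "act \<tau> 1 x = x"
  using act_single[of \<tau> 0 1 x] unfolding single_one by (simp add: zero_fmon_def)

lemmas act_left_simps = plinearD[OF plinear_act_left]

lemma act_0 [simp]: "act \<tau> 0 x = 0"
  by (rule act_left_simps)

lemma act_mult:
  assumes \<tau>: "\<And>g. plinear (\<tau> g)"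
  shows "act \<tau> (p * q) x = act \<tau> p (act \<tau> q x)"
proof (rule plinear_eq_on[where f = "\<lambda>p. act \<tau> (p * q) x" and g = "\<lambda>p. act \<tau> p (act \<tau> q x)" and x = p])
  show "plinear (\<lambda>p. act \<tau> (p * q) x)"
    by (rule plinear_comp[OF plinear_act_left plinear_mult(2)])
  show "plinear (\<lambda>p. act \<tau> p (act \<tau> q x))" by (rule plinear_act_left)
  fix m
  show "act \<tau> (Poly_Mapping.single m 1 * q) x = act \<tau> (Poly_Mapping.single m 1) (act \<tau> q x)"
  proof (rule plinear_eq_on[where f = "\<lambda>q. act \<tau> (Poly_Mapping.single m 1 * q) x"
        and g = "\<lambda>q. act \<tau> (Poly_Mapping.single m 1) (act \<tau> q x)" and x = q])
    show "plinear (\<lambda>q. act \<tau> (Poly_Mapping.single m 1 * q) x)"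
      by (rule plinear_comp[OF plinear_act_left plinear_mult(1)])
    show "plinear (\<lambda>q. act \<tau> (Poly_Mapping.single m 1) (act \<tau> q x))"
      by (rule plinear_comp[OF plinear_act[OF \<tau>] plinear_act_left])
  qed (simp add: mult_single act_single plus_fmon_def)
qed

lemma act_closed:
  assumes Y: "0 \<in> Y" "\<And>x y. x \<in> Y \<Longrightarrow> y \<in> Y \<Longrightarrow> x + y \<in> Y" "\<And>c x. x \<in> Y \<Longrightarrow> pscale c x \<in> Y"
    and \<tau>: "\<And>g x. g \<in> G \<Longrightarrow> x \<in> Y \<Longrightarrow> \<tau> g x \<in> Y"
    and p: "p \<in> carrier (free_algebra G)" and x: "x \<in> Y"
  shows "act \<tau> p x \<in> Y"
proof (rule plinear_mem[OF plinear_act_left Y])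
  fix m assume "m \<in> Poly_Mapping.keys p"
  then have "set (letters m) \<subseteq> G" using p by (auto simp: mem_free_algebra)
  moreover have "foldr \<tau> l x \<in> Y" if "set l \<subseteq> G" for l
    using that by (induction l) (simp_all add: x \<tau>)
  ultimately have "foldr \<tau> (letters m) x \<in> Y" by blast
  then show "act \<tau> (Poly_Mapping.single m 1) x \<in> Y" by (simp add: act_single)
qed

text \<open>Linearity of \<open>f\<close> is asked for on \<open>Y\<close> only, because
  homomorphisms of the model are functions with arbitrary values outside their domain.\<close>

lemma act_commute:
  assumes f: "\<And>x y. x \<in> Y \<Longrightarrow> y \<in> Y \<Longrightarrow> f (x + y) = f x + f y"
    "\<And>c x. x \<in> Y \<Longrightarrow> f (pscale c x) = pscale c (f x)"
    "\<And>g x. g \<in> G \<Longrightarrow> x \<in> Y \<Longrightarrow> f (\<tau> g x) = \<sigma> g (f x)"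
    and Y: "0 \<in> Y" "\<And>x y. x \<in> Y \<Longrightarrow> y \<in> Y \<Longrightarrow> x + y \<in> Y" "\<And>c x. x \<in> Y \<Longrightarrow> pscale c x \<in> Y"
    and \<tau>: "\<And>g x. g \<in> G \<Longrightarrow> x \<in> Y \<Longrightarrow> \<tau> g x \<in> Y"
    and p: "p \<in> carrier (free_algebra G)" and x: "x \<in> Y"
  shows "f (act \<tau> p x) = act \<sigma> p (f x)"
proof -
  have f0: "f 0 = 0" using f(2)[OF Y(1), of 0] by simp
  have word: "foldr \<tau> l x \<in> Y \<and> f (foldr \<tau> l x) = foldr \<sigma> l (f x)" if "set l \<subseteq> G" for l
    using that by (induction l) (simp_all add: x \<tau> f)
  have m: "set (letters m) \<subseteq> G" if "m \<in> Poly_Mapping.keys p" for m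
    using that p by (auto simp: mem_free_algebra)
  have "(\<Sum>m\<in>A. pscale (Poly_Mapping.lookup p m) (foldr \<tau> (letters m) x)) \<in> Y \<and>
    f (\<Sum>m\<in>A. pscale (Poly_Mapping.lookup p m) (foldr \<tau> (letters m) x)) =
      (\<Sum>m\<in>A. pscale (Poly_Mapping.lookup p m) (foldr \<sigma> (letters m) (f x)))"
    if "A \<subseteq> Poly_Mapping.keys p" for A
    using that
  proof (induction A rule: infinite_finite_induct)
    case (insert a A)
    then show ?case using word[OF m, of a] by (simp add: f Y)
  qed (simp_all add: f0 Y)
  then show ?thesis by (simp add: act_def pext_def)
qed


section \<open>The normal form model\<close>

text \<open>A list of letters applied to a free generator \<open>(u, k)\<close>, the generator at
  the vertex \<open>u\<close> in the copy number \<open>k\<close>.\<close>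

type_synonym ('t, 'u) nword = "('t \<times> 't) list \<times> 'u \<times> nat"

text \<open>A block is a regular vertex, and its two sides are the index set of the weight and the
  set of outgoing edges. Since nothing distinguishes the sides, one argument covers both families of
  matrix relations. \<open>sp\<close> fixes on each side the slot whose term the relations
  eliminate.\<close>

locale slots =
  fixes T :: "'t set" and V :: "'u set" and blk :: "'t \<Rightarrow> 'b" and sd :: "'t \<Rightarrow> bool"
    and vert :: "'t \<Rightarrow> 'u" and sp :: "'b \<Rightarrow> bool \<Rightarrow> 't"
  assumes finite_T: "finite T" and finite_V: "finite V"
    and vert_mem: "t \<in> T \<Longrightarrow> vert t \<in> V"
    and sp_mem: "t \<in> T \<Longrightarrow> sp (blk t) c \<in> T"
    and sp_blk [simp]: "t \<in> T \<Longrightarrow> blk (sp (blk t) c) = blk t"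
    and sp_sd [simp]: "t \<in> T \<Longrightarrow> sd (sp (blk t) c) = c"
begin

section \<open>Slots, letters and normal words\<close>

definition opps :: "'t \<Rightarrow> 't set" where
  "opps t = {s \<in> T. blk s = blk t \<and> sd s \<noteq> sd t}"

abbreviation sp_same :: "'t \<Rightarrow> 't" where "sp_same t \<equiv> sp (blk t) (sd t)"
abbreviation sp_opp :: "'t \<Rightarrow> 't" where "sp_opp t \<equiv> sp (blk t) (\<not> sd t)"

lemma finite_opps [simp]: "finite (opps t)"
  using finite_T by (auto simp: opps_def)

lemma oppsD: "s \<in> opps t \<Longrightarrow> s \<in> T" "s \<in> opps t \<Longrightarrow> blk s = blk t" "s \<in> opps t \<Longrightarrow> sd s \<longleftrightarrow> \<not> sd t"
  by (auto simp: opps_def)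

lemma opps_sym: "s \<in> opps t \<Longrightarrow> t \<in> T \<Longrightarrow> t \<in> opps s"
  by (auto simp: opps_def)

lemma sp_opp_mem: "t \<in> T \<Longrightarrow> sp_opp t \<in> opps t"
  using sp_mem[of t] by (auto simp: opps_def)

fun wtop :: "('t, 'u) nword \<Rightarrow> 'u" where
  "wtop ([], g) = fst g"
| "wtop (ts # l, g) = vert (fst ts)"

definition cn :: "'t \<Rightarrow> 't \<Rightarrow> ('t, 'u) nword \<Rightarrow> ('t, 'u) nword" where
  "cn t s a = ((t, s) # fst a, snd a)"

lemma cn_eq_iff [simp]: "cn t s a = cn t' s' a' \<longleftrightarrow> t = t' \<and> s = s' \<and> a = a'"
  by (auto simp: cn_def prod_eq_iff)

lemma cn_neq [simp]: "cn t s a \<noteq> ([], g)" "([], g) \<noteq> cn t s a"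
  by (auto simp: cn_def)

lemma top_cn [simp]: "wtop (cn t s a) = vert t"
  by (simp add: cn_def)

lemma word_cases [case_names gen cn]:
  obtains g where "a = ([], g)" | t s b where "a = cn t s b"
  by (cases a; cases "fst a") (auto simp: cn_def)

lemma word_induct [case_names gen cn]:
  assumes "\<And>g. Q ([], g)" and "\<And>t s a. Q a \<Longrightarrow> Q (cn t s a)"
  shows "Q a"
proof -
  have "Q (l, g)" for l g
  proof (induction l)
    case (Cons ts l)
    then show ?case using assms(2)[of "(l, g)" "fst ts" "snd ts"] by (simp add: cn_def)
  qed (rule assms)
  then show ?thesis by (cases a) simp
qed

text \<open>
  A letter \<open>(t, s)\<close> maps the component at \<open>vert s\<close> to the component at \<open>vert t\<close>.  The relation
  \<open>\<Sum>s. (t, s) (s, r) = \<delta>\<^sub>t\<^sub>r\<close> is used to eliminate its term with special \<open>s\<close>.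
\<close>

definition red :: "'t \<Rightarrow> ('t, 'u) nword \<Rightarrow> bool" where
  "red s a \<longleftrightarrow> s = sp_same s \<and> (\<exists>r b. a = cn s r b)"

fun nw_aux :: "('t \<times> 't) list \<Rightarrow> 'u \<times> nat \<Rightarrow> bool" where
  "nw_aux [] g \<longleftrightarrow> fst g \<in> V"
| "nw_aux (ts # l) g \<longleftrightarrow> snd ts \<in> T \<and> fst ts \<in> opps (snd ts) \<and> nw_aux l g \<and>
    wtop (l, g) = vert (snd ts) \<and> \<not> red (snd ts) (l, g)"

definition nw :: "('t, 'u) nword \<Rightarrow> bool" where
  "nw a \<longleftrightarrow> nw_aux (fst a) (snd a)"

lemma nw_simps [simp]:
  "nw ([], g) \<longleftrightarrow> fst g \<in> V"
  "nw (cn t s a) \<longleftrightarrow> s \<in> T \<and> t \<in> opps s \<and> nw a \<and> wtop a = vert s \<and> \<not> red s a"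
  by (simp_all add: nw_def cn_def)

section \<open>Normal forms and their vertex components\<close>

definition NF :: "(('t, 'u) nword \<Rightarrow>\<^sub>0 'k::field) set" where
  "NF = {x. \<forall>a\<in>Poly_Mapping.keys x. nw a}"

definition NFv :: "'u \<Rightarrow> (('t, 'u) nword \<Rightarrow>\<^sub>0 'k::field) set" where
  "NFv u = {x. \<forall>a\<in>Poly_Mapping.keys x. nw a \<and> wtop a = u}"

lemma NF_closed:
  "0 \<in> NF" "x \<in> NF \<Longrightarrow> y \<in> NF \<Longrightarrow> x + y \<in> NF" "x \<in> NF \<Longrightarrow> pscale c x \<in> NF"
  "x \<in> NF \<Longrightarrow> y \<in> NF \<Longrightarrow> x - y \<in> NF" "x \<in> NF \<Longrightarrow> - x \<in> NF"
  by (auto simp: NF_def in_keys_iff lookup_add lookup_minus)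

lemma NFv_closed:
  "0 \<in> NFv u" "x \<in> NFv u \<Longrightarrow> y \<in> NFv u \<Longrightarrow> x + y \<in> NFv u" "x \<in> NFv u \<Longrightarrow> pscale c x \<in> NFv u"
  "x \<in> NFv u \<Longrightarrow> y \<in> NFv u \<Longrightarrow> x - y \<in> NFv u" "x \<in> NFv u \<Longrightarrow> - x \<in> NFv u"
  by (auto simp: NFv_def in_keys_iff lookup_add lookup_minus)

lemma NF_sum: "(\<And>i. i \<in> I \<Longrightarrow> f i \<in> NF) \<Longrightarrow> sum f I \<in> NF"
  by (induction I rule: infinite_finite_induct) (auto intro: NF_closed)

lemma NFv_sum: "(\<And>i. i \<in> I \<Longrightarrow> f i \<in> NFv u) \<Longrightarrow> sum f I \<in> NFv u"
  by (induction I rule: infinite_finite_induct) (auto intro: NFv_closed)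

lemma NFv_subset: "x \<in> NFv u \<Longrightarrow> x \<in> NF"
  by (auto simp: NF_def NFv_def)

lemma single_mem: "nw a \<Longrightarrow> Poly_Mapping.single a c \<in> NF" 
  "nw a \<Longrightarrow> wtop a = u \<Longrightarrow> Poly_Mapping.single a c \<in> NFv u"
  by (auto simp: NF_def NFv_def)

lemma wtop_mem: "nw a \<Longrightarrow> wtop a \<in> V"
  by (cases a rule: word_cases) (auto simp: opps_def vert_mem)

text \<open>Words that are not normal are sent to zero. This makes the projection linear on the
  whole function space while its values always lie in the model.\<close>

definition vproj :: "'u \<Rightarrow> (('t, 'u) nword \<Rightarrow>\<^sub>0 'k::field) \<Rightarrow> (('t, 'u) nword \<Rightarrow>\<^sub>0 'k)" where
  "vproj u = pext (\<lambda>a. if nw a \<and> wtop a = u then Poly_Mapping.single a 1 else 0)"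

lemma plinear_vproj: "plinear (vproj u)"
  unfolding vproj_def by (rule plinear_pext)

lemmas vproj_simps = plinearD[OF plinear_vproj]

lemma vproj_single: "vproj u (Poly_Mapping.single a c) = (if nw a \<and> wtop a = u then Poly_Mapping.single a c else 0)"
  by (simp add: vproj_def)

lemma vproj_mem: "vproj u x \<in> NFv u"
  by (rule plinear_mem[OF plinear_vproj]) (auto simp: vproj_single intro: NFv_closed single_mem)

lemma vproj_id: "x \<in> NFv u \<Longrightarrow> vproj u x = x"
  by (rule plinear_eq_on[OF plinear_vproj plinear_intros(1)]) (auto simp: vproj_single NFv_def)

lemma vproj_other: "x \<in> NFv u \<Longrightarrow> u \<noteq> u' \<Longrightarrow> vproj u' x = 0"
  by (rule plinear_eq_on[OF plinear_vproj plinear_intros(2)]) (auto simp: vproj_single NFv_def)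

lemma vproj_vproj: "vproj u (vproj u' x) = (if u = u' then vproj u x else 0)"
  using vproj_id[OF vproj_mem[of u x]] vproj_other[OF vproj_mem[of u' x], of u] by auto

lemma sum_vproj:
  assumes "x \<in> NF"
  shows "(\<Sum>u\<in>V. vproj u x) = x"
proof (rule plinear_eq_on[where f = "\<lambda>x. \<Sum>u\<in>V. vproj u x" and g = "\<lambda>x. x" and x = x])
  show "plinear (\<lambda>x. \<Sum>u\<in>V. vproj u x)" by (intro plinear_sum_fun plinear_vproj)
  fix a assume "a \<in> Poly_Mapping.keys x"
  then have "nw a" using assms by (auto simp: NF_def)
  then show "(\<Sum>u\<in>V. vproj u (Poly_Mapping.single a 1)) = Poly_Mapping.single a 1"
    using wtop_mem[of a] finite_V by (simp add: vproj_single sum.delta)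
qed (rule plinear_intros)

lemma lookup_vproj:
  assumes "x \<in> NF"
  shows "Poly_Mapping.lookup (vproj u x) a = (if wtop a = u then Poly_Mapping.lookup x a else 0)"
proof (cases "nw a")
  case True
  have "Poly_Mapping.lookup (vproj u x) a =
    (\<Sum>b\<in>Poly_Mapping.keys x. if b = a then (if wtop a = u then Poly_Mapping.lookup x a else 0) else 0)"
    unfolding vproj_def lookup_pext
    by (intro sum.cong) (auto simp: lookup_single True when_def)
  then show ?thesis by (auto simp: sum.delta in_keys_iff)
next
  case False
  then have "a \<notin> Poly_Mapping.keys x" "a \<notin> Poly_Mapping.keys (vproj u x)"
    using assms vproj_mem[of u x] by (auto simp: NF_def NFv_def)
  then show ?thesis by (simp add: in_keys_iff)
qed

section \<open>The action of the letters and its relations\<close>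

definition lamw :: "'t \<Rightarrow> 't \<Rightarrow> ('t, 'u) nword \<Rightarrow> (('t, 'u) nword \<Rightarrow>\<^sub>0 'k::field)" where
  "lamw t s a = (if nw a \<and> wtop a = vert s then
     if red s a then
       (let r = snd (hd (fst a)); b = (tl (fst a), snd a) in
         (if t = r then Poly_Mapping.single b 1 else 0) -
           (\<Sum>s'\<in>opps t - {s}. Poly_Mapping.single (cn t s' (cn s' r b)) 1))
     else Poly_Mapping.single (cn t s a) 1 else 0)"

text \<open>In the reducible case of \<open>lamw\<close> the relation is solved for its term with
  the special slot. The resulting words are normal, because no second slot of that side is
  special.\<close>

definition lam :: "'t \<Rightarrow> 't \<Rightarrow> (('t, 'u) nword \<Rightarrow>\<^sub>0 'k::field) \<Rightarrow> (('t, 'u) nword \<Rightarrow>\<^sub>0 'k)" where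
  "lam t s = pext (lamw t s)"

lemma plinear_lam: "plinear (lam t s)"
  unfolding lam_def by (rule plinear_pext)

lemmas lam_simps = plinearD[OF plinear_lam]

lemma lam_single: "lam t s (Poly_Mapping.single a c) = pscale c (lamw t s a)"
  by (simp add: lam_def)

lemma lamw_red:
  assumes "nw (cn s r b)" "s = sp_same s"
  shows "lamw t s (cn s r b) = (if t = r then Poly_Mapping.single b 1 else 0) -
           (\<Sum>s'\<in>opps t - {s}. Poly_Mapping.single (cn t s' (cn s' r b)) 1)"
proof -
  have "red s (cn s r b)" unfolding red_def using assms(2) by blast
  moreover have "snd (hd (fst (cn s r b))) = r" "(tl (fst (cn s r b)), snd (cn s r b)) = b"
    by (simp_all add: cn_def)
  ultimately show ?thesis using assms(1) by (simp add: lamw_def Let_def del: nw_simps)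
qed

lemma lamw_nonred: "nw a \<Longrightarrow> wtop a = vert s \<Longrightarrow> \<not> red s a \<Longrightarrow> lamw t s a = Poly_Mapping.single (cn t s a) 1"
  by (simp add: lamw_def)

lemma lamw_other: "wtop a \<noteq> vert s \<Longrightarrow> lamw t s a = 0"
  by (simp add: lamw_def)

text \<open>The reducibility test of a letter reads its second slot, so the first slot of the
  outermost letter can be changed freely within its side.\<close>

lemma nw_swap:
  assumes "nw (cn s r b)" "s' \<in> T" "blk s' = blk s" "sd s' = sd s"
  shows "nw (cn s' r b)"
  using assms by (auto simp: opps_def)

lemma nw_ext:
  assumes "nw (cn s r b)" "s = sp_same s" "t \<in> opps s" "s' \<in> opps t - {s}"
  shows "nw (cn t s' (cn s' r b))"
proof -
  have s': "s' \<in> T" "blk s' = blk s" "sd s' = sd s" and t: "t \<in> opps s'" 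
    using assms(1,3,4) by (auto simp: opps_def)
  have "s' \<noteq> sp_same s'" using assms(2,4) s' by auto
  then show ?thesis using nw_swap[OF assms(1) s'] s' t by (auto simp: red_def)
qed

lemma lam_mem:
  fixes x :: "('t, 'u) nword \<Rightarrow>\<^sub>0 'k::field"
  assumes "s \<in> T" "t \<in> opps s"
  shows "lam t s x \<in> NFv (vert t)"
proof (rule plinear_mem[OF plinear_lam])
  fix a
  have "(lamw t s a :: _ \<Rightarrow>\<^sub>0 'k) \<in> NFv (vert t)"
  proof (cases "nw a \<and> wtop a = vert s")
    case True
    show ?thesis
    proof (cases "red s a")
      case red: True
      then obtain r b where a: "a = cn s r b" and s: "s = sp_same s" by (auto simp: red_def)
      have nw: "nw (cn s r b)" using True a by simp
      have wtop: "r = t \<Longrightarrow> wtop b = vert t" "nw b" using nw by auto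
      have "(if t = r then Poly_Mapping.single b (1 :: 'k) else 0) \<in> NFv (vert t)"
        using wtop by (auto intro: single_mem NFv_closed)
      moreover have "(\<Sum>s'\<in>opps t - {s}. Poly_Mapping.single (cn t s' (cn s' r b)) (1 :: 'k)) \<in> NFv (vert t)"
        by (intro NFv_sum single_mem nw_ext[OF nw s assms(2)]) auto
      ultimately show ?thesis
        unfolding a lamw_red[OF nw s] by (rule NFv_closed(4))
    next
      case False
      then show ?thesis using True assms by (simp add: lamw_nonred) (rule single_mem; simp)
    qed
  qed (auto simp: lamw_def intro: NFv_closed)
  then show "lam t s (Poly_Mapping.single a (1 :: 'k)) \<in> NFv (vert t)" by (simp add: lam_single)
qed (rule NFv_closed; assumption)+

lemma lam_other:
  assumes "x \<in> NFv u" "u \<noteq> vert s"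
  shows "lam t s x = 0"
  by (rule plinear_eq_on[OF plinear_lam plinear_intros(2)])
    (use assms in \<open>auto simp: lam_single lamw_other NFv_def\<close>)

lemma lam_vproj:
  assumes "s \<in> T" "x \<in> NF"
  shows "lam t s (vproj (vert s) x) = lam t s x"
proof -
  have "lam t s x = (\<Sum>u\<in>V. lam t s (vproj u x))"
    by (subst sum_vproj[OF assms(2), symmetric]) (rule lam_simps)
  also have "\<dots> = (\<Sum>u\<in>V. if u = vert s then lam t s (vproj u x) else 0)"
    by (intro sum.cong) (auto simp: lam_other[OF vproj_mem])
  also have "\<dots> = lam t s (vproj (vert s) x)"
    using finite_V vert_mem[OF assms(1)] by (simp add: sum.delta)
  finally show ?thesis by simp
qed

text \<open>The case distinction is whether the inner letter reduces the word.\<close>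

lemma lam_relation_word:
  assumes t: "t \<in> T" "t' \<in> T" "blk t' = blk t" "sd t' = sd t" and a: "nw a" "wtop a = vert t'"
  shows "(\<Sum>s\<in>opps t. lam t s (lamw s t' a)) = (if t = t' then Poly_Mapping.single a (1 :: 'k::field) else 0)"
proof -
  have opps_eq: "opps t' = opps t" using t by (auto simp: opps_def)
  let ?o = "sp_opp t"
  have o: "?o \<in> opps t" by (rule sp_opp_mem[OF t(1)])
  have o_special: "?o = sp_same ?o" using t(1) by simp
  have s_special: "s = ?o" if "s \<in> opps t" "s = sp_same s" for s
    using that by (auto simp: opps_def)
  \<comment> \<open>If the inner letter is merely prepended, the outer special slot contributes the
    Kronecker term minus all the other products, and these cancel against the remaining
    summands.\<close>
  have nonred: "(\<Sum>s\<in>opps t. lam t s (Poly_Mapping.single (cn s t' a) 1)) =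
      (if t = t' then Poly_Mapping.single a (1 :: 'k) else 0)"
    if t': "t' \<in> T" "blk t' = blk t" "sd t' = sd t" "\<not> red t' a" "nw a" "wtop a = vert t'" for t' a
  proof -
    have opps_t': "opps t' = opps t" using t' by (auto simp: opps_def)
    have nw: "nw (cn s t' a)" if "s \<in> opps t" for s
      using t' that opps_t' by simp
    have "(\<Sum>s\<in>opps t. lam t s (Poly_Mapping.single (cn s t' a) 1)) =
        lam t ?o (Poly_Mapping.single (cn ?o t' a) 1) +
        (\<Sum>s\<in>opps t - {?o}. lam t s (Poly_Mapping.single (cn s t' a) (1 :: 'k)))"
      by (rule sum.remove[OF _ o]) simp
    also have "lam t ?o (Poly_Mapping.single (cn ?o t' a) 1) =
        (if t = t' then Poly_Mapping.single a 1 else 0) -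
          (\<Sum>s\<in>opps t - {?o}. Poly_Mapping.single (cn t s (cn s t' a)) (1 :: 'k))"
      unfolding lam_single lamw_red[OF nw[OF o] o_special] by simp
    also have "(\<Sum>s\<in>opps t - {?o}. lam t s (Poly_Mapping.single (cn s t' a) 1)) =
        (\<Sum>s\<in>opps t - {?o}. Poly_Mapping.single (cn t s (cn s t' a)) (1 :: 'k))"
    proof (intro sum.cong refl)
      fix s assume s: "s \<in> opps t - {?o}"
      then have "\<not> red s (cn s t' a)" using s_special[of s] by (auto simp: red_def)
      then show "lam t s (Poly_Mapping.single (cn s t' a) 1) = Poly_Mapping.single (cn t s (cn s t' a)) (1 :: 'k)"
        using nw[of s] s by (simp add: lam_single lamw_nonred del: nw_simps)
    qed
    finally show ?thesis by simp
  qed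
  show ?thesis
  proof (cases "red t' a")
    case False
    show ?thesis unfolding lamw_nonred[OF a False] by (rule nonred[OF t(2-4) False a])
  next
    case True
    then obtain r b where ab: "a = cn t' r b" and t'sp: "t' = sp_same t'" by (auto simp: red_def)
    have nwb: "nw (cn t' r b)" using a ab by simp
    then have r: "r \<in> T" "t' \<in> opps r" "nw b" "wtop b = vert r" "\<not> red r b" by auto
    have r_opp: "r \<in> opps t" using r t by (auto simp: opps_def)
    \<comment> \<open>This is the overlap of two reductions. Expanding the inner letter leaves only
      inner slots from \<open>S\<close>; they differ from the special slot \<open>t'\<close> of
      their side, so \<open>nonred\<close> applies to each of them.\<close>
    define S where "S = opps r - {t'}"
    have S: "t'' \<in> T" "blk t'' = blk t" "sd t'' = sd t" "t'' \<noteq> t'" if "t'' \<in> S" for t''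
      using that r_opp t by (auto simp: S_def opps_def)
    have opps_S: "opps s - {t'} = S" if "s \<in> opps t" for s
      using that r_opp by (auto simp: S_def opps_def)
    have t_S: "t \<in> S \<longleftrightarrow> t \<noteq> t'" using r_opp t(1) by (auto simp: S_def opps_def)
    have "(\<Sum>s\<in>opps t. lam t s (lamw s t' a)) =
        (\<Sum>s\<in>opps t. (if s = r then lam t s (Poly_Mapping.single b (1 :: 'k)) else 0) -
          (\<Sum>t''\<in>S. lam t s (Poly_Mapping.single (cn s t'' (cn t'' r b)) 1)))"
    proof (intro sum.cong refl)
      fix s assume s: "s \<in> opps t"
      show "lam t s (lamw s t' a) = (if s = r then lam t s (Poly_Mapping.single b (1 :: 'k)) else 0) -
          (\<Sum>t''\<in>S. lam t s (Poly_Mapping.single (cn s t'' (cn t'' r b)) 1))"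
        unfolding ab lamw_red[OF nwb t'sp] opps_S[OF s] by (auto simp: lam_simps)
    qed
    also have "\<dots> = lam t r (Poly_Mapping.single b 1) -
        (\<Sum>t''\<in>S. \<Sum>s\<in>opps t. lam t s (Poly_Mapping.single (cn s t'' (cn t'' r b)) 1))"
      using r_opp by (simp add: sum_subtractf sum.delta sum.swap[of _ S])
    also have "(\<Sum>t''\<in>S. \<Sum>s\<in>opps t. lam t s (Poly_Mapping.single (cn s t'' (cn t'' r b)) 1)) =
        (\<Sum>t''\<in>S. if t = t'' then Poly_Mapping.single (cn t'' r b) (1 :: 'k) else 0)"
    proof (intro sum.cong refl nonred)
      fix t'' assume t'': "t'' \<in> S"
      note S = S[OF t'']
      show "t'' \<in> T" "blk t'' = blk t" "sd t'' = sd t" "wtop (cn t'' r b) = vert t''" using S by auto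
      show "nw (cn t'' r b)" using nw_swap[OF nwb S(1)] S t by auto
      have "t'' \<noteq> sp_same t''" using S t'sp t by auto
      then show "\<not> red t'' (cn t'' r b)" by (simp add: red_def)
    qed
    also have "\<dots> = (if t \<noteq> t' then Poly_Mapping.single (cn t r b) 1 else 0)"
    proof -
      have "finite S" by (simp add: S_def)
      then show ?thesis using t_S by (simp add: sum.delta')
    qed
    also have "lam t r (Poly_Mapping.single b (1 :: 'k)) = Poly_Mapping.single (cn t r b) 1"
      using r by (simp add: lam_single lamw_nonred)
    finally show ?thesis using ab by auto
  qed
qed

lemma lam_relation:
  assumes t: "t \<in> T" "t' \<in> T" "blk t' = blk t" "sd t' = sd t" and x: "x \<in> NFv (vert t')"
  shows "(\<Sum>s\<in>opps t. lam t s (lam s t' x)) = (if t = t' then x else 0)"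
proof (rule plinear_eq_on[where f = "\<lambda>x. \<Sum>s\<in>opps t. lam t s (lam s t' x)" and g = "\<lambda>x. if t = t' then x else 0" and x = x])
  show "plinear (\<lambda>x. \<Sum>s\<in>opps t. lam t s (lam s t' x))"
    by (intro plinear_sum_fun plinear_comp[OF plinear_lam plinear_lam])
  show "plinear (\<lambda>x. if t = t' then x else 0)" by (cases "t = t'") (auto intro: plinear_intros)
  fix a assume "a \<in> Poly_Mapping.keys x"
  then have "nw a" "wtop a = vert t'" using x by (auto simp: NFv_def)
  then show "(\<Sum>s\<in>opps t. lam t s (lam s t' (Poly_Mapping.single a 1))) =
      (if t = t' then Poly_Mapping.single a 1 else 0)"
    unfolding lam_single pscale_simps by (rule lam_relation_word[OF t])
qed


section \<open>Evaluation of words and the universal property\<close>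

definition wev :: "('t \<Rightarrow> 't \<Rightarrow> 'y \<Rightarrow> 'y) \<Rightarrow> ('u \<times> nat \<Rightarrow> 'y) \<Rightarrow> ('t, 'u) nword \<Rightarrow> 'y" where
  "wev \<sigma> x0 a = foldr (\<lambda>(t, s). \<sigma> t s) (fst a) (x0 (snd a))"

lemma wev_simps [simp]: "wev \<sigma> x0 ([], g) = x0 g" "wev \<sigma> x0 (cn t s a) = \<sigma> t s (wev \<sigma> x0 a)"
  by (simp_all add: wev_def cn_def)

lemma wev_mem:
  assumes "\<And>g. fst g \<in> V \<Longrightarrow> x0 g \<in> Y (fst g)"
    and "\<And>t s y. s \<in> T \<Longrightarrow> t \<in> opps s \<Longrightarrow> y \<in> Y (vert s) \<Longrightarrow> \<sigma> t s y \<in> Y (vert t)"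
    and "nw a"
  shows "wev \<sigma> x0 a \<in> Y (wtop a)"
  using assms(3) by (induction a rule: word_induct) (auto simp: assms(1,2))

text \<open>
  The target only has to satisfy the relations modulo \<open>Z\<close>, so that it may be a quotient.
\<close>

lemma pext_wev_lam:
  fixes \<sigma> :: "'t \<Rightarrow> 't \<Rightarrow> ('c \<Rightarrow>\<^sub>0 'k::field) \<Rightarrow> ('c \<Rightarrow>\<^sub>0 'k)"
  assumes x0: "\<And>g. fst g \<in> V \<Longrightarrow> x0 g \<in> Y (fst g)"
    and Y: "\<And>t s y. s \<in> T \<Longrightarrow> t \<in> opps s \<Longrightarrow> y \<in> Y (vert s) \<Longrightarrow> \<sigma> t s y \<in> Y (vert t)"
    and lin: "\<And>t s. plinear (\<sigma> t s)"
    and Z: "0 \<in> Z" "\<And>x y. x \<in> Z \<Longrightarrow> y \<in> Z \<Longrightarrow> x + y \<in> Z" "\<And>c x. x \<in> Z \<Longrightarrow> pscale c x \<in> Z"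
    and other: "\<And>t s u y. s \<in> T \<Longrightarrow> t \<in> opps s \<Longrightarrow> u \<in> V \<Longrightarrow> y \<in> Y u \<Longrightarrow> u \<noteq> vert s \<Longrightarrow> \<sigma> t s y \<in> Z"
    and rel: "\<And>t t' y. t \<in> T \<Longrightarrow> t' \<in> T \<Longrightarrow> blk t' = blk t \<Longrightarrow> sd t' = sd t \<Longrightarrow> y \<in> Y (vert t') \<Longrightarrow>
        (\<Sum>s\<in>opps t. \<sigma> t s (\<sigma> s t' y)) - (if t = t' then y else 0) \<in> Z"
    and s: "s \<in> T" "t \<in> opps s" and x: "x \<in> NF"
  shows "pext (wev \<sigma> x0) (lam t s x) - \<sigma> t s (pext (wev \<sigma> x0) x) \<in> Z"
proof (rule plinear_mem[where f = "\<lambda>x. pext (wev \<sigma> x0) (lam t s x) - \<sigma> t s (pext (wev \<sigma> x0) x)", OF _ Z])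
  let ?w = "wev \<sigma> x0"
  have mem: "?w a \<in> Y (wtop a)" if "nw a" for a by (rule wev_mem[OF x0 Y that])
  show "plinear (\<lambda>x. pext ?w (lam t s x) - \<sigma> t s (pext ?w x))"
    by (intro plinear_intros plinear_comp[OF plinear_pext plinear_lam] plinear_comp[OF lin plinear_pext])
  have neg: "- y \<in> Z" if "y \<in> Z" for y using Z(3)[OF that, of "- 1"] by simp
  fix a assume "a \<in> Poly_Mapping.keys x"
  then have a: "nw a" using x by (auto simp: NF_def)
  have "pext ?w (lamw t s a) - \<sigma> t s (?w a) \<in> Z"
  proof (cases "wtop a = vert s")
    case False
    then show ?thesis
      using neg[OF other[OF s wtop_mem[OF a] mem[OF a]]] by (simp add: lamw_other plinearD(3)[OF plinear_pext])
  next
    case top: True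
    show ?thesis
    proof (cases "red s a")
      case False
      then show ?thesis using a top Z(1) by (simp add: lamw_nonred)
    next
      case True
      then obtain r b where ab: "a = cn s r b" and sp: "s = sp_same s" by (auto simp: red_def)
      have nw: "nw (cn s r b)" using a ab by simp
      then have r: "r \<in> T" "s \<in> opps r" and b: "nw b" "wtop b = vert r" by auto
      have tT: "t \<in> T" and st: "s \<in> opps t" using s by (auto simp: opps_def)
      have rt: "blk r = blk t" "sd r = sd t" using s r by (auto simp: opps_def)
      have r1: "(\<Sum>s\<in>opps t. \<sigma> t s (\<sigma> s r (?w b))) - (if t = r then ?w b else 0) \<in> Z"
        using rel[OF tT r(1) rt, of "?w b"] mem[OF b(1)] b(2) by simp
      have r2: "(\<Sum>s\<in>opps t. \<sigma> t s (\<sigma> s r (?w b))) =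
          \<sigma> t s (\<sigma> s r (?w b)) + (\<Sum>s\<in>opps t - {s}. \<sigma> t s (\<sigma> s r (?w b)))"
        by (rule sum.remove[OF _ st]) simp
      have r3: "pext ?w (lamw t s a) = (if t = r then ?w b else 0) - (\<Sum>s\<in>opps t - {s}. \<sigma> t s (\<sigma> s r (?w b)))"
        unfolding ab lamw_red[OF nw sp] by (simp add: plinearD[OF plinear_pext])
      \<comment> \<open>The reduction is one instance of the relation solved for a term, so the
        defect is minus that instance at the value of \<open>b\<close>.\<close>
      have "pext ?w (lamw t s a) - \<sigma> t s (?w a) =
          - ((\<Sum>s\<in>opps t. \<sigma> t s (\<sigma> s r (?w b))) - (if t = r then ?w b else 0))"
        unfolding r3 r2 by (simp add: ab)
      then show ?thesis using neg[OF r1] by simp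
    qed
  qed
  then show "pext ?w (lam t s (Poly_Mapping.single a 1)) - \<sigma> t s (pext ?w (Poly_Mapping.single a 1)) \<in> Z"
    by (simp add: lam_single)
qed

definition nfext :: "('u \<times> nat \<Rightarrow> (('t, 'u) nword \<Rightarrow>\<^sub>0 'k)) \<Rightarrow>
    (('t, 'u) nword \<Rightarrow>\<^sub>0 'k) \<Rightarrow> (('t, 'u) nword \<Rightarrow>\<^sub>0 'k::field)" where
  "nfext x0 = pext (wev lam x0)"

text \<open>Vertices and letters are the generators of the algebra, so this is linearity over the
  algebra. The domain is explicit because maps out of submodules are needed.\<close>

definition nfhom :: "((('t, 'u) nword \<Rightarrow>\<^sub>0 'k::field) \<Rightarrow> (('t, 'u) nword \<Rightarrow>\<^sub>0 'k)) \<Rightarrow>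
    (('t, 'u) nword \<Rightarrow>\<^sub>0 'k) set \<Rightarrow> bool" where
  "nfhom f N \<longleftrightarrow> (\<forall>x\<in>N. f x \<in> NF) \<and> (\<forall>x\<in>N. \<forall>y\<in>N. f (x + y) = f x + f y) \<and>
     (\<forall>x\<in>N. \<forall>c. f (pscale c x) = pscale c (f x)) \<and>
     (\<forall>x\<in>N. \<forall>u\<in>V. f (vproj u x) = vproj u (f x)) \<and>
     (\<forall>x\<in>N. \<forall>s\<in>T. \<forall>t\<in>opps s. f (lam t s x) = lam t s (f x))"

lemma plinear_nfext: "plinear (nfext x0)"
  unfolding nfext_def by (rule plinear_pext)

lemma nfext_gen [simp]: "nfext x0 (Poly_Mapping.single ([], g) 1) = x0 g"
  by (simp add: nfext_def)

lemma nfext_mem: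
  assumes x0: "\<And>g. fst g \<in> V \<Longrightarrow> x0 g \<in> NFv (fst g)" and x: "x \<in> NFv u"
  shows "nfext x0 x \<in> NFv u"
proof (rule plinear_mem[OF plinear_nfext])
  fix a assume "a \<in> Poly_Mapping.keys x"
  then have "nw a" "wtop a = u" using x by (auto simp: NFv_def)
  moreover from this have "wev lam x0 a \<in> NFv (wtop a)"
    by (intro wev_mem x0 lam_mem)
  ultimately show "nfext x0 (Poly_Mapping.single a 1) \<in> NFv u" by (simp add: nfext_def)
qed (rule NFv_closed; assumption)+

lemma nfhomI_plinear:
  assumes f: "plinear f" and mem: "\<And>u x. x \<in> NFv u \<Longrightarrow> f x \<in> NFv u"
    and lam: "\<And>x s t. x \<in> NF \<Longrightarrow> s \<in> T \<Longrightarrow> t \<in> opps s \<Longrightarrow> f (lam t s x) = lam t s (f x)"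
  shows "nfhom f NF"
proof -
  have dec: "f x = (\<Sum>u\<in>V. f (vproj u x))" if "x \<in> NF" for x
    by (subst sum_vproj[OF that, symmetric]) (rule plinearD[OF f])
  have NF: "f x \<in> NF" if "x \<in> NF" for x
    unfolding dec[OF that] by (intro NF_sum NFv_subset[OF mem[OF vproj_mem]])
  have "f (vproj u x) = vproj u (f x)" if "x \<in> NF" "u \<in> V" for u x
  proof -
    have "vproj u (f x) = (\<Sum>u'\<in>V. vproj u (f (vproj u' x)))"
      unfolding dec[OF that(1)] by (rule vproj_simps)
    also have "\<dots> = (\<Sum>u'\<in>V. if u' = u then f (vproj u x) else 0)"
      by (intro sum.cong refl) (auto simp: vproj_id[OF mem[OF vproj_mem]] vproj_other[OF mem[OF vproj_mem]])
    finally show ?thesis using that(2) finite_V by (simp add: sum.delta)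
  qed
  then show ?thesis using NF lam by (simp add: nfhom_def plinearD[OF f])
qed

text \<open>Freeness of the model: the letters satisfy their own relations exactly, so the universal
  property applies with \<open>Z\<close> equal to zero.\<close>

lemma nfext_nfhom:
  fixes x0 :: "'u \<times> nat \<Rightarrow> (('t, 'u) nword \<Rightarrow>\<^sub>0 'k::field)"
  assumes x0: "\<And>g. fst g \<in> V \<Longrightarrow> x0 g \<in> NFv (fst g)"
  shows "nfhom (nfext x0) NF"
proof (rule nfhomI_plinear[OF plinear_nfext nfext_mem[OF x0]])
  fix x :: "('t, 'u) nword \<Rightarrow>\<^sub>0 'k" and s t
  assume "x \<in> NF" "s \<in> T" "t \<in> opps s"
  then have "pext (wev lam x0) (lam t s x) - lam t s (pext (wev lam x0) x) \<in> {0}"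
    by (intro pext_wev_lam[where Y = NFv] x0 plinear_lam)
      (auto simp: lam_relation lam_mem lam_other)
  then show "nfext x0 (lam t s x) = lam t s (nfext x0 x)" by (simp add: nfext_def)
qed auto

lemma nfhomD:
  assumes "nfhom f N"
  shows "x \<in> N \<Longrightarrow> f x \<in> NF" "x \<in> N \<Longrightarrow> y \<in> N \<Longrightarrow> f (x + y) = f x + f y"
    "x \<in> N \<Longrightarrow> f (pscale c x) = pscale c (f x)"
    "x \<in> N \<Longrightarrow> u \<in> V \<Longrightarrow> f (vproj u x) = vproj u (f x)"
    "x \<in> N \<Longrightarrow> s \<in> T \<Longrightarrow> t \<in> opps s \<Longrightarrow> f (lam t s x) = lam t s (f x)"
  using assms by (auto simp: nfhom_def)

section \<open>Submodules and generating sets\<close>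

inductive_set subm_gen :: "(('t, 'u) nword \<Rightarrow>\<^sub>0 'k::field) set \<Rightarrow> (('t, 'u) nword \<Rightarrow>\<^sub>0 'k) set"
  for X where
  base: "x \<in> X \<Longrightarrow> x \<in> subm_gen X"
| zero: "0 \<in> subm_gen X"
| add: "x \<in> subm_gen X \<Longrightarrow> y \<in> subm_gen X \<Longrightarrow> x + y \<in> subm_gen X"
| scale: "x \<in> subm_gen X \<Longrightarrow> pscale c x \<in> subm_gen X"
| vproj: "x \<in> subm_gen X \<Longrightarrow> u \<in> V \<Longrightarrow> vproj u x \<in> subm_gen X"
| lam: "x \<in> subm_gen X \<Longrightarrow> s \<in> T \<Longrightarrow> t \<in> opps s \<Longrightarrow> lam t s x \<in> subm_gen X"

definition subm :: "(('t, 'u) nword \<Rightarrow>\<^sub>0 'k::field) set \<Rightarrow> bool" where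
  "subm N \<longleftrightarrow> N \<subseteq> NF \<and> subm_gen N \<subseteq> N"

lemma submI:
  assumes "N \<subseteq> NF" "0 \<in> N" "\<And>x y. x \<in> N \<Longrightarrow> y \<in> N \<Longrightarrow> x + y \<in> N" "\<And>c x. x \<in> N \<Longrightarrow> pscale c x \<in> N"
    "\<And>x u. x \<in> N \<Longrightarrow> u \<in> V \<Longrightarrow> vproj u x \<in> N"
    "\<And>x s t. x \<in> N \<Longrightarrow> s \<in> T \<Longrightarrow> t \<in> opps s \<Longrightarrow> lam t s x \<in> N"
  shows "subm N"
proof -
  have "x \<in> N" if "x \<in> subm_gen N" for x
    using that by induction (auto intro: assms)
  then show ?thesis using assms(1) by (auto simp: subm_def)
qed

lemma submD:
  assumes "subm N"
  shows "N \<subseteq> NF" "0 \<in> N" "x \<in> N \<Longrightarrow> y \<in> N \<Longrightarrow> x + y \<in> N" "x \<in> N \<Longrightarrow> pscale c x \<in> N"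
    "x \<in> N \<Longrightarrow> u \<in> V \<Longrightarrow> vproj u x \<in> N"
    "x \<in> N \<Longrightarrow> s \<in> T \<Longrightarrow> t \<in> opps s \<Longrightarrow> lam t s x \<in> N"
    "x \<in> N \<Longrightarrow> y \<in> N \<Longrightarrow> x - y \<in> N"
proof -
  show *: "N \<subseteq> NF" "0 \<in> N" "x \<in> N \<Longrightarrow> y \<in> N \<Longrightarrow> x + y \<in> N" "x \<in> N \<Longrightarrow> pscale c x \<in> N"
    "x \<in> N \<Longrightarrow> u \<in> V \<Longrightarrow> vproj u x \<in> N"
    "x \<in> N \<Longrightarrow> s \<in> T \<Longrightarrow> t \<in> opps s \<Longrightarrow> lam t s x \<in> N" for x y c
    using assms subm_gen.zero[of N] subm_gen.add[of x N y] subm_gen.scale[of x N c]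
      subm_gen.vproj[of x N u] subm_gen.lam[of x N s t] subm_gen.base[of _ N]
    by (auto simp: subm_def)
  show "x \<in> N \<Longrightarrow> y \<in> N \<Longrightarrow> x - y \<in> N"
    using *(3)[of x "- y"] *(4)[of y "- 1"] by simp
qed

lemma subm_gen_min: "x \<in> subm_gen X \<Longrightarrow> X \<subseteq> N \<Longrightarrow> subm N \<Longrightarrow> x \<in> N"
  by (induction rule: subm_gen.induct) (auto intro: submD)

lemma subm_NF: "subm NF"
  by (rule submI) (auto intro: NF_closed NFv_subset[OF vproj_mem] NFv_subset[OF lam_mem])

lemma subm_subm_gen:
  assumes "X \<subseteq> NF"
  shows "subm (subm_gen X)"
proof (rule submI)
  show "subm_gen X \<subseteq> NF" using subm_gen_min[OF _ assms subm_NF] by blast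
qed (rule subm_gen.intros; assumption)+

lemma nfhom_eq_on:
  assumes "nfhom f N" "nfhom f' N" "X \<subseteq> N" "subm N" "\<And>x. x \<in> X \<Longrightarrow> f x = f' x" "x \<in> subm_gen X"
  shows "f x = f' x"
proof -
  have f0: "f 0 = 0" "f' 0 = 0"
    using nfhomD(3)[OF assms(1) submD(2)[OF assms(4)], of 0]
      nfhomD(3)[OF assms(2) submD(2)[OF assms(4)], of 0] by simp_all
  note N = submD[OF assms(4)]
  have "x \<in> N \<and> f x = f' x"
    using assms(6)
  proof induction
    case (base x)
    then show ?case using assms(3,5) by auto
  next
    case (add x y)
    then show ?case by (simp add: N(3) nfhomD(2)[OF assms(1)] nfhomD(2)[OF assms(2)])
  next
    case (scale x c)
    then show ?case by (simp add: N(4) nfhomD(3)[OF assms(1)] nfhomD(3)[OF assms(2)])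
  next
    case (vproj x u)
    then show ?case by (simp add: N(5) nfhomD(4)[OF assms(1)] nfhomD(4)[OF assms(2)])
  next
    case (lam x s t)
    then show ?case by (simp add: N(6) nfhomD(5)[OF assms(1)] nfhomD(5)[OF assms(2)])
  qed (simp add: N(2) f0)
  then show ?thesis ..
qed

lemma subm_gen_gens:
  "(NF :: (('t, 'u) nword \<Rightarrow>\<^sub>0 'k::field) set) \<subseteq>
    subm_gen {Poly_Mapping.single ([], g) 1 | g. fst g \<in> V}" (is "_ \<subseteq> ?S")
proof
  fix x :: "('t, 'u) nword \<Rightarrow>\<^sub>0 'k" assume x: "x \<in> NF"
  have word: "Poly_Mapping.single a 1 \<in> ?S" if "nw a" for a
    using that
  proof (induction a rule: word_induct)
    case (gen g)
    then have "Poly_Mapping.single ([], g) 1 \<in> {Poly_Mapping.single ([], g) 1 | g. fst g \<in> V}"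
      by (intro CollectI exI[of _ g] conjI refl) simp
    then show ?case by (rule subm_gen.base)
  next
    case (cn t s a)
    then have "lam t s (Poly_Mapping.single a 1) \<in> ?S" by (intro subm_gen.lam) auto
    then show ?case using cn.prems by (simp add: lam_single lamw_nonred)
  qed
  show "x \<in> ?S"
    by (rule plinear_mem[OF plinear_intros(1) subm_gen.zero subm_gen.add subm_gen.scale word])
      (use x in \<open>auto simp: NF_def\<close>)
qed

lemma nfhom_eqI:
  assumes "nfhom f NF" "nfhom f' NF"
    and "\<And>g. fst g \<in> V \<Longrightarrow> f (Poly_Mapping.single ([], g) 1) = f' (Poly_Mapping.single ([], g) 1)"
    and "x \<in> NF"
  shows "f x = f' x"
proof (rule nfhom_eq_on[OF assms(1,2) _ subm_NF _ subsetD[OF subm_gen_gens assms(4)]])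
  show "{Poly_Mapping.single ([], g) 1 |g. fst g \<in> V} \<subseteq> NF" by (auto intro: single_mem)
qed (use assms(3) in auto)

lemma nfhom_comp:
  "nfhom f N \<Longrightarrow> f ` N \<subseteq> N' \<Longrightarrow> nfhom h N' \<Longrightarrow> nfhom (\<lambda>x. h (f x)) N"
  by (auto simp: nfhom_def image_subset_iff)

lemma nfhom_add: "nfhom f N \<Longrightarrow> nfhom h N \<Longrightarrow> nfhom (\<lambda>x. f x + h x) N"
  by (auto simp: nfhom_def vproj_simps lam_simps pscale_add intro: NF_closed)

lemma nfhom_diff: "nfhom f N \<Longrightarrow> nfhom h N \<Longrightarrow> nfhom (\<lambda>x. f x - h x) N"
  by (auto simp: nfhom_def vproj_simps lam_simps pscale_diff intro: NF_closed)

lemma nfhom_0: "nfhom (\<lambda>x. 0) N"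
  by (auto simp: nfhom_def vproj_simps lam_simps intro: NF_closed)

lemma nfhom_id: "N \<subseteq> NF \<Longrightarrow> nfhom (\<lambda>x. x) N"
  by (auto simp: nfhom_def)

lemma nfhom_sum: "(\<And>i. i \<in> I \<Longrightarrow> nfhom (f i) N) \<Longrightarrow> nfhom (\<lambda>x. \<Sum>i\<in>I. f i x) N"
  by (induction I rule: infinite_finite_induct) (auto intro: nfhom_add nfhom_0)

lemma nfhom_NFv: "nfhom f NF \<Longrightarrow> u \<in> V \<Longrightarrow> x \<in> NFv u \<Longrightarrow> f x \<in> NFv u"
  using nfhomD(4)[of f NF x u] vproj_id[of x u] vproj_mem[of u "f x"] NFv_subset[of x u] by simp

end


declare split_paired_Ex [simp del] split_paired_All [simp del]

context slots begin

section \<open>Coefficients of letters applied to normal forms\<close>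

definition starts :: "'t \<Rightarrow> ('t, 'u) nword \<Rightarrow> bool" where
  "starts s a \<longleftrightarrow> (\<exists>r b. a = cn s r b)"

definition swap :: "'t \<Rightarrow> ('t, 'u) nword \<Rightarrow> ('t, 'u) nword" where
  "swap s a = cn s (snd (hd (fst a))) (tl (fst a), snd a)"

lemma swap_cn [simp]: "swap s (cn s' r b) = cn s r b"
  by (simp add: swap_def) (simp add: cn_def)

lemma starts_cn [simp]: "starts s (cn s' r b) \<longleftrightarrow> s' = s"
  by (auto simp: starts_def)

lemma red_iff: "red s a \<longleftrightarrow> s = sp_same s \<and> starts s a"
  by (auto simp: red_def starts_def)

text \<open>The word \<open>a\<close> can arise from \<open>b\<close> in three ways: the letter is
  prepended, the letter cancels against \<open>b\<close>, or \<open>a\<close> is a correction term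
  of a reduction. In the last case \<open>b\<close> is recovered by dropping the outer letter of
  \<open>a\<close> and putting \<open>s\<close> back as the next slot.\<close>

lemma lookup_lamw:
  assumes s: "s \<in> T" "t \<in> opps s" and b: "nw b" "wtop b = vert s" and a: "nw a"
  shows "Poly_Mapping.lookup (lamw t s b) a =
    (if a = cn t s b then 1 else 0) + (if s = sp_same s \<and> b = cn s t a then 1 else 0) -
    (if s = sp_same s \<and> (\<exists>s' c. s' \<noteq> s \<and> a = cn t s' c \<and> starts s' c \<and> b = swap s c) then 1 else (0::'k::field))"
proof (cases "red s b")
  case False
  have "\<not> (s = sp_same s \<and> b = cn s t a)" using False by (auto simp: red_iff)
  moreover have "\<not> (s = sp_same s \<and> (\<exists>s' c. s' \<noteq> s \<and> a = cn t s' c \<and> starts s' c \<and> b = swap s c))"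
    using False by (auto simp: red_iff swap_def)
  ultimately show ?thesis by (simp only: lamw_nonred[OF b False] if_False) (auto simp: lookup_single when_def)
next
  case True
  then obtain r c where bc: "b = cn s r c" and sp: "s = sp_same s" by (auto simp: red_def)
  have nw: "nw (cn s r c)" using b bc by simp
  have "a \<noteq> cn t s b" using a True by auto
  moreover have "(\<Sum>s'\<in>opps t - {s}. Poly_Mapping.lookup (Poly_Mapping.single (cn t s' (cn s' r c)) (1::'k)) a) =
     (if \<exists>s' c. s' \<noteq> s \<and> a = cn t s' c \<and> starts s' c \<and> b = swap s c then 1 else 0)"
  proof (cases "\<exists>s' c. s' \<noteq> s \<and> a = cn t s' c \<and> starts s' c \<and> b = swap s c")
    case True
    then obtain s0 where s0: "s0 \<noteq> s" "a = cn t s0 (cn s0 r c)" by (auto simp: starts_def bc)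
    then have "s0 \<in> opps t - {s}" using a s by (auto simp: opps_def)
    then have "(\<Sum>s'\<in>opps t - {s}. Poly_Mapping.lookup (Poly_Mapping.single (cn t s' (cn s' r c)) (1::'k)) a) = 
      (\<Sum>s'\<in>opps t - {s}. if s' = s0 then 1 else 0)"
      using s0 by (intro sum.cong) (auto simp: lookup_single when_def)
    also have "\<dots> = 1" using \<open>s0 \<in> opps t - {s}\<close> by (simp add: sum.delta)
    finally show ?thesis using True by simp
  next
    case False
    then have "a \<noteq> cn t s' (cn s' r c)" if "s' \<noteq> s" for s' using that by (auto simp: starts_def bc)
    then have "(\<Sum>s'\<in>opps t - {s}. Poly_Mapping.lookup (Poly_Mapping.single (cn t s' (cn s' r c)) (1::'k)) a) = 0"
      by (intro sum.neutral) (auto simp: lookup_single when_def)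
    with False show ?thesis by simp
  qed
  moreover have "(t = r \<and> c = a) \<longleftrightarrow> b = cn s t a" using bc by auto
  ultimately show ?thesis
    using sp unfolding bc lamw_red[OF nw sp]
    by (simp add: lookup_minus lookup_sum) (auto simp: lookup_single when_def)
qed

lemma lookup_lam_cn:
  assumes s: "s \<in> T" "t \<in> opps s" and x: "x \<in> NFv (vert s)" and a: "nw (cn t s0 a)"
  shows "Poly_Mapping.lookup (lam t s x) (cn t s0 a) =
    (if s = s0 then Poly_Mapping.lookup x a else 0) +
    (if s = sp_same s then Poly_Mapping.lookup x (cn s t (cn t s0 a)) -
       (if s \<noteq> s0 \<and> starts s0 a then Poly_Mapping.lookup x (swap s a) else 0) else 0)"
proof -
  let ?K = "Poly_Mapping.keys x"
  have "Poly_Mapping.lookup (lam t s x) (cn t s0 a) =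
    (\<Sum>b\<in>?K. (if b = a then if s = s0 then Poly_Mapping.lookup x b else 0 else 0) +
       ((if b = cn s t (cn t s0 a) then if s = sp_same s then Poly_Mapping.lookup x b else 0 else 0) -
       (if b = swap s a then if s = sp_same s \<and> s \<noteq> s0 \<and> starts s0 a then Poly_Mapping.lookup x b else 0 else 0)))"
    unfolding lam_def lookup_pext
  proof (intro sum.cong refl)
    fix b assume "b \<in> ?K"
    then have b: "nw b" "wtop b = vert s" using x by (auto simp: NFv_def)
    show "Poly_Mapping.lookup x b * Poly_Mapping.lookup (lamw t s b) (cn t s0 a) =
      (if b = a then if s = s0 then Poly_Mapping.lookup x b else 0 else 0) +
       ((if b = cn s t (cn t s0 a) then if s = sp_same s then Poly_Mapping.lookup x b else 0 else 0) -
       (if b = swap s a then if s = sp_same s \<and> s \<noteq> s0 \<and> starts s0 a then Poly_Mapping.lookup x b else 0 else 0))"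
      unfolding lookup_lamw[OF s b a] by auto
  qed
  also have "\<dots> = (if s = s0 then Poly_Mapping.lookup x a else 0) +
    ((if s = sp_same s then Poly_Mapping.lookup x (cn s t (cn t s0 a)) else 0) -
     (if s = sp_same s \<and> s \<noteq> s0 \<and> starts s0 a then Poly_Mapping.lookup x (swap s a) else 0))"
    unfolding sum.distrib sum_subtractf
    by (cases "s = s0"; cases "s = sp_same s"; cases "starts s0 a")
      (simp_all add: in_keys_iff)
  finally show ?thesis by simp
qed

lemma lookup_lam_other:
  assumes s: "s \<in> T" "t \<in> opps s" and x: "x \<in> NFv (vert s)" and a: "nw a" "\<And>s b. a \<noteq> cn t s b"
  shows "Poly_Mapping.lookup (lam t s x) a = (if s = sp_same s then Poly_Mapping.lookup x (cn s t a) else 0)"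
proof -
  let ?K = "Poly_Mapping.keys x"
  have "Poly_Mapping.lookup (lam t s x) a =
    (\<Sum>b\<in>?K. (if b = cn s t a then if s = sp_same s then Poly_Mapping.lookup x b else 0 else 0))"
    unfolding lam_def lookup_pext
  proof (intro sum.cong refl)
    fix b assume "b \<in> ?K"
    then have b: "nw b" "wtop b = vert s" using x by (auto simp: NFv_def)
    show "Poly_Mapping.lookup x b * Poly_Mapping.lookup (lamw t s b) a =
       (if b = cn s t a then if s = sp_same s then Poly_Mapping.lookup x b else 0 else 0)"
      unfolding lookup_lamw[OF s b a(1)] using a(2) by auto
  qed
  also have "\<dots> = (if s = sp_same s then Poly_Mapping.lookup x (cn s t a) else 0)"
    by (cases "s = sp_same s") (simp_all add: in_keys_iff)
  finally show ?thesis .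
qed

text \<open>
  A point of the graph of the isomorphism attached to the block \<open>\<beta>\<close>, with the coordinates on both
  sides collected in one family.
\<close>

definition bpair :: "'b \<Rightarrow> ('t \<Rightarrow> (('t, 'u) nword \<Rightarrow>\<^sub>0 'k::field)) \<Rightarrow> bool" where
  "bpair \<beta> z \<longleftrightarrow> (\<forall>t\<in>T. blk t = \<beta> \<longrightarrow> z t \<in> NFv (vert t) \<and> z t = (\<Sum>s\<in>opps t. lam t s (z s)))"

lemma bpairD:
  assumes "bpair (blk t) z" "t \<in> T"
  shows "z t \<in> NFv (vert t)" "z t = (\<Sum>s\<in>opps t. lam t s (z s))"
    "s \<in> opps t \<Longrightarrow> z s \<in> NFv (vert s)"
  using assms oppsD[of s t] unfolding bpair_def by blast+

lemma bpairI:
  assumes "\<And>t. t \<in> T \<Longrightarrow> blk t = \<beta> \<Longrightarrow> z t \<in> NFv (vert t)"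
    and "\<And>t. t \<in> T \<Longrightarrow> blk t = \<beta> \<Longrightarrow> z t = (\<Sum>s\<in>opps t. lam t s (z s))"
  shows "bpair \<beta> z"
  using assms by (simp add: bpair_def)

lemma bpair_scale:
  assumes z: "bpair \<beta> z"
  shows "bpair \<beta> (\<lambda>t. pscale c (z t))"
proof (rule bpairI)
  fix t assume t: "t \<in> T" "blk t = \<beta>"
  note zt = bpairD[of t z, unfolded t(2), OF z t(1)]
  show "pscale c (z t) \<in> NFv (vert t)" using zt(1) by (rule NFv_closed)
  show "pscale c (z t) = (\<Sum>s\<in>opps t. lam t s (pscale c (z s)))"
    by (subst zt(2)) (simp add: lam_simps pscale_sum)
qed

lemma bpair_diff:
  assumes z: "bpair \<beta> z" "bpair \<beta> z'"
  shows "bpair \<beta> (\<lambda>t. z t - z' t)"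
proof (rule bpairI)
  fix t assume t: "t \<in> T" "blk t = \<beta>"
  note zt = bpairD[of t z, unfolded t(2), OF z(1) t(1)]
  note zt' = bpairD[of t z', unfolded t(2), OF z(2) t(1)]
  show "z t - z' t \<in> NFv (vert t)" using zt(1) zt'(1) by (rule NFv_closed)
  show "z t - z' t = (\<Sum>s\<in>opps t. lam t s (z s - z' s))"
    by (subst zt(2), subst zt'(2)) (simp add: lam_simps sum_subtractf)
qed

lemma opps_special: "t \<in> T \<Longrightarrow> s \<in> opps t \<Longrightarrow> s = sp_same s \<longleftrightarrow> s = sp_opp t"
  by (auto simp: opps_def)

text \<open>Among the terms \<open>lam t s (z s)\<close> only the cancellation at the special
  opposite slot can produce a word that does not begin with \<open>t\<close>.\<close>

lemma lookup_bpair_other: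
  assumes z: "bpair (blk t) z" and t: "t \<in> T" and a: "nw a" "\<And>s b. a \<noteq> cn t s b"
  shows "Poly_Mapping.lookup (z t) a = Poly_Mapping.lookup (z (sp_opp t)) (cn (sp_opp t) t a)"
proof -
  have "Poly_Mapping.lookup (z t) a = (\<Sum>s\<in>opps t. Poly_Mapping.lookup (lam t s (z s)) a)"
    by (subst bpairD(2)[OF z t]) (rule lookup_sum)
  also have "\<dots> = (\<Sum>s\<in>opps t. if s = sp_opp t then Poly_Mapping.lookup (z s) (cn s t a) else 0)"
    using opps_special[OF t] bpairD(3)[OF z t] t a
    by (intro sum.cong refl, subst lookup_lam_other) (auto simp: opps_def)
  finally show ?thesis using sp_opp_mem[OF t] by (simp add: sum.delta)
qed

lemma lookup_bpair_cn_aux: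
  assumes z: "bpair (blk t) z" and t: "t \<in> T" and a: "nw (cn t s0 a)"
  shows "Poly_Mapping.lookup (z t) (cn t s0 a) =
    Poly_Mapping.lookup (z s0) a + Poly_Mapping.lookup (z (sp_opp t)) (cn (sp_opp t) t (cn t s0 a)) -
    (if sp_opp t \<noteq> s0 \<and> starts s0 a then Poly_Mapping.lookup (z (sp_opp t)) (swap (sp_opp t) a) else 0)"
proof -
  let ?o = "sp_opp t"
  have s0: "s0 \<in> opps t" using a t by (auto simp: opps_def)
  have "Poly_Mapping.lookup (z t) (cn t s0 a) = (\<Sum>s\<in>opps t. Poly_Mapping.lookup (lam t s (z s)) (cn t s0 a))"
    by (subst bpairD(2)[OF z t]) (rule lookup_sum)
  also have "\<dots> = (\<Sum>s\<in>opps t. (if s = s0 then Poly_Mapping.lookup (z s) a else 0) +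
      (if s = ?o then Poly_Mapping.lookup (z s) (cn s t (cn t s0 a)) -
       (if s \<noteq> s0 \<and> starts s0 a then Poly_Mapping.lookup (z s) (swap s a) else 0) else 0))"
  proof (intro sum.cong refl)
    fix s assume s: "s \<in> opps t"
    then have "s \<in> T" "t \<in> opps s" using t by (auto simp: opps_def)
    from lookup_lam_cn[OF this bpairD(3)[OF z t s] a]
    show "Poly_Mapping.lookup (lam t s (z s)) (cn t s0 a) =
      (if s = s0 then Poly_Mapping.lookup (z s) a else 0) +
      (if s = ?o then Poly_Mapping.lookup (z s) (cn s t (cn t s0 a)) -
       (if s \<noteq> s0 \<and> starts s0 a then Poly_Mapping.lookup (z s) (swap s a) else 0) else 0)"
      unfolding opps_special[OF t s] .
  qed
  finally show ?thesis using sp_opp_mem[OF t] s0 by (simp add: sum.distrib sum.delta)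
qed

text \<open>Compare the preceding formula for \<open>t\<close> with the one for the special slot of
  its side. The contributions that depend on \<open>s0\<close> and \<open>a\<close> alone coincide,
  and at the special slot the longer word is not normal. So, up to longer words, the coefficient
  depends on the side of \<open>t\<close> only.\<close>

lemma lookup_bpair_cn:
  assumes z: "bpair (blk t) z" and t: "t \<in> T" and a: "nw (cn t s0 a)"
  shows "Poly_Mapping.lookup (z t) (cn t s0 a) =
    Poly_Mapping.lookup (z (sp_same t)) (cn (sp_same t) s0 a) +
    Poly_Mapping.lookup (z (sp_opp t)) (cn (sp_opp t) t (cn t s0 a))"
proof -
  let ?t = "sp_same t" and ?o = "sp_opp t"
  have t': "?t \<in> T" "blk ?t = blk t" "sd ?t = sd t" using t by (auto simp: sp_mem)
  have a': "nw (cn ?t s0 a)" using nw_swap[OF a t'] .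
  have "?o \<in> T" using sp_mem[OF t] .
  have "red ?t (cn ?t s0 a)" unfolding red_iff using t' by simp
  then have "\<not> nw (cn ?o ?t (cn ?t s0 a))" by simp
  then have "cn ?o ?t (cn ?t s0 a) \<notin> Poly_Mapping.keys (z ?o)"
    using bpairD(3)[OF z t sp_opp_mem[OF t]] by (auto simp: NFv_def)
  then have "Poly_Mapping.lookup (z ?o) (cn ?o ?t (cn ?t s0 a)) = 0" by (simp add: in_keys_iff)
  then have "Poly_Mapping.lookup (z ?t) (cn ?t s0 a) = Poly_Mapping.lookup (z s0) a -
    (if ?o \<noteq> s0 \<and> starts s0 a then Poly_Mapping.lookup (z ?o) (swap ?o a) else 0)"
    using lookup_bpair_cn_aux[of ?t z, OF _ t'(1) a'] z t' by simp
  then show ?thesis unfolding lookup_bpair_cn_aux[OF z t a] by simp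
qed

section \<open>A numbering of the words\<close>

definition encT :: "'t \<Rightarrow> nat" where "encT = (SOME f. bij_betw f T {0..<card T})"
definition encV :: "'u \<Rightarrow> nat" where "encV = (SOME f. bij_betw f V {0..<card V})"

lemma encT: "inj_on encT T" "t \<in> T \<Longrightarrow> encT t < card T"
proof -
  have "bij_betw encT T {0..<card T}"
    unfolding encT_def by (rule someI_ex[OF ex_bij_betw_finite_nat[OF finite_T]])
  then show "inj_on encT T" "t \<in> T \<Longrightarrow> encT t < card T" by (auto simp: bij_betw_def)
qed

lemma encV: "inj_on encV V"
proof -
  have "bij_betw encV V {0..<card V}"
    unfolding encV_def by (rule someI_ex[OF ex_bij_betw_finite_nat[OF finite_V]])
  then show "inj_on encV V" by (auto simp: bij_betw_def)
qed

text \<open>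
  Words are ordered in type \<open>\<omega>\<close> so that the words \<open>(t, s) b\<close> with fixed \<open>s\<close> and \<open>b\<close> form an interval
  lying above \<open>b\<close>.
\<close>

fun keyl :: "('t \<times> 't) list \<Rightarrow> 'u \<times> nat \<Rightarrow> nat" where
  "keyl [] g = 2 * prod_encode (encV (fst g), snd g) * Suc (card T)"
| "keyl (ts # l) g = Suc (2 * prod_encode (encT (snd ts), keyl l g)) * Suc (card T) + encT (fst ts)"

definition key :: "('t, 'u) nword \<Rightarrow> nat" where "key a = keyl (fst a) (snd a)"

text \<open>The number of the interval of keys that holds the words \<open>(t, s) b\<close>. It is
  odd, while the intervals of the generators have even numbers. The interval length
  \<open>Suc (card T)\<close> leaves room for every slot and is positive even if there are no
  slots.\<close>

definition stage :: "'t \<Rightarrow> ('t, 'u) nword \<Rightarrow> nat" where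
  "stage s b = Suc (2 * prod_encode (encT s, key b))"

lemma key_gen: "key ([], g) = 2 * prod_encode (encV (fst g), snd g) * Suc (card T)"
  by (simp add: key_def)

lemma key_cn: "key (cn t s b) = stage s b * Suc (card T) + encT t"
  by (simp add: key_def stage_def cn_def)

lemma key_div:
  assumes "t \<in> T"
  shows "key (cn t s b) div Suc (card T) = stage s b"
proof -
  have "encT t < Suc (card T)" using encT(2)[OF assms] by simp
  then show ?thesis unfolding key_cn by (simp add: div_mult_self3 del: mult_Suc_right)
qed

lemma key_gen_div: "key ([], g) div Suc (card T) = 2 * prod_encode (encV (fst g), snd g)"
  unfolding key_gen by (rule nonzero_mult_div_cancel_right) simp

lemma key_less_stage: "key b < stage s b"
  using le_prod_encode_2[of "key b" "encT s"] by (simp add: stage_def)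

text \<open>Division by the interval length recovers the parity, hence the kind of word, and then
  \<open>s\<close> and the key of \<open>b\<close>. The remainder identifies
  \<open>t\<close>.\<close>

lemma key_inj: "nw a \<Longrightarrow> nw a' \<Longrightarrow> key a = key a' \<Longrightarrow> a = a'"
proof (induction a arbitrary: a' rule: word_induct)
  case (gen g)
  have d: "key a' div Suc (card T) = 2 * prod_encode (encV (fst g), snd g)"
    using gen key_gen_div by metis
  show ?case
  proof (cases a' rule: word_cases)
    case (gen g')
    then have "prod_encode (encV (fst g'), snd g') = prod_encode (encV (fst g), snd g)"
      using d by (simp add: key_gen_div)
    then have "encV (fst g') = encV (fst g)" "snd g' = snd g" by simp_all
    then show ?thesis using gen.prems \<open>a' = _\<close> inj_onD[OF encV, of "fst g'" "fst g"] by (auto simp: prod_eq_iff)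
  next
    case (cn t s b)
    then have "t \<in> T" using gen by (auto simp: opps_def)
    then have "stage s b = 2 * prod_encode (encV (fst g), snd g)" using d cn by (simp add: key_div)
    then have False unfolding stage_def by presburger
    then show ?thesis ..
  qed
next
  case (cn t s b)
  then have t: "t \<in> T" "s \<in> T" by (auto simp: opps_def)
  have d: "key a' div Suc (card T) = stage s b"
    using cn.prems(3) key_div[OF t(1), of s b] by simp
  show ?case
  proof (cases a' rule: word_cases)
    case (gen g)
    then have "stage s b = 2 * prod_encode (encV (fst g), snd g)" using d by (simp add: key_gen_div)
    then have False unfolding stage_def by presburger
    then show ?thesis ..
  next
    case a': (cn t' s' b')
    then have t': "t' \<in> T" "s' \<in> T" using cn.prems by (auto simp: opps_def)
    have st: "stage s b = stage s' b'" using d a' key_div[OF t'(1)] by simp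
    then have "encT s = encT s'" "key b = key b'" by (simp_all add: stage_def)
    then have s: "s = s'" "b = b'"
      using inj_onD[OF encT(1), of s s'] t t' cn.IH[of b'] cn.prems a' by auto
    then have "encT t = encT t'" using cn.prems(3) a' by (simp add: key_cn)
    then show ?thesis using s a' inj_onD[OF encT(1), of t t'] t t' by auto
  qed
qed

lemma stage_unique:
  assumes "nw a" "key a div Suc (card T) = stage s b" "s \<in> T" "nw b"
  shows "\<exists>t. a = cn t s b"
proof (cases a rule: word_cases)
  case (gen g)
  then have "stage s b = 2 * prod_encode (encV (fst g), snd g)" using assms by (simp add: key_gen_div)
  then have False unfolding stage_def by presburger
  then show ?thesis ..
next
  case (cn t s' b')
  then have t: "t \<in> T" "s' \<in> T" "nw b'" using assms by (auto simp: opps_def)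
  then have "stage s' b' = stage s b" using assms cn by (simp add: key_div)
  then have "encT s' = encT s" "key b' = key b" by (simp_all add: stage_def)
  then show ?thesis using cn t assms inj_onD[OF encT(1), of s' s] key_inj[of b' b] by auto
qed

definition KL :: "nat \<Rightarrow> (('t, 'u) nword \<Rightarrow>\<^sub>0 'k::field) set" where
  "KL k = {x. \<forall>a\<in>Poly_Mapping.keys x. key a < k}"

lemma KL_closed:
  "0 \<in> KL k" "x \<in> KL k \<Longrightarrow> y \<in> KL k \<Longrightarrow> x + y \<in> KL k" "x \<in> KL k \<Longrightarrow> pscale c x \<in> KL k"
  "x \<in> KL k \<Longrightarrow> y \<in> KL k \<Longrightarrow> x - y \<in> KL k"
  by (auto simp: KL_def in_keys_iff lookup_add lookup_minus)

lemma KL_mono: "x \<in> KL k \<Longrightarrow> k \<le> l \<Longrightarrow> x \<in> KL l"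
  by (auto simp: KL_def)

lemma KL_lookup: "x \<in> KL k \<Longrightarrow> k \<le> key a \<Longrightarrow> Poly_Mapping.lookup x a = 0"
  by (force simp: KL_def in_keys_iff)

lemma KL_ex: "\<exists>k. x \<in> KL k"
proof -
  have "x \<in> KL (Suc (Max (insert 0 (key ` Poly_Mapping.keys x))))"
    by (auto simp: KL_def less_Suc_eq_le)
  then show ?thesis ..
qed

text \<open>For suitable \<open>b\<close> the graph contains a point with the single coordinate
  \<open>b\<close> on the side of \<open>s\<close>; on the opposite side its coordinates are these
  words. The coordinate \<open>b\<close> is left out because its key lies below the
  interval.\<close>

definition fam :: "'t \<Rightarrow> ('t, 'u) nword \<Rightarrow> 't \<Rightarrow> (('t, 'u) nword \<Rightarrow>\<^sub>0 'k::field)" where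
  "fam s b t = (if t \<in> opps s then Poly_Mapping.single (cn t s b) 1 else 0)"

text \<open>
  A filtration step enlarges the graph of at most one of the isomorphisms, by at most one dimension.
\<close>

lemma bpair_step:
  assumes z: "bpair (blk t0) z" and t0: "t0 \<in> T"
    and zk: "\<And>t. t \<in> T \<Longrightarrow> blk t = blk t0 \<Longrightarrow> z t \<in> KL (Suc k)"
    and a: "Poly_Mapping.lookup (z t0) a \<noteq> 0" "key a = k"
  shows "\<exists>s b c. a = cn t0 s b \<and> nw a \<and> c \<noteq> 0 \<and>
    (\<forall>t\<in>T. blk t = blk t0 \<longrightarrow> z t - pscale c (fam s b t) \<in> KL (stage s b * Suc (card T))) \<and>
    (\<forall>t\<in>opps s. Poly_Mapping.lookup (z t) (cn t s b) = c)"
proof -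
  let ?M = "Suc (card T)"
  have nwa: "nw a" using a(1) bpairD(1)[OF z t0] by (auto simp: NFv_def in_keys_iff)
  \<comment> \<open>The longer words in the two coefficient formulas have keys beyond
    \<open>k\<close>, where all coordinates vanish, so both formulas lose their last term.\<close>
  have up: "Poly_Mapping.lookup (z (sp_opp t)) (cn (sp_opp t) t a') = 0"
    if t: "t \<in> T" "blk t = blk t0" and "k < stage t a' * ?M" for t a'
  proof -
    have "z (sp_opp t) \<in> KL (Suc k)"
      by (rule zk) (use sp_mem[OF t(1)] sp_blk[OF t(1)] t(2) in auto)
    moreover have "key (cn (sp_opp t) t a') \<ge> stage t a' * ?M" unfolding key_cn by (rule le_add1)
    ultimately show ?thesis by (rule KL_lookup[OF _ order_trans[OF Suc_leI[OF that(3)]]])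
  qed
  have "stage t0 a * 1 \<le> stage t0 a * ?M" by (rule mult_le_mono2) simp
  then have "k < stage t0 a * ?M" using key_less_stage[of a t0] a(2) by linarith
  note up0 = up[OF t0 refl this]
  obtain s b where ab: "a = cn t0 s b"
    using lookup_bpair_other[OF z t0 nwa] a(1) up0 by metis
  have s: "s \<in> T" "t0 \<in> opps s" "nw b" and blk_s: "blk s = blk t0" using nwa ab by (auto simp: opps_def)
  \<comment> \<open>Read off at the special slot, since \<open>lookup_bpair_cn\<close> compares
    every slot of the side with that one.\<close>
  define c where "c = Poly_Mapping.lookup (z (sp_same t0)) (cn (sp_same t0) s b)"
  have c: "c \<noteq> 0" using lookup_bpair_cn[OF z t0, of s b] nwa ab up0 a(1) by (auto simp: c_def)
  have k: "k div ?M = stage s b" using key_div[OF t0, of s b] a(2) ab by simp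
  \<comment> \<open>From the interval of \<open>s\<close> and \<open>b\<close> upwards, each
    coordinate agrees with \<open>c\<close> times the family. Any other word there would have a key
    that is at most \<open>k\<close>, hence would lie in the same interval and be of the form
    \<open>(t, s) b\<close> after all.\<close>
  have lk: "Poly_Mapping.lookup (z t) a' = Poly_Mapping.lookup (pscale c (fam s b t)) a'"
    if t: "t \<in> T" "blk t = blk t0" and a': "stage s b * ?M \<le> key a'" for t a'
  proof (cases "nw a'")
    case False
    have "Poly_Mapping.lookup (z t) a' = 0"
      using False bpairD(1)[of t z] z t by (auto simp: NFv_def in_keys_iff)
    moreover have "nw (cn t s b)" if "t \<in> opps s"
      using nw_swap[OF nwa[unfolded ab], of t] t that s by (auto simp: opps_def)
    ultimately show ?thesis using False by (auto simp: fam_def lookup_single when_def)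
  next
    case True
    have "k < stage t a' * ?M"
    proof -
      have "stage s b * 1 \<le> stage s b * ?M" by (rule mult_le_mono2) simp
      then have "stage s b \<le> key a'" using a' by linarith
      then have "Suc (stage s b) \<le> stage t a'" using key_less_stage[of a' t] by simp
      then have "Suc (stage s b) * ?M \<le> stage t a' * ?M" by (rule mult_le_mono1)
      moreover have "k < Suc (stage s b) * ?M" 
        using k dividend_less_div_times[of ?M k] by simp
      ultimately show ?thesis by simp
    qed
    note up' = up[OF t this]
    show ?thesis
    proof (cases "\<exists>s' b'. a' = cn t s' b'")
      case False
      then have "Poly_Mapping.lookup (z t) a' = 0"
        using lookup_bpair_other[of t z a'] z t True up' by auto
      then show ?thesis using False by (auto simp: fam_def lookup_single when_def)
    next
      case True': True
      then obtain s' b' where a'b: "a' = cn t s' b'" by blast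
      have tos: "s' \<in> T" "t \<in> opps s'" using True a'b by auto
      have eq: "Poly_Mapping.lookup (z t) a' = Poly_Mapping.lookup (z (sp_same t)) (cn (sp_same t) s' b')"
        using lookup_bpair_cn[of t z s' b'] z t True up' a'b by simp
      show ?thesis
      proof (cases "s' = s \<and> b' = b")
        case same: True
        then have "sp_same t = sp_same t0" using tos s by (auto simp: opps_def)
        then show ?thesis using same eq tos a'b by (simp add: c_def fam_def)
      next
        case False
        have "Poly_Mapping.lookup (z t) a' = 0"
        proof (rule ccontr)
          assume "Poly_Mapping.lookup (z t) a' \<noteq> 0"
          then have "key a' \<le> k" using KL_lookup[OF zk[OF t], of a'] by linarith
          then have "key a' div ?M \<le> stage s b" using k div_le_mono by metis
          moreover have "stage s b \<le> key a' div ?M"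
            using a' by (simp add: less_eq_div_iff_mult_less_eq)
          ultimately have "\<exists>t. a' = cn t s b" by (intro stage_unique[OF True _ s(1,3)]) simp
          then show False using False a'b by auto
        qed
        then show ?thesis using False a'b by (auto simp: fam_def lookup_single when_def)
      qed
    qed
  qed
  have "z t - pscale c (fam s b t) \<in> KL (stage s b * ?M)" if t: "t \<in> T" "blk t = blk t0" for t
    unfolding KL_def
  proof (intro CollectI ballI)
    fix a' assume "a' \<in> Poly_Mapping.keys (z t - pscale c (fam s b t))"
    then have "Poly_Mapping.lookup (z t) a' \<noteq> Poly_Mapping.lookup (pscale c (fam s b t)) a'"
      by (simp add: in_keys_iff lookup_minus)
    then show "key a' < stage s b * ?M" using lk[OF t, of a'] by force
  qed
  moreover have "Poly_Mapping.lookup (z t) (cn t s b) = c" if "t \<in> opps s" for t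
    using lk[of t "cn t s b"] that blk_s by (auto simp: opps_def fam_def key_cn)
  ultimately show ?thesis using ab nwa c by blast
qed


section \<open>Submodules of the model are free\<close>

definition is_forcing :: "(('t, 'u) nword \<Rightarrow>\<^sub>0 'k::field) set \<Rightarrow> 't \<Rightarrow> ('t, 'u) nword \<Rightarrow>
    ('t \<Rightarrow> (('t, 'u) nword \<Rightarrow>\<^sub>0 'k)) \<Rightarrow> bool" where
  "is_forcing N s b z \<longleftrightarrow> bpair (blk s) z \<and>
    (\<forall>t\<in>T. blk t = blk s \<longrightarrow> z t \<in> N \<and> z t - fam s b t \<in> KL (stage s b * Suc (card T)))"

text \<open>
  When the words \<open>(t, s) b\<close> enter the filtration, either they all become leading words of \<open>N\<close>
  because the graph of the isomorphism, intersected with \<open>N\<close>, grows, or that graph does not grow at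
  all.  In the first case the new elements of \<open>N\<close> are determined by earlier ones; the
  leading words arising in the second case index a basis of \<open>N\<close>.
\<close>

definition forced :: "(('t, 'u) nword \<Rightarrow>\<^sub>0 'k::field) set \<Rightarrow> ('t, 'u) nword \<Rightarrow> bool" where
  "forced N a \<longleftrightarrow> (\<exists>t s b z. a = cn t s b \<and> is_forcing N s b z)"

text \<open>One choice for each pair \<open>s\<close> and \<open>b\<close>, shared by all
  \<open>t\<close>: the basis elements of a forced interval are coordinates of a single point of the
  graph.\<close>

definition forcing :: "(('t, 'u) nword \<Rightarrow>\<^sub>0 'k::field) set \<Rightarrow> 't \<Rightarrow> ('t, 'u) nword \<Rightarrow>
    't \<Rightarrow> (('t, 'u) nword \<Rightarrow>\<^sub>0 'k)" where
  "forcing N s b = (SOME z. is_forcing N s b z)"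

definition leads :: "(('t, 'u) nword \<Rightarrow>\<^sub>0 'k::field) set \<Rightarrow> ('t, 'u) nword \<Rightarrow> bool" where
  "leads N a \<longleftrightarrow> nw a \<and> (\<exists>x\<in>N. Poly_Mapping.lookup x a \<noteq> 0 \<and> x \<in> KL (Suc (key a)))"

definition free_lead :: "(('t, 'u) nword \<Rightarrow>\<^sub>0 'k::field) set \<Rightarrow> ('t, 'u) nword \<Rightarrow> bool" where
  "free_lead N a \<longleftrightarrow> leads N a \<and> \<not> forced N a"

definition bas :: "(('t, 'u) nword \<Rightarrow>\<^sub>0 'k::field) set \<Rightarrow> ('t, 'u) nword \<Rightarrow>
    (('t, 'u) nword \<Rightarrow>\<^sub>0 'k)" where
  "bas N a = (if forced N a then forcing N (snd (hd (fst a))) (tl (fst a), snd a) (fst (hd (fst a)))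
     else (SOME x. x \<in> N \<and> x \<in> NFv (wtop a) \<and> x - Poly_Mapping.single a 1 \<in> KL (key a)))"

lemma forced_cn: "forced N (cn t s b) \<longleftrightarrow> is_forcing N s b (forcing N s b)"
  unfolding forced_def forcing_def by (metis someI_ex cn_eq_iff)

lemma forcingD:
  assumes "forced N (cn t s b)"
  shows "bpair (blk s) (forcing N s b)"
    and "t' \<in> T \<Longrightarrow> blk t' = blk s \<Longrightarrow> forcing N s b t' \<in> N"
    and "t' \<in> T \<Longrightarrow> blk t' = blk s \<Longrightarrow> forcing N s b t' - fam s b t' \<in> KL (stage s b * Suc (card T))"
  using assms unfolding forced_cn is_forcing_def by blast+

lemma cn_dest [simp]:
  "snd (hd (fst (cn t s b))) = s" "fst (hd (fst (cn t s b))) = t" "(tl (fst (cn t s b)), snd (cn t s b)) = b"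
  by (simp_all add: cn_def)

lemma bas_forced: "forced N (cn t s b) \<Longrightarrow> bas N (cn t s b) = forcing N s b t"
  by (simp add: bas_def)

lemma bas_props:
  assumes N: "subm N" and a: "leads N a"
  shows "bas N a \<in> N" "bas N a \<in> NFv (wtop a)" "bas N a - Poly_Mapping.single a 1 \<in> KL (key a)"
proof -
  have "bas N a \<in> N \<and> bas N a \<in> NFv (wtop a) \<and> bas N a - Poly_Mapping.single a 1 \<in> KL (key a)"
  proof (cases "forced N a")
    case True
    then obtain t s b where ab: "a = cn t s b" by (auto simp: forced_def)
    have f: "forced N (cn t s b)" using True ab by simp
    have ts: "t \<in> T" "s \<in> T" "blk t = blk s" "t \<in> opps s" using a ab by (auto simp: leads_def opps_def)
    have "bas N a - Poly_Mapping.single a 1 \<in> KL (stage s b * Suc (card T))"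
      using forcingD(3)[OF f ts(1,3)] ts ab bas_forced[OF f] by (simp add: fam_def)
    then have "bas N a - Poly_Mapping.single a 1 \<in> KL (key a)"
      by (rule KL_mono) (simp add: ab key_cn)
    moreover have "bas N a \<in> NFv (wtop a)"
      using bpairD(1)[of t "forcing N s b"] forcingD(1)[OF f] ts ab bas_forced[OF f] by simp
    ultimately show ?thesis using forcingD(2)[OF f ts(1,3)] ab bas_forced[OF f] by simp
  next
    case False
    obtain x where x: "x \<in> N" "Poly_Mapping.lookup x a \<noteq> 0" "x \<in> KL (Suc (key a))" "nw a"
      using a by (auto simp: leads_def)
    have xNF: "x \<in> NF" using submD(1)[OF N] x by auto
    \<comment> \<open>Projecting to the vertex of the leading word keeps that word and makes the
      element homogeneous; the scalar makes it monic.\<close>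
    let ?y = "pscale (1 / Poly_Mapping.lookup x a) (vproj (wtop a) x)"
    have y: "?y \<in> N" "?y \<in> NFv (wtop a)"
      using submD(4,5)[OF N] x wtop_mem[OF x(4)] by (auto intro: NFv_closed vproj_mem)
    have "?y - Poly_Mapping.single a 1 \<in> KL (key a)"
      unfolding KL_def
    proof (intro CollectI ballI)
      fix a' assume "a' \<in> Poly_Mapping.keys (?y - Poly_Mapping.single a 1)"
      then have *: "Poly_Mapping.lookup ?y a' \<noteq> Poly_Mapping.lookup (Poly_Mapping.single a 1) a'"
        by (simp add: in_keys_iff lookup_minus)
      then have ne: "a' \<noteq> a" using x(2) xNF by (auto simp: lookup_vproj)
      then have "Poly_Mapping.lookup x a' \<noteq> 0" using * xNF by (auto simp: lookup_vproj lookup_single split: if_splits)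
      then have "nw a'" "key a' < Suc (key a)"
        using xNF x(3) by (auto simp: NF_def KL_def in_keys_iff)
      then show "key a' < key a" using key_inj[OF _ x(4), of a'] ne by linarith
    qed
    with y have "\<exists>x. x \<in> N \<and> x \<in> NFv (wtop a) \<and> x - Poly_Mapping.single a 1 \<in> KL (key a)" by blast
    then show ?thesis using False unfolding bas_def by (simp only: if_False) (rule someI_ex)
  qed
  then show "bas N a \<in> N" "bas N a \<in> NFv (wtop a)" "bas N a - Poly_Mapping.single a 1 \<in> KL (key a)"
    by auto
qed

text \<open>Distinct normal words have distinct keys, so one multiple of one basis element clears
  the whole level.\<close>

lemma lead_reduce:
  assumes N: "subm N" and x: "x \<in> N" "x \<in> KL (Suc (key a))" and a: "leads N a"
  shows "x - pscale (Poly_Mapping.lookup x a) (bas N a) \<in> N"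
    "x - pscale (Poly_Mapping.lookup x a) (bas N a) \<in> KL (key a)"
proof -
  let ?y = "x - pscale (Poly_Mapping.lookup x a) (bas N a)"
  note b = bas_props[OF N a]
  show "?y \<in> N" using submD(4,7)[OF N] x b(1) by auto
  have xNF: "x \<in> NF" using submD(1)[OF N] x by auto
  have yNF: "?y \<in> NF" using submD(1)[OF N] \<open>?y \<in> N\<close> by auto
  have nwa: "nw a" using a by (simp add: leads_def)
  have "key a' < key a" if a': "a' \<in> Poly_Mapping.keys ?y" for a'
  proof (rule ccontr)
    assume ge: "\<not> key a' < key a"
    have "Poly_Mapping.lookup (bas N a - Poly_Mapping.single a 1) a' = 0"
      using KL_lookup[OF b(3), of a'] ge by simp
    then have ba: "Poly_Mapping.lookup (bas N a) a' = (if a' = a then 1 else 0)"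
      by (simp add: lookup_minus lookup_single when_def split: if_splits)
    have "nw a'" using yNF a' by (auto simp: NF_def)
    then have "a' \<noteq> a \<Longrightarrow> Suc (key a) \<le> key a'" using ge key_inj[OF _ nwa, of a'] by linarith
    then have "a' \<noteq> a \<Longrightarrow> Poly_Mapping.lookup x a' = 0" using KL_lookup[OF x(2)] by blast
    then have "Poly_Mapping.lookup ?y a' = 0" using ba by (cases "a' = a") (simp_all add: lookup_minus)
    then show False using a' by (simp add: in_keys_iff)
  qed
  then show "?y \<in> KL (key a)" by (simp add: KL_def)
qed

lemma no_lead:
  assumes N: "subm N" and x: "x \<in> N" "x \<in> KL (Suc k)" and k: "\<And>a. leads N a \<Longrightarrow> key a \<noteq> k"
  shows "x \<in> KL k"
  unfolding KL_def
proof (intro CollectI ballI)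
  fix a assume a: "a \<in> Poly_Mapping.keys x"
  then have "key a < Suc k" "nw a" using x submD(1)[OF N] by (auto simp: KL_def NF_def)
  moreover have "key a \<noteq> k"
  proof
    assume "key a = k"
    then have "leads N a" using a x \<open>nw a\<close> by (auto simp: leads_def in_keys_iff)
    then show False using k \<open>key a = k\<close> by blast
  qed
  ultimately show "key a < k" by simp
qed

text \<open>Induction along the filtration. A forced basis element is the sum of the
  \<open>lam t s' (z s')\<close> over the coordinates on the side of \<open>s\<close>; there the
  leading family vanishes, so these coordinates already lie in \<open>N'\<close> by
  induction.\<close>

lemma free_generate:
  assumes N: "subm N" and N': "subm N'" "N' \<subseteq> N" and bas: "\<And>a. free_lead N a \<Longrightarrow> bas N a \<in> N'"
  shows "N' = N"
proof -
  have "x \<in> N'" if "x \<in> N" "x \<in> KL k" for x k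
    using that
  proof (induction k arbitrary: x rule: less_induct)
    case (less k)
    show ?case
    proof (cases k)
      case 0
      then have "x = 0" using less.prems(2) by (intro poly_mapping_eqI) (auto simp: KL_lookup)
      then show ?thesis using submD(2)[OF N'(1)] by simp
    next
      case (Suc j)
      show ?thesis
      proof (cases "\<exists>a. leads N a \<and> key a = j")
        case False
        then have "x \<in> KL j" using no_lead[OF N less.prems(1), of j] less.prems(2) Suc by auto
        then show ?thesis using less.IH[of j x] less.prems(1) Suc by simp
      next
        case True
        then obtain a where a: "leads N a" "key a = j" by blast
        have bN: "bas N a \<in> N'"
        proof (cases "forced N a")
          case False
          then show ?thesis using a bas by (simp add: free_lead_def)
        next
          case True
          then obtain t s b where ab: "a = cn t s b" by (auto simp: forced_def)
          have f: "forced N (cn t s b)" using True ab by simp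
          have ts: "t \<in> T" "s \<in> T" "blk t = blk s" "t \<in> opps s" "sd s \<noteq> sd t" using a(1) ab by (auto simp: leads_def opps_def)
          have small: "forcing N s b s' \<in> N'" if s': "s' \<in> opps t" for s'
          proof (rule less.IH)
            have s'': "s' \<in> T" "blk s' = blk s" "s' \<notin> opps s" using s' ts by (auto simp: opps_def)
            show "forcing N s b s' \<in> N" using forcingD(2)[OF f s''(1,2)] .
            show "forcing N s b s' \<in> KL j"
              using KL_mono[OF forcingD(3)[OF f s''(1,2)], of j] s''(3) a(2) ab by (simp add: fam_def key_cn)
            show "j < k" using Suc by simp
          qed
          have "bas N a = (\<Sum>s'\<in>opps t. lam t s' (forcing N s b s'))"
            unfolding ab bas_forced[OF f] using bpairD(2)[of t "forcing N s b"] forcingD(1)[OF f] ts by simp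
          moreover have "lam t s' (forcing N s b s') \<in> N'" if "s' \<in> opps t" for s'
            using submD(6)[OF N'(1) small[OF that]] that ts by (auto simp: opps_def)
          moreover have "sum h I \<in> N'" if "\<And>i. i \<in> I \<Longrightarrow> h i \<in> N'" for h :: "'t \<Rightarrow> _" and I
            using that by (induction I rule: infinite_finite_induct) (auto intro: submD[OF N'(1)])
          ultimately show ?thesis by simp
        qed
        let ?c = "pscale (Poly_Mapping.lookup x a) (bas N a)"
        have "x - ?c \<in> N'"
          using lead_reduce[OF N less.prems(1) _ a(1)] less.prems(2) a Suc by (intro less.IH[of j]) auto
        then have "(x - ?c) + ?c \<in> N'" by (intro submD(3)[OF N'(1)] submD(4)[OF N'(1)] bN)
        then show ?thesis by simp
      qed
    qed
  qed
  then show ?thesis using KL_ex N'(2) by blast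
qed

section \<open>Homomorphisms prescribed on the free leading words\<close>

definition pval :: "(('t, 'u) nword \<Rightarrow>\<^sub>0 'k::field) set \<Rightarrow>
    (('t, 'u) nword \<Rightarrow> (('t, 'u) nword \<Rightarrow>\<^sub>0 'k)) \<Rightarrow>
    ((('t, 'u) nword \<Rightarrow>\<^sub>0 'k) \<Rightarrow> (('t, 'u) nword \<Rightarrow>\<^sub>0 'k)) \<Rightarrow>
    ('t, 'u) nword \<Rightarrow> (('t, 'u) nword \<Rightarrow>\<^sub>0 'k)" where
  "pval N x0 f a = (if forced N a then
     (let t = fst (hd (fst a)); z = forcing N (snd (hd (fst a))) (tl (fst a), snd a)
      in \<Sum>s\<in>opps t. lam t s (f (z s))) else x0 a)"

text \<open>The intended homomorphism on successive filtration steps. On a free leading word its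
  value is prescribed; on a forced one the graph equation dictates the value through coordinates
  from earlier steps. The formula makes sense for all elements, so that linearity holds
  globally.\<close>

primrec psi :: "(('t, 'u) nword \<Rightarrow>\<^sub>0 'k::field) set \<Rightarrow>
    (('t, 'u) nword \<Rightarrow> (('t, 'u) nword \<Rightarrow>\<^sub>0 'k)) \<Rightarrow> nat \<Rightarrow>
    (('t, 'u) nword \<Rightarrow>\<^sub>0 'k) \<Rightarrow> (('t, 'u) nword \<Rightarrow>\<^sub>0 'k)" where
  "psi N x0 0 = (\<lambda>x. 0)"
| "psi N x0 (Suc k) = (\<lambda>x. if \<exists>a. leads N a \<and> key a = k then
     (let a = (THE a. leads N a \<and> key a = k) in
      psi N x0 k (x - pscale (Poly_Mapping.lookup x a) (bas N a)) +
      pscale (Poly_Mapping.lookup x a) (pval N x0 (psi N x0 k) a)) else psi N x0 k x)"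

context
  fixes N :: "(('t, 'u) nword \<Rightarrow>\<^sub>0 'k::field) set"
    and x0 :: "('t, 'u) nword \<Rightarrow> (('t, 'u) nword \<Rightarrow>\<^sub>0 'k)"
  assumes N: "subm N" and x0: "\<And>a. x0 a \<in> NFv (wtop a)"
begin

lemma psi_lead:
  assumes "leads N a"
  shows "psi N x0 (Suc (key a)) x = psi N x0 (key a) (x - pscale (Poly_Mapping.lookup x a) (bas N a)) +
      pscale (Poly_Mapping.lookup x a) (pval N x0 (psi N x0 (key a)) a)"
proof -
  have "(THE a'. leads N a' \<and> key a' = key a) = a"
    using assms by (intro the_equality) (auto simp: leads_def intro: key_inj)
  then show ?thesis using assms by (auto simp: Let_def)
qed

lemma psi_no_lead:
  assumes "\<not> (\<exists>a. leads N a \<and> key a = k)"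
  shows "psi N x0 (Suc k) = psi N x0 k"
  by (simp only: psi.simps assms if_False)

lemma plinear_psi: "plinear (psi N x0 k)"
proof (induction k)
  case (Suc k)
  show ?case
  proof (cases "\<exists>a. leads N a \<and> key a = k")
    case True
    then obtain a where a: "leads N a" "key a = k" by blast
    then have "psi N x0 (Suc k) = (\<lambda>x. psi N x0 k (x - pscale (Poly_Mapping.lookup x a) (bas N a)) +
      pscale (Poly_Mapping.lookup x a) (pval N x0 (psi N x0 k) a))"
      using psi_lead[OF a(1)] by (intro ext) (simp only: a)
    moreover have "plinear (\<lambda>x. x - pscale (Poly_Mapping.lookup x a) (bas N a))"
      by (rule plinear_intros(4)[OF plinear_intros(1) plinear_intros(6)])
    ultimately show ?thesis
      using plinear_intros(3)[OF plinear_comp[OF Suc] plinear_intros(6)] by simp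
  next
    case False
    show ?thesis unfolding psi_no_lead[OF False] by (rule Suc)
  qed
qed (simp add: plinear_intros)

lemma psi_stable: "x \<in> KL k \<Longrightarrow> k \<le> l \<Longrightarrow> psi N x0 l x = psi N x0 k x"
proof (induction l)
  case (Suc l)
  show ?case
  proof (cases "k = Suc l")
    case False
    then have kl: "k \<le> l" using Suc.prems by simp
    show ?thesis
    proof (cases "\<exists>a. leads N a \<and> key a = l")
      case True
      then obtain a where a: "leads N a" "key a = l" by blast
      then have "Poly_Mapping.lookup x a = 0" using KL_lookup[OF Suc.prems(1)] kl by simp
      then show ?thesis using psi_lead[OF a(1), of x] Suc.IH[OF Suc.prems(1) kl] by (simp only: a) simp
    next
      case False
      show ?thesis unfolding psi_no_lead[OF False] by (rule Suc.IH[OF Suc.prems(1) kl])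
    qed
  qed simp
qed simp

lemma psi_mem: "x \<in> N \<Longrightarrow> x \<in> NFv u \<Longrightarrow> x \<in> KL k \<Longrightarrow> psi N x0 k x \<in> NFv u"
proof (induction k arbitrary: x u rule: less_induct)
  case (less k)
  show ?case
  proof (cases k)
    case 0
    then show ?thesis by (simp add: NFv_closed)
  next
    case (Suc j)
    show ?thesis
    proof (cases "\<exists>a. leads N a \<and> key a = j")
      case False
      then have "x \<in> KL j" using no_lead[OF N less.prems(1), of j] less.prems(3) Suc by auto
      then show ?thesis using less.IH[of j x u] less.prems Suc psi_no_lead[OF False] by simp
    next
      case True
      then obtain a where a: "leads N a" "key a = j" by blast
      have val: "pval N x0 (psi N x0 j) a \<in> NFv (wtop a)"
      proof (cases "forced N a")
        case True
        then obtain t s b where ab: "a = cn t s b" by (auto simp: forced_def)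
        have f: "forced N (cn t s b)" using True ab by simp
        have ts: "t \<in> T" "s \<in> T" using a(1) ab by (auto simp: leads_def opps_def)
        show ?thesis using f ab opps_sym ts
          by (auto simp: pval_def Let_def intro!: NFv_sum lam_mem dest: oppsD)
      qed (simp add: pval_def x0)
      show ?thesis
      proof (cases "Poly_Mapping.lookup x a = 0")
        case True
        then have "x \<in> KL j" using lead_reduce(2)[OF N less.prems(1) _ a(1)] less.prems(3) a Suc by simp
        then show ?thesis using psi_stable[of x j k] less.IH[of j x u] less.prems Suc by simp
      next
        case False
        then have "wtop a = u" using less.prems(2) by (auto simp: NFv_def in_keys_iff)
        then have "x - pscale (Poly_Mapping.lookup x a) (bas N a) \<in> NFv u"
          using less.prems(2) bas_props(2)[OF N a(1)] by (auto intro: NFv_closed)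
        then have "psi N x0 j (x - pscale (Poly_Mapping.lookup x a) (bas N a)) \<in> NFv u"
          using lead_reduce[OF N less.prems(1) _ a(1)] less.prems(3) a Suc by (intro less.IH) auto
        then show ?thesis
          using psi_lead[OF a(1), of x] val \<open>wtop a = u\<close> Suc by (auto simp: a(2) intro: NFv_closed)
      qed
    qed
  qed
qed

text \<open>A basis element is monic, so subtracting its own multiple at its key leaves zero and
  only the prescribed value remains.\<close>

lemma psi_bas:
  assumes "leads N a" "key a < k"
  shows "psi N x0 k (bas N a) = pval N x0 (psi N x0 (key a)) a"
proof -
  note b = bas_props[OF N assms(1)]
  have "bas N a = (bas N a - Poly_Mapping.single a 1) + Poly_Mapping.single a 1" by simp
  also have "\<dots> \<in> KL (Suc (key a))"
    by (intro KL_closed(2) KL_mono[OF b(3)]) (auto simp: KL_def)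
  finally have bK: "bas N a \<in> KL (Suc (key a))" .
  have "Poly_Mapping.lookup (bas N a) a = 1"
    using KL_lookup[OF b(3), of a] by (simp add: lookup_minus)
  then have "psi N x0 (Suc (key a)) (bas N a) = pval N x0 (psi N x0 (key a)) a"
    using psi_lead[OF assms(1), of "bas N a"] plinearD(3)[OF plinear_psi] by simp
  then show ?thesis using psi_stable[OF bK, of k] assms(2) by simp
qed

text \<open>After exchanging the two sums, \<open>lam_relation\<close> applies to each inner sum:
  the composite of the two block matrices is the identity.\<close>

lemma lam_lam_sum:
  assumes t: "t \<in> T" and y: "\<And>s. s \<in> T \<Longrightarrow> blk s = blk t \<Longrightarrow> y s \<in> NFv (vert s)"
  shows "(\<Sum>s\<in>opps t. lam t s (\<Sum>t'\<in>opps s. lam s t' (y t'))) = y t"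
proof -
  let ?S = "{s \<in> T. blk s = blk t \<and> sd s = sd t}"
  have S: "finite ?S" using finite_T by simp
  have opps_S: "opps s = ?S" if "s \<in> opps t" for s
    using that by (auto simp: opps_def)
  have "(\<Sum>s\<in>opps t. lam t s (\<Sum>t'\<in>opps s. lam s t' (y t'))) = (\<Sum>s\<in>opps t. \<Sum>t'\<in>?S. lam t s (lam s t' (y t')))"
    by (intro sum.cong refl) (simp add: opps_S lam_simps)
  also have "\<dots> = (\<Sum>t'\<in>?S. \<Sum>s\<in>opps t. lam t s (lam s t' (y t')))" by (rule sum.swap)
  also have "\<dots> = (\<Sum>t'\<in>?S. if t' = t then y t' else 0)"
    using t y by (intro sum.cong refl) (subst lam_relation, auto)
  also have "\<dots> = y t" using S t by (simp add: sum.delta)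
  finally show ?thesis .
qed

text \<open>For slots opposite to \<open>s\<close> the equation is the definition of
  \<open>pval\<close>. For slots on the side of \<open>s\<close> it follows by inverting the block
  matrix.\<close>

lemma psi_forcing:
  assumes f: "forced N (cn t0 s b)" and s: "s \<in> T"
    and keys: "\<And>t. t \<in> opps s \<Longrightarrow> leads N (cn t s b) \<and> key (cn t s b) < k"
    and k: "stage s b * Suc (card T) \<le> k" and t: "t \<in> T" "blk t = blk s"
  shows "psi N x0 k (forcing N s b t) = (\<Sum>s'\<in>opps t. lam t s' (psi N x0 k (forcing N s b s')))"
proof -
  let ?z = "forcing N s b"
  have fz: "forced N (cn t s b)" for t using f by (simp add: forced_cn)
  \<comment> \<open>On the side of \<open>s\<close> the leading family vanishes, so these
    coordinates lie below the interval and later steps no longer change their values.\<close>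
  have low: "psi N x0 l (?z t) = psi N x0 (stage s b * Suc (card T)) (?z t)"
    if t: "t \<in> T" "blk t = blk s" "sd t = sd s" and l: "stage s b * Suc (card T) \<le> l" for t l
    using forcingD(3)[OF f t(1,2)] t l by (intro psi_stable) (auto simp: fam_def opps_def)
  have opp: "psi N x0 k (?z t) = (\<Sum>s'\<in>opps t. lam t s' (psi N x0 k (?z s')))" if t: "t \<in> opps s" for t
  proof -
    have tT: "t \<in> T" "blk t = blk s" "sd t \<noteq> sd s" using t by (auto simp: opps_def)
    have "psi N x0 k (?z t) = pval N x0 (psi N x0 (key (cn t s b))) (cn t s b)"
      using psi_bas[of "cn t s b" k] keys[OF t] bas_forced[OF fz, of t] by simp
    also have "\<dots> = (\<Sum>s'\<in>opps t. lam t s' (psi N x0 (key (cn t s b)) (?z s')))"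
      using fz[of t] by (simp add: pval_def Let_def)
    also have "\<dots> = (\<Sum>s'\<in>opps t. lam t s' (psi N x0 k (?z s')))"
    proof (intro sum.cong refl)
      fix s' assume "s' \<in> opps t"
      then have s': "s' \<in> T" "blk s' = blk s" "sd s' = sd s" using tT by (auto simp: opps_def)
      have "stage s b * Suc (card T) \<le> key (cn t s b)" unfolding key_cn by (rule le_add1)
      then show "lam t s' (psi N x0 (key (cn t s b)) (?z s')) = lam t s' (psi N x0 k (?z s'))"
        unfolding low[OF s' k] by (subst low[OF s']) auto
    qed
    finally show ?thesis .
  qed
  show ?thesis
  proof (cases "sd t = sd s")
    case False
    then show ?thesis using opp t by (auto simp: opps_def)
  next
    case True
    have zt: "psi N x0 k (?z t') \<in> NFv (vert t')" if t': "t' \<in> T" "blk t' = blk t" for t'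
    proof (rule psi_mem)
      have t's: "blk t' = blk s" using t' t by simp
      show "?z t' \<in> N" by (rule forcingD(2)[OF f t'(1) t's])
      show "?z t' \<in> NFv (vert t')" using bpairD(1)[of t' ?z] forcingD(1)[OF f] t' t's by simp
      have "?z t' = (?z t' - fam s b t') + fam s b t'" by simp
      also have "\<dots> \<in> KL k"
      proof (rule KL_closed(2))
        show "?z t' - fam s b t' \<in> KL k" by (rule KL_mono[OF forcingD(3)[OF f t'(1) t's] k])
        show "(fam s b t' :: _ \<Rightarrow>\<^sub>0 'k) \<in> KL k" using keys[of t'] by (auto simp: fam_def KL_def)
      qed
      finally show "?z t' \<in> KL k" .
    qed
    have "(\<Sum>s'\<in>opps t. lam t s' (psi N x0 k (?z s'))) =
      (\<Sum>s'\<in>opps t. lam t s' (\<Sum>t'\<in>opps s'. lam s' t' (psi N x0 k (?z t'))))"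
    proof (intro sum.cong refl)
      fix s' assume "s' \<in> opps t"
      then have "s' \<in> opps s" using True t by (auto simp: opps_def)
      then show "lam t s' (psi N x0 k (?z s')) = lam t s' (\<Sum>t'\<in>opps s'. lam s' t' (psi N x0 k (?z t')))"
        by (subst opp) auto
    qed
    also have "\<dots> = psi N x0 k (?z t)" by (rule lam_lam_sum[OF t(1) zt])
    finally show ?thesis by simp
  qed
qed

text \<open>Induction over the steps. If a step enlarges some coordinate, \<open>bpair_step\<close>
  shows that the point has the leading part of a forcing family; subtracting a multiple of the
  chosen one leaves a point of the graph in the previous step.\<close>

lemma psi_bpair:
  assumes "bpair \<beta> z" "\<And>t. t \<in> T \<Longrightarrow> blk t = \<beta> \<Longrightarrow> z t \<in> N \<and> z t \<in> KL k" "t \<in> T" "blk t = \<beta>"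
  shows "psi N x0 k (z t) = (\<Sum>s\<in>opps t. lam t s (psi N x0 k (z s)))"
  using assms
proof (induction k arbitrary: z t)
  case 0
  then show ?case by (simp add: lam_simps)
next
  case (Suc k)
  let ?M = "Suc (card T)"
  show ?case
  proof (cases "\<forall>t\<in>T. blk t = \<beta> \<longrightarrow> z t \<in> KL k")
    case True
    then have "psi N x0 (Suc k) (z t) = psi N x0 k (z t)" if "t \<in> T" "blk t = \<beta>" for t
      using that by (intro psi_stable) auto
    moreover have "psi N x0 k (z t) = (\<Sum>s\<in>opps t. lam t s (psi N x0 k (z s)))"
      using Suc True by (intro Suc.IH) auto
    moreover have "s \<in> T \<and> blk s = \<beta>" if "s \<in> opps t" for s
      using that Suc.prems(4) by (auto simp: opps_def)
    ultimately show ?thesis using Suc.prems(3,4) by (simp cong: sum.cong)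
  next
    case False
    then obtain t0 where t0: "t0 \<in> T" "blk t0 = \<beta>" "z t0 \<notin> KL k" by blast
    then obtain a where a: "Poly_Mapping.lookup (z t0) a \<noteq> 0" "\<not> key a < k"
      by (auto simp: KL_def in_keys_iff)
    have zK: "z t \<in> KL (Suc k)" if "t \<in> T" "blk t = blk t0" for t using Suc.prems(2) that t0 by auto
    then have "key a = k" using a KL_lookup[OF zK[OF t0(1) refl], of a] by linarith
    obtain s b c where ab: "a = cn t0 s b" "nw a" "c \<noteq> 0"
      and c: "\<And>t. t \<in> T \<Longrightarrow> blk t = blk t0 \<Longrightarrow> z t - pscale c (fam s b t) \<in> KL (stage s b * ?M)"
        "\<And>t. t \<in> opps s \<Longrightarrow> Poly_Mapping.lookup (z t) (cn t s b) = c"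
      using bpair_step[of t0 z k a] Suc.prems(1) t0 zK a \<open>key a = k\<close> by auto
    have s: "s \<in> T" "nw b" "blk s = \<beta>" "t0 \<in> opps s" using ab t0 by (auto simp: opps_def)
    \<comment> \<open>Scaled to leading coefficient one, the given point itself witnesses that the
      new words are forced.\<close>
    define z' where "z' = (\<lambda>t. pscale (1 / c) (z t))"
    have fam_c: "z' t - fam s b t = pscale (1 / c) (z t - pscale c (fam s b t))" for t
      using ab(3) by (simp add: z'_def pscale_diff)
    have "is_forcing N s b z'"
      unfolding is_forcing_def
    proof (intro conjI ballI impI)
      show "bpair (blk s) z'" unfolding z'_def using Suc.prems(1) s by (intro bpair_scale) simp
      fix t assume t: "t \<in> T" "blk t = blk s"
      then show "z' t \<in> N" using Suc.prems(2)[of t] s submD(4)[OF N] by (simp add: z'_def)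
      show "z' t - fam s b t \<in> KL (stage s b * ?M)"
        unfolding fam_c using c(1)[of t] t s t0 by (intro KL_closed(3)) auto
    qed
    then have f: "forced N (cn t s b)" for t by (auto simp: forced_def)
    let ?f = "forcing N s b"
    have st: "stage s b * ?M \<le> k"
      using \<open>key a = k\<close> ab(1) key_cn[of t0 s b] by (metis le_add1)
    have keys: "leads N (cn t s b) \<and> key (cn t s b) < Suc k" if t: "t \<in> opps s" for t
    proof
      have tT: "t \<in> T" "blk t = \<beta>" using t s by (auto simp: opps_def)
      have "cn t s b \<in> Poly_Mapping.keys (z t)" using c(2)[OF t] ab(3) by (simp add: in_keys_iff)
      then show *: "key (cn t s b) < Suc k" using Suc.prems(2)[OF tT] by (auto simp: KL_def)
      have "?f t \<in> N" using forcingD(2)[OF f tT(1)] tT s by simp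
      moreover have "Poly_Mapping.lookup (?f t) (cn t s b) \<noteq> 0 \<and> ?f t \<in> KL (Suc (key (cn t s b)))"
      proof
        have d: "?f t - Poly_Mapping.single (cn t s b) 1 \<in> KL (stage s b * ?M)"
          using forcingD(3)[OF f tT(1)] tT s t by (simp add: fam_def)
        have ge: "stage s b * ?M \<le> key (cn t s b)" unfolding key_cn by (rule le_add1)
        show "Poly_Mapping.lookup (?f t) (cn t s b) \<noteq> 0"
          using KL_lookup[OF d ge] by (simp add: lookup_minus)
        have "?f t = (?f t - Poly_Mapping.single (cn t s b) 1) + Poly_Mapping.single (cn t s b) 1" by simp
        also have "\<dots> \<in> KL (Suc (key (cn t s b)))"
          using ge by (intro KL_closed(2) KL_mono[OF d]) (auto simp: KL_def)
        finally show "?f t \<in> KL (Suc (key (cn t s b)))" .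
      qed
      moreover have "nw (cn t s b)" using nw_swap[OF ab(2)[unfolded ab(1)] tT(1)] tT t0 t s by (auto simp: opps_def)
      ultimately show "leads N (cn t s b)" by (auto simp: leads_def)
    qed
    define y where "y = (\<lambda>t. z t - pscale c (?f t))"
    have y: "y t \<in> N \<and> y t \<in> KL k" if t: "t \<in> T" "blk t = \<beta>" for t
    proof
      show "y t \<in> N"
        unfolding y_def using submD(4,7)[OF N] Suc.prems(2)[OF t] forcingD(2)[OF f t(1)] t s by auto
      have "y t = (z t - pscale c (fam s b t)) - pscale c (?f t - fam s b t)"
        by (simp add: y_def pscale_diff)
      also have "\<dots> \<in> KL (stage s b * ?M)"
      proof (rule KL_closed(4)[OF _ KL_closed(3)])
        show "z t - pscale c (fam s b t) \<in> KL (stage s b * ?M)" using c(1)[of t] t t0 by simp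
        show "?f t - fam s b t \<in> KL (stage s b * ?M)" using forcingD(3)[OF f t(1)] t s by simp
      qed
      finally show "y t \<in> KL k" using st by (rule KL_mono)
    qed
    have "bpair \<beta> y"
      unfolding y_def using forcingD(1)[OF f] s Suc.prems(1) by (intro bpair_diff bpair_scale) auto
    then have IH: "psi N x0 k (y t) = (\<Sum>s\<in>opps t. lam t s (psi N x0 k (y s)))"
      using Suc.prems(3,4) y by (intro Suc.IH) auto
    have dec: "psi N x0 (Suc k) (z t) = psi N x0 k (y t) + pscale c (psi N x0 (Suc k) (?f t))"
      if "t \<in> T" "blk t = \<beta>" for t
    proof -
      have "z t = y t + pscale c (?f t)" by (simp add: y_def)
      then have "psi N x0 (Suc k) (z t) = psi N x0 (Suc k) (y t) + pscale c (psi N x0 (Suc k) (?f t))"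
        by (simp only: plinearD[OF plinear_psi])
      then show ?thesis using psi_stable[of "y t" k "Suc k"] y[OF that] by simp
    qed
    have "psi N x0 (Suc k) (?f t) = (\<Sum>s'\<in>opps t. lam t s' (psi N x0 (Suc k) (?f s')))"
      using st Suc.prems(3,4) s by (intro psi_forcing[OF f s(1) keys]) auto
    then have "psi N x0 (Suc k) (z t) = (\<Sum>s\<in>opps t. lam t s (psi N x0 k (y s) + pscale c (psi N x0 (Suc k) (?f s))))"
      unfolding dec[OF Suc.prems(3,4)] IH by (simp add: lam_simps sum.distrib pscale_sum del: psi.simps)
    also have "\<dots> = (\<Sum>s\<in>opps t. lam t s (psi N x0 (Suc k) (z s)))"
      using Suc.prems(4) by (intro sum.cong refl, subst dec) (auto simp: opps_def)
    finally show ?thesis .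
  qed
qed

lemma free_extension:
  "\<exists>f. nfhom f N \<and> (\<forall>a. free_lead N a \<longrightarrow> f (bas N a) = x0 a)"
proof -
  \<comment> \<open>By \<open>psi_stable\<close> every step that contains \<open>x\<close> gives the
    same value; the least one is taken to have a single function.\<close>
  define K where "K x = (LEAST k. x \<in> KL k)" for x :: "('t, 'u) nword \<Rightarrow>\<^sub>0 'k"
  define f where "f x = psi N x0 (K x) x" for x
  have fk: "f x = psi N x0 k x" if "x \<in> KL k" for x k
  proof -
    have "x \<in> KL (K x)" "K x \<le> k" unfolding K_def using that by (auto intro: LeastI Least_le)
    then show ?thesis unfolding f_def by (intro psi_stable[symmetric])
  qed
  have common: "\<exists>k. x \<in> KL k \<and> y \<in> KL k" for x y :: "('t, 'u) nword \<Rightarrow>\<^sub>0 'k"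
    using KL_ex[of x] KL_ex[of y] by (meson KL_mono max.cobounded1 max.cobounded2)
  have lin: "plinear f"
  proof (rule plinearI)
    fix x y :: "('t, 'u) nword \<Rightarrow>\<^sub>0 'k" and c
    obtain k where k: "x \<in> KL k" "y \<in> KL k" using common by blast
    then show "f (x + y) = f x + f y"
      using fk[OF KL_closed(2)[OF k]] fk[OF k(1)] fk[OF k(2)] by (simp add: plinearD[OF plinear_psi])
    show "f (pscale c x) = pscale c (f x)"
      using fk[OF KL_closed(3)[OF k(1)]] fk[OF k(1)] by (simp add: plinearD[OF plinear_psi])
  qed
  have mem: "f x \<in> NFv u" if "x \<in> N" "x \<in> NFv u" for x u
    using KL_ex[of x] fk psi_mem[OF that] by metis
  have dec: "f x = (\<Sum>u\<in>V. f (vproj u x))" if "x \<in> N" for x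
    using submD(1)[OF N] that by (subst sum_vproj[symmetric]) (auto simp: plinearD[OF lin])
  have vmem: "f (vproj u x) \<in> NFv u" if "x \<in> N" "u \<in> V" for u x
    using submD(5)[OF N that] vproj_mem by (rule mem)
  have bp: "f (z t) = (\<Sum>s\<in>opps t. lam t s (f (z s)))"
    if z: "bpair (blk t) z" "\<And>t'. t' \<in> T \<Longrightarrow> blk t' = blk t \<Longrightarrow> z t' \<in> N" and t: "t \<in> T" for z t
  proof -
    define k where "k = Max (K ` z ` T)"
    have "z t' \<in> KL k" if "t' \<in> T" for t'
    proof (rule KL_mono)
      show "z t' \<in> KL (K (z t'))" unfolding K_def using KL_ex[of "z t'"] by (auto intro: LeastI)
      show "K (z t') \<le> k" unfolding k_def using finite_T that by (intro Max_ge) auto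
    qed
    note fz = fk[OF this]
    have "psi N x0 k (z t) = (\<Sum>s\<in>opps t. lam t s (psi N x0 k (z s)))"
      using \<open>\<And>t'. t' \<in> T \<Longrightarrow> z t' \<in> KL k\<close> z(2) t by (intro psi_bpair[OF z(1)]) auto
    also have "\<dots> = (\<Sum>s\<in>opps t. lam t s (f (z s)))"
      by (intro sum.cong refl) (simp add: fz opps_def)
    finally show ?thesis using fz[OF t] by simp
  qed
  have "nfhom f N"
    unfolding nfhom_def
  proof (intro conjI ballI allI)
    fix x assume x: "x \<in> N"
    show "f x \<in> NF" unfolding dec[OF x] using vmem[OF x] by (intro NF_sum) (auto intro: NFv_subset)
    fix u assume u: "u \<in> V"
    have "vproj u (f x) = (\<Sum>u'\<in>V. vproj u (f (vproj u' x)))"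
      unfolding dec[OF x] by (rule vproj_simps)
    also have "\<dots> = (\<Sum>u'\<in>V. if u' = u then f (vproj u x) else 0)"
      using vproj_id[OF vmem[OF x]] vproj_other[OF vmem[OF x], of _ u] by (intro sum.cong refl) auto
    finally show "f (vproj u x) = vproj u (f x)" using u finite_V by (simp add: sum.delta)
  next
    fix x s t assume x: "x \<in> N" and s: "s \<in> T" and t: "t \<in> opps s"
    have xNF: "x \<in> NF" using submD(1)[OF N] x by auto
    have tT: "t \<in> T" "blk t = blk s" "sd t \<noteq> sd s" "s \<in> opps t" using t s by (auto simp: opps_def)
    have vx: "vproj (vert s) x \<in> N" using submD(5)[OF N x vert_mem[OF s]] .
    \<comment> \<open>One column of the block matrix: the vertex part of \<open>x\<close> stands at
      \<open>s\<close>, its images under the letters stand on the opposite side, and the other slots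
      on the side of \<open>s\<close> are zero. The graph equation at \<open>t\<close> for the image
      under \<open>f\<close> is then the wanted commutation with the letter
      \<open>(t, s)\<close>.\<close>
    define z where "z t' = (if t' \<in> opps s then lam t' s x else if t' = s then vproj (vert s) x else 0)" for t'
    have "bpair (blk t) z"
    proof (rule bpairI)
      fix t' assume t': "t' \<in> T" "blk t' = blk t"
      show "z t' \<in> NFv (vert t')"
        using s by (auto simp: z_def lam_mem vproj_mem NFv_closed)
      show "z t' = (\<Sum>s'\<in>opps t'. lam t' s' (z s'))"
      proof (cases "t' \<in> opps s")
        case True
        then have "(\<Sum>s'\<in>opps t'. lam t' s' (z s')) = (\<Sum>s'\<in>opps t'. if s' = s then lam t' s (vproj (vert s) x) else 0)"
          by (intro sum.cong refl) (auto simp: z_def opps_def lam_simps)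
        also have "\<dots> = lam t' s x" using True s by (simp add: sum.delta opps_sym lam_vproj[OF s xNF])
        finally show ?thesis using True by (simp add: z_def)
      next
        case False
        then have side: "sd t' = sd s" "blk t' = blk s" using t' tT by (auto simp: opps_def)
        then have "(\<Sum>s'\<in>opps t'. lam t' s' (z s')) = (\<Sum>s'\<in>opps t'. lam t' s' (lam s' s (vproj (vert s) x)))"
          by (intro sum.cong refl) (auto simp: z_def opps_def lam_vproj[OF s xNF])
        also have "\<dots> = (if t' = s then vproj (vert s) x else 0)"
          using side t' s by (intro lam_relation) (auto intro: vproj_mem)
        finally show ?thesis using False by (simp add: z_def)
      qed
    qed
    moreover have "z t' \<in> N" for t'
      using submD(6)[OF N x s] vx submD(2)[OF N] by (auto simp: z_def)
    ultimately have "f (z t) = (\<Sum>s'\<in>opps t. lam t s' (f (z s')))" using tT by (intro bp) auto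
    also have "\<dots> = (\<Sum>s'\<in>opps t. if s' = s then lam t s (f (vproj (vert s) x)) else 0)"
      using tT by (intro sum.cong refl) (auto simp: z_def opps_def plinearD[OF lin] lam_simps)
    also have "\<dots> = lam t s (f (vproj (vert s) x))" using tT by (simp add: sum.delta)
    also have "\<dots> = lam t s (f x)"
    proof -
      have "lam t s (f x) = (\<Sum>u\<in>V. lam t s (f (vproj u x)))"
        by (subst dec[OF x]) (rule lam_simps)
      also have "\<dots> = (\<Sum>u\<in>V. if u = vert s then lam t s (f (vproj (vert s) x)) else 0)"
        by (intro sum.cong refl) (auto simp: lam_other[OF vmem[OF x]])
      finally show ?thesis using finite_V vert_mem[OF s] by (simp add: sum.delta)
    qed
    finally show "f (lam t s x) = lam t s (f x)" using t by (simp add: z_def)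
  qed (simp_all add: plinearD[OF lin])
  moreover have "f (bas N a) = x0 a" if "free_lead N a" for a
  proof -
    have a: "leads N a" "\<not> forced N a" using that by (auto simp: free_lead_def)
    obtain k where "bas N a \<in> KL k" "key a < k"
      using KL_ex[of "bas N a"] by (meson KL_mono lessI less_le_trans max.cobounded1 max.cobounded2)
    then show ?thesis using fk[of "bas N a" k] psi_bas[OF a(1), of k] a(2) by (simp add: pval_def)
  qed
  ultimately show ?thesis by blast
qed

end

end


section \<open>Cosets of the defining ideal\<close>

definition wcls :: "('v, 'e) pre_digraph \<Rightarrow> ('e \<Rightarrow> nat) \<Rightarrow> (('v, 'e) wgen fmon \<Rightarrow>\<^sub>0 'k::field) \<Rightarrow> ('k, 'v, 'e) wlp" where
  "wcls E w p = wlp_ideal E w +>\<^bsub>free_algebra (wgens E w)\<^esub> p"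

lemma pscale_mem:
  "p \<in> augmentation X \<Longrightarrow> pscale c p \<in> augmentation X"
  "p \<in> carrier (free_algebra X) \<Longrightarrow> pscale c p \<in> carrier (free_algebra X)"
  using keys_pscale[of c p] by (auto simp: augmentation_def mem_free_algebra)

lemma single_0_mult: "Poly_Mapping.single 0 c * p = pscale c p"
  by (simp add: pscale_def mult_map_scale_conv_mult)

context
  fixes E :: "('v, 'e) pre_digraph" and w :: "'e \<Rightarrow> nat"
  assumes wf: "wf_digraph E"
begin

lemma wlp_ideal_subset: "p \<in> wlp_ideal E w \<Longrightarrow> p \<in> carrier (free_algebra (wgens E w))"
  using additive_subgroup.a_subset[OF ideal.axioms(1)[OF ideal_wlp[OF wf]]] by blast

lemma wlp_ideal_pscale: "p \<in> wlp_ideal E w \<Longrightarrow> pscale c p \<in> wlp_ideal E w"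
  unfolding single_0_mult[symmetric]
  by (rule wlp_ideal_mem(4)[OF wf]) (auto simp: mem_free_algebra zero_fmon_def)

lemma wlp_ideal_uminus: "p \<in> wlp_ideal E w \<Longrightarrow> - p \<in> wlp_ideal E w"
  using wlp_ideal_pscale[of p "- 1"] by simp

lemma wcls_eq_iff:
  fixes p q :: "('v, 'e) wgen fmon \<Rightarrow>\<^sub>0 'k::field"
  assumes "p \<in> carrier (free_algebra (wgens E w))" "q \<in> carrier (free_algebra (wgens E w))"
  shows "wcls E w p = wcls E w q \<longleftrightarrow> p - q \<in> wlp_ideal E w"
proof -
  let ?F = "free_algebra (wgens E w) :: (('v, 'e) wgen fmon \<Rightarrow>\<^sub>0 'k) ring"
  interpret J: ideal "wlp_ideal E w :: (('v, 'e) wgen fmon \<Rightarrow>\<^sub>0 'k) set" ?F by (rule ideal_wlp[OF wf])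
  have mem: "r \<in> wcls E w q \<longleftrightarrow> r - q \<in> wlp_ideal E w" for r :: "('v, 'e) wgen fmon \<Rightarrow>\<^sub>0 'k"
    unfolding wcls_def a_r_coset_def r_coset_def
    by (auto simp: algebra_simps intro!: bexI[of _ "r - q"])
  show ?thesis
  proof
    assume "wcls E w p = wcls E w q"
    moreover have "p \<in> wcls E w p"
      unfolding wcls_def using J.a_rcos_self[OF assms(1)] .
    ultimately show "p - q \<in> wlp_ideal E w" using mem by blast
  next
    assume "p - q \<in> wlp_ideal E w"
    then have "p \<in> wlp_ideal E w +>\<^bsub>?F\<^esub> q" using mem wcls_def by blast
    then show "wcls E w p = wcls E w q"
      unfolding wcls_def using J.a_repr_independence'[OF _ assms(2)] by metis
  qed
qed

lemma wlpa_simps: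
  shows wlpa_carrier: "carrier (wlpa E w :: ('k::field, ('k, 'v, 'e) wlp) module) = wcls E w ` augmentation (wgens E w)"
    and wlpa_one: "\<one>\<^bsub>wlpa E w :: ('k, ('k, 'v, 'e) wlp) module\<^esub> = wcls E w (\<Sum>v\<in>verts E. vtx v)"
    and wlpa_zero: "\<zero>\<^bsub>wlpa E w :: ('k, ('k, 'v, 'e) wlp) module\<^esub> = wcls E w 0"
    and wlpa_mult: "p \<in> augmentation (wgens E w) \<Longrightarrow> q \<in> augmentation (wgens E w) \<Longrightarrow>
      wcls E w p \<otimes>\<^bsub>wlpa E w :: ('k, ('k, 'v, 'e) wlp) module\<^esub> wcls E w q = wcls E w (p * q)"
    and wlpa_add: "p \<in> augmentation (wgens E w) \<Longrightarrow> q \<in> augmentation (wgens E w) \<Longrightarrow>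
      wcls E w p \<oplus>\<^bsub>wlpa E w :: ('k, ('k, 'v, 'e) wlp) module\<^esub> wcls E w q = wcls E w (p + q)"
    and wlpa_smult: "p \<in> augmentation (wgens E w) \<Longrightarrow>
      c \<odot>\<^bsub>wlpa E w :: ('k, ('k, 'v, 'e) wlp) module\<^esub> wcls E w p = wcls E w (pscale c p)"
proof -
  let ?F = "free_algebra (wgens E w) :: (('v, 'e) wgen fmon \<Rightarrow>\<^sub>0 'k) ring"
  interpret J: ideal "wlp_ideal E w :: (('v, 'e) wgen fmon \<Rightarrow>\<^sub>0 'k) set" ?F by (rule ideal_wlp[OF wf])
  note AD = augD[OF wf, of _ "wgens E w"]
  show "carrier (wlpa E w :: ('k, ('k, 'v, 'e) wlp) module) = wcls E w ` augmentation (wgens E w)"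
    "\<one>\<^bsub>wlpa E w :: ('k, ('k, 'v, 'e) wlp) module\<^esub> = wcls E w (\<Sum>v\<in>verts E. vtx v)"
    "\<zero>\<^bsub>wlpa E w :: ('k, ('k, 'v, 'e) wlp) module\<^esub> = wcls E w 0"
    using J.a_rcos_const[OF additive_subgroup.zero_closed[OF J.is_additive_subgroup]]
    by (simp_all add: wlpa_def Let_def FactRing_def wcls_def fun_eq_iff)
  show "p \<in> augmentation (wgens E w) \<Longrightarrow> q \<in> augmentation (wgens E w) \<Longrightarrow>
      wcls E w p \<otimes>\<^bsub>wlpa E w :: ('k, ('k, 'v, 'e) wlp) module\<^esub> wcls E w q = wcls E w (p * q)"
    "p \<in> augmentation (wgens E w) \<Longrightarrow> q \<in> augmentation (wgens E w) \<Longrightarrow>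
      wcls E w p \<oplus>\<^bsub>wlpa E w :: ('k, ('k, 'v, 'e) wlp) module\<^esub> wcls E w q = wcls E w (p + q)"
    using J.rcoset_mult_add[OF AD AD, of p q] J.a_rcos_sum[OF AD AD, of p q]
    by (simp_all add: wlpa_def Let_def FactRing_def wcls_def)
  have c: "Poly_Mapping.single 0 c \<in> carrier ?F" by (auto simp: mem_free_algebra zero_fmon_def)
  show "p \<in> augmentation (wgens E w) \<Longrightarrow>
      c \<odot>\<^bsub>wlpa E w :: ('k, ('k, 'v, 'e) wlp) module\<^esub> wcls E w p = wcls E w (pscale c p)"
    using J.rcoset_mult_add[OF c AD, of p]
    by (simp add: wlpa_def Let_def FactRing_def wcls_def single_0_mult)
qed

text \<open>As \<open>Y\<close> and \<open>Z\<close> are stable under the generators, the elements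
  that map \<open>Y\<close> into \<open>Z\<close> form a two-sided ideal, so it suffices to test the
  relators. It is used with \<open>Z\<close> zero and with \<open>Z\<close> another defining
  ideal.\<close>

lemma wlp_ideal_act:
  fixes \<tau> :: "('v, 'e) wgen \<Rightarrow> ('a \<Rightarrow>\<^sub>0 'k::field) \<Rightarrow> ('a \<Rightarrow>\<^sub>0 'k)"
  assumes lin: "\<And>g. plinear (\<tau> g)"
    and Y: "0 \<in> Y" "\<And>x y. x \<in> Y \<Longrightarrow> y \<in> Y \<Longrightarrow> x + y \<in> Y" "\<And>c x. x \<in> Y \<Longrightarrow> pscale c x \<in> Y"
      "\<And>g x. g \<in> wgens E w \<Longrightarrow> x \<in> Y \<Longrightarrow> \<tau> g x \<in> Y"
    and Z: "0 \<in> Z" "\<And>x y. x \<in> Z \<Longrightarrow> y \<in> Z \<Longrightarrow> x + y \<in> Z" "\<And>c x. x \<in> Z \<Longrightarrow> pscale c x \<in> Z"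
      "\<And>g x. g \<in> wgens E w \<Longrightarrow> x \<in> Z \<Longrightarrow> \<tau> g x \<in> Z"
    and rel: "\<And>r y. r \<in> wlp_relators E w \<Longrightarrow> y \<in> Y \<Longrightarrow> act \<tau> r y \<in> Z"
    and p: "p \<in> wlp_ideal E w" and y: "y \<in> Y"
  shows "act \<tau> p y \<in> Z"
proof -
  let ?F = "free_algebra (wgens E w) :: (('v, 'e) wgen fmon \<Rightarrow>\<^sub>0 'k) ring"
  let ?I = "{p \<in> carrier ?F. \<forall>y\<in>Y. act \<tau> p y \<in> Z}"
  interpret F: ring ?F by (rule ring_free_algebra)
  have inv: "\<ominus>\<^bsub>?F\<^esub> p = - p" if "p \<in> carrier ?F" for p
    using free_algebra_closed(3)[OF that that] that by (intro F.minus_equality) simp_all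
  have neg: "- x \<in> Z" if "x \<in> Z" for x using Z(3)[OF that, of "- 1"] by simp
  have "ideal ?I ?F"
  proof (rule idealI)
    show "ring ?F" by (rule ring_free_algebra)
    show "subgroup ?I (add_monoid ?F)"
    proof
      fix x assume x: "x \<in> ?I"
      then have "\<ominus>\<^bsub>?F\<^esub> x = - x" by (intro inv) simp
      then show "inv\<^bsub>add_monoid ?F\<^esub> x \<in> ?I"
        unfolding a_inv_def[symmetric]
        using x free_algebra_closed(3)[of x _ x] neg by (auto simp: act_left_simps)
    qed (auto simp: free_algebra_closed free_algebra_0_1 act_left_simps Z)
    fix a x assume a: "a \<in> ?I" and x: "x \<in> carrier ?F"
    have "act \<tau> x (act \<tau> a y) \<in> Z" "act \<tau> a (act \<tau> x y) \<in> Z" if "y \<in> Y" for y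
      using a x that by (auto intro: act_closed[where G = "wgens E w" and Y = Z, OF Z]
          act_closed[where G = "wgens E w" and Y = Y, OF Y])
    then show "x \<otimes>\<^bsub>?F\<^esub> a \<in> ?I" "a \<otimes>\<^bsub>?F\<^esub> x \<in> ?I"
      using a x by (auto simp: free_algebra_closed act_mult[OF lin])
  qed
  moreover have "wlp_relators E w \<subseteq> ?I"
    using rel relators_mem[OF wf, of w] by (auto simp: augmentation_def)
  ultimately have "wlp_ideal E w \<subseteq> ?I"
    unfolding wlp_ideal_def by (rule F.genideal_minimal)
  then show ?thesis using p y by blast
qed

end


section \<open>The model of a vertex weighted graph\<close>

text \<open>\<open>Inl (v, i)\<close> belongs to the component at \<open>v\<close>, and
  \<open>Inr e\<close> to the component at the head of \<open>e\<close>. The letter from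
  \<open>Inr e\<close> to \<open>Inl (tail E e, i)\<close> is the edge generator with index
  \<open>i\<close>, and the reverse letter is its ghost.\<close>

definition wslots :: "('v, 'e) pre_digraph \<Rightarrow> ('e \<Rightarrow> nat) \<Rightarrow> (('v \<times> nat) + 'e) set" where
  "wslots E w = {Inl (v, i) | v i. v \<in> regular_verts E \<and> 1 \<le> i \<and> i \<le> vertex_weight E w v} \<union> Inr ` arcs E"

definition wblk :: "('v, 'e) pre_digraph \<Rightarrow> ('v \<times> nat) + 'e \<Rightarrow> 'v" where
  "wblk E = case_sum fst (tail E)"

definition wvert :: "('v, 'e) pre_digraph \<Rightarrow> ('v \<times> nat) + 'e \<Rightarrow> 'v" where
  "wvert E = case_sum fst (head E)"

text \<open>An arbitrary slot of each side would do. Index \<open>1\<close> is available because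
  weights are positive, and an outgoing edge because the vertex is regular.\<close>

definition wsp :: "('v, 'e) pre_digraph \<Rightarrow> 'v \<Rightarrow> bool \<Rightarrow> ('v \<times> nat) + 'e" where
  "wsp E v b = (if b then Inl (v, 1) else Inr (SOME e. e \<in> out_arcs E v))"

locale finite_vwg =
  fixes E :: "('v, 'e) pre_digraph" and w :: "'e \<Rightarrow> nat"
  assumes fin: "fin_digraph E" and vw: "vertex_weighted_graph E w"
begin

sublocale fin_digraph E by (rule fin)

lemma wf: "wf_digraph E" ..

lemma out_arcs_finite [simp]: "finite (out_arcs E v)"
  by (rule finite_subset[OF _ finite_arcs]) (auto simp: out_arcs_def)

lemma regular_iff: "v \<in> regular_verts E \<longleftrightarrow> v \<in> verts E \<and> out_arcs E v \<noteq> {}"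
  by (auto simp: regular_verts_def)

lemma regular_tail: "e \<in> arcs E \<Longrightarrow> tail E e \<in> regular_verts E"
  unfolding regular_iff by (auto simp: out_arcs_def)

lemma vertex_weight_eq:
  assumes "e \<in> out_arcs E v"
  shows "vertex_weight E w v = w e"
proof -
  have v: "v \<in> regular_verts E" using assms regular_tail[of e] by (auto simp: out_arcs_def)
  have "w e' = w e" if "e' \<in> out_arcs E v" for e'
    using vertex_weighted_graph.weight_const[OF vw v that assms] .
  then have "w ` out_arcs E v = {w e}" using assms by blast
  then show ?thesis by (simp add: vertex_weight_def)
qed

lemma weight_pos: "e \<in> arcs E \<Longrightarrow> 1 \<le> w e"
  using vw weighted_graph.weight_pos[of E w e] by (simp add: vertex_weighted_graph_def)

lemma vertex_weight_pos:
  assumes "v \<in> regular_verts E"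
  shows "1 \<le> vertex_weight E w v"
proof -
  obtain e where e: "e \<in> out_arcs E v" using assms unfolding regular_iff by blast
  then have "e \<in> arcs E" by simp
  then show ?thesis using weight_pos vertex_weight_eq[OF e] by simp
qed

lemma Inl_slot: "Inl (v, i) \<in> wslots E w \<longleftrightarrow> v \<in> regular_verts E \<and> 1 \<le> i \<and> i \<le> vertex_weight E w v"
  by (auto simp: wslots_def)

lemma Inr_slot [simp]: "Inr e \<in> wslots E w \<longleftrightarrow> e \<in> arcs E"
  by (auto simp: wslots_def)

text \<open>Here the constancy of the weight enters: the indices at a vertex are exactly those of
  each edge leaving it, so the block is a full matrix of letters.\<close>

lemma edge_slot:
  assumes "e \<in> arcs E"
  shows "Inl (tail E e, i) \<in> wslots E w \<longleftrightarrow> 1 \<le> i \<and> i \<le> w e"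
  using vertex_weight_eq[of e "tail E e"] regular_tail[OF assms] assms by (simp add: Inl_slot)

sublocale slots "wslots E w" "verts E" "wblk E" isl "wvert E" "wsp E"
proof
  have "wslots E w \<subseteq> Inl ` (Sigma (verts E) (\<lambda>v. {..vertex_weight E w v})) \<union> Inr ` arcs E"
    by (auto simp: wslots_def regular_iff)
  then show "finite (wslots E w)" by (rule finite_subset) auto
  fix t c assume t: "t \<in> wslots E w"
  show "wvert E t \<in> verts E" using t by (auto simp: wslots_def wvert_def regular_iff)
  have reg: "wblk E t \<in> regular_verts E" using t by (auto simp: wslots_def wblk_def regular_tail)
  then have "\<exists>e. e \<in> out_arcs E (wblk E t)" by (auto simp: regular_iff)
  then have e: "(SOME e. e \<in> out_arcs E (wblk E t)) \<in> out_arcs E (wblk E t)" by (rule someI_ex)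
  show "wsp E (wblk E t) c \<in> wslots E w"
    using e reg vertex_weight_pos[OF reg] by (auto simp: wsp_def Inl_slot)
  show "wblk E (wsp E (wblk E t) c) = wblk E t"
    using e by (cases c) (simp_all add: wsp_def wblk_def)
  show "isl (wsp E (wblk E t) c) = c" by (simp add: wsp_def)
qed simp_all

lemma wvert_simps [simp]: "wvert E (Inl (v, i)) = v" "wvert E (Inr e) = head E e"
  "wblk E (Inl (v, i)) = v" "wblk E (Inr e) = tail E e"
  by (simp_all add: wvert_def wblk_def)

lemma mem_opps: "s \<in> opps t \<longleftrightarrow> s \<in> wslots E w \<and> wblk E s = wblk E t \<and> isl s \<noteq> isl t"
  by (simp only: opps_def mem_Collect_eq)

lemma opps_Inl:
  assumes "v \<in> regular_verts E"
  shows "opps (Inl (v, i)) = Inr ` out_arcs E v"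
proof (rule Set.set_eqI)
  fix s show "s \<in> opps (Inl (v, i)) \<longleftrightarrow> s \<in> Inr ` out_arcs E v"
    by (cases s) (simp_all add: mem_opps image_iff)
qed

lemma opps_Inr:
  assumes "e \<in> arcs E"
  shows "opps (Inr e) = (\<lambda>i. Inl (tail E e, i)) ` {1..w e}"
proof (rule Set.set_eqI)
  fix s show "s \<in> opps (Inr e) \<longleftrightarrow> s \<in> (\<lambda>i. Inl (tail E e, i)) ` {1..w e}"
  proof (cases s)
    case (Inl a)
    obtain v i where "a = (v, i)" by (cases a)
    then show ?thesis using Inl edge_slot[OF assms, of i] by (cases "v = tail E e") (simp_all add: mem_opps image_iff)
  qed (simp add: mem_opps image_iff)
qed

type_synonym ('v1, 'e1) word = "(('v1 \<times> nat) + 'e1, 'v1) nword"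

fun tau :: "('v, 'e) wgen \<Rightarrow> (('v, 'e) word \<Rightarrow>\<^sub>0 'k::field) \<Rightarrow> (('v, 'e) word \<Rightarrow>\<^sub>0 'k)" where
  "tau (Vtx u) = vproj u"
| "tau (Edge e i) = lam (Inl (tail E e, i)) (Inr e)"
| "tau (Ghost e i) = lam (Inr e) (Inl (tail E e, i))"

lemma plinear_tau: "plinear (tau g)"
  by (cases g) (auto simp: plinear_vproj plinear_lam)

lemmas tau_simps = plinearD[OF plinear_tau]

lemma wgens_simps [simp]:
  "Vtx v \<in> wgens E w \<longleftrightarrow> v \<in> verts E"
  "Edge e i \<in> wgens E w \<longleftrightarrow> e \<in> arcs E \<and> 1 \<le> i \<and> i \<le> w e"
  "Ghost e i \<in> wgens E w \<longleftrightarrow> e \<in> arcs E \<and> 1 \<le> i \<and> i \<le> w e"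
  by (auto simp: wgens_def)

lemma edge_opps:
  assumes "e \<in> arcs E" "1 \<le> i" "i \<le> w e"
  shows "Inl (tail E e, i) \<in> opps (Inr e)" "Inr e \<in> opps (Inl (tail E e, i))"
    "Inl (tail E e, i) \<in> wslots E w"
  using assms edge_slot[of e i] by (simp_all add: mem_opps)

lemma tau_mem:
  assumes "g \<in> wgens E w" "x \<in> NF"
  shows "tau g x \<in> NF"
proof (cases g)
  case (Edge e i)
  then show ?thesis using NFv_subset[OF lam_mem[of "Inr e" "Inl (tail E e, i)" x]] assms(1) edge_opps[of e i] by simp
next
  case (Ghost e i)
  then show ?thesis using NFv_subset[OF lam_mem[of "Inl (tail E e, i)" "Inr e" x]] assms(1) edge_opps[of e i] by simp
qed (simp add: NFv_subset[OF vproj_mem])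

lemma letter_cases:
  assumes "s \<in> wslots E w" "t \<in> opps s"
  obtains e i where "e \<in> arcs E" "1 \<le> i" "i \<le> w e" "t = Inl (tail E e, i)" "s = Inr e"
    | e i where "e \<in> arcs E" "1 \<le> i" "i \<le> w e" "t = Inr e" "s = Inl (tail E e, i)"
proof (cases s)
  case (Inl a)
  then obtain v i where s: "s = Inl (v, i)" by (cases a) auto
  then have "v \<in> regular_verts E" using assms(1) by (simp add: Inl_slot)
  then obtain e where "t = Inr e" "e \<in> out_arcs E v" using assms(2) s by (auto simp: opps_Inl)
  then show ?thesis using that(2)[of e i] s assms(1) edge_slot[of e i] by (auto simp: out_arcs_def)
next
  case (Inr e)
  then show ?thesis using assms that(1)[of e] by (auto simp: opps_Inr)
qed

lemma nfhom_iff_tau: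
  "nfhom f N \<longleftrightarrow> (\<forall>x\<in>N. f x \<in> NF) \<and> (\<forall>x\<in>N. \<forall>y\<in>N. f (x + y) = f x + f y) \<and>
     (\<forall>x\<in>N. \<forall>c. f (pscale c x) = pscale c (f x)) \<and>
     (\<forall>x\<in>N. \<forall>g\<in>wgens E w. f (tau g x) = tau g (f x))"
proof -
  have "(\<forall>x\<in>N. \<forall>u\<in>verts E. f (vproj u x) = vproj u (f x)) \<and>
     (\<forall>x\<in>N. \<forall>s\<in>wslots E w. \<forall>t\<in>opps s. f (lam t s x) = lam t s (f x)) \<longleftrightarrow>
     (\<forall>x\<in>N. \<forall>g\<in>wgens E w. f (tau g x) = tau g (f x))" (is "?L \<longleftrightarrow> ?R")
  proof
    assume L: ?L
    show ?R
    proof (intro ballI)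
      fix x g assume "x \<in> N" "g \<in> wgens E w"
      then show "f (tau g x) = tau g (f x)" using L edge_opps
        by (cases g) (simp_all add: Ball_def)
    qed
  next
    assume R: ?R
    show ?L
    proof (intro conjI ballI)
      fix x u assume "x \<in> N" "u \<in> verts E"
      then show "f (vproj u x) = vproj u (f x)" using R[rule_format, of x "Vtx u"] by simp
    next
      fix x s t assume x: "x \<in> N" and s: "s \<in> wslots E w" "t \<in> opps s"
      show "f (lam t s x) = lam t s (f x)"
        using s
      proof (cases rule: letter_cases)
        case (1 e i)
        then show ?thesis using R[rule_format, OF x, of "Edge e i"] by simp
      next
        case (2 e i)
        then show ?thesis using R[rule_format, OF x, of "Ghost e i"] by simp
      qed
    qed
  qed
  then show ?thesis unfolding nfhom_def by blast
qed

lemma act_vtx [simp]: "act tau (vtx v) x = vproj v x"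
  by (simp add: vtx_def)

lemma act_edge: "i \<le> w e \<Longrightarrow> act tau (edge w e i) x = lam (Inl (tail E e, i)) (Inr e) x"
  and act_ghost: "i \<le> w e \<Longrightarrow> act tau (ghost w e i) x = lam (Inr e) (Inl (tail E e, i)) x"
  by (simp_all add: edge_def ghost_def)

text \<open>The two families of matrix relations are \<open>lam_relation\<close> for the two sides
  of the block at \<open>v\<close>; the other relators concern vertex components only.\<close>

lemma act_relator:
  assumes "r \<in> wlp_relators E w" "x \<in> NF"
  shows "act tau r x = 0"
  using assms(1)
proof cases
  case (vtx_vtx u v)
  then show ?thesis by (simp add: act_left_simps act_mult[OF plinear_tau] vproj_vproj)
next
  case (tail_edge e i)
  note o = edge_opps[OF tail_edge(2-4)]
  show ?thesis unfolding tail_edge(1)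
    using tail_edge(2-4) vproj_id[OF lam_mem[of "Inr e" "Inl (tail E e, i)" x]] o
    by (simp add: act_left_simps act_mult[OF plinear_tau] act_edge)
next
  case (edge_head e i)
  show ?thesis unfolding edge_head(1)
    using edge_head(2-4) lam_vproj[of "Inr e" x "Inl (tail E e, i)"] assms(2)
    by (simp add: act_left_simps act_mult[OF plinear_tau] act_edge)
next
  case (head_ghost e i)
  note o = edge_opps[OF head_ghost(2-4)]
  show ?thesis unfolding head_ghost(1)
    using head_ghost(2-4) vproj_id[OF lam_mem[of "Inl (tail E e, i)" "Inr e" x]] o
    by (simp add: act_left_simps act_mult[OF plinear_tau] act_ghost)
next
  case (ghost_tail e i)
  note o = edge_opps[OF ghost_tail(2-4)]
  show ?thesis unfolding ghost_tail(1)
    using ghost_tail(2-4) lam_vproj[of "Inl (tail E e, i)" x "Inr e"] assms(2) o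
    by (simp add: act_left_simps act_mult[OF plinear_tau] act_ghost)
next
  case (edge_ghost v i j)
  let ?s = "\<lambda>i. Inl (v, i) :: ('v \<times> nat) + 'e"
  have T: "?s i \<in> wslots E w" "?s j \<in> wslots E w" using edge_ghost by (simp_all add: Inl_slot)
  \<comment> \<open>The projection to \<open>v\<close> is inserted because
    \<open>lam_relation\<close> expects an argument in one vertex component.\<close>
  have "act tau (\<Sum>e\<in>out_arcs E v. edge w e i * ghost w e j) x =
      (\<Sum>e\<in>out_arcs E v. lam (?s i) (Inr e) (lam (Inr e) (?s j) (vproj v x)))"
  proof (unfold act_left_simps, intro sum.cong refl)
    fix e assume e: "e \<in> out_arcs E v"
    then have "i \<le> w e" "j \<le> w e" "tail E e = v" using edge_ghost vertex_weight_eq[of e v] by auto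
    then show "act tau (edge w e i * ghost w e j) x = lam (?s i) (Inr e) (lam (Inr e) (?s j) (vproj v x))"
      using lam_vproj[OF T(2) assms(2)] by (simp add: act_mult[OF plinear_tau] act_edge act_ghost)
  qed
  also have "\<dots> = (\<Sum>s\<in>opps (?s i). lam (?s i) s (lam s (?s j) (vproj v x)))"
    using edge_ghost by (simp add: opps_Inl sum.reindex)
  also have "\<dots> = (if i = j then vproj v x else 0)"
    using lam_relation[OF T, of "vproj v x"] vproj_mem[of v x] by simp
  finally show ?thesis unfolding edge_ghost(1) by (simp add: act_left_simps)
next
  case (ghost_edge v e f)
  have arcs: "e \<in> arcs E" "f \<in> arcs E" "tail E e = v" "tail E f = v" using ghost_edge by auto
  have wt: "w e = vertex_weight E w v" "w f = vertex_weight E w v"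
    using vertex_weight_eq[OF ghost_edge(3)] vertex_weight_eq[OF ghost_edge(4)] by simp_all
  have "act tau (\<Sum>i=1..vertex_weight E w v. ghost w e i * edge w f i) x =
      (\<Sum>i=1..w e. lam (Inr e) (Inl (v, i)) (lam (Inl (v, i)) (Inr f) (vproj (head E f) x)))"
  proof (unfold act_left_simps wt(1), intro sum.cong refl)
    fix i assume i: "i \<in> {1..vertex_weight E w v}"
    show "act tau (ghost w e i * edge w f i) x =
        lam (Inr e) (Inl (v, i)) (lam (Inl (v, i)) (Inr f) (vproj (head E f) x))"
      using lam_vproj[of "Inr f" x "Inl (v, i)"] assms(2) arcs i wt
      by (simp add: act_mult[OF plinear_tau] act_edge act_ghost)
  qed
  also have "\<dots> = (\<Sum>s\<in>opps (Inr e). lam (Inr e) s (lam s (Inr f) (vproj (head E f) x)))"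
    using arcs by (simp add: opps_Inr sum.reindex inj_on_def)
  also have "\<dots> = (if e = f then vproj (head E f) x else 0)"
    using arcs vproj_mem[of "head E f" x] by (subst lam_relation) auto
  finally show ?thesis unfolding ghost_edge(1) by (simp add: act_left_simps)
qed

lemma act_ideal:
  assumes "p \<in> wlp_ideal E w" "x \<in> NF"
  shows "act tau p x = 0"
proof -
  have "act tau p x \<in> {0}"
    by (rule wlp_ideal_act[OF wf plinear_tau NF_closed(1-3) tau_mem])
      (use assms act_relator in \<open>auto simp: tau_simps\<close>)
  then show ?thesis by simp
qed

lemma act_mem: "p \<in> carrier (free_algebra (wgens E w)) \<Longrightarrow> x \<in> NF \<Longrightarrow> act tau p x \<in> NF"
  by (rule act_closed[OF NF_closed(1-3) tau_mem])

lemma act_nfhom: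
  assumes f: "nfhom f NF" and "p \<in> carrier (free_algebra (wgens E w))" "x \<in> NF"
  shows "f (act tau p x) = act tau p (f x)"
  using f[unfolded nfhom_iff_tau] assms(2,3)
  by (intro act_commute[where G = "wgens E w" and Y = NF]) (auto intro: NF_closed tau_mem)

end


section \<open>Congruence modulo the defining ideal\<close>

text \<open>Membership in the free algebra on the generators is part of the relation, so congruences
  can be chained and multiplied without side conditions.\<close>

definition weq :: "('v, 'e) pre_digraph \<Rightarrow> ('e \<Rightarrow> nat) \<Rightarrow> (('v, 'e) wgen fmon \<Rightarrow>\<^sub>0 'k::field) \<Rightarrow>
    (('v, 'e) wgen fmon \<Rightarrow>\<^sub>0 'k) \<Rightarrow> bool" where
  "weq E w p q \<longleftrightarrow> p \<in> carrier (free_algebra (wgens E w)) \<and> q \<in> carrier (free_algebra (wgens E w)) \<and>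
     p - q \<in> wlp_ideal E w"

lemma carrier_sum: "(\<And>i. i \<in> I \<Longrightarrow> f i \<in> carrier (free_algebra X)) \<Longrightarrow> sum f I \<in> carrier (free_algebra X)"
  by (induction I rule: infinite_finite_induct) (auto intro: free_algebra_closed free_algebra_0_1)

lemma augmentation_subset: "p \<in> augmentation X \<Longrightarrow> p \<in> carrier (free_algebra X)"
  by (simp add: augmentation_def)

context
  fixes E :: "('v, 'e) pre_digraph" and w :: "'e \<Rightarrow> nat"
  assumes wf: "wf_digraph E"
begin

lemma weq_carrier: "weq E w p q \<Longrightarrow> p \<in> carrier (free_algebra (wgens E w))"
  "weq E w p q \<Longrightarrow> q \<in> carrier (free_algebra (wgens E w))"
  by (auto simp: weq_def)

lemma weq_refl: "p \<in> carrier (free_algebra (wgens E w)) \<Longrightarrow> weq E w p p"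
  by (simp add: weq_def wlp_ideal_mem(5)[OF wf])

lemma weq_sym: "weq E w p q \<Longrightarrow> weq E w q p"
  using wlp_ideal_uminus[OF wf, of "p - q" w] by (simp add: weq_def)

lemma weq_trans [trans]: "weq E w p q \<Longrightarrow> weq E w q r \<Longrightarrow> weq E w p r"
  using wlp_ideal_mem(2)[OF wf, of "p - q" w "q - r"] by (simp add: weq_def)

lemma weq_add: "weq E w p q \<Longrightarrow> weq E w p' q' \<Longrightarrow> weq E w (p + p') (q + q')"
  using wlp_ideal_mem(2)[OF wf, of "p - q" w "p' - q'"]
  by (simp add: weq_def free_algebra_closed algebra_simps)

lemma weq_pscale: "weq E w p q \<Longrightarrow> weq E w (pscale c p) (pscale c q)"
  using wlp_ideal_pscale[OF wf, of "p - q" w c] by (simp add: weq_def pscale_mem pscale_diff)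

lemma weq_mult:
  assumes "weq E w p q" "weq E w p' q'"
  shows "weq E w (p * p') (q * q')"
proof -
  have "(p - q) * p' + q * (p' - q') \<in> wlp_ideal E w"
    using assms by (intro wlp_ideal_mem(2)[OF wf wlp_ideal_mem(3)[OF wf] wlp_ideal_mem(4)[OF wf]])
      (auto simp: weq_def)
  then show ?thesis using assms by (simp add: weq_def free_algebra_closed algebra_simps)
qed

lemma weq_sum: "(\<And>i. i \<in> I \<Longrightarrow> weq E w (f i) (g i)) \<Longrightarrow> weq E w (sum f I) (sum g I)"
  by (induction I rule: infinite_finite_induct) (auto intro: weq_add weq_refl free_algebra_0_1)

lemma weq_0_iff: "weq E w p 0 \<longleftrightarrow> p \<in> wlp_ideal E w"
  using wlp_ideal_subset[OF wf] by (auto simp: weq_def free_algebra_0_1)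

lemma weq_wcls: "weq E w p q \<Longrightarrow> wcls E w p = wcls E w q"
  using wcls_eq_iff[OF wf, of p w q] by (simp add: weq_def)

lemma wcls_weq: "wcls E w p = wcls E w q \<Longrightarrow> p \<in> carrier (free_algebra (wgens E w)) \<Longrightarrow>
   q \<in> carrier (free_algebra (wgens E w)) \<Longrightarrow> weq E w p q"
  using wcls_eq_iff[OF wf, of p w q] by (simp add: weq_def)

lemma weq_relator:
  assumes "p - q \<in> wlp_relators E w" "q \<in> carrier (free_algebra (wgens E w))"
  shows "weq E w p q"
proof -
  have "p - q \<in> wlp_ideal E w" using wlp_ideal_mem(1)[OF wf assms(1)] .
  moreover from this have "p - q + q \<in> carrier (free_algebra (wgens E w))"
    by (intro free_algebra_closed assms(2) wlp_ideal_subset[OF wf])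
  ultimately show ?thesis using assms(2) by (simp add: weq_def)
qed

lemma vtx_carrier: "v \<in> verts E \<Longrightarrow> vtx v \<in> carrier (free_algebra (wgens E w))"
  by (rule augmentation_subset[OF vtx_mem[OF wf]])

lemma gen_carrier: "g \<in> X \<Longrightarrow> gen g \<in> carrier (free_algebra X)"
  by (rule augmentation_subset[OF gen_mem])

lemma weq_vtx:
  assumes "u \<in> verts E" "v \<in> verts E"
  shows "weq E w (vtx u * vtx v) (if u = v then vtx u else 0)"
  by (rule weq_relator[OF wlp_relators.vtx_vtx[OF assms]])
    (auto simp: assms vtx_carrier free_algebra_0_1)

lemma weq_one:
  assumes "finite (verts E)" "p \<in> augmentation (wgens E w)"
  shows "weq E w ((\<Sum>v\<in>verts E. vtx v) * p) p" "weq E w (p * (\<Sum>v\<in>verts E. vtx v)) p"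
  using one_rep_id[OF wf assms] augmentation_subset[OF assms(2)]
    free_algebra_closed(2)[OF augmentation_subset[OF one_rep_mem[OF wf]] augmentation_subset[OF assms(2)]]
    free_algebra_closed(2)[OF augmentation_subset[OF assms(2)] augmentation_subset[OF one_rep_mem[OF wf]]]
  by (simp_all add: weq_def)

lemma weq_ends:
  assumes "e \<in> arcs E" "1 \<le> i" "i \<le> w e"
  shows "weq E w (vtx (tail E e) * gen (Edge e i)) (gen (Edge e i))"
    "weq E w (gen (Edge e i) * vtx (head E e)) (gen (Edge e i))"
    "weq E w (vtx (head E e) * gen (Ghost e i)) (gen (Ghost e i))"
    "weq E w (gen (Ghost e i) * vtx (tail E e)) (gen (Ghost e i))"
proof -
  have g: "Edge e i \<in> wgens E w" "Ghost e i \<in> wgens E w" using assms by (auto simp: wgens_def)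
  have eg: "edge w e i = gen (Edge e i)" "ghost w e i = gen (Ghost e i)"
    using assms by (auto simp: edge_def ghost_def)
  show "weq E w (vtx (tail E e) * gen (Edge e i)) (gen (Edge e i))"
    "weq E w (gen (Edge e i) * vtx (head E e)) (gen (Edge e i))"
    "weq E w (vtx (head E e) * gen (Ghost e i)) (gen (Ghost e i))"
    "weq E w (gen (Ghost e i) * vtx (tail E e)) (gen (Ghost e i))"
    using weq_relator[OF wlp_relators.tail_edge[of e E i w, OF assms]] weq_relator[OF wlp_relators.edge_head[of e E i w, OF assms]]
      weq_relator[OF wlp_relators.head_ghost[of e E i w, OF assms]] weq_relator[OF wlp_relators.ghost_tail[of e E i w, OF assms]]
      gen_carrier[OF g(1)] gen_carrier[OF g(2)] by (simp_all add: eg)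
qed

lemma wlpa_mult_weq:
  assumes "p \<in> augmentation (wgens E w)" "q \<in> augmentation (wgens E w)" "weq E w r (p * q)"
  shows "wcls E w p \<otimes>\<^bsub>wlpa E w :: ('k::field, ('k, 'v, 'e) wlp) module\<^esub> wcls E w q = wcls E w r"
  using wlpa_mult[OF wf assms(1,2)] weq_wcls[OF assms(3)] by simp

end


section \<open>The model as a free module\<close>

fun glt :: "('v \<times> nat) + 'e \<Rightarrow> ('v \<times> nat) + 'e \<Rightarrow> ('v, 'e) wgen" where
  "glt (Inl a) (Inr e) = Edge e (snd a)"
| "glt (Inr e) (Inl a) = Ghost e (snd a)"
| "glt (Inl a) (Inl b) = Vtx (fst a)"
| "glt (Inr e) (Inr f) = Edge e 0"

context finite_vwg begin

declare weq_trans[OF wf, trans]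

lemma glt_props:
  assumes "s \<in> wslots E w" "t \<in> opps s"
  shows "glt t s \<in> wgens E w" "tau (glt t s) = lam t s"
    "weq E w (vtx (wvert E t) * gen (glt t s)) (gen (glt t s))"
    "weq E w (gen (glt t s) * vtx (wvert E s)) (gen (glt t s))"
  using assms by (cases rule: letter_cases; simp add: weq_ends[OF wf])+

lemma glt_relation:
  assumes t: "t \<in> wslots E w" "t' \<in> wslots E w" "wblk E t' = wblk E t" "isl t' = isl t"
  shows "weq E w (\<Sum>s\<in>opps t. gen (glt t s) * gen (glt s t'))
    (if t = t' then vtx (wvert E t) else 0 :: ('v, 'e) wgen fmon \<Rightarrow>\<^sub>0 'k::field)"
proof (cases t)
  case (Inl a)
  then obtain v i where ti: "t = Inl (v, i)" by (cases a) auto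
  then obtain j where tj: "t' = Inl (v, j)" using t by (cases t') (auto simp: wblk_def)
  have v: "v \<in> regular_verts E" and i: "1 \<le> i" "i \<le> vertex_weight E w v" "1 \<le> j" "j \<le> vertex_weight E w v"
    using t ti tj by (auto simp: Inl_slot)
  have wt: "e \<in> out_arcs E v \<Longrightarrow> i \<le> w e \<and> j \<le> w e" for e using vertex_weight_eq[of e v] i by simp
  have "(\<Sum>s\<in>opps t. gen (glt t s) * gen (glt s t')) = (\<Sum>e\<in>out_arcs E v. edge w e i * ghost w e j :: ('v, 'e) wgen fmon \<Rightarrow>\<^sub>0 'k)"
    using wt by (simp add: ti tj opps_Inl[OF v] sum.reindex edge_def ghost_def)
  moreover have "weq E w (\<Sum>e\<in>out_arcs E v. edge w e i * ghost w e j) (if i = j then vtx v else 0 :: ('v, 'e) wgen fmon \<Rightarrow>\<^sub>0 'k)"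
    using v by (intro weq_relator[OF wf wlp_relators.edge_ghost[OF v i]])
      (auto simp: regular_iff intro: vtx_carrier[OF wf] free_algebra_0_1)
  ultimately show ?thesis using ti tj by (cases "i = j") simp_all
next
  case (Inr e)
  then obtain f where f: "t' = Inr f" using t by (cases t') auto
  have arcs: "e \<in> out_arcs E (tail E e)" "f \<in> out_arcs E (tail E e)" "e \<in> arcs E" using t Inr f by auto
  have v: "tail E e \<in> regular_verts E" using regular_tail arcs by simp
  have wt: "w e = vertex_weight E w (tail E e)" "w f = vertex_weight E w (tail E e)"
    using vertex_weight_eq[OF arcs(1)] vertex_weight_eq[OF arcs(2)] by simp_all
  have "(\<Sum>s\<in>opps t. gen (glt t s) * gen (glt s t')) =
      (\<Sum>i=1..vertex_weight E w (tail E e). ghost w e i * edge w f i :: ('v, 'e) wgen fmon \<Rightarrow>\<^sub>0 'k)"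
    using wt by (simp add: Inr f opps_Inr[OF arcs(3)] sum.reindex inj_on_def edge_def ghost_def)
  moreover have "weq E w (\<Sum>i=1..vertex_weight E w (tail E e). ghost w e i * edge w f i)
      (if e = f then vtx (head E e) else 0 :: ('v, 'e) wgen fmon \<Rightarrow>\<^sub>0 'k)"
    using arcs(3) by (intro weq_relator[OF wf wlp_relators.ghost_edge[OF v arcs(1,2)]])
      (auto intro: vtx_carrier[OF wf] free_algebra_0_1)
  ultimately show ?thesis using Inr f by (cases "e = f") simp_all
qed

text \<open>Reads a word as a product of generators ending in a vertex; words over the other copies
  evaluate to zero.\<close>

definition evw :: "nat \<Rightarrow> ('v, 'e) word \<Rightarrow> (('v, 'e) wgen fmon \<Rightarrow>\<^sub>0 'k::field)" where
  "evw k = wev (\<lambda>t s p. gen (glt t s) * p) (\<lambda>g. if snd g = k then vtx (fst g) else 0)"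

text \<open>The coordinates of an element of the model with respect to its free generators.\<close>

definition evp :: "nat \<Rightarrow> (('v, 'e) word \<Rightarrow>\<^sub>0 'k::field) \<Rightarrow> (('v, 'e) wgen fmon \<Rightarrow>\<^sub>0 'k)" where
  "evp k = pext (evw k)"

lemma plinear_evp: "plinear (evp k)"
  unfolding evp_def by (rule plinear_pext)

lemma evw_simps [simp]:
  "evw k ([], g) = (if snd g = k then vtx (fst g) else 0)"
  "evw k (cn t s a) = gen (glt t s) * evw k a"
  by (simp_all add: evw_def)

lemma evp_single [simp]: "evp k (Poly_Mapping.single a 1) = evw k a"
  by (simp add: evp_def)

definition aug_at :: "'v \<Rightarrow> (('v, 'e) wgen fmon \<Rightarrow>\<^sub>0 'k::field) set" where
  "aug_at u = {p \<in> augmentation (wgens E w). weq E w (vtx u * p) p}"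

lemma aug_at_vtx: "u \<in> verts E \<Longrightarrow> vtx u \<in> aug_at u"
  using weq_vtx[OF wf, of u u w] vtx_mem[OF wf, of u w] by (simp add: aug_at_def)

lemma aug_at_0: "u \<in> verts E \<Longrightarrow> 0 \<in> aug_at u"
  by (simp add: aug_at_def augmentation_closed weq_refl[OF wf] free_algebra_0_1)

lemma aug_at_letter:
  assumes "s \<in> wslots E w" "t \<in> opps s" "p \<in> aug_at (wvert E s)"
  shows "gen (glt t s) * p \<in> aug_at (wvert E t)"
proof -
  note g = glt_props[OF assms(1,2)]
  have p: "p \<in> augmentation (wgens E w)" "weq E w p p"
    using assms(3) by (auto simp: aug_at_def intro: weq_refl[OF wf augmentation_subset])
  have "weq E w (vtx (wvert E t) * gen (glt t s) * p) (gen (glt t s) * p)"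
    by (rule weq_mult[OF wf g(3) p(2)])
  then show ?thesis using augmentation_closed(3)[OF gen_mem[OF g(1)] p(1)]
    by (simp add: aug_at_def mult.assoc)
qed

lemma evw_mem: "nw a \<Longrightarrow> evw k a \<in> aug_at (wtop a)"
  unfolding evw_def
  by (rule wev_mem) (auto simp: aug_at_letter aug_at_vtx aug_at_0)

lemma evp_mem:
  fixes x :: "('v, 'e) word \<Rightarrow>\<^sub>0 'k::field"
  assumes "x \<in> NF"
  shows "evp k x \<in> augmentation (wgens E w)"
proof (rule plinear_mem[OF plinear_evp])
  fix a assume "a \<in> Poly_Mapping.keys x"
  then have "nw a" using assms by (auto simp: NF_def)
  then have "(evw k a :: _ \<Rightarrow>\<^sub>0 'k) \<in> aug_at (wtop a)" by (rule evw_mem)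
  then show "evp k (Poly_Mapping.single a 1 :: _ \<Rightarrow>\<^sub>0 'k) \<in> augmentation (wgens E w)"
    by (simp add: aug_at_def)
qed (auto intro: augmentation_closed pscale_mem)

text \<open>In the free algebra the products of generators satisfy the relations only modulo the
  defining ideal, so this is the universal property with that ideal as \<open>Z\<close>.\<close>

lemma evp_lam:
  assumes s: "s \<in> wslots E w" "t \<in> opps s" and x: "x \<in> NF"
  shows "weq E w (evp k (lam t s x)) (gen (glt t s) * evp k x)"
proof -
  have "evp k (lam t s x) - gen (glt t s) * evp k x \<in> wlp_ideal E w"
    unfolding evp_def evw_def
  proof (rule pext_wev_lam[where Y = aug_at and Z = "wlp_ideal E w" and \<sigma> = "\<lambda>t s p. gen (glt t s) * p", OF _ _ _ _ _ _ _ _ s x])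
    fix t s u and y :: "('v, 'e) wgen fmon \<Rightarrow>\<^sub>0 'a"
    assume s: "s \<in> wslots E w" "t \<in> opps s" and u: "u \<in> verts E" "y \<in> aug_at u" "u \<noteq> wvert E s"
    note g = glt_props[OF s]
    have y: "weq E w y (vtx u * y)" "weq E w y y"
      using u(2) unfolding aug_at_def
      by (blast intro: weq_sym[OF wf], blast intro: weq_refl[OF wf] augmentation_subset)
    have su: "wvert E s \<in> verts E" using vert_mem[OF s(1)] .
    have gg: "weq E w (gen (glt t s)) (gen (glt t s))" by (rule weq_refl[OF wf gen_carrier[OF wf g(1)]])
    have "weq E w (gen (glt t s) * y) (gen (glt t s) * vtx (wvert E s) * (vtx u * y))"
      by (rule weq_mult[OF wf weq_sym[OF wf g(4)] y(1)])
    also have "gen (glt t s) * vtx (wvert E s) * (vtx u * y) = gen (glt t s) * ((vtx (wvert E s) * vtx u) * y)"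
      by (simp add: mult.assoc)
    also have "weq E w \<dots> (gen (glt t s) * (0 * y))"
      using weq_vtx[OF wf su u(1), of w] u(3) by (intro weq_mult[OF wf gg] weq_mult[OF wf _ y(2)]) auto
    finally show "gen (glt t s) * y \<in> wlp_ideal E w" by (simp add: weq_0_iff[OF wf])
  next
    fix t t' and y :: "('v, 'e) wgen fmon \<Rightarrow>\<^sub>0 'a"
    assume t: "t \<in> wslots E w" "t' \<in> wslots E w" "wblk E t' = wblk E t" "isl t' = isl t" and y: "y \<in> aug_at (wvert E t')"
    have y': "weq E w (vtx (wvert E t') * y) y" "weq E w y y"
      using y by (auto simp: aug_at_def intro: weq_refl[OF wf] augmentation_subset)
    have "(\<Sum>s\<in>opps t. gen (glt t s) * (gen (glt s t') * y)) = (\<Sum>s\<in>opps t. gen (glt t s) * gen (glt s t')) * y"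
      by (simp add: sum_distrib_right mult.assoc)
    also have "weq E w \<dots> ((if t = t' then vtx (wvert E t) else 0) * y)"
      by (rule weq_mult[OF wf glt_relation[OF t] y'(2)])
    also have "weq E w \<dots> (if t = t' then y else 0)"
      using y' by (auto intro: weq_refl[OF wf] free_algebra_0_1)
    finally show "(\<Sum>s\<in>opps t. gen (glt t s) * (gen (glt s t') * y)) - (if t = t' then y else 0) \<in> wlp_ideal E w"
      by (simp add: weq_def)
  qed (auto simp: aug_at_vtx aug_at_0 aug_at_letter plinear_mult wlp_ideal_mem[OF wf] wlp_ideal_pscale[OF wf])
  moreover have "evp k (lam t s x) \<in> carrier (free_algebra (wgens E w))"
    by (intro augmentation_subset evp_mem NFv_subset[OF lam_mem[OF s]])
  moreover have "gen (glt t s) * evp k x \<in> carrier (free_algebra (wgens E w))"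
    using glt_props(1)[OF s] by (intro free_algebra_closed gen_carrier[OF wf] augmentation_subset evp_mem x)
  ultimately show ?thesis by (simp add: weq_def)
qed

lemma evp_vproj:
  fixes x :: "('v, 'e) word \<Rightarrow>\<^sub>0 'k::field"
  assumes u: "u \<in> verts E" and x: "x \<in> NF"
  shows "weq E w (evp k (vproj u x)) (vtx u * evp k x)"
proof -
  have "evp k (vproj u x) - vtx u * evp k x \<in> wlp_ideal E w"
  proof (rule plinear_mem[where f = "\<lambda>x. evp k (vproj u x) - vtx u * evp k x"])
    show "plinear (\<lambda>x. evp k (vproj u x) - vtx u * evp k x)"
      by (intro plinear_intros(4) plinear_comp[OF plinear_evp plinear_vproj] plinear_comp[OF plinear_mult(1) plinear_evp])
    fix a assume "a \<in> Poly_Mapping.keys x"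
    then have a: "nw a" using x by (auto simp: NF_def)
    have "(evw k a :: _ \<Rightarrow>\<^sub>0 'k) \<in> aug_at (wtop a)" by (rule evw_mem[OF a])
    then have ev: "weq E w (vtx (wtop a) * evw k a) (evw k a :: _ \<Rightarrow>\<^sub>0 'k)"
      "(evw k a :: _ \<Rightarrow>\<^sub>0 'k) \<in> carrier (free_algebra (wgens E w))"
      by (auto simp: aug_at_def intro: augmentation_subset)
    have "weq E w (evp k (vproj u (Poly_Mapping.single a (1 :: 'k)))) (vtx u * evw k a)"
    proof (cases "wtop a = u")
      case True
      then show ?thesis using a weq_sym[OF wf ev(1)] by (simp add: vproj_single)
    next
      case False
      have "weq E w (vtx u * (evw k a :: _ \<Rightarrow>\<^sub>0 'k)) (vtx u * (vtx (wtop a) * evw k a))"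
        by (rule weq_mult[OF wf weq_refl[OF wf vtx_carrier[OF wf u]] weq_sym[OF wf ev(1)]])
      also have "\<dots> = (vtx u * vtx (wtop a)) * evw k a" by (simp add: mult.assoc)
      also have "weq E w \<dots> (0 * evw k a)"
        using weq_vtx[OF wf u wtop_mem[OF a], of w] False
        by (intro weq_mult[OF wf] weq_refl[OF wf] ev(2)) auto
      finally have "weq E w (vtx u * (evw k a :: _ \<Rightarrow>\<^sub>0 'k)) 0" by simp
      from weq_sym[OF wf this] have "weq E w 0 (vtx u * (evw k a :: _ \<Rightarrow>\<^sub>0 'k))" .
      then show ?thesis using False by (simp add: vproj_single plinearD[OF plinear_evp])
    qed
    then show "evp k (vproj u (Poly_Mapping.single a 1)) - vtx u * evp k (Poly_Mapping.single a (1 :: 'k)) \<in> wlp_ideal E w"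
      by (simp add: weq_def)
  qed (auto intro: wlp_ideal_mem[OF wf] wlp_ideal_pscale[OF wf])
  moreover have "evp k (vproj u x) \<in> carrier (free_algebra (wgens E w))"
    by (intro augmentation_subset evp_mem NFv_subset[OF vproj_mem])
  moreover have "vtx u * evp k x \<in> carrier (free_algebra (wgens E w))"
    by (intro free_algebra_closed vtx_carrier[OF wf] u augmentation_subset evp_mem x)
  ultimately show ?thesis by (simp add: weq_def)
qed

lemma evp_tau:
  assumes "g \<in> wgens E w" "x \<in> NF"
  shows "weq E w (evp k (tau g x)) (gen g * evp k x)"
proof (cases g)
  case (Vtx v)
  then show ?thesis using evp_vproj[of v x k] assms by (simp add: vtx_def)
next
  case (Edge e i)
  then show ?thesis
    using evp_lam[of "Inr e" "Inl (tail E e, i)" x k] edge_opps[of e i] assms by simp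
next
  case (Ghost e i)
  then show ?thesis
    using evp_lam[of "Inl (tail E e, i)" "Inr e" x k] edge_opps[of e i] assms by simp
qed

lemma evp_act:
  fixes x :: "('v, 'e) word \<Rightarrow>\<^sub>0 'k::field"
  assumes p: "p \<in> carrier (free_algebra (wgens E w))" and x: "x \<in> NF"
  shows "weq E w (evp k (act tau p x)) (p * evp k x)"
proof -
  have "evp k (act tau p x) - p * evp k x \<in> wlp_ideal E w"
  proof (rule plinear_mem[where f = "\<lambda>p. evp k (act tau p x) - p * evp k x"])
    show "plinear (\<lambda>p. evp k (act tau p x) - p * evp k x)"
      by (intro plinear_intros(4) plinear_comp[OF plinear_evp plinear_act_left] plinear_mult)
    fix m assume "m \<in> Poly_Mapping.keys p"
    then have m: "set (letters m) \<subseteq> wgens E w" using p by (auto simp: mem_free_algebra)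
    have "foldr tau l x \<in> NF \<and> weq E w (evp k (foldr tau l x)) (Poly_Mapping.single (FMon l) 1 * evp k x)"
      if "set l \<subseteq> wgens E w" for l
      using that
    proof (induction l)
      case Nil
      have "Poly_Mapping.single (FMon []) (1 :: 'k) = (1 :: ('v, 'e) wgen fmon \<Rightarrow>\<^sub>0 'k)"
        unfolding zero_fmon_def[symmetric] by (rule single_one)
      then show ?case using x by (simp add: weq_refl[OF wf] augmentation_subset evp_mem)
    next
      case (Cons g l)
      then have g: "g \<in> wgens E w" and IH: "foldr tau l x \<in> NF"
        "weq E w (evp k (foldr tau l x)) (Poly_Mapping.single (FMon l) 1 * evp k x)" by auto
      have "weq E w (evp k (tau g (foldr tau l x))) (gen g * evp k (foldr tau l x))"
        by (rule evp_tau[OF g IH(1)])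
      also have "weq E w \<dots> (gen g * (Poly_Mapping.single (FMon l) 1 * evp k x))"
        by (intro weq_mult[OF wf] IH(2) weq_refl[OF wf] gen_carrier[OF wf] g)
      also have "\<dots> = Poly_Mapping.single (FMon (g # l)) 1 * evp k x"
        by (simp add: gen_def mult.assoc[symmetric] mult_single plus_fmon_def)
      finally show ?case using tau_mem[OF g IH(1)] by simp
    qed
    from this[OF m] have "weq E w (evp k (foldr tau (letters m) x)) (Poly_Mapping.single m 1 * evp k x)"
      by simp
    then show "evp k (act tau (Poly_Mapping.single m 1) x) - Poly_Mapping.single m 1 * evp k x \<in> wlp_ideal E w"
      by (simp add: act_single weq_def)
  qed (auto intro: wlp_ideal_mem[OF wf] wlp_ideal_pscale[OF wf])
  moreover have "evp k (act tau p x) \<in> carrier (free_algebra (wgens E w))"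
    by (intro augmentation_subset evp_mem act_mem p x)
  moreover have "p * evp k x \<in> carrier (free_algebra (wgens E w))"
    by (intro free_algebra_closed p augmentation_subset evp_mem x)
  ultimately show ?thesis by (simp add: weq_def)
qed

definition bgen :: "'v \<Rightarrow> nat \<Rightarrow> (('v, 'e) word \<Rightarrow>\<^sub>0 'k::field)" where
  "bgen u k = Poly_Mapping.single ([], u, k) 1"

text \<open>The sum of the generators of one copy corresponds to the identity of the algebra, as the
  regular module is the direct sum of the modules generated by the vertices.\<close>

definition bone :: "nat \<Rightarrow> (('v, 'e) word \<Rightarrow>\<^sub>0 'k::field)" where
  "bone k = (\<Sum>u\<in>verts E. bgen u k)"

lemma bgen_mem: "u \<in> verts E \<Longrightarrow> bgen u k \<in> NFv u" "u \<in> verts E \<Longrightarrow> bgen u k \<in> NF"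
  by (auto simp: bgen_def intro: single_mem)

lemma bone_mem: "bone k \<in> NF"
  unfolding bone_def by (intro NF_sum bgen_mem)

lemma vproj_bone: "u \<in> verts E \<Longrightarrow> vproj u (bone k) = bgen u k"
proof -
  assume u: "u \<in> verts E"
  have "vproj u (bone k) = (\<Sum>v\<in>verts E. if v = u then bgen u k else 0)"
    unfolding bone_def vproj_simps
    by (intro sum.cong refl) (auto simp: vproj_id[OF bgen_mem(1)] vproj_other[OF bgen_mem(1)])
  then show ?thesis using u by (simp add: sum.delta)
qed

lemma evp_bgen [simp]: "evp k (bgen u l) = (if l = k then vtx u else 0)"
  by (simp add: bgen_def)

lemma evp_bone: "evp k (bone l) = (if l = k then \<Sum>v\<in>verts E. vtx v else 0)"
  by (simp add: bone_def plinearD[OF plinear_evp])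

lemma act_evw: "nw a \<Longrightarrow> act tau (evw k a) (bone k) = (if snd (snd a) = k then Poly_Mapping.single a 1 else 0)"
proof (induction a rule: word_induct)
  case (gen g)
  then show ?case using vproj_bone[of "fst g" k] by (auto simp: bgen_def)
next
  case (cn t s a)
  then have a: "s \<in> wslots E w" "t \<in> opps s" "nw a" "wtop a = wvert E s" "\<not> red s a" by auto
  have "snd (snd (cn t s a)) = snd (snd a)" by (simp add: cn_def)
  then show ?case using cn.IH[OF a(3)] a
    by (simp add: act_mult[OF plinear_tau] glt_props(2)[OF a(1,2)] lam_single lamw_nonred lam_simps)
qed

text \<open>Together with \<open>evp_act\<close> this identifies the model with a direct sum of
  copies of the regular module. \<open>K\<close> has to contain the finitely many copies met by
  \<open>x\<close>.\<close>

lemma act_evp: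
  assumes x: "x \<in> NF" and K: "finite K" "\<And>a. a \<in> Poly_Mapping.keys x \<Longrightarrow> snd (snd a) \<in> K"
  shows "(\<Sum>k\<in>K. act tau (evp k x) (bone k)) = x"
proof (rule plinear_eq_on[where f = "\<lambda>x. \<Sum>k\<in>K. act tau (evp k x) (bone k)" and g = "\<lambda>x. x" and x = x])
  show "plinear (\<lambda>x. \<Sum>k\<in>K. act tau (evp k x) (bone k))"
    by (intro plinear_sum_fun plinear_comp[OF plinear_act_left plinear_evp])
  fix a assume "a \<in> Poly_Mapping.keys x"
  then have a: "nw a" "snd (snd a) \<in> K" using x K(2) by (auto simp: NF_def)
  then show "(\<Sum>k\<in>K. act tau (evp k (Poly_Mapping.single a 1)) (bone k)) = Poly_Mapping.single a 1"
    using K(1) by (simp add: act_evw sum.delta')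
qed (rule plinear_intros)

text \<open>For \<open>y = bgen u 0\<close> this is the projection of the model onto the cyclic
  summand of that generator, so its fixed points are the elements of the summand.\<close>

definition ext0 :: "'v \<Rightarrow> (('v, 'e) word \<Rightarrow>\<^sub>0 'k::field) \<Rightarrow> (('v, 'e) word \<Rightarrow>\<^sub>0 'k) \<Rightarrow> (('v, 'e) word \<Rightarrow>\<^sub>0 'k)" where
  "ext0 u y = nfext (\<lambda>g. if g = (u, 0) then y else 0)"

lemma ext0_nfhom: "y \<in> NFv u \<Longrightarrow> nfhom (ext0 u y) NF"
  unfolding ext0_def by (rule nfext_nfhom) (auto intro: NFv_closed)

lemma ext0_bgen [simp]: "ext0 u y (bgen v k) = (if v = u \<and> k = 0 then y else 0)"
  by (simp add: ext0_def bgen_def)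

lemma nfhom_bgen_eqI:
  assumes "nfhom f NF" "nfhom f' NF" "\<And>u k. u \<in> verts E \<Longrightarrow> f (bgen u k) = f' (bgen u k)" "x \<in> NF"
  shows "f x = f' x"
  by (rule nfhom_eqI[OF assms(1,2) _ assms(4)]) (use assms(3) in \<open>auto simp: bgen_def\<close>)

lemma nfhom_sum_apply:
  assumes "nfhom f NF" "\<And>i. i \<in> I \<Longrightarrow> y i \<in> NF"
  shows "f (\<Sum>i\<in>I. y i) = (\<Sum>i\<in>I. f (y i))"
proof -
  have "f 0 = 0" using nfhomD(3)[OF assms(1) NF_closed(1), of 0] by simp
  then show ?thesis using assms(2)
    by (induction I rule: infinite_finite_induct) (auto simp: nfhomD(2)[OF assms(1)] NF_sum)
qed

lemma nfhom_zero: "nfhom f NF \<Longrightarrow> f 0 = 0"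
  using nfhomD(3)[OF _ NF_closed(1), of f 0] by simp

lemma ext0_bone: "u \<in> verts E \<Longrightarrow> y \<in> NFv u \<Longrightarrow> ext0 u y (bone k) = (if k = 0 then y else 0)"
  unfolding bone_def
  by (subst nfhom_sum_apply[OF ext0_nfhom]) (auto intro: bgen_mem simp: sum.delta)

lemma act_evp_0:
  assumes u: "u \<in> verts E" and y: "y \<in> NF" "ext0 u (bgen u 0) y = y"
  shows "act tau (evp 0 y) (bgen u 0) = y"
proof -
  let ?f = "ext0 u (bgen u 0)"
  have f: "nfhom ?f NF" by (rule ext0_nfhom[OF bgen_mem(1)[OF u]])
  define K where "K = insert 0 ((\<lambda>a. snd (snd a)) ` Poly_Mapping.keys y)"
  have K: "finite K" "0 \<in> K" by (auto simp: K_def)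
  have "y = (\<Sum>k\<in>K. act tau (evp k y) (bone k))"
    by (rule act_evp[symmetric, OF y(1) K(1)]) (auto simp: K_def)
  then have "?f y = ?f (\<Sum>k\<in>K. act tau (evp k y) (bone k))" by simp
  also have "\<dots> = (\<Sum>k\<in>K. ?f (act tau (evp k y) (bone k)))"
    by (rule nfhom_sum_apply[OF f]) (intro act_mem augmentation_subset evp_mem y bone_mem)
  also have "\<dots> = (\<Sum>k\<in>K. act tau (evp k y) (?f (bone k)))"
    by (intro sum.cong refl act_nfhom[OF f] augmentation_subset evp_mem y bone_mem)
  also have "\<dots> = (\<Sum>k\<in>K. if k = 0 then act tau (evp 0 y) (bgen u 0) else 0)"
    by (intro sum.cong refl) (auto simp: ext0_bone[OF u bgen_mem(1)[OF u]] plinearD[OF plinear_act[OF plinear_tau]])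
  finally show ?thesis using K y(2) by (simp add: sum.delta)
qed

text \<open>Faithfulness: the coordinate \<open>evp 0\<close> turns the action on a generator into a
  product in the algebra, which must vanish with it.\<close>

lemma act_bgen_eq_0:
  assumes "p \<in> carrier (free_algebra (wgens E w))" "u \<in> verts E" "act tau p (bgen u 0) = 0"
  shows "weq E w (p * vtx u) 0"
  using weq_sym[OF wf evp_act[OF assms(1) bgen_mem(2)[OF assms(2)], of 0 0]] assms(3)
  by (simp add: plinearD[OF plinear_evp])

end


section \<open>Finitely generated projective modules and the model\<close>

context finite_vwg begin

text \<open>Scalars are cosets; by \<open>act_ideal\<close> the result does not depend on the chosen
  representative.\<close>

definition nfmod :: "(('k::field, 'v, 'e) wlp, ('v, 'e) word \<Rightarrow>\<^sub>0 'k) module" where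
  "nfmod = \<lparr>carrier = NF, monoid.mult = undefined, one = undefined, zero = 0, add = (+),
     smult = (\<lambda>a x. act tau (SOME p. p \<in> augmentation (wgens E w) \<and> wcls E w p = a) x)\<rparr>"

lemma nfmod_simps [simp]: "carrier nfmod = NF" "zero nfmod = 0" "add nfmod = (+)"
  by (simp_all add: nfmod_def)

lemma act_weq:
  assumes "weq E w p q" "x \<in> NF"
  shows "act tau p x = act tau q x"
  using act_ideal[of "p - q" x] assms by (simp add: weq_def act_left_simps)

lemma nfmod_smult:
  assumes p: "p \<in> augmentation (wgens E w)" and x: "x \<in> NF"
  shows "wcls E w p \<odot>\<^bsub>nfmod\<^esub> x = act tau p x"
proof -
  let ?q = "SOME q. q \<in> augmentation (wgens E w) \<and> wcls E w q = wcls E w p"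
  have q: "?q \<in> augmentation (wgens E w) \<and> wcls E w ?q = wcls E w p"
    by (rule someI[of _ p]) (use p in simp)
  then have "weq E w ?q p"
    by (intro wcls_weq[OF wf] augmentation_subset) (use p in auto)
  from act_weq[OF this x] show ?thesis by (simp add: nfmod_def)
qed

lemma one_aug: "(\<Sum>v\<in>verts E. vtx v) \<in> augmentation (wgens E w)"
  by (rule one_rep_mem[OF wf])

lemma act_one: "x \<in> NF \<Longrightarrow> act tau (\<Sum>v\<in>verts E. vtx v) x = x"
  by (simp add: act_left_simps sum_vproj)

lemma ring_wlpa': "ring (wlpa E w :: ('k::field, ('k, 'v, 'e) wlp) module)"
  by (rule ring_wlpa[OF wf finite_verts])

lemma wcls_carrier [simp]:
  "p \<in> augmentation (wgens E w) \<Longrightarrow> wcls E w p \<in> carrier (wlpa E w :: ('k::field, ('k, 'v, 'e) wlp) module)"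
  by (simp add: wlpa_carrier[OF wf])

lemma carrier_wlpaE:
  assumes "a \<in> carrier (wlpa E w :: ('k::field, ('k, 'v, 'e) wlp) module)"
  obtains p where "p \<in> augmentation (wgens E w)" "a = wcls E w p"
  using assms by (auto simp: wlpa_carrier[OF wf])

lemma left_module_nfmod: "left_module (wlpa E w) (nfmod :: (('k::field, 'v, 'e) wlp, _) module)"
proof (intro left_module.intro left_module_axioms.intro ring_wlpa')
  show "abelian_group (nfmod :: (('k::field, 'v, 'e) wlp, _) module)"
  proof (rule abelian_groupI)
    fix x :: "('v, 'e) word \<Rightarrow>\<^sub>0 'k" assume "x \<in> carrier nfmod"
    then show "\<exists>y\<in>carrier nfmod. y \<oplus>\<^bsub>nfmod\<^esub> x = \<zero>\<^bsub>nfmod\<^esub>"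
      by (intro bexI[of _ "- x"]) (auto intro: NF_closed)
  qed (auto intro: NF_closed simp: add_ac)
next
  fix a b :: "('k, 'v, 'e) wlp" and x y :: "('v, 'e) word \<Rightarrow>\<^sub>0 'k"
  let ?A = "wlpa E w :: ('k, ('k, 'v, 'e) wlp) module"
  assume "a \<in> carrier ?A"
  then obtain p where p: "p \<in> augmentation (wgens E w)" "a = wcls E w p" by (rule carrier_wlpaE)
  note pc = augmentation_subset[OF p(1)]
  {
    assume x: "x \<in> carrier nfmod"
    then show "a \<odot>\<^bsub>nfmod\<^esub> x \<in> carrier nfmod" by (simp add: p nfmod_smult act_mem pc)
    assume "y \<in> carrier nfmod"
    then show "a \<odot>\<^bsub>nfmod\<^esub> (x \<oplus>\<^bsub>nfmod\<^esub> y) = a \<odot>\<^bsub>nfmod\<^esub> x \<oplus>\<^bsub>nfmod\<^esub> a \<odot>\<^bsub>nfmod\<^esub> y"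
      using x by (simp add: p nfmod_smult NF_closed plinearD[OF plinear_act[OF plinear_tau]])
  next
    assume "b \<in> carrier ?A"
    then obtain q where q: "q \<in> augmentation (wgens E w)" "b = wcls E w q" by (rule carrier_wlpaE)
    assume x: "x \<in> carrier nfmod"
    then show "(a \<oplus>\<^bsub>?A\<^esub> b) \<odot>\<^bsub>nfmod\<^esub> x = a \<odot>\<^bsub>nfmod\<^esub> x \<oplus>\<^bsub>nfmod\<^esub> b \<odot>\<^bsub>nfmod\<^esub> x"
      by (simp add: p q wlpa_add[OF wf] nfmod_smult augmentation_closed act_left_simps)
    show "(a \<otimes>\<^bsub>?A\<^esub> b) \<odot>\<^bsub>nfmod\<^esub> x = a \<odot>\<^bsub>nfmod\<^esub> (b \<odot>\<^bsub>nfmod\<^esub> x)"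
      using x by (simp add: p q wlpa_mult[OF wf] nfmod_smult augmentation_closed act_mult[OF plinear_tau]
          act_mem augmentation_subset)
  }
next
  fix x :: "('v, 'e) word \<Rightarrow>\<^sub>0 'k" assume "x \<in> carrier nfmod"
  then show "\<one>\<^bsub>wlpa E w\<^esub> \<odot>\<^bsub>nfmod\<^esub> x = x"
    by (simp add: wlpa_one[OF wf] nfmod_smult one_aug act_one)
qed

lemma left_hom_nfmod_iff:
  fixes f :: "(('v, 'e) word \<Rightarrow>\<^sub>0 'k::field) \<Rightarrow> _"
  shows "f \<in> left_hom (wlpa E w :: ('k, ('k, 'v, 'e) wlp) module) nfmod nfmod \<longleftrightarrow> nfhom f NF"
proof
  assume f: "f \<in> left_hom (wlpa E w :: ('k, ('k, 'v, 'e) wlp) module) nfmod nfmod"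
  have act: "f (act tau p x) = act tau p (f x)" if "p \<in> augmentation (wgens E w)" "x \<in> NF" for p x
    using left_homD(3)[OF f wcls_carrier[OF that(1)], of x] left_homD(1)[OF f, of x] that
    by (simp add: nfmod_smult)
  \<comment> \<open>Multiplication by \<open>c\<close> is the action of \<open>c\<close> times the
    identity, so linearity over the algebra contains linearity over the field.\<close>
  have "f (pscale c x) = pscale c (f x)" if "x \<in> NF" for c x
  proof -
    have "pscale c y = act tau (pscale c (\<Sum>v\<in>verts E. vtx v)) y" if "y \<in> NF" for y
      using act_one[OF that] by (simp only: plinearD(2)[OF plinear_act_left])
    then show ?thesis using act[OF pscale_mem(1)[OF one_aug, of c] that] that left_homD(1)[OF f, of x] by simp
  qed
  moreover have "f (tau g x) = tau g (f x)" if "g \<in> wgens E w" "x \<in> NF" for g x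
    using act[OF gen_mem[OF that(1)] that(2)] by simp
  ultimately show "nfhom f NF"
    using left_homD(1,2)[OF f] by (simp add: nfhom_iff_tau)
next
  assume f: "nfhom f NF"
  show "f \<in> left_hom (wlpa E w :: ('k, ('k, 'v, 'e) wlp) module) nfmod nfmod"
  proof (rule left_homI)
    fix a :: "('k, 'v, 'e) wlp" and x :: "('v, 'e) word \<Rightarrow>\<^sub>0 'k"
    assume "a \<in> carrier (wlpa E w :: ('k, ('k, 'v, 'e) wlp) module)" "x \<in> carrier nfmod"
    then show "f (a \<odot>\<^bsub>nfmod\<^esub> x) = a \<odot>\<^bsub>nfmod\<^esub> f x"
      by (auto elim!: carrier_wlpaE simp: nfmod_smult nfhomD(1)[OF f] act_nfhom[OF f] augmentation_subset)
  qed (auto simp: nfhomD[OF f])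
qed

text \<open>The identity of copy number \<open>k\<close> is sent to the \<open>k\<close>-th
  generator of \<open>P\<close> while \<open>k < K\<close>, and the remaining copies are sent to
  zero. This vanishing later makes the complement finitely generated.\<close>

lemma fin_gen_cover:
  fixes P :: "(('k::field, 'v, 'e) wlp, 'p) module"
  assumes P: "fin_gen_module (wlpa E w) P"
  shows "\<exists>q K. q \<in> left_hom (wlpa E w :: ('k, ('k, 'v, 'e) wlp) module) nfmod P \<and> q ` NF = carrier P \<and>
    (\<forall>u\<in>verts E. \<forall>k\<ge>K. q (bgen u k) = \<zero>\<^bsub>P\<^esub>)"
proof -
  let ?A = "wlpa E w :: ('k, ('k, 'v, 'e) wlp) module"
  interpret P: left_module ?A P using P by (simp add: fin_gen_module_def)
  obtain S where S: "finite S" "S \<subseteq> carrier P"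
    "\<And>x. x \<in> carrier P \<Longrightarrow> \<exists>a\<in>S \<rightarrow> carrier ?A. x = (\<Oplus>\<^bsub>P\<^esub>s\<in>S. a s \<odot>\<^bsub>P\<^esub> s)"
    using P unfolding fin_gen_module_def by blast
  define K where "K = card S"
  obtain s where s: "bij_betw s {0..<K} S" using ex_bij_betw_nat_finite[OF S(1)] K_def by blast
  then have sS: "s ` {..<K} = S" "inj_on s {..<K}" by (auto simp: bij_betw_def atLeast0LessThan)
  have sP: "s k \<in> carrier P" if "k < K" for k using sS(1) S(2) that by blast
  define q where "q x = (\<Oplus>\<^bsub>P\<^esub>k\<in>{..<K}. wcls E w (evp k x) \<odot>\<^bsub>P\<^esub> s k)" for x
  have ev: "wcls E w (evp k x) \<in> carrier ?A" if "x \<in> NF" for k x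
    using evp_mem[OF that] by simp
  have pi: "(\<lambda>k. wcls E w (evp k x) \<odot>\<^bsub>P\<^esub> s k) \<in> {..<K} \<rightarrow> carrier P" if "x \<in> NF" for x
    using ev[OF that] sP by auto
  have hom: "q \<in> left_hom ?A nfmod P"
  proof (rule left_homI)
    fix x :: "('v, 'e) word \<Rightarrow>\<^sub>0 'k" assume "x \<in> carrier nfmod"
    then show "q x \<in> carrier P" unfolding q_def using pi by (intro P.M.finsum_closed) simp
  next
    fix x y :: "('v, 'e) word \<Rightarrow>\<^sub>0 'k" assume "x \<in> carrier nfmod" "y \<in> carrier nfmod"
    then have xy: "x \<in> NF" "y \<in> NF" by simp_all
    have "q (x + y) = (\<Oplus>\<^bsub>P\<^esub>k\<in>{..<K}. wcls E w (evp k x) \<odot>\<^bsub>P\<^esub> s k \<oplus>\<^bsub>P\<^esub> wcls E w (evp k y) \<odot>\<^bsub>P\<^esub> s k)"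
      unfolding q_def
    proof (rule P.M.finsum_cong'[OF refl])
      fix k assume "k \<in> {..<K}"
      then show "wcls E w (evp k (x + y)) \<odot>\<^bsub>P\<^esub> s k = wcls E w (evp k x) \<odot>\<^bsub>P\<^esub> s k \<oplus>\<^bsub>P\<^esub> wcls E w (evp k y) \<odot>\<^bsub>P\<^esub> s k"
        using ev[OF xy(1)] ev[OF xy(2)] sP
        by (simp add: plinearD[OF plinear_evp] P.smult_l_distr[symmetric] wlpa_add[OF wf] evp_mem xy)
    qed (use pi[OF xy(1)] pi[OF xy(2)] in \<open>auto simp: Pi_iff\<close>)
    also have "\<dots> = q x \<oplus>\<^bsub>P\<^esub> q y"
      unfolding q_def by (rule P.M.finsum_addf[OF pi[OF xy(1)] pi[OF xy(2)]])
    finally show "q (x \<oplus>\<^bsub>nfmod\<^esub> y) = q x \<oplus>\<^bsub>P\<^esub> q y" by simp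
  next
    fix a :: "('k, 'v, 'e) wlp" and x :: "('v, 'e) word \<Rightarrow>\<^sub>0 'k"
    assume a: "a \<in> carrier ?A" and "x \<in> carrier nfmod"
    then have x: "x \<in> NF" by simp
    obtain p where p: "p \<in> augmentation (wgens E w)" "a = wcls E w p" using a by (rule carrier_wlpaE)
    have "q (act tau p x) = (\<Oplus>\<^bsub>P\<^esub>k\<in>{..<K}. a \<odot>\<^bsub>P\<^esub> (wcls E w (evp k x) \<odot>\<^bsub>P\<^esub> s k))"
      unfolding q_def
    proof (rule P.M.finsum_cong'[OF refl])
      fix k assume k: "k \<in> {..<K}"
      have "wcls E w p \<otimes>\<^bsub>?A\<^esub> wcls E w (evp k x) = wcls E w (evp k (act tau p x))"
        by (rule wlpa_mult_weq[OF wf p(1) evp_mem[OF x] evp_act[OF augmentation_subset[OF p(1)] x]])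
      then show "wcls E w (evp k (act tau p x)) \<odot>\<^bsub>P\<^esub> s k = a \<odot>\<^bsub>P\<^esub> (wcls E w (evp k x) \<odot>\<^bsub>P\<^esub> s k)"
        using P.smult_assoc[OF a ev[OF x] sP, of k k] k p(2) by simp
    qed (use pi[OF x] a in \<open>auto simp: Pi_iff\<close>)
    also have "\<dots> = a \<odot>\<^bsub>P\<^esub> q x"
      unfolding q_def by (rule P.smult_finsum[OF _ a pi[OF x], symmetric]) simp
    finally show "q (a \<odot>\<^bsub>nfmod\<^esub> x) = a \<odot>\<^bsub>P\<^esub> q x" using p x by (simp add: nfmod_smult)
  qed
  moreover have "y \<in> q ` NF" if y: "y \<in> carrier P" for y
  proof -
    obtain a where a: "a \<in> S \<rightarrow> carrier ?A" "y = (\<Oplus>\<^bsub>P\<^esub>s\<in>S. a s \<odot>\<^bsub>P\<^esub> s)" using S(3)[OF y] by blast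
    have "\<exists>p. p \<in> augmentation (wgens E w) \<and> a (s k) = wcls E w p" if "k < K" for k
    proof -
      have "a (s k) \<in> carrier ?A" using a(1) sS(1) that by blast
      then show ?thesis by (rule carrier_wlpaE) blast
    qed
    then obtain p where p: "\<And>k. k < K \<Longrightarrow> p k \<in> augmentation (wgens E w) \<and> a (s k) = wcls E w (p k)" by metis
    define x :: "('v, 'e) word \<Rightarrow>\<^sub>0 'k" where "x = (\<Sum>k<K. act tau (p k) (bone k))"
    have x: "x \<in> NF" unfolding x_def
      by (intro NF_sum act_mem augmentation_subset bone_mem) (use p in auto)
    have ex: "wcls E w (evp l x) = a (s l)" if l: "l < K" for l
    proof -
      have pc: "p k \<in> carrier (free_algebra (wgens E w))" if "k < K" for k
        using p[OF that] augmentation_subset by blast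
      have "evp l x = (\<Sum>k<K. evp l (act tau (p k) (bone k)))"
        unfolding x_def by (rule plinearD[OF plinear_evp])
      also have "weq E w \<dots> (\<Sum>k<K. p k * evp l (bone k))"
        by (intro weq_sum[OF wf] evp_act bone_mem pc) simp
      also have "(\<Sum>k<K. p k * evp l (bone k)) = (\<Sum>k<K. if k = l then p l * (\<Sum>v\<in>verts E. vtx v) else 0)"
        by (intro sum.cong) (auto simp: evp_bone)
      also have "\<dots> = p l * (\<Sum>v\<in>verts E. vtx v)" using l by (simp add: sum.delta)
      also have "weq E w \<dots> (p l)" using p[OF l] by (intro weq_one[OF wf finite_verts]) blast
      finally show ?thesis using weq_wcls[OF wf] p[OF l] by metis
    qed
    have "q x = (\<Oplus>\<^bsub>P\<^esub>k\<in>{..<K}. a (s k) \<odot>\<^bsub>P\<^esub> s k)"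
      unfolding q_def
      by (rule P.M.finsum_cong'[OF refl]) (use ex a(1) sS(1) sP in \<open>auto simp: Pi_iff\<close>)
    also have "\<dots> = (\<Oplus>\<^bsub>P\<^esub>s\<in>s ` {..<K}. a s \<odot>\<^bsub>P\<^esub> s)"
      by (rule P.M.add.finprod_reindex[symmetric]) (use a(1) S(2) sS in \<open>auto simp: Pi_iff\<close>)
    finally have "q x = y" using a(2) sS(1) by simp
    then show ?thesis using x by blast
  qed
  moreover have "q (bgen u k) = \<zero>\<^bsub>P\<^esub>" if "u \<in> verts E" "K \<le> k" for u k
  proof -
    have "q (bgen u k) = (\<Oplus>\<^bsub>P\<^esub>k\<in>{..<K}. \<zero>\<^bsub>P\<^esub>)"
      unfolding q_def
    proof (rule P.M.finsum_cong'[OF refl])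
      fix l assume l: "l \<in> {..<K}"
      then have "evp l (bgen u k :: _ \<Rightarrow>\<^sub>0 'k) = 0" using that by simp
      then show "wcls E w (evp l (bgen u k)) \<odot>\<^bsub>P\<^esub> s l = \<zero>\<^bsub>P\<^esub>"
        using P.smult_l_null[OF sP, of l] l by (simp add: wlpa_zero[OF wf])
    qed simp
    then show ?thesis by simp
  qed
  ultimately show ?thesis using left_homD(1)[OF hom] by (intro exI[of _ q] exI[of _ K]) auto
qed

text \<open>
  The images of the homomorphisms from a generator \<open>P\<close> span every module: otherwise the quotient
  map by their span and the zero map would not be separated by \<open>P\<close>.
\<close>

lemma generator_trace:
  fixes P :: "(('k::field, 'v, 'e) wlp, 'p) module"
  assumes P: "generator_module (wlpa E w) P" and x: "x \<in> NF"
  shows "\<exists>n>0 :: nat. \<exists>h y. (\<forall>i<n. h i \<in> left_hom (wlpa E w :: ('k, ('k, 'v, 'e) wlp) module) P nfmod \<and> y i \<in> carrier P) \<and>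
    x = (\<Sum>i<n. h i (y i))"
proof -
  let ?A = "wlpa E w :: ('k, ('k, 'v, 'e) wlp) module"
  interpret P: left_module ?A P using P by (simp add: generator_module_def)
  interpret F: left_module ?A "nfmod :: (('k, 'v, 'e) wlp, _) module" by (rule left_module_nfmod)
  define ok where "ok l \<longleftrightarrow> (\<forall>(h, y)\<in>set l. h \<in> left_hom ?A P nfmod \<and> y \<in> carrier P)"
    for l :: "(('p \<Rightarrow> (('v, 'e) word \<Rightarrow>\<^sub>0 'k)) \<times> 'p) list"
  define val where "val l = sum_list (map (\<lambda>(h, y). h y) l)"
    for l :: "(('p \<Rightarrow> (('v, 'e) word \<Rightarrow>\<^sub>0 'k)) \<times> 'p) list"
  \<comment> \<open>The trace of \<open>P\<close> in the model. Lists of pairs make the closure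
    under sums and under the algebra a matter of appending and mapping.\<close>
  define Tr where "Tr = val ` {l. ok l}"
  have Tr_NF: "z \<in> NF" if "z \<in> Tr" for z
  proof -
    have "val l \<in> NF" if "ok l" for l
      using that unfolding ok_def val_def
    proof (induction l)
      case (Cons a l)
      then show ?case using left_homD(1)[of "fst a" ?A P nfmod "snd a"] by (auto intro!: NF_closed)
    qed (simp add: NF_closed)
    then show ?thesis using that by (auto simp: Tr_def)
  qed
  have Tr_add: "z + z' \<in> Tr" if zz: "z \<in> Tr" "z' \<in> Tr" for z z'
  proof -
    obtain l l' where l: "ok l" "z = val l" "ok l'" "z' = val l'" using zz by (auto simp: Tr_def)
    then have "ok (l @ l')" "val (l @ l') = z + z'" by (auto simp: ok_def val_def)
    then show ?thesis by (auto simp: Tr_def intro!: image_eqI[of _ _ "l @ l'"])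
  qed
  have Tr_act: "act tau p z \<in> Tr" if p: "p \<in> augmentation (wgens E w)" and z: "z \<in> Tr" for p z
  proof -
    obtain l where l: "ok l" "z = val l" using z by (auto simp: Tr_def)
    have "act tau p (val l) = val (map (\<lambda>(h, y). (h, wcls E w p \<odot>\<^bsub>P\<^esub> y)) l)"
      using l(1) unfolding ok_def val_def
    proof (induction l)
      case Nil
      then show ?case by (simp add: plinearD[OF plinear_act[OF plinear_tau]])
    next
      case (Cons a l)
      obtain h y where a: "a = (h, y)" by (cases a)
      have hy: "h \<in> left_hom ?A P nfmod" "y \<in> carrier P" using Cons.prems a by auto
      have "act tau p (h y) = h (wcls E w p \<odot>\<^bsub>P\<^esub> y)"
        using left_homD(3)[OF hy(1) wcls_carrier[OF p] hy(2)] left_homD(1)[OF hy] by (simp add: nfmod_smult p)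
      then show ?case using Cons a by (simp add: plinearD[OF plinear_act[OF plinear_tau]])
    qed
    moreover have "ok (map (\<lambda>(h, y). (h, wcls E w p \<odot>\<^bsub>P\<^esub> y)) l)"
      using l(1) wcls_carrier[OF p] unfolding ok_def by fastforce
    ultimately show ?thesis using l(2) by (auto simp: Tr_def)
  qed
  have Tr0: "0 \<in> Tr" by (auto simp: Tr_def ok_def val_def intro!: image_eqI[of _ _ "[]"])
  have Tr_minus: "- z \<in> Tr" if z: "z \<in> Tr" for z
  proof -
    have "act tau (pscale (- 1) (\<Sum>v\<in>verts E. vtx v)) z = - z"
      unfolding plinearD(2)[OF plinear_act_left] using act_one[OF Tr_NF[OF z]] by simp
    then show ?thesis using Tr_act[OF pscale_mem(1)[OF one_aug, of "- 1"] z] by simp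
  qed
  have Tr_diff: "z - z' \<in> Tr" if "z \<in> Tr" "z' \<in> Tr" for z z'
    using Tr_add[OF that(1) Tr_minus[OF that(2)]] by simp
  \<comment> \<open>The quotient by the trace is realised on chosen representatives of the cosets;
    \<open>\<rho>\<close> is constant on cosets and becomes the quotient map.\<close>
  define \<rho> where "\<rho> z = (SOME z'. z' \<in> NF \<and> z - z' \<in> Tr)" for z
  have \<rho>: "\<rho> z \<in> NF" "z - \<rho> z \<in> Tr" if "z \<in> NF" for z
    using someI[of "\<lambda>z'. z' \<in> NF \<and> z - z' \<in> Tr" z] that Tr0 by (auto simp: \<rho>_def)
  have \<rho>_cong: "\<rho> z = \<rho> z'" if "z - z' \<in> Tr" for z z'
  proof -
    have "z - y \<in> Tr \<longleftrightarrow> z' - y \<in> Tr" for y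
      using Tr_add[OF that, of "z' - y"] Tr_diff[of "z - y" "z - z'"] that by (auto simp: algebra_simps)
    then show ?thesis by (simp add: \<rho>_def)
  qed
  have \<rho>_add: "\<rho> (\<rho> y + z) = \<rho> (y + z)" "\<rho> (z + \<rho> y) = \<rho> (z + y)" if "y \<in> NF" "z \<in> NF" for y z
    using Tr_minus[OF \<rho>(2)[OF that(1)]] by (auto intro!: \<rho>_cong simp: algebra_simps)
  have \<rho>\<rho>: "\<rho> (\<rho> y) = \<rho> y" if "y \<in> NF" for y
    using \<rho>_add(1)[OF that NF_closed(1)] by simp
  have \<rho>_act: "\<rho> (act tau p (\<rho> z)) = \<rho> (act tau p z)" if "p \<in> augmentation (wgens E w)" "z \<in> NF" for p z
    using Tr_minus[OF Tr_act[OF that(1) \<rho>(2)[OF that(2)]]]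
    by (intro \<rho>_cong) (simp add: plinearD[OF plinear_act[OF plinear_tau]])
  define N :: "(('k, 'v, 'e) wlp, ('v, 'e) word \<Rightarrow>\<^sub>0 'k) module" where
    "N = \<lparr>carrier = \<rho> ` NF, monoid.mult = undefined, one = undefined, zero = \<rho> 0,
       add = (\<lambda>y z. \<rho> (y + z)), smult = (\<lambda>a z. \<rho> (a \<odot>\<^bsub>nfmod\<^esub> z))\<rparr>"
  have N_simps: "carrier N = \<rho> ` NF" "zero N = \<rho> 0" "add N = (\<lambda>y z. \<rho> (y + z))" "smult N = (\<lambda>a z. \<rho> (a \<odot>\<^bsub>nfmod\<^esub> z))"
    by (simp_all add: N_def)
  have N: "left_module ?A N"
  proof (intro left_module.intro left_module_axioms.intro ring_wlpa')
    show "abelian_group N"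
    proof (rule abelian_groupI)
      fix y assume "y \<in> carrier N"
      then obtain y' where y': "y' \<in> NF" "y = \<rho> y'" by (auto simp: N_simps)
      show "\<exists>z\<in>carrier N. z \<oplus>\<^bsub>N\<^esub> y = \<zero>\<^bsub>N\<^esub>"
        by (rule bexI[of _ "\<rho> (- y')"]) (use y' \<rho> in \<open>auto simp: N_simps \<rho>_add NF_closed\<close>)
    next
      fix y z z' assume "y \<in> carrier N" "z \<in> carrier N" "z' \<in> carrier N"
      then have NF: "y \<in> NF" "z \<in> NF" "z' \<in> NF" using \<rho> by (auto simp: N_simps)
      have "\<rho> (\<rho> (y + z) + z') = \<rho> (y + z + z')" "\<rho> (y + \<rho> (z + z')) = \<rho> (y + (z + z'))"
        by (intro \<rho>_add NF_closed(2) NF)+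
      then show "y \<oplus>\<^bsub>N\<^esub> z \<oplus>\<^bsub>N\<^esub> z' = y \<oplus>\<^bsub>N\<^esub> (z \<oplus>\<^bsub>N\<^esub> z')"
        by (simp add: N_simps add.assoc)
    qed (use \<rho> \<rho>\<rho> in \<open>auto simp: N_simps \<rho>_add NF_closed add.commute\<close>)
  next
    fix a b :: "('k, 'v, 'e) wlp" and y z :: "('v, 'e) word \<Rightarrow>\<^sub>0 'k"
    assume "a \<in> carrier ?A"
    then obtain p where p: "p \<in> augmentation (wgens E w)" "a = wcls E w p" by (rule carrier_wlpaE)
    note pc = augmentation_subset[OF p(1)]
    {
      assume y: "y \<in> carrier N"
      then obtain y' where y': "y' \<in> NF" "y = \<rho> y'" by (auto simp: N_simps)
      show "a \<odot>\<^bsub>N\<^esub> y \<in> carrier N" using y' p \<rho> by (auto simp: N_simps nfmod_smult act_mem[OF pc])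
      assume "z \<in> carrier N"
      then obtain z' where z': "z' \<in> NF" "z = \<rho> z'" by (auto simp: N_simps)
      show "a \<odot>\<^bsub>N\<^esub> (y \<oplus>\<^bsub>N\<^esub> z) = a \<odot>\<^bsub>N\<^esub> y \<oplus>\<^bsub>N\<^esub> a \<odot>\<^bsub>N\<^esub> z"
        using y' z' p \<rho> act_mem[OF pc]
        by (simp add: N_simps nfmod_smult \<rho>_add \<rho>_act NF_closed plinearD[OF plinear_act[OF plinear_tau]])
    next
      assume "b \<in> carrier ?A"
      then obtain q where q: "q \<in> augmentation (wgens E w)" "b = wcls E w q" by (rule carrier_wlpaE)
      assume y: "y \<in> carrier N"
      then obtain y' where y': "y' \<in> NF" "y = \<rho> y'" by (auto simp: N_simps)
      show "(a \<oplus>\<^bsub>?A\<^esub> b) \<odot>\<^bsub>N\<^esub> y = a \<odot>\<^bsub>N\<^esub> y \<oplus>\<^bsub>N\<^esub> b \<odot>\<^bsub>N\<^esub> y"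
        using y' p q \<rho> by (simp add: N_simps nfmod_smult wlpa_add[OF wf] augmentation_closed \<rho>_add
            act_left_simps act_mem augmentation_subset)
      show "(a \<otimes>\<^bsub>?A\<^esub> b) \<odot>\<^bsub>N\<^esub> y = a \<odot>\<^bsub>N\<^esub> (b \<odot>\<^bsub>N\<^esub> y)"
        using y' p q \<rho> \<rho>_act[OF augmentation_closed(3)[OF p(1) q(1)] y'(1)]
        by (simp add: N_simps nfmod_smult wlpa_mult[OF wf] augmentation_closed \<rho>_act
            act_mult[OF plinear_tau] act_mem augmentation_subset)
    }
  next
    fix y assume "y \<in> carrier N"
    then obtain y' where y': "y' \<in> NF" "y = \<rho> y'" by (auto simp: N_simps)
    then show "\<one>\<^bsub>?A\<^esub> \<odot>\<^bsub>N\<^esub> y = y"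
      using \<rho> \<rho>\<rho>[OF y'(1)] by (simp add: N_simps wlpa_one[OF wf] nfmod_smult one_aug act_one)
  qed
  interpret N: left_module ?A N by (rule N)
  have \<rho>_hom: "\<rho> \<in> left_hom ?A nfmod N"
  proof (rule left_homI)
    fix a :: "('k, 'v, 'e) wlp" and y :: "('v, 'e) word \<Rightarrow>\<^sub>0 'k"
    assume "a \<in> carrier ?A" "y \<in> carrier nfmod"
    then show "\<rho> (a \<odot>\<^bsub>nfmod\<^esub> y) = a \<odot>\<^bsub>N\<^esub> \<rho> y"
      by (auto elim!: carrier_wlpaE simp: N_simps nfmod_smult \<rho> \<rho>_act)
  qed (auto simp: N_simps \<rho> \<rho>_add)
  have z_hom: "(\<lambda>_. \<zero>\<^bsub>N\<^esub>) \<in> left_hom ?A nfmod N"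
    by (rule left_homI) auto
  have "x \<in> Tr"
  proof (rule ccontr)
    assume "x \<notin> Tr"
    then have "\<rho> x \<noteq> \<zero>\<^bsub>N\<^esub>"
      using \<rho>(2)[OF x] \<rho>(2)[OF NF_closed(1)] Tr_diff[of "x - \<rho> x" "0 - \<rho> 0"] by (auto simp: N_simps)
    then have "\<exists>h\<in>left_hom ?A P nfmod. \<exists>y\<in>carrier P. \<rho> (h y) \<noteq> \<zero>\<^bsub>N\<^esub>"
      using x by (intro generator_module_separates[OF P left_module_nfmod N \<rho>_hom z_hom]) auto
    then obtain h y where hy: "h \<in> left_hom ?A P nfmod" "y \<in> carrier P" "\<rho> (h y) \<noteq> \<rho> 0"
      by (auto simp: N_simps)
    have "h y \<in> Tr"
      unfolding Tr_def by (rule image_eqI[of _ _ "[(h, y)]"]) (use hy in \<open>auto simp: ok_def val_def\<close>)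
    then show False using hy(3) \<rho>_cong[of "h y" 0] by simp
  qed
  then obtain l where l: "ok l" "x = val l" by (auto simp: Tr_def)
  \<comment> \<open>A zero summand is prepended so that the number of summands is positive even for
    an empty list.\<close>
  let ?h0 = "\<lambda>_. 0 :: ('v, 'e) word \<Rightarrow>\<^sub>0 'k"
  have "?h0 \<in> left_hom ?A P nfmod"
    by (rule left_homI) (auto simp: NF_closed elim!: carrier_wlpaE simp: nfmod_smult plinearD[OF plinear_act[OF plinear_tau]])
  then have l': "ok ((?h0, \<zero>\<^bsub>P\<^esub>) # l)" "x = val ((?h0, \<zero>\<^bsub>P\<^esub>) # l)"
    using l by (auto simp: ok_def val_def)
  define l2 where "l2 = (?h0, \<zero>\<^bsub>P\<^esub>) # l"
  have xl: "x = (\<Sum>i<length l2. fst (l2 ! i) (snd (l2 ! i)))"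
    using l'(2) unfolding l2_def[symmetric] val_def
    by (simp add: sum_list_sum_nth atLeast0LessThan case_prod_beta)
  have hl: "\<forall>i<length l2. fst (l2 ! i) \<in> left_hom ?A P nfmod \<and> snd (l2 ! i) \<in> carrier P"
    using l'(1) nth_mem[of _ l2] unfolding l2_def[symmetric] ok_def by (auto simp: case_prod_beta)
  have pos: "0 < length l2" by (simp add: l2_def)
  show ?thesis
    by (rule exI[where x = "length l2"], rule conjI[OF pos], rule exI[where x = "\<lambda>i. fst (l2 ! i)"],
        rule exI[where x = "\<lambda>i. snd (l2 ! i)"], rule conjI[OF hl xl])
qed


section \<open>Finitely generated direct summands of the model\<close>

lemma nfhom_mono: "nfhom f N \<Longrightarrow> N' \<subseteq> N \<Longrightarrow> nfhom f N'"
  unfolding nfhom_def by blast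

lemma subm_gen_mono:
  assumes "x \<in> subm_gen X" "X \<subseteq> Y"
  shows "x \<in> subm_gen Y"
  using assms(1)
proof induction
  case (base x)
  then show ?case using assms(2) by (intro subm_gen.base) blast
qed (rule subm_gen.intros; assumption)+

lemma subm_gen_finite:
  assumes "x \<in> subm_gen (f ` C)"
  shows "\<exists>D\<subseteq>C. finite D \<and> x \<in> subm_gen (f ` D)"
  using assms
proof induction
  case (base x)
  then obtain a where "a \<in> C" "x = f a" by blast
  then show ?case by (intro exI[of _ "{a}"]) (auto intro: subm_gen.base)
next
  case (add x y)
  then obtain D D' where "D \<subseteq> C" "finite D" "x \<in> subm_gen (f ` D)" "D' \<subseteq> C" "finite D'" "y \<in> subm_gen (f ` D')"
    by blast
  then show ?case
    by (intro exI[of _ "D \<union> D'"]) (auto intro!: subm_gen.add elim: subm_gen_mono)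
next
  case zero
  show ?case by (intro exI[of _ "{}"]) (auto intro: subm_gen.zero)
next
  case (scale x c)
  then show ?case using subm_gen.scale[where X = "f ` _"] by blast
next
  case (vproj x u)
  then show ?case using subm_gen.vproj[where X = "f ` _"] by blast
next
  case (lam x s t)
  then show ?case using subm_gen.lam[where X = "f ` _"] by blast
qed

lemma subm_gen_image:
  assumes f: "nfhom f NF" and X: "X \<subseteq> NF" and x: "x \<in> subm_gen X"
  shows "f x \<in> subm_gen (f ` X)"
proof -
  note sub = subm_subm_gen[OF X] 
  have NF: "y \<in> NF" if "y \<in> subm_gen X" for y using submD(1)[OF sub] that by blast
  show ?thesis using x
  proof induction
    case (base x)
    then show ?case by (auto intro: subm_gen.base)
  next
    case zero
    then show ?case using nfhom_zero[OF f] by (simp add: subm_gen.zero)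
  qed (simp_all add: NF nfhomD[OF f] subm_gen.intros)
qed

lemma nfext_bgen [simp]: "nfext x0 (bgen u k) = x0 (u, k)"
  by (simp add: bgen_def)

lemma NF_subset_gens:
  "(NF :: (('v, 'e) word \<Rightarrow>\<^sub>0 'k::field) set) \<subseteq> subm_gen {bgen u k | u k. u \<in> verts E}"
proof
  fix x :: "('v, 'e) word \<Rightarrow>\<^sub>0 'k" assume "x \<in> NF"
  then have x: "x \<in> subm_gen {Poly_Mapping.single ([], g) 1 | g. fst g \<in> verts E}" using subm_gen_gens by blast
  have "Poly_Mapping.single ([], g) 1 = (bgen (fst g) (snd g) :: ('v, 'e) word \<Rightarrow>\<^sub>0 'k)" for g
    by (simp add: bgen_def)
  then show "x \<in> subm_gen {bgen u k | u k. u \<in> verts E}" by (intro subm_gen_mono[OF x]) blast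
qed

text \<open>The image of \<open>d\<close> is a submodule, hence free on its free leading words. Only
  finitely many generators survive under \<open>d\<close>, so the image is finitely generated and
  its basis is finite. The maps \<open>\<gamma>\<close> are the coordinates with respect to this
  basis.\<close>

lemma free_summand:
  fixes d :: "(('v, 'e) word \<Rightarrow>\<^sub>0 'k::field) \<Rightarrow> (('v, 'e) word \<Rightarrow>\<^sub>0 'k)"
  assumes d: "nfhom d NF" and idem: "\<And>x. x \<in> NF \<Longrightarrow> d (d x) = d x"
    and B: "finite B" "\<And>u k. u \<in> verts E \<Longrightarrow> k \<notin> B \<Longrightarrow> d (bgen u k) = 0"
  shows "\<exists>C g \<gamma>. finite C \<and> (\<forall>a\<in>C. wtop a \<in> verts E \<and> g a \<in> NFv (wtop a) \<and> d (g a) = g a \<and> nfhom (\<gamma> a) NF \<and>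
      (\<forall>b\<in>C. \<gamma> a (g b) = (if a = b then bgen (wtop a) 0 else 0)) \<and>
      (\<forall>x\<in>NF. \<gamma> a (d x) = \<gamma> a x \<and> ext0 (wtop a) (bgen (wtop a) 0) (\<gamma> a x) = \<gamma> a x)) \<and>
      (\<forall>x\<in>NF. d x = (\<Sum>a\<in>C. ext0 (wtop a) (g a) (\<gamma> a x)))"
proof -
  define N where "N = {x \<in> NF. d x = x}"
  have d0: "d 0 = 0" by (rule nfhom_zero[OF d])
  have N: "subm N"
  proof (rule submI)
    fix x s t assume "x \<in> N" "s \<in> wslots E w" "t \<in> opps s"
    then show "lam t s x \<in> N" using nfhomD(5)[OF d, of x s t] NFv_subset[OF lam_mem] by (auto simp: N_def)
  next
    fix x u assume "x \<in> N" "u \<in> verts E"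
    then show "vproj u x \<in> N" using nfhomD(4)[OF d, of x u] NFv_subset[OF vproj_mem] by (auto simp: N_def)
  qed (auto simp: N_def NF_closed d0 nfhomD[OF d])
  have NNF: "N \<subseteq> NF" by (auto simp: N_def)
  have dN: "d x \<in> N" if "x \<in> NF" for x using that idem nfhomD(1)[OF d] by (simp add: N_def)
  define C where "C = {a. free_lead N a}"
  have lead: "leads N a" if "a \<in> C" for a using that by (simp add: C_def free_lead_def)
  note bas = bas_props[OF N lead]
  have gen: "subm_gen (bas N ` C) = N"
  proof (rule free_generate[OF N])
    have sub: "bas N ` C \<subseteq> N" using bas(1) by blast
    then show "subm (subm_gen (bas N ` C))" using NNF by (intro subm_subm_gen) blast
    show "subm_gen (bas N ` C) \<subseteq> N" using subm_gen_min[OF _ sub N] by blast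
  qed (auto simp: C_def intro: subm_gen.base)
  have top: "wtop a \<in> verts E" if "a \<in> C" for a
    using lead[OF that] wtop_mem by (auto simp: leads_def)
  have "\<exists>f. nfhom f N \<and> (\<forall>b. free_lead N b \<longrightarrow> f (bas N b) = (if b = a then bgen (wtop a) 0 else 0))"
    if a: "a \<in> C" for a
    by (rule free_extension[OF N]) (auto simp: bgen_mem(1)[OF top[OF a]] NFv_closed)
  then obtain f where f: "\<And>a. a \<in> C \<Longrightarrow> nfhom (f a) N"
    "\<And>a b. a \<in> C \<Longrightarrow> b \<in> C \<Longrightarrow> f a (bas N b) = (if b = a then bgen (wtop a) 0 else 0)"
    unfolding C_def by (metis mem_Collect_eq)
  let ?G = "{bgen u k | u k. u \<in> verts E} :: (('v, 'e) word \<Rightarrow>\<^sub>0 'k) set"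
  let ?D = "(\<lambda>(u, k). d (bgen u k)) ` (verts E \<times> B)"
  have gens: "N \<subseteq> subm_gen ?D"
  proof
    fix x assume x: "x \<in> N"
    have G: "?G \<subseteq> NF" using bgen_mem(2) by blast
    have "d x \<in> subm_gen (d ` ?G)"
      using x NNF NF_subset_gens by (intro subm_gen_image[OF d G]) blast
    moreover have "y \<in> subm_gen ?D" if y: "y \<in> subm_gen (d ` ?G)" for y
      using y
    proof induction
      case (base y)
      then obtain u k where u: "u \<in> verts E" "y = d (bgen u k)" by blast
      show ?case
      proof (cases "k \<in> B")
        case True
        then show ?thesis using u by (auto intro!: subm_gen.base image_eqI[of _ _ "(u, k)"])
      qed (simp add: u B(2) subm_gen.zero)
    qed (rule subm_gen.intros; assumption)+
    ultimately show "x \<in> subm_gen ?D" using x by (simp add: N_def)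
  qed
  have "\<exists>D. D \<subseteq> C \<and> finite D \<and> d (bgen u k) \<in> subm_gen (bas N ` D)" if "u \<in> verts E" for u k
    using subm_gen_finite[of "d (bgen u k)" "bas N" C] gen dN[OF bgen_mem(2)[OF that]] by auto
  then obtain D where D: "\<And>u k. u \<in> verts E \<Longrightarrow> D u k \<subseteq> C \<and> finite (D u k) \<and> d (bgen u k) \<in> subm_gen (bas N ` D u k)"
    by metis
  define D' where "D' = (\<Union>u\<in>verts E. \<Union>k\<in>B. D u k)"
  have D': "finite D'" "D' \<subseteq> C" unfolding D'_def using D B(1) by auto
  have D'N: "bas N ` D' \<subseteq> N" using D'(2) bas(1) by blast
  have sub: "subm (subm_gen (bas N ` D'))"
    using D'N NNF by (intro subm_subm_gen) blast
  have gen': "x \<in> subm_gen (bas N ` D')" if x: "x \<in> N" for x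
  proof (rule subm_gen_min[OF _ _ sub])
    show "x \<in> subm_gen ?D" using gens x by blast
    have "d (bgen u k) \<in> subm_gen (bas N ` D')" if "u \<in> verts E" "k \<in> B" for u k
      by (rule subm_gen_mono[where X = "bas N ` D u k"]) (use D that in \<open>auto simp: D'_def\<close>)
    then show "?D \<subseteq> subm_gen (bas N ` D')" by auto
  qed
  have "C \<subseteq> D'"
  proof
    fix a assume a: "a \<in> C"
    show "a \<in> D'"
    proof (rule ccontr)
      assume "a \<notin> D'"
      \<comment> \<open>The coordinate at a basis word outside \<open>D'\<close> vanishes on a
        generating set, hence everywhere, although its value at its own basis element is a nonzero
        generator.\<close>
      have "f a (bas N a) = 0"
        by (rule nfhom_eq_on[OF f(1)[OF a] nfhom_0 D'N N _ gen'[OF bas(1)[OF a]]])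
          (use f(2)[OF a] D'(2) \<open>a \<notin> D'\<close> in auto)
      then have "bgen (wtop a) 0 = (0 :: ('v, 'e) word \<Rightarrow>\<^sub>0 'k)" using f(2)[OF a a] by simp
      then have "Poly_Mapping.lookup (bgen (wtop a) 0 :: ('v, 'e) word \<Rightarrow>\<^sub>0 'k) ([], wtop a, 0) = 0" by simp
      then show False by (simp add: bgen_def)
    qed
  qed
  then have C: "finite C" using D'(1) finite_subset by blast
  \<comment> \<open>Composition with \<open>d\<close> carries the coordinate from the summand to the
    whole model. The projection makes it explicit that the values lie in one cyclic summand.\<close>
  define \<gamma> where "\<gamma> a x = ext0 (wtop a) (bgen (wtop a) 0) (f a (d x))" for a x
  have pr: "nfhom (ext0 (wtop a) (bgen (wtop a) 0 :: ('v, 'e) word \<Rightarrow>\<^sub>0 'k)) NF" if "a \<in> C" for a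
    by (rule ext0_nfhom[OF bgen_mem(1)[OF top[OF that]]])
  have fd: "nfhom (\<lambda>x. f a (d x)) NF" if "a \<in> C" for a
    using dN by (intro nfhom_comp[OF d _ f(1)[OF that]]) blast
  have \<gamma>: "nfhom (\<gamma> a) NF" if "a \<in> C" for a
    unfolding \<gamma>_def using nfhomD(1)[OF fd[OF that]] by (intro nfhom_comp[OF fd[OF that] _ pr[OF that]]) blast
  have dbas: "d (bas N a) = bas N a" if "a \<in> C" for a using bas(1)[OF that] by (simp add: N_def)
  have \<gamma>bas: "\<gamma> a (bas N b) = (if a = b then bgen (wtop a) 0 else 0)" if "a \<in> C" "b \<in> C" for a b
    using f(2)[OF that] dbas[OF that(2)] nfhom_zero[OF pr[OF that(1)]] by (auto simp: \<gamma>_def)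
  have prpr: "ext0 (wtop a) (bgen (wtop a) 0) (\<gamma> a x) = \<gamma> a x" if "a \<in> C" "x \<in> NF" for a x
  proof -
    let ?p = "ext0 (wtop a) (bgen (wtop a) 0 :: ('v, 'e) word \<Rightarrow>\<^sub>0 'k)"
    have "?p (?p y) = ?p y" if "y \<in> NF" for y
      by (rule nfhom_bgen_eqI[OF nfhom_comp[OF pr[OF \<open>a \<in> C\<close>] _ pr[OF \<open>a \<in> C\<close>]] pr[OF \<open>a \<in> C\<close>] _ that])
        (use nfhomD(1)[OF pr[OF \<open>a \<in> C\<close>]] nfhom_zero[OF pr[OF \<open>a \<in> C\<close>]] in auto)
    then show ?thesis using nfhomD(1)[OF fd[OF that(1)] that(2)] by (simp add: \<gamma>_def)
  qed
  have dec: "d x = (\<Sum>a\<in>C. ext0 (wtop a) (bas N a) (\<gamma> a x))" if x: "x \<in> NF" for x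
  proof -
    let ?S = "\<lambda>x. \<Sum>a\<in>C. ext0 (wtop a) (bas N a) (\<gamma> a x)"
    have ext: "nfhom (ext0 (wtop a) (bas N a)) NF" if "a \<in> C" for a
      by (rule ext0_nfhom[OF bas(2)[OF that]])
    have S: "nfhom ?S NF"
      using nfhomD(1)[OF \<gamma>] by (intro nfhom_sum nfhom_comp[OF \<gamma> _ ext]) auto
    have "?S (d x) = d x"
    proof (rule nfhom_eq_on[OF nfhom_mono[OF S NNF] nfhom_id[OF NNF] _ N])
      show "bas N ` C \<subseteq> N" using bas(1) by blast
      show "d x \<in> subm_gen (bas N ` C)" using gen dN[OF x] by simp
      fix y assume "y \<in> bas N ` C"
      then obtain b where b: "b \<in> C" "y = bas N b" by blast
      have "?S y = (\<Sum>a\<in>C. if a = b then bas N b else 0)"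
        using b \<gamma>bas nfhom_zero[OF ext] by (intro sum.cong) auto
      then show "?S y = y" using C b by (simp add: sum.delta)
    qed
    then show ?thesis using idem[OF x] by (simp add: \<gamma>_def)
  qed
  have "\<gamma> a (d x) = \<gamma> a x" if "x \<in> NF" for a x using idem[OF that] by (simp add: \<gamma>_def)
  then show ?thesis
    using C top bas(2) dbas \<gamma> \<gamma>bas prpr dec
    by (intro exI[of _ C] exI[of _ "bas N"] exI[of _ \<gamma>] conjI ballI) simp_all
qed

lemma nfhom_compose: "nfhom f NF \<Longrightarrow> nfhom h NF \<Longrightarrow> nfhom (\<lambda>x. h (f x)) NF"
  using nfhom_comp[of f NF NF h] nfhomD(1)[of f NF] by (simp add: image_subset_iff)

text \<open>The pairing function splits the copies in the model into infinitely many infinite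
  families, which makes room for several embedded copies of the model side by side.\<close>

definition shift :: "nat \<Rightarrow> (('v, 'e) word \<Rightarrow>\<^sub>0 'k::field) \<Rightarrow> (('v, 'e) word \<Rightarrow>\<^sub>0 'k)" where
  "shift i = nfext (\<lambda>g. bgen (fst g) (prod_encode (i, snd g)))"

definition unshift :: "nat \<Rightarrow> (('v, 'e) word \<Rightarrow>\<^sub>0 'k::field) \<Rightarrow> (('v, 'e) word \<Rightarrow>\<^sub>0 'k)" where
  "unshift i = nfext (\<lambda>g. if fst (prod_decode (snd g)) = i then bgen (fst g) (snd (prod_decode (snd g))) else 0)"

lemma shift_nfhom: "nfhom (shift i) NF" "nfhom (unshift i) NF"
  unfolding shift_def unshift_def
  by (rule nfext_nfhom, simp add: bgen_mem) (rule nfext_nfhom, simp add: bgen_mem NFv_closed)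

lemma unshift_shift: "x \<in> NF \<Longrightarrow> unshift l (shift i x) = (if l = i then x else 0)"
proof -
  assume x: "x \<in> NF"
  have 1: "nfhom (\<lambda>x. unshift l (shift i x)) NF"
    by (rule nfhom_compose[OF shift_nfhom])
  have 2: "nfhom (\<lambda>x. if l = i then x else 0) NF" using nfhom_id nfhom_0 by (cases "l = i") auto
  show ?thesis
    by (rule nfhom_bgen_eqI[OF 1 2 _ x]) (auto simp: shift_def unshift_def)
qed


text \<open>
  A power of a projective generator contains the regular module as a direct summand; the complement
  is free by the above, so that the power is free on a family of generators in which every vertex
  occurs.
\<close>

theorem progenerator_structure:
  fixes P :: "(('k::field, 'v, 'e) wlp, 'p) module"
  assumes fg: "fin_gen_module (wlpa E w) P" and pr: "projective_module (wlpa E w) P"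
    and gen: "generator_module (wlpa E w) P"
  shows "\<exists>(n :: nat) J Q h g \<gamma>. 0 < n \<and>
    (\<forall>i<n. J i \<in> left_hom (wlpa E w :: ('k, ('k, 'v, 'e) wlp) module) P nfmod \<and>
       Q i \<in> left_hom (wlpa E w :: ('k, ('k, 'v, 'e) wlp) module) nfmod P) \<and>
    (\<forall>i<n. \<forall>l<n. \<forall>y\<in>carrier P. Q l (J i y) = (if l = i then y else \<zero>\<^bsub>P\<^esub>)) \<and>
    (\<forall>v\<in>verts E. 0 < h v) \<and>
    (\<forall>v\<in>verts E. \<forall>j<(h v :: nat). g v j \<in> NFv v \<and> nfhom (\<gamma> v j) NF \<and>
       (\<forall>v'\<in>verts E. \<forall>j'<h v'. \<gamma> v j (g v' j') = (if v = v' \<and> j = j' then bgen v 0 else 0)) \<and>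
       (\<forall>x\<in>NF. ext0 v (bgen v 0) (\<gamma> v j x) = \<gamma> v j x)) \<and>
    (\<forall>x\<in>NF. (\<Sum>i<n. J i (Q i x)) = (\<Sum>v\<in>verts E. \<Sum>j<h v. ext0 v (g v j) (\<gamma> v j x)))"
proof -
  let ?A = "wlpa E w :: ('k, ('k, 'v, 'e) wlp) module"
  let ?F = "nfmod :: (('k, 'v, 'e) wlp, ('v, 'e) word \<Rightarrow>\<^sub>0 'k) module"
  interpret P: left_module ?A P using fg by (simp add: fin_gen_module_def)
  note Pm = P.left_module_axioms
  obtain q K where "q \<in> left_hom ?A ?F P \<and> q ` NF = carrier P \<and>
      (\<forall>u\<in>verts E. \<forall>k\<ge>K. q (bgen u k) = \<zero>\<^bsub>P\<^esub>)"
    using fin_gen_cover[OF fg] by (elim exE)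
  then have q: "q \<in> left_hom ?A ?F P" "q ` NF = carrier P"
    "\<And>u k. u \<in> verts E \<Longrightarrow> K \<le> k \<Longrightarrow> q (bgen u k) = \<zero>\<^bsub>P\<^esub>"
    by simp_all
  have idP: "(\<lambda>y. y) \<in> left_hom ?A P P" by (rule left_homI) auto
  have "\<exists>h\<in>left_hom ?A P ?F. \<forall>x\<in>carrier P. q (h x) = x"
    by (rule projective_module_lift[OF pr left_module_nfmod Pm q(1) _ idP]) (simp add: q(2))
  then obtain j where j: "j \<in> left_hom ?A P ?F" "\<And>y. y \<in> carrier P \<Longrightarrow> q (j y) = y"
    by (elim bexE) (rule that, assumption, erule bspec)
  obtain n :: nat and h0 y where "0 < n \<and> (\<forall>i<n. h0 i \<in> left_hom ?A P ?F \<and> y i \<in> carrier P) \<and>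
      bone 0 = (\<Sum>i<n. h0 i (y i))"
    using generator_trace[OF gen bone_mem[of 0]] by (elim exE conjE) (rule that, intro conjI; assumption)
  then have n: "0 < n" and h0: "\<And>i. i < n \<Longrightarrow> h0 i \<in> left_hom ?A P ?F" "\<And>i. i < n \<Longrightarrow> y i \<in> carrier P"
    and one: "bone 0 = (\<Sum>i<n. h0 i (y i))" by simp_all
  have q0: "q 0 = \<zero>\<^bsub>P\<^esub>" using left_hom_zero[OF left_module_nfmod Pm q(1)] by simp
  have lh0: "f \<zero>\<^bsub>P\<^esub> = 0" if "f \<in> left_hom ?A P ?F" for f using left_hom_zero[OF Pm left_module_nfmod that] by simp
  have sh: "shift i \<in> left_hom ?A ?F ?F" "unshift i \<in> left_hom ?A ?F ?F" for i
    using shift_nfhom by (simp_all add: left_hom_nfmod_iff)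
  \<comment> \<open>The section \<open>j\<close> embeds \<open>P\<close> into the model, and the
    shifts place the \<open>n\<close> copies of \<open>P\<close> into disjoint families of free
    generators.\<close>
  define J where "J i y = shift i (j y)" for i y
  define Q where "Q i x = q (unshift i x)" for i x
  have J: "J i \<in> left_hom ?A P ?F" and Q: "Q i \<in> left_hom ?A ?F P" for i
    unfolding J_def Q_def using left_hom_comp[OF j(1) sh(1)] left_hom_comp[OF sh(2) q(1)] by blast+
  have JNF: "J i y \<in> NF" if "y \<in> carrier P" for i y using left_homD(1)[OF J that] by simp
  have QP: "Q i x \<in> carrier P" if "x \<in> NF" for i x using left_homD(1)[OF Q, of x] that by simp
  have QJ: "Q l (J i y) = (if l = i then y else \<zero>\<^bsub>P\<^esub>)" if "y \<in> carrier P" for i l y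
    using left_homD(1)[OF j(1) that] j(2)[OF that] q0 by (simp add: J_def Q_def unshift_shift)
  have JQ: "nfhom (\<lambda>x. f (Q i x)) NF" if "f \<in> left_hom ?A P ?F" for f i
    using left_hom_comp[OF Q that] by (simp add: left_hom_nfmod_iff)
  \<comment> \<open>The idempotent whose image is \<open>n\<close> copies of
    \<open>P\<close>.\<close>
  define e where "e x = (\<Sum>i<n. J i (Q i x))" for x
  \<comment> \<open>The maps \<open>h0 i\<close> reach the identity \<open>bone 0\<close> at the
    elements \<open>y i\<close>, so this is a map from the power of \<open>P\<close> onto copy
    number \<open>0\<close> of the regular module. The projection \<open>?pr\<close> cuts off the
    other copies.\<close>
  define H where "H x = nfext (\<lambda>g. if snd g = 0 then bgen (fst g) 0 else 0) (\<Sum>i<n. h0 i (Q i x))" for x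
  let ?pr = "nfext (\<lambda>g. if snd g = 0 then bgen (fst g) 0 else (0 :: ('v, 'e) word \<Rightarrow>\<^sub>0 'k))"
  have prh: "nfhom ?pr NF" by (rule nfext_nfhom) (auto intro: bgen_mem NFv_closed)
  have e: "nfhom e NF" unfolding e_def by (intro nfhom_sum JQ J)
  have hs: "nfhom (\<lambda>x. \<Sum>i<n. h0 i (Q i x)) NF" by (intro nfhom_sum JQ h0) simp
  have H: "nfhom H NF" unfolding H_def by (rule nfhom_compose[OF hs prh])
  have eJ: "e (J l z) = J l z" if "l < n" "z \<in> carrier P" for l z
  proof -
    have "e (J l z) = (\<Sum>i<n. if i = l then J l z else 0)"
      unfolding e_def using QJ[OF that(2)] lh0[OF J] by (intro sum.cong) auto
    then show ?thesis using that(1) by (simp add: sum.delta)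
  qed
  have HJ: "H (J l z) = ?pr (h0 l z)" if "l < n" "z \<in> carrier P" for l z
  proof -
    have "(\<Sum>i<n. h0 i (Q i (J l z))) = (\<Sum>i<n. if i = l then h0 l z else 0)"
      using QJ[OF that(2)] lh0 h0 by (intro sum.cong) auto
    then show ?thesis using that(1) by (simp add: H_def sum.delta)
  qed
  have ee: "e (e x) = e x" and He: "H (e x) = H x" if x: "x \<in> NF" for x
  proof -
    have JQx: "J i (Q i x) \<in> NF" for i using JNF[OF QP[OF x]] .
    have "e (e x) = (\<Sum>i<n. e (J i (Q i x)))"
      unfolding e_def[of x] by (rule nfhom_sum_apply[OF e JQx])
    then show "e (e x) = e x" using eJ[OF _ QP[OF x]] by (simp add: e_def)
    have "H (e x) = (\<Sum>i<n. H (J i (Q i x)))"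
      unfolding e_def by (rule nfhom_sum_apply[OF H JQx])
    also have "\<dots> = (\<Sum>i<n. ?pr (h0 i (Q i x)))"
      using HJ[OF _ QP[OF x]] by simp
    also have "\<dots> = H x"
      unfolding H_def using nfhomD(1)[OF JQ[OF h0(1)] x] by (intro nfhom_sum_apply[OF prh, symmetric]) simp
    finally show "H (e x) = H x" .
  qed
  \<comment> \<open>A preimage of the identity under \<open>H\<close> inside the power of
    \<open>P\<close>; its vertex parts will generate the copy of the regular module.\<close>
  define \<zeta> where "\<zeta> = (\<Sum>i<n. J i (y i))"
  have \<zeta>NF: "\<zeta> \<in> NF" unfolding \<zeta>_def using JNF h0(2) by (intro NF_sum) simp
  have e\<zeta>: "e \<zeta> = \<zeta>"
    unfolding \<zeta>_def using eJ h0(2) JNF by (subst nfhom_sum_apply[OF e]) auto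
  have H\<zeta>: "H \<zeta> = bone 0"
  proof -
    have "H \<zeta> = (\<Sum>i<n. ?pr (h0 i (y i)))"
      unfolding \<zeta>_def using HJ h0(2) JNF by (subst nfhom_sum_apply[OF H]) auto
    also have "\<dots> = ?pr (\<Sum>i<n. h0 i (y i))"
      using left_homD(1)[OF h0] by (intro nfhom_sum_apply[OF prh, symmetric]) simp
    also have "\<dots> = ?pr (bone 0)" by (simp add: one)
    also have "\<dots> = bone 0"
      unfolding bone_def by (subst nfhom_sum_apply[OF prh]) (auto intro: bgen_mem)
    finally show ?thesis .
  qed
  have e\<zeta>v: "e (vproj v \<zeta>) = vproj v \<zeta>" and H\<zeta>v: "H (vproj v \<zeta>) = bgen v 0" if "v \<in> verts E" for v
    using nfhomD(4)[OF e \<zeta>NF that] nfhomD(4)[OF H \<zeta>NF that] e\<zeta> H\<zeta> vproj_bone[OF that] by simp_all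
  \<comment> \<open>The section of \<open>H\<close> that sends the identity of copy number
    \<open>0\<close> to \<open>\<zeta>\<close>.\<close>
  define Z where "Z = nfext (\<lambda>g. if snd g = 0 then vproj (fst g) \<zeta> else 0)"
  have Z: "nfhom Z NF" unfolding Z_def by (rule nfext_nfhom) (auto intro: vproj_mem NFv_closed)
  have HZ: "H (Z x) = ?pr x" and eZ: "e (Z x) = Z x" if "x \<in> NF" for x
  proof -
    show "H (Z x) = ?pr x"
      by (rule nfhom_bgen_eqI[OF nfhom_compose[OF Z H] prh _ that])
        (use H\<zeta>v nfhom_zero[OF H] in \<open>auto simp: Z_def\<close>)
    show "e (Z x) = Z x"
      by (rule nfhom_bgen_eqI[OF nfhom_compose[OF Z e] Z _ that])
        (use e\<zeta>v nfhom_zero[OF e] in \<open>auto simp: Z_def\<close>)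
  qed
  have prH: "?pr (H x) = H x" if "x \<in> NF" for x
  proof -
    have "?pr (?pr z) = ?pr z" if "z \<in> NF" for z
      by (rule nfhom_bgen_eqI[OF nfhom_compose[OF prh prh] prh _ that])
        (use nfhom_zero[OF prh] in auto)
    then show ?thesis using nfhomD(1)[OF hs that] by (simp add: H_def)
  qed
  \<comment> \<open>The idempotent onto the kernel of \<open>H\<close> within the power of
    \<open>P\<close>, that is, onto the complement of the regular module.\<close>
  define d where "d x = e x - Z (H x)" for x
  have ZH: "nfhom (\<lambda>x. Z (H x)) NF" by (rule nfhom_compose[OF H Z])
  have d: "nfhom d NF" unfolding d_def by (rule nfhom_diff[OF e ZH])
  have Hd: "H (d x) = 0" if "x \<in> NF" for x
  proof -
    have "e x \<in> NF" "Z (H x) \<in> NF" using nfhomD(1)[OF e that] nfhomD(1)[OF ZH that] by auto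
    then have "H (d x) = H (e x) - H (Z (H x))"
      unfolding d_def using nfhomD(2)[OF H, of "e x - Z (H x)" "Z (H x)"] by (simp add: NF_closed)
    then show ?thesis using He[OF that] HZ[OF nfhomD(1)[OF H that]] prH[OF that] by simp
  qed
  have ed: "e (d x) = d x" if "x \<in> NF" for x
  proof -
    have NF: "e x \<in> NF" "Z (H x) \<in> NF" using nfhomD(1)[OF e that] nfhomD(1)[OF ZH that] by auto
    then have "e (d x) = e (e x) - e (Z (H x))"
      unfolding d_def using nfhomD(2)[OF e, of "e x - Z (H x)" "Z (H x)"] by (simp add: NF_closed)
    then show ?thesis using ee[OF that] eZ[OF nfhomD(1)[OF H that]] by (simp add: d_def)
  qed
  have idem: "d (d x) = d x" if "x \<in> NF" for x
    using ed[OF that] Hd[OF that] nfhom_zero[OF Z] by (simp add: d_def[of "d x"])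
  \<comment> \<open>The indices of the generators that some \<open>Q i\<close> may not kill: a
    family \<open>i < n\<close> and, within it, one of the first \<open>K\<close> copies.\<close>
  define B where "B = prod_encode ` ({..<n} \<times> {..<K})"
  have Q0: "Q i (bgen u k) = \<zero>\<^bsub>P\<^esub>" if "u \<in> verts E" "k \<notin> B" "i < n" for u k i
  proof (cases "fst (prod_decode k) = i")
    case True
    have "K \<le> snd (prod_decode k)"
    proof (rule ccontr)
      assume "\<not> K \<le> snd (prod_decode k)"
      then have "prod_decode k \<in> {..<n} \<times> {..<K}" using True that(3) by (auto simp: mem_Times_iff)
      then have "prod_encode (prod_decode k) \<in> B" unfolding B_def by (rule imageI)
      then show False using that(2) by simp
    qed
    then show ?thesis using True q(3)[OF that(1)] by (simp add: Q_def unshift_def)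
  qed (simp add: Q_def unshift_def q0)
  have "d (bgen u k) = 0" if "u \<in> verts E" "k \<notin> B" for u k
  proof -
    have "e (bgen u k) = 0" unfolding e_def using Q0[OF that] lh0[OF J] by simp
    moreover have "(\<Sum>i<n. h0 i (Q i (bgen u k))) = 0" using Q0[OF that] lh0[OF h0(1)] by simp
    ultimately show ?thesis using nfhom_zero[OF prh] nfhom_zero[OF Z] by (simp add: d_def H_def)
  qed
  then have "\<exists>C g \<gamma>. finite C \<and> (\<forall>a\<in>C. wtop a \<in> verts E \<and> g a \<in> NFv (wtop a) \<and> d (g a) = g a \<and> nfhom (\<gamma> a) NF \<and>
      (\<forall>b\<in>C. \<gamma> a (g b) = (if a = b then bgen (wtop a) 0 else 0)) \<and>
      (\<forall>x\<in>NF. \<gamma> a (d x) = \<gamma> a x \<and> ext0 (wtop a) (bgen (wtop a) 0) (\<gamma> a x) = \<gamma> a x)) \<and>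
      (\<forall>x\<in>NF. d x = (\<Sum>a\<in>C. ext0 (wtop a) (g a) (\<gamma> a x)))"
    by (intro free_summand[OF d idem, of B]) (simp_all add: B_def)
  then obtain C b \<beta> where C: "finite C"
    and Cb: "\<forall>a\<in>C. wtop a \<in> verts E \<and> b a \<in> NFv (wtop a) \<and> d (b a) = b a \<and> nfhom (\<beta> a) NF \<and>
      (\<forall>a'\<in>C. \<beta> a (b a') = (if a = a' then bgen (wtop a) 0 else 0)) \<and>
      (\<forall>x\<in>NF. \<beta> a (d x) = \<beta> a x \<and> ext0 (wtop a) (bgen (wtop a) 0) (\<beta> a x) = \<beta> a x)"
    and dec': "\<forall>x\<in>NF. d x = (\<Sum>a\<in>C. ext0 (wtop a) (b a) (\<beta> a x))"
    by (elim exE conjE)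
  have b: "\<And>a. a \<in> C \<Longrightarrow> wtop a \<in> verts E" "\<And>a. a \<in> C \<Longrightarrow> b a \<in> NFv (wtop a)" "\<And>a. a \<in> C \<Longrightarrow> d (b a) = b a"
    and \<beta>: "\<And>a. a \<in> C \<Longrightarrow> nfhom (\<beta> a) NF"
      "\<And>a a'. a \<in> C \<Longrightarrow> a' \<in> C \<Longrightarrow> \<beta> a (b a') = (if a = a' then bgen (wtop a) 0 else 0)"
      "\<And>a x. a \<in> C \<Longrightarrow> x \<in> NF \<Longrightarrow> \<beta> a (d x) = \<beta> a x"
      "\<And>a x. a \<in> C \<Longrightarrow> x \<in> NF \<Longrightarrow> ext0 (wtop a) (bgen (wtop a) 0) (\<beta> a x) = \<beta> a x"
    using Cb by simp_all
  have dec: "\<And>x. x \<in> NF \<Longrightarrow> d x = (\<Sum>a\<in>C. ext0 (wtop a) (b a) (\<beta> a x))"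
    using dec' by (rule bspec)
  let ?C = "\<lambda>v. {a \<in> C. wtop a = v}"
  define idx where "idx v = (SOME f. bij_betw f {0..<card (?C v)} (?C v))" for v
  have "\<exists>f. bij_betw f {0..<card (?C v)} (?C v)" for v
    using C by (intro ex_bij_betw_nat_finite) simp
  then have idx: "bij_betw (idx v) {0..<card (?C v)} (?C v)" for v
    unfolding idx_def by (rule someI_ex)
  have idxC: "idx v i \<in> C \<and> wtop (idx v i) = v" if "i < card (?C v)" for v i
    using bij_betwE[OF idx[of v]] that by auto
  \<comment> \<open>At each vertex the index \<open>0\<close> is reserved for the generator from the
    regular module, whence the successor and the positivity of \<open>h\<close>; the other indices
    count basis elements of the complement.\<close>
  define h where "h v = Suc (card (?C v))" for v
  define g where "g v i = (case i of 0 \<Rightarrow> vproj v \<zeta> | Suc i \<Rightarrow> b (idx v i))" for v i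
  define \<gamma> where "\<gamma> v i = (case i of 0 \<Rightarrow> (\<lambda>x. ext0 v (bgen v 0) (H x)) | Suc i \<Rightarrow> \<beta> (idx v i))" for v i
  have pv: "nfhom (ext0 v (bgen v 0 :: ('v, 'e) word \<Rightarrow>\<^sub>0 'k)) NF" if "v \<in> verts E" for v
    by (rule ext0_nfhom[OF bgen_mem(1)[OF that]])
  have gm: "g v i \<in> NFv v" if "v \<in> verts E" "i < h v" for v i
  proof (cases i)
    case (Suc m)
    then show ?thesis using idxC[of m v] b(2)[of "idx v m"] that(2) by (simp add: g_def h_def)
  qed (simp add: g_def vproj_mem)
  have \<gamma>m: "nfhom (\<gamma> v i) NF" if "v \<in> verts E" "i < h v" for v i
  proof (cases i)
    case 0
    then show ?thesis using nfhom_compose[OF H pv[OF that(1)]] by (simp add: \<gamma>_def)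
  next
    case (Suc m)
    then show ?thesis using that(2) idxC[of m v] \<beta>(1)[of "idx v m"] by (simp add: \<gamma>_def h_def)
  qed
  have \<gamma>g: "\<gamma> v i (g v' i') = (if v = v' \<and> i = i' then bgen v 0 else 0)"
    if v: "v \<in> verts E" "i < h v" "v' \<in> verts E" "i' < h v'" for v i v' i'
  proof (cases i)
    case i0: 0
    show ?thesis
    proof (cases i')
      case 0
      then show ?thesis using i0 v H\<zeta>v by (auto simp: \<gamma>_def g_def)
    next
      case (Suc m)
      have a: "idx v' m \<in> C" using idxC[of m v'] v Suc by (simp add: h_def)
      then have "H (b (idx v' m)) = 0"
        using Hd[of "b (idx v' m)"] b[of "idx v' m"] NFv_subset by auto
      then show ?thesis using i0 Suc nfhom_zero[OF pv[OF v(1)]] by (simp add: \<gamma>_def g_def)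
    qed
  next
    case (Suc m)
    have a: "idx v m \<in> C" "wtop (idx v m) = v" "m < card (?C v)" using idxC[of m v] v Suc by (auto simp: h_def)
    show ?thesis
    proof (cases i')
      case 0
      have "d (vproj v' \<zeta>) = 0"
        using e\<zeta>v[OF v(3)] H\<zeta>v[OF v(3)] v(3) by (simp add: d_def Z_def)
      then have "\<beta> (idx v m) (vproj v' \<zeta>) = 0"
        using \<beta>(3)[OF a(1), of "vproj v' \<zeta>"] nfhom_zero[OF \<beta>(1)[OF a(1)]]
        by (simp add: NFv_subset[OF vproj_mem])
      then show ?thesis using 0 Suc by (simp add: \<gamma>_def g_def)
    next
      case i': (Suc m')
      have a': "idx v' m' \<in> C" "wtop (idx v' m') = v'" "m' < card (?C v')" using idxC[of m' v'] v i' by (auto simp: h_def)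
      have "idx v m = idx v' m' \<longleftrightarrow> v = v' \<and> m = m'"
        using inj_on_eq_iff[OF bij_betw_imp_inj_on[OF idx[of v]], of m m'] a a' by (cases "v = v'") auto
      then show ?thesis using \<beta>(2)[OF a(1) a'(1)] Suc i' a(2) a'(2) by (simp add: \<gamma>_def g_def)
    qed
  qed
  have \<gamma>p: "ext0 v (bgen v 0) (\<gamma> v i x) = \<gamma> v i x" if v: "v \<in> verts E" "i < h v" and x: "x \<in> NF" for v i x
  proof (cases i)
    case 0
    have "ext0 v (bgen v 0) (ext0 v (bgen v 0) z) = ext0 v (bgen v 0) z" if "z \<in> NF" for z :: "('v, 'e) word \<Rightarrow>\<^sub>0 'k"
      by (rule nfhom_bgen_eqI[OF nfhom_compose[OF pv[OF v(1)] pv[OF v(1)]] pv[OF v(1)] _ that])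
        (use nfhom_zero[OF pv[OF v(1)]] in auto)
    then show ?thesis using 0 nfhomD(1)[OF H x] by (simp add: \<gamma>_def)
  next
    case (Suc m)
    then show ?thesis using idxC[of m v] v \<beta>(4)[OF _ x, of "idx v m"] by (simp add: \<gamma>_def h_def)
  qed
  have final: "e x = (\<Sum>v\<in>verts E. \<Sum>i<h v. ext0 v (g v i) (\<gamma> v i x))" if x: "x \<in> NF" for x
  proof -
    have Zdec: "Z z = (\<Sum>v\<in>verts E. ext0 v (vproj v \<zeta>) (ext0 v (bgen v 0) z))" if "z \<in> NF" for z
    proof (rule nfhom_bgen_eqI[OF Z _ _ that])
      have ext: "nfhom (ext0 v (vproj v \<zeta>)) NF" for v by (rule ext0_nfhom[OF vproj_mem])
      show "nfhom (\<lambda>z. \<Sum>v\<in>verts E. ext0 v (vproj v \<zeta>) (ext0 v (bgen v 0) z)) NF"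
        by (rule nfhom_sum) (rule nfhom_compose[OF pv ext])
      fix u k assume u: "u \<in> verts E"
      have "(\<Sum>v\<in>verts E. ext0 v (vproj v \<zeta>) (ext0 v (bgen v 0) (bgen u k))) =
        (\<Sum>v\<in>verts E. if v = u then (if k = 0 then vproj u \<zeta> else 0) else 0)"
        by (intro sum.cong) (auto simp: nfhom_zero[OF ext])
      then show "Z (bgen u k) = (\<Sum>v\<in>verts E. ext0 v (vproj v \<zeta>) (ext0 v (bgen v 0) (bgen u k)))"
        using u by (simp add: Z_def sum.delta)
    qed
    have "d x = (\<Sum>v\<in>verts E. \<Sum>a\<in>?C v. ext0 (wtop a) (b a) (\<beta> a x))"
      unfolding dec[OF x] by (rule sum.group[symmetric, OF C finite_verts]) (use b(1) in auto)
    also have "\<dots> = (\<Sum>v\<in>verts E. \<Sum>i<card (?C v). ext0 v (g v (Suc i)) (\<gamma> v (Suc i) x))"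
    proof (intro sum.cong refl)
      fix v
      have "(\<Sum>a\<in>?C v. ext0 (wtop a) (b a) (\<beta> a x)) = (\<Sum>a\<in>?C v. ext0 v (b a) (\<beta> a x))"
        by (intro sum.cong) auto
      also have "\<dots> = (\<Sum>i<card (?C v). ext0 v (b (idx v i)) (\<beta> (idx v i) x))"
        using sum.reindex_bij_betw[OF idx[of v], of "\<lambda>a. ext0 v (b a) (\<beta> a x)"] by (simp add: atLeast0LessThan)
      finally show "(\<Sum>a\<in>?C v. ext0 (wtop a) (b a) (\<beta> a x)) = (\<Sum>i<card (?C v). ext0 v (g v (Suc i)) (\<gamma> v (Suc i) x))"
        by (simp add: g_def \<gamma>_def)
    qed
    finally have dx: "d x = (\<Sum>v\<in>verts E. \<Sum>i<card (?C v). ext0 v (g v (Suc i)) (\<gamma> v (Suc i) x))" .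
    have "Z (H x) = (\<Sum>v\<in>verts E. ext0 v (g v 0) (\<gamma> v 0 x))"
      unfolding Zdec[OF nfhomD(1)[OF H x]] by (simp add: g_def \<gamma>_def)
    moreover have "e x = Z (H x) + d x" by (simp add: d_def)
    ultimately show ?thesis unfolding dx h_def by (simp only: sum.lessThan_Suc_shift sum.distrib)
  qed
  show ?thesis
  proof (intro exI[of _ n] exI[of _ J] exI[of _ Q] exI[of _ h] exI[of _ g] exI[of _ \<gamma>] conjI allI impI ballI)
    show "0 < h v" for v by (simp add: h_def)
    show "(\<Sum>i<n. J i (Q i x)) = (\<Sum>v\<in>verts E. \<Sum>j<h v. ext0 v (g v j) (\<gamma> v j x))" if "x \<in> NF" for x
      using final[OF that] by (simp add: e_def)
  qed (use n in \<open>simp_all add: J Q QJ gm \<gamma>m \<gamma>g \<gamma>p\<close>)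
qed

end


section \<open>The action of the algebra of the hair extension\<close>

text \<open>The hair vertex \<open>(v, j)\<close> indexes the \<open>j\<close>-th copy of the module
  at \<open>v\<close> in a direct summand of the model: \<open>g\<close> gives its generator and
  \<open>\<gamma>\<close> its coordinate. Linearity of \<open>\<gamma>\<close> on the whole function
  space is demanded because actions of free algebras are built from globally linear maps.\<close>

locale hair_model = finite_vwg E w
  for E :: "('v, 'e) pre_digraph" and w :: "'e \<Rightarrow> nat" +
  fixes h :: "'v \<Rightarrow> nat"
    and g \<gamma> :: "'v \<times> nat \<Rightarrow> _"
  assumes h_pos: "v \<in> verts E \<Longrightarrow> 0 < h v"
    and g_mem: "c \<in> verts (hair_graph E h) \<Longrightarrow> g c \<in> NFv (fst c)"
    and plinear_\<gamma>: "plinear (\<gamma> c :: (('v, 'e) word \<Rightarrow>\<^sub>0 'k::field) \<Rightarrow> _)"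
    and \<gamma>_nfhom: "c \<in> verts (hair_graph E h) \<Longrightarrow> nfhom (\<gamma> c) NF"
    and \<gamma>_g: "c \<in> verts (hair_graph E h) \<Longrightarrow> d \<in> verts (hair_graph E h) \<Longrightarrow>
      \<gamma> c (g d) = (if c = d then bgen (fst c) 0 else 0)"
begin

abbreviation (input) "hg \<equiv> hair_graph E h"
abbreviation (input) "hw \<equiv> hair_weight w"

section \<open>Regular vertices, weights and generators of the hair graph\<close>

lemma hair_weight_simps [simp]: "hw (Inl e) = w e" "hw (Inr c) = 1"
  by (simp_all add: hair_weight_def)

lemma hair_verts [simp]: "(v, j) \<in> verts hg \<longleftrightarrow> v \<in> verts E \<and> j < h v"
  by (simp add: hair_graph_def)

lemma hair_arcs [simp]:
  "Inl e \<in> arcs hg \<longleftrightarrow> e \<in> arcs E"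
  "Inr (v, j) \<in> arcs hg \<longleftrightarrow> v \<in> verts E \<and> 1 \<le> j \<and> j < h v"
  by (auto simp: hair_graph_def)

lemma hair_ends [simp]:
  "tail hg (Inl e) = (tail E e, 0)" "head hg (Inl e) = (head E e, 0)"
  "tail hg (Inr (v, j)) = (v, j)" "head hg (Inr (v, j)) = (v, j - 1)"
  by (simp_all add: hair_graph_def)

lemma hair_finite: "finite (verts hg)"
proof -
  have "verts hg = Sigma (verts E) (\<lambda>v. {..<h v})" by (auto simp: hair_graph_def)
  then show ?thesis by simp
qed

lemma hair_wf: "wf_digraph hg"
proof
  fix a assume a: "a \<in> arcs hg"
  show "tail hg a \<in> verts hg"
    using a h_pos by (cases a) (auto simp: hair_graph_def)
  show "head hg a \<in> verts hg"
    using a h_pos by (cases a) (auto simp: hair_graph_def)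
qed

lemma hair_out_arcs:
  "out_arcs hg (v, 0) = Inl ` out_arcs E v"
  "out_arcs hg (v, Suc j) = (if (v, Suc j) \<in> verts hg then {Inr (v, Suc j)} else {})"
  by (auto simp: out_arcs_def hair_graph_def)

lemma hair_regular:
  "(v, 0) \<in> regular_verts hg \<longleftrightarrow> v \<in> regular_verts E"
  "(v, Suc j) \<in> regular_verts hg \<longleftrightarrow> (v, Suc j) \<in> verts hg"
  using h_pos by (auto simp: regular_verts_def hair_out_arcs)

lemma hair_vertex_weight:
  "vertex_weight hg hw (v, 0) = vertex_weight E w v"
  "(v, Suc j) \<in> verts hg \<Longrightarrow> vertex_weight hg hw (v, Suc j) = 1"
  by (simp_all add: vertex_weight_def hair_out_arcs image_image)

lemma hair_wgens:
  "Vtx c \<in> wgens hg hw \<longleftrightarrow> c \<in> verts hg"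
  "Edge a i \<in> wgens hg hw \<longleftrightarrow> a \<in> arcs hg \<and> 1 \<le> i \<and> i \<le> hw a"
  "Ghost a i \<in> wgens hg hw \<longleftrightarrow> a \<in> arcs hg \<and> 1 \<le> i \<and> i \<le> hw a"
  by (auto simp: wgens_def)

lemma plinear_ab: "plinear (act tau p)"
  by (rule plinear_act[OF plinear_tau])

text \<open>
  On the free module with basis \<open>g\<close>, the homomorphism that sends \<open>g c\<close> to \<open>a (g d)\<close> and the other
  generators to \<open>0\<close>.
\<close>

definition mu :: "'v \<times> nat \<Rightarrow> (('v, 'e) wgen fmon \<Rightarrow>\<^sub>0 'k) \<Rightarrow> 'v \<times> nat \<Rightarrow>
    (('v, 'e) word \<Rightarrow>\<^sub>0 'k) \<Rightarrow> (('v, 'e) word \<Rightarrow>\<^sub>0 'k)" where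
  "mu c a d x = act tau (evp 0 (\<gamma> c x) * a) (g d)"

lemma plinear_mu: "plinear (mu c a d)"
  unfolding mu_def
  by (rule plinear_comp[where h = "\<lambda>p. act tau (p * a) (g d)" and f = "\<lambda>x. evp 0 (\<gamma> c x)"])
    (rule plinear_comp[OF plinear_act_left plinear_mult(2)], rule plinear_comp[OF plinear_evp plinear_\<gamma>])

lemma g_NF: "c \<in> verts hg \<Longrightarrow> g c \<in> NF"
  using NFv_subset[OF g_mem] .

lemma evp_\<gamma>: "c \<in> verts hg \<Longrightarrow> x \<in> NF \<Longrightarrow> evp 0 (\<gamma> c x) \<in> carrier (free_algebra (wgens E w))"
  by (intro augmentation_subset evp_mem nfhomD(1)[OF \<gamma>_nfhom])

lemma mu_weq:
  assumes "c \<in> verts hg" "d \<in> verts hg" "weq E w a b" "x \<in> NF"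
  shows "mu c a d x = mu c b d x"
  unfolding mu_def
  by (rule act_weq[OF weq_mult[OF wf weq_refl[OF wf evp_\<gamma>] assms(3)]]) (simp_all add: assms g_NF)

lemma mu_mem:
  assumes "c \<in> verts hg" "d \<in> verts hg" "a \<in> carrier (free_algebra (wgens E w))" "x \<in> NF"
  shows "mu c a d x \<in> NF"
  unfolding mu_def by (intro act_mem free_algebra_closed evp_\<gamma> g_NF assms)

lemma mu_act:
  assumes c: "c \<in> verts hg" and d: "d \<in> verts hg" and a: "a \<in> carrier (free_algebra (wgens E w))"
    and p: "p \<in> carrier (free_algebra (wgens E w))" and x: "x \<in> NF"
  shows "mu c a d (act tau p x) = act tau p (mu c a d x)"
proof -
  note gx = nfhomD(1)[OF \<gamma>_nfhom[OF c] x]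
  have "mu c a d (act tau p x) = act tau (evp 0 (act tau p (\<gamma> c x)) * a) (g d)"
    by (simp add: mu_def act_nfhom[OF \<gamma>_nfhom[OF c] p x])
  also have "\<dots> = act tau (p * evp 0 (\<gamma> c x) * a) (g d)"
    by (rule act_weq[OF weq_mult[OF wf evp_act[OF p gx] weq_refl[OF wf a]] g_NF[OF d]])
  also have "\<dots> = act tau p (mu c a d x)"
    by (simp add: mu_def mult.assoc act_mult[OF plinear_tau])
  finally show ?thesis .
qed

lemma mu_nfhom:
  assumes "c \<in> verts hg" "d \<in> verts hg" "a \<in> carrier (free_algebra (wgens E w))"
  shows "nfhom (mu c a d) NF"
  unfolding nfhom_iff_tau
proof (intro conjI ballI allI)
  fix x :: "('v, 'e) word \<Rightarrow>\<^sub>0 'k" and k assume x: "x \<in> NF" "k \<in> wgens E w"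
  show "mu c a d (tau k x) = tau k (mu c a d x)"
    using mu_act[OF assms gen_carrier[OF wf x(2)] x(1)] by simp
qed (simp_all add: mu_mem assms plinearD[OF plinear_mu])

text \<open>The entries multiply in the opposite order to the maps, as for all endomorphisms of a
  free left module. The vertex appears because \<open>\<gamma> c\<close> sends \<open>g c\<close> to
  the free generator at that vertex.\<close>

lemma mu_comp:
  assumes c: "c \<in> verts hg" and d: "d \<in> verts hg" and a: "a \<in> carrier (free_algebra (wgens E w))"
    and c': "c' \<in> verts hg" and d': "d' \<in> verts hg" and a': "a' \<in> carrier (free_algebra (wgens E w))"
    and x: "x \<in> NF"
  shows "mu c a d (mu c' a' d' x) = (if c = d' then mu c' (a' * (vtx (fst c) * a)) d x else 0)"
proof -
  have p: "evp 0 (\<gamma> c' x) * a' \<in> carrier (free_algebra (wgens E w))"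
    by (intro free_algebra_closed evp_\<gamma> a' c' x)
  have "mu c a d (mu c' a' d' x) = act tau (evp 0 (\<gamma> c' x) * a') (mu c a d (g d'))"
    unfolding mu_def[of c'] by (rule mu_act[OF c d a p g_NF[OF d']])
  then show ?thesis
    by (simp add: mu_def \<gamma>_g c d' act_mult[OF plinear_tau] plinearD[OF plinear_evp] plinearD[OF plinear_ab])
qed

lemma mu_g:
  assumes c: "c \<in> verts hg" and d: "d \<in> verts hg" and b: "b \<in> verts hg"
    and a: "weq E w (vtx (fst c) * a) a"
  shows "mu c a d (g b) = (if b = c then act tau a (g d) else 0)"
  using act_weq[OF a g_NF[OF d]] by (simp add: mu_def \<gamma>_g b c plinearD[OF plinear_evp])

text \<open>The vertices that fix a generator from the right and, in \<open>hl\<close> below, from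
  the left. Its action carries the basis element at the former to a multiple of the one at the
  latter.\<close>

fun hr :: "('v \<times> nat, 'e + 'v \<times> nat) wgen \<Rightarrow> 'v \<times> nat" where
  "hr (Vtx c) = c"
| "hr (Edge a i) = head hg a"
| "hr (Ghost a i) = tail hg a"

fun hl :: "('v \<times> nat, 'e + 'v \<times> nat) wgen \<Rightarrow> 'v \<times> nat" where
  "hl (Vtx c) = c"
| "hl (Edge a i) = tail hg a"
| "hl (Ghost a i) = head hg a"

text \<open>Edges and ghosts of the old graph are exchanged to compensate for the reversed order of
  the entries. Hair edges and their ghosts have the entry one at the vertex, so they act as matrix
  units.\<close>

fun ha :: "('v \<times> nat, 'e + 'v \<times> nat) wgen \<Rightarrow> (('v, 'e) wgen fmon \<Rightarrow>\<^sub>0 'k)" where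
  "ha (Vtx c) = vtx (fst c)"
| "ha (Edge (Inl e) i) = gen (Ghost e i)"
| "ha (Ghost (Inl e) i) = gen (Edge e i)"
| "ha (Edge (Inr c) i) = vtx (fst c)"
| "ha (Ghost (Inr c) i) = vtx (fst c)"

definition hact :: "('v \<times> nat, 'e + 'v \<times> nat) wgen \<Rightarrow> (('v, 'e) word \<Rightarrow>\<^sub>0 'k) \<Rightarrow> (('v, 'e) word \<Rightarrow>\<^sub>0 'k)" where
  "hact k = mu (hr k) (ha k) (hl k)"

lemma plinear_hact: "plinear (hact k)"
  unfolding hact_def by (rule plinear_mu)

lemma hair_gen_cases:
  assumes "k \<in> wgens hg hw"
  obtains v j where "k = Vtx (v, j)" "v \<in> verts E" "j < h v"
    | e i where "k = Edge (Inl e) i" "e \<in> arcs E" "1 \<le> i" "i \<le> w e"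
    | e i where "k = Ghost (Inl e) i" "e \<in> arcs E" "1 \<le> i" "i \<le> w e"
    | v j where "k = Edge (Inr (v, Suc j)) 1" "v \<in> verts E" "Suc j < h v"
    | v j where "k = Ghost (Inr (v, Suc j)) 1" "v \<in> verts E" "Suc j < h v"
proof (cases k)
  case (Vtx c)
  then show ?thesis using that(1)[of "fst c" "snd c"] assms by (cases c) (simp add: hair_wgens)
next
  case (Edge a i)
  show ?thesis
  proof (cases a)
    case (Inl e)
    then show ?thesis using that(2) assms Edge by (simp add: hair_wgens)
  next
    case (Inr c)
    then show ?thesis using that(4)[of "fst c" "snd c - 1"] assms Edge by (cases c) (auto simp: hair_wgens)
  qed
next
  case (Ghost a i)
  show ?thesis
  proof (cases a)
    case (Inl e)
    then show ?thesis using that(3) assms Ghost by (simp add: hair_wgens)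
  next
    case (Inr c)
    then show ?thesis using that(5)[of "fst c" "snd c - 1"] assms Ghost by (cases c) (auto simp: hair_wgens)
  qed
qed

lemma h_props:
  assumes "k \<in> wgens hg hw"
  shows "hr k \<in> verts hg" "hl k \<in> verts hg" "ha k \<in> carrier (free_algebra (wgens E w))"
    "weq E w (vtx (fst (hr k)) * ha k) (ha k)" "weq E w (ha k * vtx (fst (hl k))) (ha k)"
  using assms weq_vtx[OF wf, where w = w]
  by (cases rule: hair_gen_cases; force simp: h_pos intro: vtx_carrier[OF wf] gen_carrier[OF wf] weq_ends[OF wf])+

lemma hact_nfhom: "k \<in> wgens hg hw \<Longrightarrow> nfhom (hact k) NF"
  unfolding hact_def by (intro mu_nfhom h_props)

lemma hact_mem: "k \<in> wgens hg hw \<Longrightarrow> x \<in> NF \<Longrightarrow> hact k x \<in> NF"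
  using nfhomD(1)[OF hact_nfhom] .

lemma hact_comp:
  assumes k: "k \<in> wgens hg hw" and l: "l \<in> wgens hg hw" and x: "x \<in> NF"
  shows "hact k (hact l x) = (if hr k = hl l then mu (hr l) (ha l * ha k) (hl k) x else 0)"
proof -
  note hk = h_props[OF k] and hl = h_props[OF l]
  have "weq E w (ha l * (vtx (fst (hr k)) * ha k)) (ha l * ha k)"
    by (rule weq_mult[OF wf weq_refl[OF wf hl(3)] hk(4)])
  from mu_weq[OF hl(1) hk(2) this x] show ?thesis
    by (simp only: hact_def mu_comp[OF hk(1,2,3) hl(1,2,3) x])
qed

lemma hact_ends:
  assumes k: "k \<in> wgens hg hw" and x: "x \<in> NF"
  shows "hact (Vtx (hl k)) (hact k x) = hact k x" "hact k (hact (Vtx (hr k)) x) = hact k x"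
proof -
  note hk = h_props[OF k]
  have V: "Vtx (hl k) \<in> wgens hg hw" "Vtx (hr k) \<in> wgens hg hw" using hk by (simp_all add: hair_wgens)
  show "hact (Vtx (hl k)) (hact k x) = hact k x"
    using hact_comp[OF V(1) k x] mu_weq[OF hk(1,2,5) x] by (simp add: hact_def)
  show "hact k (hact (Vtx (hr k)) x) = hact k x"
    using hact_comp[OF k V(2) x] mu_weq[OF hk(1,2,4) x] by (simp add: hact_def)
qed

lemma mu_sum: "(\<Sum>i\<in>I. mu c (a i) d x) = mu c (\<Sum>i\<in>I. a i) d x"
  by (simp add: mu_def sum_distrib_left act_left_simps)

text \<open>At an old vertex each matrix relation is the same kind of relation of the old graph with
  its two indices, or its two edges, exchanged. At a hair vertex there is one outgoing edge of
  weight one, and the relation is one between matrix units.\<close>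

lemma hact_relator:
  assumes "r \<in> wlp_relators hg hw" "x \<in> NF"
  shows "act hact r x = 0"
  using assms(1)
proof cases
  case (vtx_vtx u v)
  then have V: "Vtx u \<in> wgens hg hw" "Vtx v \<in> wgens hg hw" by (simp_all add: hair_wgens)
  show ?thesis using hact_comp[OF V assms(2)] hact_ends(1)[OF V(1) assms(2)]
    by (cases "u = v") (simp_all add: vtx_vtx(1) vtx_def act_left_simps act_mult[OF plinear_hact])
next
  case (tail_edge a i)
  then have "Edge a i \<in> wgens hg hw" by (simp add: hair_wgens)
  from hact_ends(1)[OF this assms(2)] show ?thesis
    using tail_edge by (simp add: vtx_def edge_def act_left_simps act_mult[OF plinear_hact])
next
  case (edge_head a i)
  then have "Edge a i \<in> wgens hg hw" by (simp add: hair_wgens)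
  from hact_ends(2)[OF this assms(2)] show ?thesis
    using edge_head by (simp add: vtx_def edge_def act_left_simps act_mult[OF plinear_hact])
next
  case (head_ghost a i)
  then have "Ghost a i \<in> wgens hg hw" by (simp add: hair_wgens)
  from hact_ends(1)[OF this assms(2)] show ?thesis
    using head_ghost by (simp add: vtx_def ghost_def act_left_simps act_mult[OF plinear_hact])
next
  case (ghost_tail a i)
  then have "Ghost a i \<in> wgens hg hw" by (simp add: hair_wgens)
  from hact_ends(2)[OF this assms(2)] show ?thesis
    using ghost_tail by (simp add: vtx_def ghost_def act_left_simps act_mult[OF plinear_hact])
next
  case (edge_ghost c i j)
  obtain v m where c: "c = (v, m)" by (cases c)
  show ?thesis
  proof (cases m)
    case 0
    have v: "v \<in> regular_verts E" "v \<in> verts E" and ij: "i \<le> vertex_weight E w v" "j \<le> vertex_weight E w v"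
      using edge_ghost c 0 by (auto simp: hair_regular hair_vertex_weight regular_iff)
    have vh: "(v, 0) \<in> verts hg" using v h_pos by simp
    have "act hact (\<Sum>a\<in>out_arcs hg c. edge hw a i * ghost hw a j) x =
        (\<Sum>e\<in>out_arcs E v. mu c (gen (Edge e j) * gen (Ghost e i)) c x)"
      unfolding c 0 hair_out_arcs act_left_simps
    proof (subst sum.reindex, simp, unfold o_def, intro sum.cong refl)
      fix e assume e: "e \<in> out_arcs E v"
      then have "Edge (Inl e) i \<in> wgens hg hw" "Ghost (Inl e) j \<in> wgens hg hw" "i \<le> w e" "j \<le> w e"
        using edge_ghost ij vertex_weight_eq[OF e] by (simp_all add: hair_wgens)
      then show "act hact (edge hw (Inl e) i * ghost hw (Inl e) j) x = mu (v, 0) (gen (Edge e j) * gen (Ghost e i)) (v, 0) x"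
        using e hact_comp[of "Edge (Inl e) i" "Ghost (Inl e) j" x] assms(2)
        by (simp add: edge_def ghost_def act_mult[OF plinear_hact])
    qed
    also have "\<dots> = mu c (\<Sum>e\<in>out_arcs E v. edge w e j * ghost w e i) c x"
      unfolding mu_sum[symmetric]
    proof (intro sum.cong refl)
      fix e assume "e \<in> out_arcs E v"
      then show "mu c (gen (Edge e j) * gen (Ghost e i)) c x = mu c (edge w e j * ghost w e i) c x"
        using ij vertex_weight_eq[of e v] by (simp add: edge_def ghost_def)
    qed
    also have "\<dots> = mu c (if j = i then vtx v else 0) c x"
      using edge_ghost(3-6) v ij c 0 vh
      by (intro mu_weq assms(2) weq_relator[OF wf wlp_relators.edge_ghost[OF v(1)]])
        (auto intro: vtx_carrier[OF wf] free_algebra_0_1)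
    also have "\<dots> = (if i = j then hact (Vtx c) x else 0)"
      using c by (simp add: hact_def mu_def)
    finally show ?thesis unfolding edge_ghost(1) by (simp add: act_left_simps vtx_def)
  next
    case (Suc m')
    then have v: "(v, Suc m') \<in> verts hg" using edge_ghost c by (simp only: hair_regular)
    then have ij: "i = 1" "j = 1" using edge_ghost c Suc by (simp_all only: hair_vertex_weight)
    have k: "Edge (Inr c) 1 \<in> wgens hg hw" "Ghost (Inr c) 1 \<in> wgens hg hw" "Vtx c \<in> wgens hg hw"
      using v c Suc by (simp_all add: hair_wgens)
    have "act hact (\<Sum>a\<in>out_arcs hg c. edge hw a i * ghost hw a j) x = hact (Edge (Inr c) 1) (hact (Ghost (Inr c) 1) x)"
      using v ij by (simp add: c Suc hair_out_arcs edge_def ghost_def act_mult[OF plinear_hact])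
    also have "\<dots> = hact (Vtx c) (hact (Vtx c) x)"
      using hact_comp[OF k(1,2) assms(2)] hact_comp[OF k(3,3) assms(2)] by (simp add: c)
    also have "\<dots> = hact (Vtx c) x" using hact_ends(1)[OF k(3) assms(2)] by simp
    finally show ?thesis unfolding edge_ghost(1) by (simp add: act_left_simps vtx_def ij)
  qed
next
  case (ghost_edge c a b)
  obtain v m where c: "c = (v, m)" by (cases c)
  show ?thesis
  proof (cases m)
    case 0
    obtain e f where e: "a = Inl e" "e \<in> out_arcs E v" and f: "b = Inl f" "f \<in> out_arcs E v"
      using ghost_edge(3,4) unfolding c 0 hair_out_arcs by blast
    have v: "v \<in> regular_verts E" using ghost_edge(2) c 0 by (simp add: hair_regular)
    note wt = vertex_weight_eq[OF e(2)] vertex_weight_eq[OF f(2)]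
    have arcs: "e \<in> arcs E" "tail E e = v" "f \<in> arcs E" "tail E f = v" using e f by auto
    have heads: "(head E e, 0) \<in> verts hg" "(head E f, 0) \<in> verts hg" using arcs h_pos by simp_all
    have "act hact (\<Sum>i = 1..vertex_weight hg hw c. ghost hw a i * edge hw b i) x =
        (\<Sum>i = 1..vertex_weight E w v. mu (head E f, 0) (gen (Ghost f i) * gen (Edge e i)) (head E e, 0) x)"
      unfolding c 0 hair_vertex_weight act_left_simps
    proof (intro sum.cong refl)
      fix i assume i: "i \<in> {1..vertex_weight E w v}"
      then have "Ghost a i \<in> wgens hg hw" "Edge b i \<in> wgens hg hw" "i \<le> w e" "i \<le> w f"
        using e f wt by (simp_all add: hair_wgens)
      then show "act hact (ghost hw a i * edge hw b i) x = mu (head E f, 0) (gen (Ghost f i) * gen (Edge e i)) (head E e, 0) x"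
        using arcs e f hact_comp[of "Ghost a i" "Edge b i" x] assms(2)
        by (simp add: edge_def ghost_def act_mult[OF plinear_hact])
    qed
    also have "\<dots> = mu (head E f, 0) (\<Sum>i = 1..vertex_weight E w v. ghost w f i * edge w e i) (head E e, 0) x"
      unfolding mu_sum[symmetric] using wt
      by (intro sum.cong refl) (simp add: edge_def ghost_def)
    also have "\<dots> = mu (head E f, 0) (if f = e then vtx (head E f) else 0) (head E e, 0) x"
      using arcs by (intro mu_weq heads assms(2) weq_relator[OF wf wlp_relators.ghost_edge[OF v f(2) e(2)]])
        (auto intro: vtx_carrier[OF wf] free_algebra_0_1)
    also have "\<dots> = (if a = b then hact (Vtx (head hg a)) x else 0)"
      using e f by (auto simp: hact_def mu_def)
    finally show ?thesis unfolding ghost_edge(1) by (simp add: act_left_simps vtx_def)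
  next
    case (Suc m')
    then have v: "(v, Suc m') \<in> verts hg" using ghost_edge c by (simp only: hair_regular)
    then have ab: "a = Inr c" "b = Inr c" using ghost_edge c Suc by (simp_all add: hair_out_arcs)
    have k: "Edge (Inr c) 1 \<in> wgens hg hw" "Ghost (Inr c) 1 \<in> wgens hg hw" "Vtx (v, m') \<in> wgens hg hw"
      using v c Suc by (simp_all add: hair_wgens)
    have "act hact (\<Sum>i = 1..vertex_weight hg hw c. ghost hw a i * edge hw b i) x = hact (Ghost (Inr c) 1) (hact (Edge (Inr c) 1) x)"
      using v ab hair_vertex_weight(2)[OF v] by (simp add: c Suc edge_def ghost_def act_mult[OF plinear_hact])
    also have "\<dots> = hact (Vtx (v, m')) (hact (Vtx (v, m')) x)"
      using hact_comp[OF k(2,1) assms(2)] hact_comp[OF k(3,3) assms(2)] by (simp add: c Suc)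
    also have "\<dots> = hact (Vtx (v, m')) x" using hact_ends(1)[OF k(3) assms(2)] by simp
    finally show ?thesis unfolding ghost_edge(1) by (simp add: act_left_simps vtx_def ab c Suc)
  qed
qed

lemma hact_ideal:
  assumes "p \<in> wlp_ideal hg hw" "x \<in> NF"
  shows "act hact p x = 0"
proof -
  have "act hact p x \<in> {0}"
    by (rule wlp_ideal_act[OF hair_wf plinear_hact NF_closed(1-3) hact_mem])
      (use assms hact_relator in \<open>auto simp: plinearD[OF plinear_hact]\<close>)
  then show ?thesis by simp
qed

lemma hact_weq: "weq hg hw p q \<Longrightarrow> x \<in> NF \<Longrightarrow> act hact p x = act hact q x"
  using hact_ideal[of "p - q" x] by (simp add: weq_def act_left_simps)

lemma act_hact_mem: "p \<in> carrier (free_algebra (wgens hg hw)) \<Longrightarrow> x \<in> NF \<Longrightarrow> act hact p x \<in> NF"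
  by (rule act_closed[OF NF_closed(1-3) hact_mem])

lemma plinear_act_hact: "plinear (act hact p)"
  by (rule plinear_act[OF plinear_hact])

lemma act_hact_nfhom:
  assumes p: "p \<in> carrier (free_algebra (wgens hg hw))"
  shows "nfhom (act hact p) NF"
  unfolding nfhom_iff_tau
proof (intro conjI ballI allI)
  fix x :: "('v, 'e) word \<Rightarrow>\<^sub>0 'k" and k assume x: "x \<in> NF" "k \<in> wgens E w"
  have "tau k (act hact p x) = act hact p (tau k x)"
  proof (rule act_commute[OF _ _ _ NF_closed(1-3) hact_mem p x(1)])
    fix l and y :: "('v, 'e) word \<Rightarrow>\<^sub>0 'k" assume l: "l \<in> wgens hg hw" and y: "y \<in> NF"
    show "tau k (hact l y) = hact l (tau k y)"
      using hact_nfhom[OF l] y x(2) unfolding nfhom_iff_tau by simp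
  qed (simp_all add: tau_simps)
  then show "act hact p (tau k x) = tau k (act hact p x)" by simp
qed (simp_all add: act_hact_mem p plinearD[OF plinear_act_hact])

lemma act_hact_commute:
  "p \<in> carrier (free_algebra (wgens hg hw)) \<Longrightarrow> q \<in> carrier (free_algebra (wgens E w)) \<Longrightarrow> x \<in> NF \<Longrightarrow>
    act hact p (act tau q x) = act tau q (act hact p x)"
  by (rule act_nfhom[OF act_hact_nfhom])

lemma hact_g:
  assumes "k \<in> wgens hg hw" "b \<in> verts hg"
  shows "hact k (g b) = (if b = hr k then act tau (ha k) (g (hl k)) else 0)"
  unfolding hact_def by (rule mu_g[OF h_props(1,2)[OF assms(1)] assms(2) h_props(4)[OF assms(1)]])

end


section \<open>Faithfulness and fullness\<close>

context hair_model begin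

abbreviation (input) "H \<equiv> free_algebra (wgens hg hw) :: (('v \<times> nat, 'e + 'v \<times> nat) wgen fmon \<Rightarrow>\<^sub>0 'k) ring"

declare weq_trans[OF hair_wf, trans]

lemma heq_left: "p \<in> carrier H \<Longrightarrow> weq hg hw q r \<Longrightarrow> weq hg hw (p * q) (p * r)"
  by (intro weq_mult[OF hair_wf] weq_refl[OF hair_wf])

lemma heq_right: "p \<in> carrier H \<Longrightarrow> weq hg hw q r \<Longrightarrow> weq hg hw (q * p) (r * p)"
  by (intro weq_mult[OF hair_wf] weq_refl[OF hair_wf])

lemma heq_mult_0:
  assumes p: "weq hg hw (p * vtx b) p" and q: "weq hg hw (vtx c * q) q"
    and bc: "b \<in> verts hg" "c \<in> verts hg" "b \<noteq> c"
  shows "weq hg hw (p * q) (0 :: _ \<Rightarrow>\<^sub>0 'k)"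
proof -
  note C = weq_carrier(2)[OF hair_wf p] weq_carrier(2)[OF hair_wf q]
  have "weq hg hw (p * q) (p * vtx b * (vtx c * q))"
    by (rule weq_mult[OF hair_wf weq_sym[OF hair_wf p] weq_sym[OF hair_wf q]])
  also have "p * vtx b * (vtx c * q) = p * ((vtx b * vtx c) * q)" by (simp add: mult.assoc)
  also have "weq hg hw \<dots> (p * (0 * q))"
    using weq_vtx[OF hair_wf bc(1,2), of hw] bc(3) C by (intro heq_left heq_right) auto
  finally show ?thesis by simp
qed

text \<open>The involution of \<open>L(E, w)\<close>, followed by the inclusion into the algebra of the hair extension.\<close>

fun igen :: "('v, 'e) wgen \<Rightarrow> ('v \<times> nat, 'e + 'v \<times> nat) wgen" where
  "igen (Vtx v) = Vtx (v, 0)"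
| "igen (Edge e i) = Ghost (Inl e) i"
| "igen (Ghost e i) = Edge (Inl e) i"

definition iota :: "(('v, 'e) wgen fmon \<Rightarrow>\<^sub>0 'k) \<Rightarrow> (('v \<times> nat, 'e + 'v \<times> nat) wgen fmon \<Rightarrow>\<^sub>0 'k)" where
  "iota p = act (\<lambda>k q. q * gen (igen k)) p 1"

lemma plinear_iota: "plinear iota"
  unfolding iota_def by (rule plinear_act_left)

lemmas iota_simps = plinearD[OF plinear_iota]

lemma act_right_mult:
  "act (\<lambda>k q. q * gen (igen k)) p y = y * (iota p)"
proof -
  have "y * act (\<lambda>k q. q * gen (igen k)) p 1 = act (\<lambda>k q. q * gen (igen k)) p (y * 1)"
    by (rule act_commute[where Y = UNIV and G = UNIV])
      (auto simp: mem_free_algebra mult.assoc algebra_simps mult_pscale)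
  then show ?thesis by (simp add: iota_def)
qed

text \<open>The letters act by right multiplication, which collects them in reverse order.\<close>

lemma iota_mult: "iota (p * q) = iota q * iota p"
proof -
  have "iota (p * q) = act (\<lambda>k q. q * gen (igen k)) p (iota q)"
    unfolding iota_def by (rule act_mult) (rule plinear_mult)
  then show ?thesis by (simp add: act_right_mult)
qed

lemma iota_gen [simp]: "iota (gen k) = gen (igen k)"
  by (simp add: iota_def)

lemma iota_letters [simp]:
  "iota (vtx v) = vtx (v, 0)" "iota (edge w e i) = ghost hw (Inl e) i" "iota (ghost w e i) = edge hw (Inl e) i"
  by (simp_all add: vtx_def edge_def ghost_def iota_simps)

lemma igen_mem: "k \<in> wgens E w \<Longrightarrow> igen k \<in> wgens hg hw"
  using h_pos by (cases k) (auto simp: hair_wgens)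

lemma iota_carrier: "p \<in> carrier (free_algebra (wgens E w)) \<Longrightarrow> iota p \<in> carrier H"
  unfolding iota_def
  by (rule act_closed[where G = "wgens E w"])
    (auto intro: free_algebra_closed free_algebra_0_1 pscale_mem gen_carrier[OF hair_wf] igen_mem)

lemma iota_relator: "r \<in> wlp_relators E w \<Longrightarrow> iota r \<in> wlp_relators hg hw"
proof (induction rule: wlp_relators.cases)
  case (vtx_vtx u v)
  then show ?case
    using wlp_relators.vtx_vtx[of "(v, 0)" hg "(u, 0)" hw] h_pos by (auto simp: iota_simps iota_mult)
next
  case (tail_edge e i)
  then show ?case
    using wlp_relators.ghost_tail[of "Inl e" hg i hw] by (simp add: iota_simps iota_mult)
next
  case (edge_head e i)
  then show ?case
    using wlp_relators.head_ghost[of "Inl e" hg i hw] by (simp add: iota_simps iota_mult)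
next
  case (head_ghost e i)
  then show ?case
    using wlp_relators.edge_head[of "Inl e" hg i hw] by (simp add: iota_simps iota_mult)
next
  case (ghost_tail e i)
  then show ?case
    using wlp_relators.tail_edge[of "Inl e" hg i hw] by (simp add: iota_simps iota_mult)
next
  case (edge_ghost v i j)
  then show ?case
    using wlp_relators.edge_ghost[of "(v, 0)" hg j hw i]
    by (cases "i = j") (simp_all add: iota_simps iota_mult hair_regular hair_vertex_weight hair_out_arcs sum.reindex)
next
  case (ghost_edge v e f)
  then show ?case
    using wlp_relators.ghost_edge[of "(v, 0)" hg "Inl f" "Inl e" hw]
    by (auto simp: iota_simps iota_mult hair_regular hair_vertex_weight hair_out_arcs)
qed

text \<open>Relators are sent to relators, so \<open>wlp_ideal_act\<close> applies to the right
  multiplications.\<close>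

lemma iota_weq: "weq E w p q \<Longrightarrow> weq hg hw (iota p) (iota q)"
proof -
  assume pq: "weq E w p q"
  have "act (\<lambda>k q. q * gen (igen k)) (p - q) 1 \<in> wlp_ideal hg hw"
  proof (rule wlp_ideal_act[OF wf plinear_mult(2), where Y = "carrier H"])
    fix r :: "('v, 'e) wgen fmon \<Rightarrow>\<^sub>0 'k" and y assume "r \<in> wlp_relators E w" "y \<in> carrier H"
    then show "act (\<lambda>k q. q * gen (igen k)) r y \<in> wlp_ideal hg hw"
      unfolding act_right_mult by (intro wlp_ideal_mem[OF hair_wf] iota_relator)
  qed (use pq in \<open>auto simp: weq_def intro: wlp_ideal_mem[OF hair_wf] wlp_ideal_pscale[OF hair_wf]
      free_algebra_closed free_algebra_0_1 pscale_mem gen_carrier[OF hair_wf] igen_mem\<close>)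
  then have "iota p - iota q \<in> wlp_ideal hg hw" by (simp add: iota_def[symmetric] iota_simps)
  then show ?thesis using pq iota_carrier by (simp add: weq_def)
qed

definition gsum :: "('v, 'e) word \<Rightarrow>\<^sub>0 'k" where
  "gsum = (\<Sum>v\<in>verts E. g (v, 0))"

lemma root_mem: "v \<in> verts E \<Longrightarrow> (v, 0) \<in> verts hg"
  using h_pos by simp

lemma gsum_NF: "gsum \<in> NF"
  unfolding gsum_def by (intro NF_sum g_NF root_mem)

lemma vproj_g: "c \<in> verts hg \<Longrightarrow> vproj u (g c) = (if fst c = u then g c else 0)"
  using vproj_id[OF g_mem[of c]] vproj_other[OF g_mem[of c], of u] by auto

lemma vproj_gsum: "u \<in> verts E \<Longrightarrow> vproj u gsum = g (u, 0)"
  using root_mem by (simp add: gsum_def vproj_simps vproj_g sum.delta)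

text \<open>\<open>gsum\<close> plays the role of the identity element, on which multiplication from
  the right and from the left by the same letter agree.\<close>

lemma hact_igen:
  assumes k: "k \<in> wgens E w"
  shows "hact (igen k) gsum = tau k gsum"
proof -
  obtain u where u: "hr (igen k) = (u, 0)" "u \<in> verts E"
    using k by (cases k) auto
  have "hact (igen k) gsum = (\<Sum>v\<in>verts E. hact (igen k) (g (v, 0)))"
    unfolding gsum_def by (rule plinearD[OF plinear_hact])
  also have "\<dots> = (\<Sum>v\<in>verts E. if v = u then act tau (ha (igen k)) (g (hl (igen k))) else 0)"
    by (intro sum.cong refl) (simp add: hact_g[OF igen_mem[OF k] root_mem] u)
  also have "\<dots> = act tau (ha (igen k)) (g (hl (igen k)))" using u(2) by (simp add: sum.delta)
  also have "\<dots> = tau k gsum"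
  proof (cases k)
    case (Vtx v)
    then show ?thesis using k root_mem[of v] by (simp add: vproj_g vproj_gsum)
  next
    case (Edge e i)
    then have e: "e \<in> arcs E" using k by simp
    have "lam (Inl (tail E e, i)) (Inr e) gsum = lam (Inl (tail E e, i)) (Inr e) (vproj (head E e) gsum)"
      using lam_vproj[of "Inr e" gsum "Inl (tail E e, i)"] e gsum_NF by simp
    then show ?thesis using Edge e by (simp add: vproj_gsum)
  next
    case (Ghost e i)
    then have e: "e \<in> arcs E" "Inl (tail E e, i) \<in> wslots E w" using k edge_opps[of e i] by simp_all
    have "lam (Inr e) (Inl (tail E e, i)) gsum = lam (Inr e) (Inl (tail E e, i)) (vproj (tail E e) gsum)"
      using lam_vproj[of "Inl (tail E e, i)" gsum "Inr e"] e gsum_NF by simp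
    then show ?thesis using Ghost e by (simp add: vproj_gsum)
  qed
  finally show ?thesis .
qed

text \<open>Endomorphisms commute with the algebra, so the agreement on letters extends to words;
  this is where the reversal by \<open>iota\<close> is used.\<close>

lemma act_iota:
  assumes p: "p \<in> carrier (free_algebra (wgens E w))"
  shows "act hact (iota p) gsum = act tau p gsum"
proof (rule plinear_eq_on[where f = "\<lambda>p. act hact (iota p) gsum" and g = "\<lambda>p. act tau p gsum" and x = p])
  show "plinear (\<lambda>p. act hact (iota p) gsum)" by (rule plinear_comp[OF plinear_act_left plinear_iota])
  show "plinear (\<lambda>p. act tau p gsum)" by (rule plinear_act_left)
  fix m assume "m \<in> Poly_Mapping.keys p"
  then have m: "set (letters m) \<subseteq> wgens E w" using p by (auto simp: mem_free_algebra)
  have "act hact (iota (Poly_Mapping.single (FMon l) 1)) gsum = act tau (Poly_Mapping.single (FMon l) 1) gsum"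
    if "set l \<subseteq> wgens E w" for l
    using that
  proof (induction l)
    case Nil
    have 1: "Poly_Mapping.single (FMon []) (1 :: 'k) = (1 :: ('v, 'e) wgen fmon \<Rightarrow>\<^sub>0 'k)"
      unfolding zero_fmon_def[symmetric] by (rule single_one)
    show ?case unfolding 1 by (simp add: iota_def)
  next
    case (Cons k l)
    then have k: "k \<in> wgens E w" and l: "set l \<subseteq> wgens E w" by auto
    let ?S = "Poly_Mapping.single (FMon l) 1 :: ('v, 'e) wgen fmon \<Rightarrow>\<^sub>0 'k"
    have S: "?S \<in> carrier (free_algebra (wgens E w))" using l by (simp add: mem_free_algebra)
    have kl: "Poly_Mapping.single (FMon (k # l)) 1 = gen k * ?S"
      by (simp add: gen_def mult_single plus_fmon_def)
    have "act hact (iota ?S) (tau k gsum) = tau k (act hact (iota ?S) gsum)"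
      using act_hact_commute[OF iota_carrier[OF S] gen_carrier[OF wf k] gsum_NF] by simp
    then show ?case
      unfolding kl using Cons.IH[OF l] hact_igen[OF k]
      by (simp add: iota_mult act_mult[OF plinear_hact] act_mult[OF plinear_tau])
  qed
  from this[OF m] show "act hact (iota (Poly_Mapping.single m 1)) gsum = act tau (Poly_Mapping.single m 1) gsum"
    by simp
qed

lemma act_iota_g:
  assumes p: "p \<in> carrier (free_algebra (wgens E w))" and u: "u \<in> verts E"
  shows "act hact (iota p) (g (u, 0)) = vproj u (act tau p gsum)"
proof -
  have "act hact (iota p) (g (u, 0)) = act hact (iota p) (act tau (vtx u) gsum)"
    using u by (simp add: vproj_gsum)
  also have "\<dots> = vproj u (act tau p gsum)"
    using act_hact_commute[OF iota_carrier[OF p] vtx_carrier[OF wf u] gsum_NF] by (simp add: act_iota p)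
  finally show ?thesis .
qed

text \<open>The path along the hair from \<open>(v, j)\<close> to \<open>(v, 0)\<close>, and the corresponding ghost path.\<close>

fun pth :: "'v \<times> nat \<Rightarrow> (('v \<times> nat, 'e + 'v \<times> nat) wgen fmon \<Rightarrow>\<^sub>0 'k)" where
  "pth (v, 0) = vtx (v, 0)"
| "pth (v, Suc j) = gen (Edge (Inr (v, Suc j)) 1) * pth (v, j)"

fun pthg :: "'v \<times> nat \<Rightarrow> (('v \<times> nat, 'e + 'v \<times> nat) wgen fmon \<Rightarrow>\<^sub>0 'k)" where
  "pthg (v, 0) = vtx (v, 0)"
| "pthg (v, Suc j) = pthg (v, j) * gen (Ghost (Inr (v, Suc j)) 1)"

lemma hair_relations:
  assumes "(v, Suc j) \<in> verts hg"
  shows "weq hg hw (gen (Edge (Inr (v, Suc j)) 1) * gen (Ghost (Inr (v, Suc j)) 1)) (vtx (v, Suc j) :: _ \<Rightarrow>\<^sub>0 'k)"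
    and "weq hg hw (gen (Ghost (Inr (v, Suc j)) 1) * gen (Edge (Inr (v, Suc j)) 1)) (vtx (v, j) :: _ \<Rightarrow>\<^sub>0 'k)"
proof -
  have r: "(v, Suc j) \<in> regular_verts hg" using assms by (simp only: hair_regular)
  have v: "(v, j) \<in> verts hg" using assms by simp
  show "weq hg hw (gen (Edge (Inr (v, Suc j)) 1) * gen (Ghost (Inr (v, Suc j)) 1)) (vtx (v, Suc j) :: _ \<Rightarrow>\<^sub>0 'k)"
    using wlp_relators.edge_ghost[OF r, of 1 hw 1] assms
    by (intro weq_relator[OF hair_wf] vtx_carrier[OF hair_wf])
      (simp_all add: hair_out_arcs hair_vertex_weight edge_def ghost_def)
  show "weq hg hw (gen (Ghost (Inr (v, Suc j)) 1) * gen (Edge (Inr (v, Suc j)) 1)) (vtx (v, j) :: _ \<Rightarrow>\<^sub>0 'k)"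
    using wlp_relators.ghost_edge[OF r, of "Inr (v, Suc j)" "Inr (v, Suc j)" hw] assms v
    by (intro weq_relator[OF hair_wf] vtx_carrier[OF hair_wf])
      (simp_all add: hair_out_arcs hair_vertex_weight edge_def ghost_def)
qed

text \<open>Induction along the hair: in the product of the two paths the innermost edge and ghost
  cancel to a vertex, by the weight one relations.\<close>

lemma pth_props:
  assumes "(v, j) \<in> verts hg"
  shows "pth (v, j) \<in> augmentation (wgens hg hw) \<and> pthg (v, j) \<in> augmentation (wgens hg hw) \<and>
    weq hg hw (vtx (v, j) * pth (v, j)) (pth (v, j)) \<and> weq hg hw (pth (v, j) * vtx (v, 0)) (pth (v, j)) \<and>
    weq hg hw (pthg (v, j) * vtx (v, j)) (pthg (v, j)) \<and> weq hg hw (vtx (v, 0) * pthg (v, j)) (pthg (v, j)) \<and>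
    weq hg hw (pthg (v, j) * pth (v, j)) (vtx (v, 0)) \<and> weq hg hw (pth (v, j) * pthg (v, j)) (vtx (v, j))"
  using assms
proof (induction j)
  case 0
  then show ?case using weq_vtx[OF hair_wf 0 0, of hw] vtx_mem[OF hair_wf 0, of hw] by simp
next
  case (Suc j)
  let ?E = "gen (Edge (Inr (v, Suc j)) 1) :: ('v \<times> nat, 'e + 'v \<times> nat) wgen fmon \<Rightarrow>\<^sub>0 'k"
  let ?G = "gen (Ghost (Inr (v, Suc j)) 1) :: ('v \<times> nat, 'e + 'v \<times> nat) wgen fmon \<Rightarrow>\<^sub>0 'k"
  let ?p = "pth (v, j)" and ?q = "pthg (v, j)"
  have v: "(v, j) \<in> verts hg" using Suc.prems by simp
  note IH = Suc.IH[OF v]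
  then have p: "?p \<in> augmentation (wgens hg hw)" "?q \<in> augmentation (wgens hg hw)"
    and pC: "?p \<in> carrier H" "?q \<in> carrier H" by (auto intro: augmentation_subset)
  have k: "Edge (Inr (v, Suc j)) 1 \<in> wgens hg hw" "Ghost (Inr (v, Suc j)) 1 \<in> wgens hg hw"
    using Suc.prems by (simp_all add: hair_wgens)
  have E: "?E \<in> carrier H" and G: "?G \<in> carrier H" using gen_carrier[OF hair_wf k(1)] gen_carrier[OF hair_wf k(2)] .
  have en: "weq hg hw (vtx (v, Suc j) * ?E) ?E" "weq hg hw (?G * vtx (v, Suc j)) ?G"
    "weq hg hw (?E * vtx (v, j)) ?E" "weq hg hw (vtx (v, j) * ?G) ?G"
    using weq_ends[OF hair_wf, of "Inr (v, Suc j)" 1 hw] Suc.prems by simp_all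
  note rel = hair_relations[OF Suc.prems]
  have "weq hg hw (?q * ?G * (?E * ?p)) (vtx (v, 0))"
  proof -
    have "?q * ?G * (?E * ?p) = ?q * (?G * ?E * ?p)" by (simp add: mult.assoc)
    also have "weq hg hw \<dots> (?q * (vtx (v, j) * ?p))" by (intro heq_left heq_right rel pC)
    also have "weq hg hw \<dots> (?q * ?p)" using IH by (intro heq_left pC) simp
    also have "weq hg hw \<dots> (vtx (v, 0))" using IH by simp
    finally show ?thesis .
  qed
  moreover have "weq hg hw (?E * ?p * (?q * ?G)) (vtx (v, Suc j))"
  proof -
    have "?E * ?p * (?q * ?G) = ?E * (?p * ?q * ?G)" by (simp add: mult.assoc)
    also have "weq hg hw \<dots> (?E * (vtx (v, j) * ?G))" using IH by (intro heq_left heq_right E G) simp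
    also have "weq hg hw \<dots> (?E * ?G)" by (intro heq_left E en)
    also have "weq hg hw \<dots> (vtx (v, Suc j))" by (rule rel)
    finally show ?thesis .
  qed
  moreover have "?E * ?p \<in> augmentation (wgens hg hw)" "?q * ?G \<in> augmentation (wgens hg hw)"
    by (intro augmentation_closed gen_mem k p)+
  moreover have "weq hg hw (vtx (v, Suc j) * (?E * ?p)) (?E * ?p)" "weq hg hw (?q * ?G * vtx (v, Suc j)) (?q * ?G)"
    using heq_right[OF pC(1) en(1)] heq_left[OF pC(2) en(2)] by (simp_all add: mult.assoc)
  moreover have "weq hg hw (?E * ?p * vtx (v, 0)) (?E * ?p)" "weq hg hw (vtx (v, 0) * (?q * ?G)) (?q * ?G)"
    using heq_left[OF E, of "?p * vtx (v, 0)" ?p] heq_right[OF G, of "vtx (v, 0) * ?q" ?q] IH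
    by (simp_all add: mult.assoc)
  ultimately show ?case by simp
qed

lemma pthD:
  assumes "c \<in> verts hg"
  shows "pth c \<in> augmentation (wgens hg hw)" "pthg c \<in> augmentation (wgens hg hw)"
    "weq hg hw (vtx c * pth c) (pth c)" "weq hg hw (pth c * vtx (fst c, 0)) (pth c)"
    "weq hg hw (pthg c * vtx c) (pthg c)" "weq hg hw (vtx (fst c, 0) * pthg c) (pthg c)"
    "weq hg hw (pthg c * pth c) (vtx (fst c, 0))" "weq hg hw (pth c * pthg c) (vtx c)"
  using pth_props[of "fst c" "snd c"] assms by simp_all

lemma pth_carrier: "c \<in> verts hg \<Longrightarrow> pth c \<in> carrier H" "c \<in> verts hg \<Longrightarrow> pthg c \<in> carrier H"
  by (intro augmentation_subset pthD; assumption)+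

text \<open>The identity is the sum of the \<open>pth c * pthg c\<close>. Inserting it on both sides
  decomposes \<open>p\<close> into its matrix entries, transported to the old vertices.\<close>

lemma heq_decomp:
  assumes p: "p \<in> augmentation (wgens hg hw)"
  shows "weq hg hw p (\<Sum>c\<in>verts hg. \<Sum>d\<in>verts hg. pth d * (pthg d * p * pth c) * pthg c)"
proof -
  let ?one = "\<Sum>c\<in>verts hg. vtx c :: _ \<Rightarrow>\<^sub>0 'k" and ?S = "\<Sum>c\<in>verts hg. pth c * pthg c"
  have pC: "p \<in> carrier H" by (rule augmentation_subset[OF p])
  have one: "weq hg hw ?one ?S" by (rule weq_sum[OF hair_wf weq_sym[OF hair_wf pthD(8)]])
  have "weq hg hw p (p * ?one)" by (rule weq_sym[OF hair_wf weq_one(2)[OF hair_wf hair_finite p]])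
  also have "weq hg hw \<dots> (?one * p * ?one)"
    by (rule heq_right[OF carrier_sum[OF vtx_carrier[OF hair_wf]] weq_sym[OF hair_wf weq_one(1)[OF hair_wf hair_finite p]]])
  also have "weq hg hw \<dots> (?S * p * ?S)"
    by (intro weq_mult[OF hair_wf] one weq_refl[OF hair_wf pC])
  also have "?S * p * ?S = (\<Sum>c\<in>verts hg. \<Sum>d\<in>verts hg. pth d * (pthg d * p * pth c) * pthg c)"
    by (simp add: sum_distrib_left sum_distrib_right mult.assoc)
  finally show ?thesis .
qed

text \<open>If the paths do not meet the ends of the generator, the product vanishes. If they do, a
  hair edge is absorbed into the paths and leaves a vertex, and an edge of the old graph is left
  unchanged.\<close>

lemma sandwich_gen:
  assumes k: "k \<in> wgens hg hw" and c: "c \<in> verts hg" and d: "d \<in> verts hg"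
  shows "\<exists>a\<in>augmentation (wgens E w). weq hg hw (pthg d * gen k * pth c) (iota a)"
proof -
  have gk: "gen k \<in> carrier H" by (rule gen_carrier[OF hair_wf k])
  have en: "weq hg hw (vtx (hl k) * gen k) (gen k :: _ \<Rightarrow>\<^sub>0 'k)" "weq hg hw (gen k * vtx (hr k)) (gen k :: _ \<Rightarrow>\<^sub>0 'k)"
  proof (atomize (full), cases k)
    case (Vtx b)
    then show "weq hg hw (vtx (hl k) * gen k) (gen k :: _ \<Rightarrow>\<^sub>0 'k) \<and> weq hg hw (gen k * vtx (hr k)) (gen k :: _ \<Rightarrow>\<^sub>0 'k)"
      using weq_vtx[OF hair_wf, of b b hw] k by (simp add: hair_wgens vtx_def)
  qed (use k in \<open>simp_all add: hair_wgens weq_ends[OF hair_wf]\<close>)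
  note D = pthD[OF d] and C = pthD[OF c] and PC = pth_carrier(1)[OF c] and QD = pth_carrier(2)[OF d]
  consider "d \<noteq> hl k" | "c \<noteq> hr k" | "d = hl k" "c = hr k" by blast
  then show ?thesis
  proof cases
    case 1
    have "weq hg hw (pthg d * gen k) 0"
      by (rule heq_mult_0[OF D(5) en(1) d h_props(2)[OF k] 1])
    from heq_right[OF PC this] show ?thesis
      by (intro bexI[of _ 0]) (simp_all add: iota_simps augmentation_closed)
  next
    case 2
    have "weq hg hw (gen k * pth c) 0"
      by (rule heq_mult_0[OF en(2) C(3) h_props(1)[OF k] c]) (use 2 in simp)
    from heq_left[OF QD this] show ?thesis
      by (intro bexI[of _ 0]) (simp_all add: iota_simps augmentation_closed mult.assoc)
  next
    case 3
    show ?thesis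
      using k
    proof (cases rule: hair_gen_cases)
      case (1 v j)
      have "weq hg hw (pthg d * gen k * pth c) (pthg d * pth c)"
        using heq_left[OF QD C(3)] 1 3 by (simp add: vtx_def mult.assoc)
      also have "weq hg hw \<dots> (iota (vtx v))" using D(7) 1 3 by simp
      finally show ?thesis using 1 by (intro bexI[of _ "vtx v"] vtx_mem[OF wf])
    next
      case (2 e i)
      have "weq hg hw (pthg d * gen k * pth c) (gen k * pth c)"
        using heq_right[OF PC en(1)] 2 3 by simp
      also have "weq hg hw \<dots> (gen k)" using en(2) 2 3 by simp
      also have "gen k = iota (gen (Ghost e i))" using 2 by simp
      finally show ?thesis using 2 by (intro bexI[of _ "gen (Ghost e i)"] gen_mem) simp_all
    next
      case (3 e i)
      have "weq hg hw (pthg d * gen k * pth c) (gen k * pth c)"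
        using heq_right[OF PC en(1)] 3 \<open>d = hl k\<close> by simp
      also have "weq hg hw \<dots> (gen k)" using en(2) 3 \<open>c = hr k\<close> by simp
      also have "gen k = iota (gen (Edge e i))" using 3 by simp
      finally show ?thesis using 3 by (intro bexI[of _ "gen (Edge e i)"] gen_mem) simp_all
    next
      case (4 v j)
      have "pthg d * gen k * pth c = pthg d * pth d" using 3 4 by (simp add: mult.assoc)
      then have "weq hg hw (pthg d * gen k * pth c) (iota (vtx v))" using D(7) 3 4 by simp
      then show ?thesis using 4 by (intro bexI[of _ "vtx v"] vtx_mem[OF wf])
    next
      case (5 v j)
      have "pthg d * gen k * pth c = pthg c * pth c" using 3 5 by (simp add: mult.assoc)
      then have "weq hg hw (pthg d * gen k * pth c) (iota (vtx v))" using C(7) 3 5 by simp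
      then show ?thesis using 5 by (intro bexI[of _ "vtx v"] vtx_mem[OF wf])
    qed
  qed
qed

definition sandwiches :: "(('v \<times> nat, 'e + 'v \<times> nat) wgen fmon \<Rightarrow>\<^sub>0 'k) set" where
  "sandwiches = {p \<in> augmentation (wgens hg hw). \<forall>c\<in>verts hg. \<forall>d\<in>verts hg.
     \<exists>a\<in>augmentation (wgens E w). weq hg hw (pthg d * p * pth c) (iota a)}"

text \<open>Multiplication of matrices: the identity, written as a sum over paths, is inserted
  between \<open>p\<close> and \<open>q\<close>. The coefficients appear in reverse order under
  \<open>iota\<close>.\<close>

lemma sandwich_mult:
  assumes p: "p \<in> sandwiches" and q: "q \<in> sandwiches"
  shows "p * q \<in> sandwiches"
  unfolding sandwiches_def
proof (intro CollectI conjI ballI)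
  have pq: "p \<in> augmentation (wgens hg hw)" "q \<in> augmentation (wgens hg hw)"
    using p q by (simp_all add: sandwiches_def)
  then show "p * q \<in> augmentation (wgens hg hw)" by (rule augmentation_closed)
  note pC = augmentation_subset[OF pq(1)] and qC = augmentation_subset[OF pq(2)]
  fix c d assume c: "c \<in> verts hg" and d: "d \<in> verts hg"
  have "\<exists>a. a \<in> augmentation (wgens E w) \<and> weq hg hw (pthg d * p * pth b) (iota a)"
    "\<exists>a. a \<in> augmentation (wgens E w) \<and> weq hg hw (pthg b * q * pth c) (iota a)"
    if "b \<in> verts hg" for b
    using p q c d that unfolding sandwiches_def by blast+
  then obtain a a' where a: "\<And>b. b \<in> verts hg \<Longrightarrow> a b \<in> augmentation (wgens E w) \<and> weq hg hw (pthg d * p * pth b) (iota (a b))"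
    and a': "\<And>b. b \<in> verts hg \<Longrightarrow> a' b \<in> augmentation (wgens E w) \<and> weq hg hw (pthg b * q * pth c) (iota (a' b))"
    by metis
  note cl = free_algebra_closed(2)[OF free_algebra_closed(2)[OF pth_carrier(2)[OF d] pC] free_algebra_closed(2)[OF qC pth_carrier(1)[OF c]]]
  have "weq hg hw ((\<Sum>b\<in>verts hg. vtx b) * q) (q)" by (rule weq_one(1)[OF hair_wf hair_finite pq(2)])
  from heq_left[OF free_algebra_closed(2)[OF pth_carrier(2)[OF d] pC] heq_right[OF pth_carrier(1)[OF c] weq_sym[OF hair_wf this]]]
  have "weq hg hw (pthg d * p * (q * pth c)) (pthg d * p * ((\<Sum>b\<in>verts hg. vtx b) * q * pth c))" .
  also have "weq hg hw \<dots> (pthg d * p * ((\<Sum>b\<in>verts hg. pth b * pthg b) * q * pth c))"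
    by (intro heq_left heq_right free_algebra_closed(2) pth_carrier c d pC qC
        weq_sum[OF hair_wf weq_sym[OF hair_wf pthD(8)]])
  also have "\<dots> = (\<Sum>b\<in>verts hg. (pthg d * p * pth b) * (pthg b * q * pth c))"
    by (simp add: sum_distrib_left sum_distrib_right mult.assoc)
  also have "weq hg hw \<dots> (\<Sum>b\<in>verts hg. iota (a b) * iota (a' b))"
    using a a' by (intro weq_sum[OF hair_wf] weq_mult[OF hair_wf]) simp_all
  also have "\<dots> = iota (\<Sum>b\<in>verts hg. a' b * a b)" by (simp add: iota_simps iota_mult)
  finally have "weq hg hw (pthg d * (p * q) * pth c) (iota (\<Sum>b\<in>verts hg. a' b * a b))" by (simp add: mult.assoc)
  moreover have "(\<Sum>b\<in>verts hg. a' b * a b) \<in> augmentation (wgens E w)"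
    using a a' by (intro augmentation_sum augmentation_closed) simp_all
  ultimately show "\<exists>a\<in>augmentation (wgens E w). weq hg hw (pthg d * (p * q) * pth c) (iota a)" by blast
qed

lemma sandwich:
  assumes p: "p \<in> augmentation (wgens hg hw)"
  shows "p \<in> sandwiches"
proof (rule plinear_mem[where f = "\<lambda>p. p"])
  show "plinear (\<lambda>p. p)" by (rule plinear_intros)
  show "0 \<in> sandwiches"
    unfolding sandwiches_def
    by (auto simp: augmentation_closed iota_simps intro!: bexI[of _ 0] weq_refl[OF hair_wf] free_algebra_0_1)
  fix q r assume q: "q \<in> sandwiches"
  show "pscale c q \<in> sandwiches" for c
    unfolding sandwiches_def
  proof (intro CollectI conjI ballI)
    show "pscale c q \<in> augmentation (wgens hg hw)" using q by (simp add: sandwiches_def pscale_mem)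
    fix b d assume "b \<in> verts hg" "d \<in> verts hg"
    then obtain a where "a \<in> augmentation (wgens E w)" "weq hg hw (pthg d * q * pth b) (iota a)"
      using q unfolding sandwiches_def by blast
    then show "\<exists>a\<in>augmentation (wgens E w). weq hg hw (pthg d * pscale c q * pth b) (iota a)"
      using weq_pscale[OF hair_wf, of hw "pthg d * q * pth b" "iota a" c]
      by (intro bexI[of _ "pscale c a"]) (simp_all add: mult_pscale iota_simps pscale_mem)
  qed
  assume r: "r \<in> sandwiches"
  show "q + r \<in> sandwiches"
    unfolding sandwiches_def
  proof (intro CollectI conjI ballI)
    show "q + r \<in> augmentation (wgens hg hw)" using q r by (simp add: sandwiches_def augmentation_closed)
    fix b d assume bd: "b \<in> verts hg" "d \<in> verts hg"
    obtain a where "a \<in> augmentation (wgens E w)" "weq hg hw (pthg d * q * pth b) (iota a)"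
      using q bd unfolding sandwiches_def by blast
    moreover obtain a' where "a' \<in> augmentation (wgens E w)" "weq hg hw (pthg d * r * pth b) (iota a')"
      using r bd unfolding sandwiches_def by blast
    ultimately show "\<exists>a\<in>augmentation (wgens E w). weq hg hw (pthg d * (q + r) * pth b) (iota a)"
      using weq_add[OF hair_wf, of hw "pthg d * q * pth b" "iota a" "pthg d * r * pth b" "iota a'"]
      by (intro bexI[of _ "a + a'"]) (simp_all add: algebra_simps iota_simps augmentation_closed)
  qed
next
  fix m assume m: "m \<in> Poly_Mapping.keys p"
  have gen: "gen k \<in> sandwiches" if "k \<in> wgens hg hw" for k
    using that sandwich_gen[OF that] by (simp add: sandwiches_def gen_mem)
  have "Poly_Mapping.single (FMon l) 1 \<in> sandwiches" if "l \<noteq> []" "set l \<subseteq> wgens hg hw" for l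
    using that
  proof (induction l rule: list_nonempty_induct)
    case (single k)
    then show ?case using gen[of k] by (simp add: gen_def)
  next
    case (cons k l)
    have "Poly_Mapping.single (FMon (k # l)) 1 = gen k * (Poly_Mapping.single (FMon l) 1 :: _ \<Rightarrow>\<^sub>0 'k)"
      by (simp add: gen_def mult_single plus_fmon_def)
    moreover have "gen k * (Poly_Mapping.single (FMon l) 1 :: _ \<Rightarrow>\<^sub>0 'k) \<in> sandwiches"
      using cons by (intro sandwich_mult gen) auto
    ultimately show ?case by simp
  qed
  moreover have "m \<noteq> 0" "set (letters m) \<subseteq> wgens hg hw"
    using m p by (auto simp: augmentation_def mem_free_algebra in_keys_iff)
  ultimately show "Poly_Mapping.single m 1 \<in> sandwiches"
    by (cases m) (auto simp: zero_fmon_def)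
qed

lemma hact_vtx_g: "c \<in> verts hg \<Longrightarrow> b \<in> verts hg \<Longrightarrow> act hact (vtx c) (g b) = (if b = c then g c else 0)"
  using hact_g[of "Vtx c" b] by (simp add: vtx_def hair_wgens) (simp add: vtx_def[symmetric] vproj_g)

lemma act_pth:
  "(v, j) \<in> verts hg \<Longrightarrow> act hact (pth (v, j)) (g (v, 0)) = g (v, j) \<and> act hact (pthg (v, j)) (g (v, j)) = g (v, 0)"
proof (induction j)
  case 0
  then show ?case using hact_vtx_g[OF 0 0] by simp
next
  case (Suc j)
  then have v: "(v, j) \<in> verts hg" by simp
  have k: "Edge (Inr (v, Suc j)) 1 \<in> wgens hg hw" "Ghost (Inr (v, Suc j)) 1 \<in> wgens hg hw"
    using Suc.prems by (simp_all add: hair_wgens)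
  have "hact (Edge (Inr (v, Suc j)) 1) (g (v, j)) = g (v, Suc j)"
    "hact (Ghost (Inr (v, Suc j)) 1) (g (v, Suc j)) = g (v, j)"
    using hact_g[OF k(1) v] hact_g[OF k(2) Suc.prems] vproj_g[OF v] vproj_g[OF Suc.prems] by simp_all
  then show ?case using Suc.IH[OF v] by (simp add: act_mult[OF plinear_hact])
qed

lemma act_pth_g:
  assumes c: "c \<in> verts hg"
  shows "u \<in> verts E \<Longrightarrow> act hact (pth c) (g (u, 0)) = (if u = fst c then g c else 0)"
    and "b \<in> verts hg \<Longrightarrow> act hact (pthg c) (g b) = (if b = c then g (fst c, 0) else 0)"
proof -
  have r: "(fst c, 0) \<in> verts hg" using c by (cases c) (simp add: h_pos)
  assume u: "u \<in> verts E"
  have "act hact (pth c) (g (u, 0)) = act hact (pth c) (act hact (vtx (fst c, 0)) (g (u, 0)))"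
    using hact_weq[OF pthD(4)[OF c] g_NF[OF root_mem[OF u]]] by (simp add: act_mult[OF plinear_hact])
  then show "act hact (pth c) (g (u, 0)) = (if u = fst c then g c else 0)"
    using act_pth[of "fst c" "snd c"] c hact_vtx_g[OF r root_mem[OF u]]
    by (simp add: plinearD[OF plinear_act_hact])
next
  assume b: "b \<in> verts hg"
  have "act hact (pthg c) (g b) = act hact (pthg c) (act hact (vtx c) (g b))"
    using hact_weq[OF pthD(5)[OF c] g_NF[OF b]] by (simp add: act_mult[OF plinear_hact])
  then show "act hact (pthg c) (g b) = (if b = c then g (fst c, 0) else 0)"
    using act_pth[of "fst c" "snd c"] c hact_vtx_g[OF c b]
    by (simp add: plinearD[OF plinear_act_hact])
qed

text \<open>Each transported entry is congruent to some \<open>iota a\<close>. The hypothesis makes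
  \<open>a\<close>, cut down to its two vertices, act as zero on \<open>gsum\<close>;
  \<open>\<gamma>\<close> moves this to a free generator, where faithfulness of the model shows that
  the cut down element is congruent to zero.\<close>

lemma hact_faithful:
  assumes p: "p \<in> augmentation (wgens hg hw)" and z: "\<And>c. c \<in> verts hg \<Longrightarrow> act hact p (g c) = 0"
  shows "weq hg hw p 0"
proof -
  note pC = augmentation_subset[OF p]
  have *: "weq hg hw (pthg d * p * pth c) 0" if c: "c \<in> verts hg" and d: "d \<in> verts hg" for c d
  proof -
    let ?q = "pthg d * p * pth c"
    obtain u where u: "fst c = u" "u \<in> verts E" using c by (cases c) simp
    obtain v where v: "fst d = v" "v \<in> verts E" using d by (cases d) simp
    obtain a where a: "a \<in> augmentation (wgens E w)" "weq hg hw ?q (iota a)"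
      using sandwich[OF p] c d unfolding sandwiches_def by blast
    note aC = augmentation_subset[OF a(1)]
    have "act tau (vtx u * a) gsum = act hact (iota a) (g (u, 0))"
      using act_iota_g[OF aC u(2)] by (simp add: act_mult[OF plinear_tau])
    also have "\<dots> = act hact ?q (g (u, 0))"
      by (rule hact_weq[OF a(2) g_NF[OF root_mem[OF u(2)]], symmetric])
    also have "\<dots> = 0"
      using act_pth_g(1)[OF c u(2)] z[OF c] u by (simp add: act_mult[OF plinear_hact] plinearD[OF plinear_act_hact])
    finally have ua: "act tau (vtx u * a) gsum = 0" .
    have uaC: "vtx u * a \<in> carrier (free_algebra (wgens E w))"
      by (intro free_algebra_closed vtx_carrier[OF wf] u aC)
    have gam: "nfhom (\<gamma> (v, 0)) NF" by (rule \<gamma>_nfhom[OF root_mem[OF v(2)]])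
    have "\<gamma> (v, 0) gsum = (\<Sum>v'\<in>verts E. if v' = v then bgen v 0 else 0)"
      unfolding gsum_def plinearD[OF plinear_\<gamma>]
      using v root_mem by (intro sum.cong refl) (simp add: \<gamma>_g)
    also have "\<dots> = bgen v 0" using v by (simp add: sum.delta)
    finally have "act tau (vtx u * a) (bgen v 0) = \<gamma> (v, 0) (act tau (vtx u * a) gsum)"
      using act_nfhom[OF gam uaC gsum_NF] by simp
    then have "weq E w (vtx u * a * vtx v) 0"
      using ua by (intro act_bgen_eq_0 uaC v) (simp add: plinearD[OF plinear_\<gamma>])
    from iota_weq[OF this] have "weq hg hw (vtx (v, 0) * (iota a * vtx (u, 0))) 0"
      by (simp add: iota_mult iota_simps)
    moreover have "weq hg hw ?q (vtx (v, 0) * (iota a * vtx (u, 0)))"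
    proof -
      have "weq hg hw ?q (?q * vtx (u, 0))"
        using heq_left[OF free_algebra_closed(2)[OF pth_carrier(2)[OF d] pC] weq_sym[OF hair_wf pthD(4)[OF c]]] u
        by (simp add: mult.assoc)
      also have "weq hg hw \<dots> (vtx (v, 0) * (?q * vtx (u, 0)))"
        using heq_right[OF _ weq_sym[OF hair_wf pthD(6)[OF d]], of "p * pth c * vtx (u, 0)"] v
          free_algebra_closed(2)[OF free_algebra_closed(2)[OF pC pth_carrier(1)[OF c]] vtx_carrier[OF hair_wf root_mem[OF u(2)]]]
        by (simp add: mult.assoc)
      also have "weq hg hw \<dots> (vtx (v, 0) * (iota a * vtx (u, 0)))"
        by (intro heq_left heq_right a vtx_carrier[OF hair_wf root_mem] u v)
      finally show ?thesis .
    qed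
    ultimately show ?thesis using weq_trans[OF hair_wf] by blast
  qed
  have "weq hg hw p (\<Sum>c\<in>verts hg. \<Sum>d\<in>verts hg. pth d * (pthg d * p * pth c) * pthg c)"
    by (rule heq_decomp[OF p])
  also have "weq hg hw \<dots> (\<Sum>c\<in>verts hg. \<Sum>d\<in>verts hg. pth d * 0 * pthg c)"
    by (intro weq_sum[OF hair_wf] heq_right heq_left pth_carrier *)
  finally show ?thesis by simp
qed

text \<open>The element is assembled from the matrix of the coordinates of the \<open>y c\<close>,
  each entry being moved from the old vertices into its place by a path and a ghost path.\<close>

lemma hact_full:
  assumes y: "\<And>c. c \<in> verts hg \<Longrightarrow> y c \<in> NFv (fst c)"
    and dec: "\<And>c. c \<in> verts hg \<Longrightarrow> (\<Sum>d\<in>verts hg. act tau (evp 0 (\<gamma> d (y c))) (g d)) = y c"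
  shows "\<exists>p\<in>augmentation (wgens hg hw). \<forall>c\<in>verts hg. act hact p (g c) = y c"
proof -
  define a where "a c d = evp 0 (\<gamma> d (y c))" for c d
  have a: "a c d \<in> carrier (free_algebra (wgens E w))" if "c \<in> verts hg" "d \<in> verts hg" for c d
    unfolding a_def using that by (intro evp_\<gamma> NFv_subset[OF y])
  define p where "p = (\<Sum>c\<in>verts hg. \<Sum>d\<in>verts hg. pth d * iota (a c d) * pthg c)"
  have "pth d * iota (a c d) * pthg c \<in> augmentation (wgens hg hw)" if "c \<in> verts hg" "d \<in> verts hg" for c d
    using ideal.I_l_closed[OF ideal_augmentation pthD(2)[OF that(1)] free_algebra_closed(2)[OF pth_carrier(1)[OF that(2)] iota_carrier[OF a[OF that]]]]
    by simp
  then have "p \<in> augmentation (wgens hg hw)" unfolding p_def by (intro augmentation_sum)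
  moreover have "act hact p (g b) = y b" if b: "b \<in> verts hg" for b
  proof -
    obtain v where v: "fst b = v" "v \<in> verts E" using b by (cases b) simp
    have *: "act hact (pth d * iota (a c d) * pthg c) (g b) = (if c = b then vproj v (act tau (a b d) (g d)) else 0)"
      if c: "c \<in> verts hg" and d: "d \<in> verts hg" for c d
    proof (cases "c = b")
      case True
      have ga: "act tau (vtx v * a b d) gsum \<in> NF"
        by (intro act_mem free_algebra_closed vtx_carrier[OF wf] v a b d gsum_NF)
      have vC: "vtx v * a b d \<in> carrier (free_algebra (wgens E w))"
        by (intro free_algebra_closed vtx_carrier[OF wf] v a b d)
      obtain v' where v': "fst d = v'" "v' \<in> verts E" using d by (cases d) simp
      have "act hact (pth d * iota (a c d) * pthg c) (g b) = act hact (pth d) (act tau (vtx v * a b d) gsum)"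
        using True v act_pth_g(2)[OF b b] act_iota_g[OF a[OF b d] v(2)]
        by (simp add: act_mult[OF plinear_hact] act_mult[OF plinear_tau])
      also have "\<dots> = act tau (vtx v * a b d) (act hact (pth d) gsum)"
        by (rule act_hact_commute[OF pth_carrier(1)[OF d] vC gsum_NF])
      also have "act hact (pth d) gsum = g d"
        unfolding gsum_def plinearD[OF plinear_act_hact] using v' by (simp add: act_pth_g(1)[OF d] sum.delta)
      finally show ?thesis using True by (simp add: act_mult[OF plinear_tau])
    next
      case False
      then show ?thesis using act_pth_g(2)[OF c b]
        by (simp add: act_mult[OF plinear_hact] plinearD[OF plinear_act_hact])
    qed
    have "act hact p (g b) = (\<Sum>c\<in>verts hg. \<Sum>d\<in>verts hg. if c = b then vproj v (act tau (a b d) (g d)) else 0)"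
      unfolding p_def act_left_simps using * by (intro sum.cong refl) simp
    also have "\<dots> = (\<Sum>c\<in>verts hg. if c = b then \<Sum>d\<in>verts hg. vproj v (act tau (a b d) (g d)) else 0)"
      by (intro sum.cong refl) simp
    also have "\<dots> = vproj v (\<Sum>d\<in>verts hg. act tau (a b d) (g d))"
      using b hair_finite by (simp add: sum.delta vproj_simps)
    also have "\<dots> = y b" using dec[OF b] vproj_id[OF y[OF b]] v by (simp add: a_def)
    finally show ?thesis .
  qed
  ultimately show ?thesis by blast
qed

end


section \<open>Matrices over endomorphism rings\<close>

lemma end_algebra_simps [simp]:
  "carrier (end_algebra A P) = left_hom A P P \<inter> extensional (carrier P)"
  "monoid.mult (end_algebra A P) = compose (carrier P)"
  "one (end_algebra A P) = (\<lambda>x\<in>carrier P. x)"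
  "zero (end_algebra A P) = (\<lambda>x\<in>carrier P. \<zero>\<^bsub>P\<^esub>)"
  "add (end_algebra A P) = (\<lambda>f g. \<lambda>x\<in>carrier P. f x \<oplus>\<^bsub>P\<^esub> g x)"
  "smult (end_algebra A P) = (\<lambda>c f. \<lambda>x\<in>carrier P. (c \<odot>\<^bsub>A\<^esub> \<one>\<^bsub>A\<^esub>) \<odot>\<^bsub>P\<^esub> f x)"
  by (simp_all add: end_algebra_def)

lemma mat_algebra_carrier:
  "carrier (mat_algebra n A) = {X \<in> carrier_mat n n. elements_mat X \<subseteq> carrier A}"
  by (simp add: mat_algebra_def)

lemma mat_algebra_dims:
  "X \<otimes>\<^bsub>mat_algebra n A\<^esub> Y \<in> carrier_mat n n" "X \<oplus>\<^bsub>mat_algebra n A\<^esub> Y \<in> carrier_mat n n"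
  "\<one>\<^bsub>mat_algebra n A\<^esub> \<in> carrier_mat n n"
  "X \<in> carrier_mat n n \<Longrightarrow> c \<odot>\<^bsub>mat_algebra n A\<^esub> X \<in> carrier_mat n n"
  by (simp_all add: mat_algebra_def)

lemma mat_algebra_entry:
  assumes "i < n" "j < n"
  shows "(X \<otimes>\<^bsub>mat_algebra n A\<^esub> Y) $$ (i, j) = (\<Oplus>\<^bsub>A\<^esub>l\<in>{..<n}. X $$ (i, l) \<otimes>\<^bsub>A\<^esub> Y $$ (l, j))"
    and "(X \<oplus>\<^bsub>mat_algebra n A\<^esub> Y) $$ (i, j) = X $$ (i, j) \<oplus>\<^bsub>A\<^esub> Y $$ (i, j)"
    and "\<one>\<^bsub>mat_algebra n A\<^esub> $$ (i, j) = (if i = j then \<one>\<^bsub>A\<^esub> else \<zero>\<^bsub>A\<^esub>)"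
    and "X \<in> carrier_mat n n \<Longrightarrow> (c \<odot>\<^bsub>mat_algebra n A\<^esub> X) $$ (i, j) = c \<odot>\<^bsub>A\<^esub> X $$ (i, j)"
  using assms by (simp_all add: mat_algebra_def)

lemma carrier_mat_eqI:
  assumes "X \<in> carrier_mat n n" "Y \<in> carrier_mat n n"
    and "\<And>i j. i < n \<Longrightarrow> j < n \<Longrightarrow> X $$ (i, j) = Y $$ (i, j)"
  shows "X = Y"
  using assms by (intro eq_matI) auto

lemma left_hom_restrict:
  assumes "left_module R M" "f \<in> left_hom R M N"
  shows "restrict f (carrier M) \<in> left_hom R M N"
proof -
  interpret left_module R M by fact
  show ?thesis by (rule left_homI) (simp_all add: left_homD[OF assms(2)])
qed

lemma left_hom_add:
  assumes "left_module R M" "left_module R N" "f \<in> left_hom R M N" "g \<in> left_hom R M N"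
  shows "(\<lambda>x. f x \<oplus>\<^bsub>N\<^esub> g x) \<in> left_hom R M N"
proof -
  interpret M: left_module R M by fact
  interpret N: left_module R N by fact
  note D = left_homD[OF assms(3)] left_homD[OF assms(4)]
  show ?thesis by (rule left_homI) (simp_all add: D N.M.a_ac N.smult_r_distr)
qed

lemma end_algebra_monoid:
  assumes P: "left_module A P"
  shows "abelian_monoid (end_algebra A P)"
proof -
  interpret left_module A P by fact
  have ext: "(\<lambda>x\<in>carrier P. F x) = f" if "f \<in> extensional (carrier P)" "\<And>x. x \<in> carrier P \<Longrightarrow> F x = f x"
    for F f :: "'c \<Rightarrow> 'c"
    using that by (intro extensionalityI[of _ "carrier P"]) auto
  show ?thesis
  proof (rule abelian_monoidI)
    have "(\<lambda>x. \<zero>\<^bsub>P\<^esub>) \<in> left_hom A P P" by (rule left_homI) auto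
    then show "\<zero>\<^bsub>end_algebra A P\<^esub> \<in> carrier (end_algebra A P)"
      using left_hom_restrict[OF P] by simp
  next
    fix f g assume "f \<in> carrier (end_algebra A P)" "g \<in> carrier (end_algebra A P)"
    then show "f \<oplus>\<^bsub>end_algebra A P\<^esub> g \<in> carrier (end_algebra A P)"
      using left_hom_restrict[OF P left_hom_add[OF P P]] by simp
  next
    fix f assume "f \<in> carrier (end_algebra A P)"
    then show "\<zero>\<^bsub>end_algebra A P\<^esub> \<oplus>\<^bsub>end_algebra A P\<^esub> f = f"
      by (auto intro!: ext dest: left_homD(1))
  next
    fix f g k assume "f \<in> carrier (end_algebra A P)" "g \<in> carrier (end_algebra A P)" "k \<in> carrier (end_algebra A P)"
    then have D: "f x \<in> carrier P" "g x \<in> carrier P" "k x \<in> carrier P" if "x \<in> carrier P" for x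
      using that by (auto dest: left_homD(1))
    show "f \<oplus>\<^bsub>end_algebra A P\<^esub> g \<oplus>\<^bsub>end_algebra A P\<^esub> k = f \<oplus>\<^bsub>end_algebra A P\<^esub> (g \<oplus>\<^bsub>end_algebra A P\<^esub> k)"
      "f \<oplus>\<^bsub>end_algebra A P\<^esub> g = g \<oplus>\<^bsub>end_algebra A P\<^esub> f"
      by (auto intro!: restrict_ext simp: D M.a_ac)
  qed
qed

lemma end_algebra_finsum:
  assumes P: "left_module A P" and I: "finite I" and f: "f \<in> I \<rightarrow> carrier (end_algebra A P)"
  shows "(\<Oplus>\<^bsub>end_algebra A P\<^esub>i\<in>I. f i) = (\<lambda>x\<in>carrier P. \<Oplus>\<^bsub>P\<^esub>i\<in>I. f i x)"
  using I f
proof (induction I)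
  interpret abelian_monoid "end_algebra A P" by (rule end_algebra_monoid[OF P])
  interpret P: left_module A P by fact
  case empty
  show ?case by (simp add: finsum_empty)
next
  interpret abelian_monoid "end_algebra A P" by (rule end_algebra_monoid[OF P])
  interpret P: left_module A P by fact
  case (insert j I)
  then have f: "f \<in> I \<rightarrow> carrier (end_algebra A P)" "f j \<in> carrier (end_algebra A P)" by auto
  have "f i x \<in> carrier P" if "i \<in> insert j I" "x \<in> carrier P" for i x
    using insert.prems that by (auto simp: Pi_iff dest: left_homD(1))
  then have "(\<lambda>i. f i x) \<in> I \<rightarrow> carrier P" "f j x \<in> carrier P" if "x \<in> carrier P" for x
    using that by auto
  then show ?case
    unfolding finsum_insert[OF insert.hyps f] insert.IH[OF f(1)]
    using insert.hyps by (auto intro!: restrict_ext simp: P.M.finsum_insert)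
qed

text \<open>The map is easier to build out of the algebra of the hair extension. Only its source has
  to be known as a ring, which spares verifying the ring axioms for the matrices.\<close>

lemma algebra_isomorphic_inverse:
  assumes R: "ring R" and iso: "\<psi> \<in> ring_iso R S"
    and sm: "\<And>c x. x \<in> carrier R \<Longrightarrow> c \<odot>\<^bsub>R\<^esub> x \<in> carrier R \<and> \<psi> (c \<odot>\<^bsub>R\<^esub> x) = c \<odot>\<^bsub>S\<^esub> \<psi> x"
  shows "algebra_isomorphic S R"
  unfolding algebra_isomorphic_def
proof (intro bexI[OF _ ring_iso_set_sym[OF R iso]] allI ballI)
  have bij: "bij_betw \<psi> (carrier R) (carrier S)" using iso by (rule ring_iso_memE)
  fix c y assume y: "y \<in> carrier S"
  let ?x = "inv_into (carrier R) \<psi> y"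
  have x: "?x \<in> carrier R" "\<psi> ?x = y"
    using bij y by (auto simp: bij_betw_def inv_into_into f_inv_into_f)
  then have "inv_into (carrier R) \<psi> (c \<odot>\<^bsub>S\<^esub> y) = inv_into (carrier R) \<psi> (\<psi> (c \<odot>\<^bsub>R\<^esub> ?x))"
    using sm[OF x(1), of c] by simp
  also have "\<dots> = c \<odot>\<^bsub>R\<^esub> ?x"
    using bij sm[OF x(1), of c] by (intro inv_into_f_f) (auto simp: bij_betw_def)
  finally show "inv_into (carrier R) \<psi> (c \<odot>\<^bsub>S\<^esub> y) = c \<odot>\<^bsub>R\<^esub> ?x" .
qed

context hair_model begin

definition hone :: "('v \<times> nat, 'e + 'v \<times> nat) wgen fmon \<Rightarrow>\<^sub>0 'k" where
  "hone = (\<Sum>c\<in>verts hg. vtx c)"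

text \<open>The identity of the hair algebra acts as the sum of the projections onto the cyclic
  pieces generated by the \<open>g c\<close>, expressed by coordinates.\<close>

lemma act_hone:
  assumes x: "x \<in> NF"
  shows "act hact hone x = (\<Sum>c\<in>verts hg. act tau (evp 0 (\<gamma> c x)) (g c))"
proof -
  have "act hact (vtx c) x = act tau (evp 0 (\<gamma> c x)) (g c)" if "c \<in> verts hg" for c
    using that by (simp add: vtx_def hact_def mu_def act_mult[OF plinear_tau]) (simp add: vtx_def[symmetric] vproj_g)
  then show ?thesis by (simp add: hone_def act_left_simps)
qed

lemma hone_aug: "hone \<in> augmentation (wgens hg hw)"
  unfolding hone_def by (rule one_rep_mem[OF hair_wf])

lemma hone_act:
  assumes p: "p \<in> augmentation (wgens hg hw)" and x: "x \<in> NF"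
  shows "act hact p (act hact hone x) = act hact p x" "act hact hone (act hact p x) = act hact p x"
  using hact_weq[OF weq_one(2)[OF hair_wf hair_finite p] x] hact_weq[OF weq_one(1)[OF hair_wf hair_finite p] x]
  by (simp_all add: hone_def act_mult[OF plinear_hact])

text \<open>Such an endomorphism lives on the image of \<open>hone\<close>, where it is determined
  by the basis elements; \<open>hact_full\<close> realises their images.\<close>

lemma hact_endo:
  assumes f: "nfhom f NF" and fe: "\<And>x. x \<in> NF \<Longrightarrow> f (act hact hone x) = f x"
    and ef: "\<And>x. x \<in> NF \<Longrightarrow> act hact hone (f x) = f x"
  shows "\<exists>p\<in>augmentation (wgens hg hw). \<forall>x\<in>NF. act hact p x = f x"
proof -
  have "\<exists>p\<in>augmentation (wgens hg hw). \<forall>c\<in>verts hg. act hact p (g c) = f (g c)"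
  proof (rule hact_full)
    fix c assume c: "c \<in> verts hg"
    have "fst c \<in> verts E" using c by (cases c) simp
    then show "f (g c) \<in> NFv (fst c)" by (rule nfhom_NFv[OF f _ g_mem[OF c]])
    show "(\<Sum>d\<in>verts hg. act tau (evp 0 (\<gamma> d (f (g c)))) (g d)) = f (g c)"
      using act_hone[OF nfhomD(1)[OF f g_NF[OF c]]] ef[OF g_NF[OF c]] by simp
  qed
  then obtain p where p: "p \<in> augmentation (wgens hg hw)" "\<And>c. c \<in> verts hg \<Longrightarrow> act hact p (g c) = f (g c)"
    by blast
  have "act hact p x = f x" if x: "x \<in> NF" for x
  proof -
    have mem: "act tau (evp 0 (\<gamma> c x)) (g c) \<in> NF" if "c \<in> verts hg" for c
      using that x by (intro act_mem evp_\<gamma> g_NF)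
    have "act hact p x = act hact p (\<Sum>c\<in>verts hg. act tau (evp 0 (\<gamma> c x)) (g c))"
      using hone_act(1)[OF p(1) x] act_hone[OF x] by simp
    also have "\<dots> = (\<Sum>c\<in>verts hg. act tau (evp 0 (\<gamma> c x)) (act hact p (g c)))"
      unfolding plinearD[OF plinear_act_hact]
      using x p(1) by (intro sum.cong refl act_hact_commute augmentation_subset evp_mem nfhomD(1)[OF \<gamma>_nfhom] g_NF)
    also have "\<dots> = (\<Sum>c\<in>verts hg. f (act tau (evp 0 (\<gamma> c x)) (g c)))"
      using x p(2) by (intro sum.cong refl) (simp add: act_nfhom[OF f] evp_\<gamma> g_NF)
    also have "\<dots> = f (act hact hone x)"
      unfolding act_hone[OF x] using mem by (rule nfhom_sum_apply[OF f, symmetric])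
    also have "\<dots> = f x" by (rule fe[OF x])
    finally show ?thesis .
  qed
  then show ?thesis using p(1) by blast
qed

lemma nfmod_finsum:
  assumes "finite I" "\<And>i. i \<in> I \<Longrightarrow> y i \<in> NF"
  shows "finsum (nfmod :: (('k, 'v, 'e) wlp, _) module) y I = sum y I"
proof -
  interpret F: left_module "wlpa E w :: ('k, ('k, 'v, 'e) wlp) module" "nfmod :: (('k, 'v, 'e) wlp, _) module"
    by (rule left_module_nfmod)
  show ?thesis using assms
  proof (induction I)
    case (insert i I)
    then show ?case by (simp add: F.M.finsum_insert Pi_iff)
  qed simp
qed


text \<open>By \<open>JQ\<close> the image of \<open>hone\<close> is \<open>n\<close> copies of
  \<open>P\<close>. An element of the hair algebra goes to the matrix of blocks of its action; the
  faithfulness and fullness of that action give injectivity and surjectivity.\<close>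

theorem matrix_iso:
  fixes P :: "(('k, 'v, 'e) wlp, 'p) module" and n :: nat
  assumes P: "left_module (wlpa E w :: ('k, ('k, 'v, 'e) wlp) module) P"
    and J: "\<And>i. i < n \<Longrightarrow> J i \<in> left_hom (wlpa E w :: ('k, ('k, 'v, 'e) wlp) module) P nfmod"
    and Q: "\<And>i. i < n \<Longrightarrow> Q i \<in> left_hom (wlpa E w :: ('k, ('k, 'v, 'e) wlp) module) nfmod P"
    and QJ: "\<And>i l y. i < n \<Longrightarrow> l < n \<Longrightarrow> y \<in> carrier P \<Longrightarrow> Q l (J i y) = (if l = i then y else \<zero>\<^bsub>P\<^esub>)"
    and JQ: "\<And>x. x \<in> NF \<Longrightarrow> (\<Sum>i<n. J i (Q i x)) = act hact hone x"
  shows "algebra_isomorphic (mat_algebra n (end_algebra (wlpa E w :: ('k, ('k, 'v, 'e) wlp) module) P))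
    (wlpa hg hw)"
proof -
  let ?A = "wlpa E w :: ('k, ('k, 'v, 'e) wlp) module"
  let ?B = "wlpa hg hw :: ('k, ('k, 'v \<times> nat, 'e + 'v \<times> nat) wlp) module"
  let ?F = "nfmod :: (('k, 'v, 'e) wlp, ('v, 'e) word \<Rightarrow>\<^sub>0 'k) module"
  let ?N = "end_algebra ?A P" and ?aug = "augmentation (wgens hg hw) :: (_ \<Rightarrow>\<^sub>0 'k) set"
  let ?M = "mat_algebra n ?N"
  interpret P: left_module ?A P by fact
  note F = left_module_nfmod[where ?'k = 'k]
  have JNF: "J i y \<in> NF" if "i < n" "y \<in> carrier P" for i y using left_homD(1)[OF J[OF that(1)] that(2)] by simp
  have QP: "Q i x \<in> carrier P" if "i < n" "x \<in> NF" for i x using left_homD(1)[OF Q[OF that(1)], of x] that(2) by simp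
  have act_left_hom: "act hact p \<in> left_hom ?A ?F ?F" if "p \<in> ?aug" for p
    using act_hact_nfhom[OF augmentation_subset[OF that]] by (simp add: left_hom_nfmod_iff)
  have aNF: "act hact p x \<in> NF" if "p \<in> ?aug" "x \<in> NF" for p x
    using act_hact_mem augmentation_subset that by blast
  have Q_sum: "Q i (\<Sum>l<n. z l) = (\<Oplus>\<^bsub>P\<^esub>l\<in>{..<n}. Q i (z l))" if "i < n" "\<And>l. l < n \<Longrightarrow> z l \<in> NF" for i z
    using left_hom_finsum[OF F P Q[OF that(1)], of "{..<n}" z] nfmod_finsum[of "{..<n}" z] that(2) by (simp add: Pi_iff)
  have Q_delta: "(\<Oplus>\<^bsub>P\<^esub>l\<in>{..<n}. if i = l then z l else \<zero>\<^bsub>P\<^esub>) = z i"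
    if "i < n" "\<And>l. l < n \<Longrightarrow> z l \<in> carrier P" for i z
    using that by (intro P.M.finsum_singleton) auto
  define blk where "blk p i l = (\<lambda>x\<in>carrier P. Q i (act hact p (J l x)))" for p i l
  define Xi where "Xi p = mat n n (\<lambda>(i, l). blk p i l)" for p
  have blk_mem: "blk p i l \<in> carrier ?N" if "p \<in> ?aug" "i < n" "l < n" for p i l
    using left_hom_restrict[OF P left_hom_comp[OF left_hom_comp[OF J act_left_hom] Q]] that
    by (simp add: blk_def)
  have Xi_dim: "Xi p \<in> carrier_mat n n" for p by (simp add: Xi_def)
  have Xi_entry: "Xi p $$ (i, j) = blk p i j" if "i < n" "j < n" for p i j using that by (simp add: Xi_def)
  have Xi_mem: "Xi p \<in> carrier ?M" if p: "p \<in> ?aug" for p 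
    unfolding mat_algebra_carrier 
  proof (intro CollectI conjI Xi_dim subsetI)
    fix f assume "f \<in> elements_mat (Xi p)"
    from elements_matD[OF this] obtain i j where ij: "i < n" "j < n" "f = Xi p $$ (i, j)"
      unfolding carrier_matD[OF Xi_dim] by (elim exE conjE) (rule that)
    show "f \<in> carrier ?N"
      unfolding ij(3) Xi_entry[OF ij(1,2)] by (rule blk_mem[OF p ij(1,2)])
  qed
  have Xi_mult: "Xi (p * q) = Xi p \<otimes>\<^bsub>?M\<^esub> Xi q" if p: "p \<in> ?aug" and q: "q \<in> ?aug" for p q
  proof (rule carrier_mat_eqI[OF Xi_dim mat_algebra_dims(1)])
    fix i j assume ij: "i < n" "j < n"
    have cmp: "(\<lambda>l. compose (carrier P) (blk p i l) (blk q l j)) \<in> {..<n} \<rightarrow> carrier ?N"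
    proof
      fix l assume "l \<in> {..<n}"
      then have l: "l < n" by simp
      have "blk q l j \<in> left_hom ?A P P" "blk p i l \<in> left_hom ?A P P"
        using blk_mem[OF q l ij(2)] blk_mem[OF p ij(1) l] by simp_all
      from left_hom_restrict[OF P left_hom_comp[OF this]] show "compose (carrier P) (blk p i l) (blk q l j) \<in> carrier ?N"
        by (simp add: compose_def)
    qed
    have "(\<Oplus>\<^bsub>?N\<^esub>l\<in>{..<n}. compose (carrier P) (blk p i l) (blk q l j)) =
        (\<lambda>x\<in>carrier P. \<Oplus>\<^bsub>P\<^esub>l\<in>{..<n}. compose (carrier P) (blk p i l) (blk q l j) x)"
      by (rule end_algebra_finsum[OF P finite_lessThan cmp])
    also have "\<dots> = blk (p * q) i j"
      unfolding blk_def[of "p * q"]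
    proof (rule restrict_ext)
      fix x assume x: "x \<in> carrier P"
      let ?y = "act hact q (J j x)"
      have y: "?y \<in> NF" by (rule aNF[OF q JNF[OF ij(2) x]])
      have "(\<Oplus>\<^bsub>P\<^esub>l\<in>{..<n}. compose (carrier P) (blk p i l) (blk q l j) x) =
          (\<Oplus>\<^bsub>P\<^esub>l\<in>{..<n}. Q i (act hact p (J l (Q l ?y))))"
        by (rule P.M.finsum_cong'[OF refl])
          (use x y ij in \<open>auto simp: compose_def blk_def QP JNF aNF[OF p]\<close>)
      also have "\<dots> = Q i (\<Sum>l<n. act hact p (J l (Q l ?y)))"
        using ij y by (intro Q_sum[symmetric] aNF[OF p] JNF QP)
      also have "(\<Sum>l<n. act hact p (J l (Q l ?y))) = act hact p (\<Sum>l<n. J l (Q l ?y))"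
        by (rule plinearD(6)[OF plinear_act_hact, symmetric])
      also have "\<dots> = act hact (p * q) (J j x)"
        unfolding JQ[OF y] hone_act(1)[OF p y] by (simp add: act_mult[OF plinear_hact])
      finally show "(\<Oplus>\<^bsub>P\<^esub>l\<in>{..<n}. compose (carrier P) (blk p i l) (blk q l j) x) = Q i (act hact (p * q) (J j x))" .
    qed
    finally have "(\<Oplus>\<^bsub>?N\<^esub>l\<in>{..<n}. compose (carrier P) (blk p i l) (blk q l j)) = blk (p * q) i j" .
    moreover have "(\<Oplus>\<^bsub>?N\<^esub>l\<in>{..<n}. Xi p $$ (i, l) \<otimes>\<^bsub>?N\<^esub> Xi q $$ (l, j)) =
        (\<Oplus>\<^bsub>?N\<^esub>l\<in>{..<n}. compose (carrier P) (blk p i l) (blk q l j))"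
      using cmp ij
      by (intro abelian_monoid.finsum_cong'[OF end_algebra_monoid[OF P] refl]) (simp_all add: Xi_entry)
    ultimately show "Xi (p * q) $$ (i, j) = (Xi p \<otimes>\<^bsub>?M\<^esub> Xi q) $$ (i, j)"
      unfolding mat_algebra_entry(1)[OF ij] Xi_entry[OF ij] by (simp only:)
  qed
  have Xi_add: "Xi (p + q) = Xi p \<oplus>\<^bsub>?M\<^esub> Xi q" if "p \<in> ?aug" "q \<in> ?aug" for p q
  proof (rule carrier_mat_eqI[OF Xi_dim mat_algebra_dims(2)])
    fix i j assume ij: "i < n" "j < n"
    have "Q i (act hact p (J j x) + act hact q (J j x)) = Q i (act hact p (J j x)) \<oplus>\<^bsub>P\<^esub> Q i (act hact q (J j x))"
      if "x \<in> carrier P" for x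
      using left_homD(2)[OF Q[OF ij(1)], of "act hact p (J j x)" "act hact q (J j x)"] aNF JNF[OF ij(2) that]
        \<open>p \<in> ?aug\<close> \<open>q \<in> ?aug\<close> by simp
    then show "Xi (p + q) $$ (i, j) = (Xi p \<oplus>\<^bsub>?M\<^esub> Xi q) $$ (i, j)"
      unfolding mat_algebra_entry(2)[OF ij] Xi_entry[OF ij] by (auto simp: blk_def act_left_simps intro!: restrict_ext)
  qed
  have Xi_one: "Xi hone = \<one>\<^bsub>?M\<^esub>"
  proof (rule carrier_mat_eqI[OF Xi_dim mat_algebra_dims(3)])
    fix i j assume ij: "i < n" "j < n"
    have "Q i (act hact hone (J j x)) = (if i = j then x else \<zero>\<^bsub>P\<^esub>)" if x: "x \<in> carrier P" for x
    proof -
      have "Q i (act hact hone (J j x)) = (\<Oplus>\<^bsub>P\<^esub>l\<in>{..<n}. Q i (J l (Q l (J j x))))"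
        unfolding JQ[OF JNF[OF ij(2) x], symmetric] using ij x by (intro Q_sum JNF QP)
      also have "\<dots> = (\<Oplus>\<^bsub>P\<^esub>l\<in>{..<n}. if i = l then Q l (J j x) else \<zero>\<^bsub>P\<^esub>)"
        using ij x by (intro P.M.finsum_cong'[OF refl]) (simp_all add: QJ QP JNF)
      also have "\<dots> = Q i (J j x)" using ij x by (intro Q_delta QP JNF)
      finally show ?thesis using ij x by (simp add: QJ)
    qed
    then show "Xi hone $$ (i, j) = \<one>\<^bsub>?M\<^esub> $$ (i, j)"
      unfolding mat_algebra_entry(3)[OF ij] Xi_entry[OF ij] by (auto simp: blk_def intro!: restrict_ext)
  qed
  have Xi_scale: "Xi (pscale c p) = c \<odot>\<^bsub>?M\<^esub> Xi p" if p: "p \<in> ?aug" for c p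
  proof (rule carrier_mat_eqI[OF Xi_dim mat_algebra_dims(4)[OF Xi_dim]])
    fix i j assume ij: "i < n" "j < n"
    have "Q i (pscale c y) = (c \<odot>\<^bsub>?A\<^esub> \<one>\<^bsub>?A\<^esub>) \<odot>\<^bsub>P\<^esub> Q i y" if y: "y \<in> NF" for y
    proof -
      have c1: "pscale c (\<Sum>v\<in>verts E. vtx v) \<in> augmentation (wgens E w)" by (rule pscale_mem(1)[OF one_aug])
      have "c \<odot>\<^bsub>?A\<^esub> \<one>\<^bsub>?A\<^esub> = wcls E w (pscale c (\<Sum>v\<in>verts E. vtx v))"
        unfolding wlpa_one[OF wf] by (rule wlpa_smult[OF wf one_aug])
      moreover have "wcls E w (pscale c (\<Sum>v\<in>verts E. vtx v)) \<odot>\<^bsub>?F\<^esub> y = pscale c y"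
        unfolding nfmod_smult[OF c1 y] using act_one[OF y] by (simp only: plinearD(2)[OF plinear_act_left])
      ultimately show ?thesis using left_homD(3)[OF Q[OF ij(1)] wcls_carrier[OF c1], of y] y by simp
    qed
    then show "Xi (pscale c p) $$ (i, j) = (c \<odot>\<^bsub>?M\<^esub> Xi p) $$ (i, j)"
      unfolding mat_algebra_entry(4)[OF ij Xi_dim] Xi_entry[OF ij]
      using ij aNF[OF p] JNF by (auto simp: blk_def act_left_simps intro!: restrict_ext)
  qed
  have Xi_inj: "weq hg hw p q" if p: "p \<in> ?aug" and q: "q \<in> ?aug" and eq: "Xi p = Xi q" for p q
  proof -
    have blk_eq: "blk p i l = blk q i l" if "i < n" "l < n" for i l
      using arg_cong[OF eq, of "\<lambda>X. X $$ (i, l)"] that by (simp add: Xi_entry)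
    \<comment> \<open>The blocks determine the action, because the sum of the \<open>J i\<close>
      after \<open>Q i\<close> is the identity of the hair algebra and can be inserted on both
      sides.\<close>
    have recon: "act hact r x = (\<Sum>i<n. J i (\<Oplus>\<^bsub>P\<^esub>l\<in>{..<n}. blk r i l (Q l x)))" if r: "r \<in> ?aug" and x: "x \<in> NF" for r x
    proof -
      have "act hact r x = (\<Sum>i<n. J i (Q i (act hact r x)))"
        using JQ[OF aNF[OF r x]] hone_act(2)[OF r x] by simp
      also have "\<dots> = (\<Sum>i<n. J i (\<Oplus>\<^bsub>P\<^esub>l\<in>{..<n}. blk r i l (Q l x)))"
      proof (intro sum.cong refl arg_cong[of _ _ "J _"])
        fix i assume "i \<in> {..<n}"
        then have i: "i < n" by simp
        have "act hact r x = (\<Sum>l<n. act hact r (J l (Q l x)))"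
          using hone_act(1)[OF r x] JQ[OF x] by (simp add: plinearD(6)[OF plinear_act_hact, symmetric])
        then have "Q i (act hact r x) = (\<Oplus>\<^bsub>P\<^esub>l\<in>{..<n}. Q i (act hact r (J l (Q l x))))"
          using Q_sum[OF i, of "\<lambda>l. act hact r (J l (Q l x))"] aNF[OF r] JNF QP[OF _ x] by simp
        also have "\<dots> = (\<Oplus>\<^bsub>P\<^esub>l\<in>{..<n}. blk r i l (Q l x))"
          using QP[OF _ x] QP[OF i aNF[OF r JNF]] by (intro P.M.finsum_cong'[OF refl]) (simp_all add: blk_def)
        finally show "Q i (act hact r x) = (\<Oplus>\<^bsub>P\<^esub>l\<in>{..<n}. blk r i l (Q l x))" .
      qed
      finally show ?thesis .
    qed
    have "act hact p x = act hact q x" if x: "x \<in> NF" for x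
      unfolding recon[OF p x] recon[OF q x]
    proof (intro sum.cong refl arg_cong[of _ _ "J _"] P.M.finsum_cong')
      fix i l assume "i \<in> {..<n}" "l \<in> {..<n}"
      then show "blk p i l (Q l x) = blk q i l (Q l x)" by (simp add: blk_eq)
    next
      fix i assume "i \<in> {..<n}"
      then show "(\<lambda>l. blk q i l (Q l x)) \<in> {..<n} \<rightarrow> carrier P"
        using x q by (auto simp: blk_def QP JNF aNF)
    qed
    then have "weq hg hw (p - q) 0"
      using augmentation_closed(2)[OF p q] by (intro hact_faithful) (simp_all add: act_left_simps g_NF)
    then show ?thesis using augmentation_subset[OF p] augmentation_subset[OF q] by (simp add: weq_def)
  qed
  have Xi_surj: "\<exists>p\<in>?aug. Xi p = Y" if Y: "Y \<in> carrier ?M" for Y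
  proof -
    have Yn: "Y \<in> carrier_mat n n" and Ye: "elements_mat Y \<subseteq> carrier ?N"
      using Y unfolding mat_algebra_carrier by blast+
    have Yh: "Y $$ (i, l) \<in> left_hom ?A P P" "Y $$ (i, l) \<in> extensional (carrier P)" if "i < n" "l < n" for i l
      using Ye elements_matI[OF Yn that refl] by auto
    \<comment> \<open>The endomorphism of the model with the given blocks; the retractions
      \<open>Q l\<close> extend it by zero to the complement.\<close>
    define f where "f x = (\<Sum>i<n. \<Sum>l<n. J i ((Y $$ (i, l)) (Q l x)))" for x
    have YQ: "(Y $$ (i, l)) (Q l x) \<in> carrier P" if "i < n" "l < n" "x \<in> NF" for i l x
      using left_homD(1)[OF Yh(1)[OF that(1,2)] QP[OF that(2,3)]] .
    have f: "nfhom f NF"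
      unfolding f_def
    proof (intro nfhom_sum)
      fix i l assume "i \<in> {..<n}" "l \<in> {..<n}"
      then have "(\<lambda>x. J i ((Y $$ (i, l)) (Q l x))) \<in> left_hom ?A ?F ?F"
        by (intro left_hom_comp[OF left_hom_comp[OF Q Yh(1)] J]) simp_all
      then show "nfhom (\<lambda>x. J i ((Y $$ (i, l)) (Q l x))) NF" by (simp add: left_hom_nfmod_iff)
    qed
    have Qe: "Q l (act hact hone x) = Q l x" if l: "l < n" and x: "x \<in> NF" for l x
    proof -
      have "Q l (act hact hone x) = (\<Oplus>\<^bsub>P\<^esub>i\<in>{..<n}. Q l (J i (Q i x)))"
        unfolding JQ[OF x, symmetric] using l x by (intro Q_sum JNF QP)
      also have "\<dots> = (\<Oplus>\<^bsub>P\<^esub>i\<in>{..<n}. if l = i then Q i x else \<zero>\<^bsub>P\<^esub>)"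
        using l x by (intro P.M.finsum_cong'[OF refl]) (simp_all add: QJ QP)
      also have "\<dots> = Q l x" using l x by (intro Q_delta QP)
      finally show ?thesis .
    qed
    have J0: "J i \<zero>\<^bsub>P\<^esub> = 0" if "i < n" for i using left_hom_zero[OF P F J[OF that]] by simp
    have eJ: "act hact hone (J l y) = J l y" if l: "l < n" and y: "y \<in> carrier P" for l y
    proof -
      have "act hact hone (J l y) = (\<Sum>i<n. if i = l then J i y else 0)"
        unfolding JQ[OF JNF[OF l y], symmetric] using l y by (intro sum.cong refl) (simp add: QJ J0)
      then show ?thesis using l by (simp add: sum.delta)
    qed
    obtain p where p: "p \<in> ?aug" "\<And>x. x \<in> NF \<Longrightarrow> act hact p x = f x"
    proof -
      have "\<exists>p\<in>?aug. \<forall>x\<in>NF. act hact p x = f x"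
      proof (rule hact_endo[OF f])
        fix x :: "('v, 'e) word \<Rightarrow>\<^sub>0 'k" assume x: "x \<in> NF"
        show "f (act hact hone x) = f x" by (simp add: f_def Qe[OF _ x])
        show "act hact hone (f x) = f x"
          by (simp add: f_def plinearD[OF plinear_act_hact] eJ YQ[OF _ _ x])
      qed
      then show ?thesis using that by blast
    qed
    have "Xi p = Y"
    proof (rule carrier_mat_eqI[OF Xi_dim Yn])
      fix i j assume ij: "i < n" "j < n"
      have "blk p i j = Y $$ (i, j)"
      proof (rule extensionalityI[of _ "carrier P"])
        show "blk p i j \<in> extensional (carrier P)" by (simp add: blk_def)
        show "Y $$ (i, j) \<in> extensional (carrier P)" by (rule Yh(2)[OF ij])
        fix x assume x: "x \<in> carrier P"
        have Yx: "(Y $$ (i', j)) x \<in> carrier P" if "i' < n" for i'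
          using left_homD(1)[OF Yh(1)[OF that ij(2)] x] .
        have Y0: "(Y $$ (i', l)) \<zero>\<^bsub>P\<^esub> = \<zero>\<^bsub>P\<^esub>" if "i' < n" "l < n" for i' l
          using left_hom_zero[OF P P Yh(1)[OF that]] .
        have "f (J j x) = (\<Sum>i<n. \<Sum>l<n. if l = j then J i ((Y $$ (i, l)) x) else 0)"
          unfolding f_def using ij x by (intro sum.cong refl) (simp add: QJ Y0 J0)
        also have "\<dots> = (\<Sum>i<n. J i ((Y $$ (i, j)) x))" using ij by (simp add: sum.delta)
        finally have "Q i (f (J j x)) = (\<Oplus>\<^bsub>P\<^esub>l\<in>{..<n}. Q i (J l ((Y $$ (l, j)) x)))"
          using Q_sum[OF ij(1), of "\<lambda>l. J l ((Y $$ (l, j)) x)"] JNF Yx by simp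
        also have "\<dots> = (\<Oplus>\<^bsub>P\<^esub>l\<in>{..<n}. if i = l then (Y $$ (l, j)) x else \<zero>\<^bsub>P\<^esub>)"
          using ij Yx by (intro P.M.finsum_cong'[OF refl]) (simp_all add: QJ)
        also have "\<dots> = (Y $$ (i, j)) x" using ij Yx by (intro Q_delta)
        finally show "blk p i j x = (Y $$ (i, j)) x"
          using x by (simp add: blk_def p(2)[OF JNF[OF ij(2) x]])
      qed
      then show "Xi p $$ (i, j) = Y $$ (i, j)" using ij by (simp add: Xi_entry)
    qed
    then show ?thesis using p(1) by blast
  qed
  have Xi_weq: "Xi p = Xi q" if "weq hg hw p q" for p q
  proof (rule carrier_mat_eqI[OF Xi_dim Xi_dim])
    fix i j assume ij: "i < n" "j < n"
    show "Xi p $$ (i, j) = Xi q $$ (i, j)"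
      using hact_weq[OF that JNF[OF ij(2)]] ij by (auto simp: Xi_entry blk_def intro!: restrict_ext)
  qed
  define \<psi> where "\<psi> X = Xi (SOME p. p \<in> ?aug \<and> wcls hg hw p = X)" for X
  have \<psi>: "\<psi> (wcls hg hw p) = Xi p" if p: "p \<in> ?aug" for p
  proof -
    let ?q = "SOME q. q \<in> ?aug \<and> wcls hg hw q = wcls hg hw p"
    have q: "?q \<in> ?aug \<and> wcls hg hw ?q = wcls hg hw p" by (rule someI[of _ p]) (use p in simp)
    then have "weq hg hw ?q p" by (intro wcls_weq[OF hair_wf] augmentation_subset) (use p in auto)
    from Xi_weq[OF this] show ?thesis by (simp add: \<psi>_def)
  qed
  have B: "\<exists>p\<in>?aug. X = wcls hg hw p" if "X \<in> carrier ?B" for X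
    using that unfolding wlpa_carrier[OF hair_wf] by blast
  have "\<psi> \<in> ring_iso ?B ?M"
  proof (rule ring_iso_memI)
    fix X assume "X \<in> carrier ?B"
    then obtain p where p: "p \<in> ?aug" "X = wcls hg hw p" using B by blast
    show "\<psi> X \<in> carrier ?M" unfolding p(2) \<psi>[OF p(1)] by (rule Xi_mem[OF p(1)])
    fix Y assume "Y \<in> carrier ?B"
    then obtain q where q: "q \<in> ?aug" "Y = wcls hg hw q" using B by blast
    show "\<psi> (X \<otimes>\<^bsub>?B\<^esub> Y) = \<psi> X \<otimes>\<^bsub>?M\<^esub> \<psi> Y"
      unfolding p(2) q(2) wlpa_mult[OF hair_wf p(1) q(1)] \<psi>[OF p(1)] \<psi>[OF q(1)]
        \<psi>[OF augmentation_closed(3)[OF p(1) q(1)]] by (rule Xi_mult[OF p(1) q(1)])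
    show "\<psi> (X \<oplus>\<^bsub>?B\<^esub> Y) = \<psi> X \<oplus>\<^bsub>?M\<^esub> \<psi> Y"
      unfolding p(2) q(2) wlpa_add[OF hair_wf p(1) q(1)] \<psi>[OF p(1)] \<psi>[OF q(1)]
        \<psi>[OF augmentation_closed(1)[OF p(1) q(1)]] by (rule Xi_add[OF p(1) q(1)])
  next
    show "\<psi> \<one>\<^bsub>?B\<^esub> = \<one>\<^bsub>?M\<^esub>"
      unfolding wlpa_one[OF hair_wf] hone_def[symmetric] \<psi>[OF hone_aug] by (rule Xi_one)
    show "bij_betw \<psi> (carrier ?B) (carrier ?M)"
      unfolding bij_betw_def
    proof
      show "inj_on \<psi> (carrier ?B)"
      proof (rule inj_onI)
        fix X Y assume XY: "X \<in> carrier ?B" "Y \<in> carrier ?B" "\<psi> X = \<psi> Y"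
        obtain p q where pq: "p \<in> ?aug" "X = wcls hg hw p" "q \<in> ?aug" "Y = wcls hg hw q"
          using B[OF XY(1)] B[OF XY(2)] by blast
        then have "Xi p = Xi q" using XY(3) by (simp add: \<psi>)
        from weq_wcls[OF hair_wf Xi_inj[OF pq(1,3) this]] show "X = Y" using pq by simp
      qed
      show "\<psi> ` carrier ?B = carrier ?M"
      proof
        show "\<psi> ` carrier ?B \<subseteq> carrier ?M"
          using B \<psi> Xi_mem by (metis image_subsetI)
        show "carrier ?M \<subseteq> \<psi> ` carrier ?B"
        proof
          fix Y assume "Y \<in> carrier ?M"
          then obtain p where p: "p \<in> ?aug" "Xi p = Y" using Xi_surj by blast
          then have "Y = \<psi> (wcls hg hw p)" by (simp add: \<psi>)
          then show "Y \<in> \<psi> ` carrier ?B" unfolding wlpa_carrier[OF hair_wf] using p(1) by blast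
        qed
      qed
    qed
  qed
  moreover have "c \<odot>\<^bsub>?B\<^esub> X \<in> carrier ?B \<and> \<psi> (c \<odot>\<^bsub>?B\<^esub> X) = c \<odot>\<^bsub>?M\<^esub> \<psi> X" if X: "X \<in> carrier ?B" for c X
  proof -
    obtain p where p: "p \<in> ?aug" "X = wcls hg hw p" using B[OF X] by blast
    have c: "c \<odot>\<^bsub>?B\<^esub> X = wcls hg hw (pscale c p)" unfolding p(2) by (rule wlpa_smult[OF hair_wf p(1)])
    note cp = pscale_mem(1)[OF p(1), of c]
    show ?thesis
      unfolding c unfolding p(2) \<psi>[OF cp] \<psi>[OF p(1)] wlpa_carrier[OF hair_wf]
      using Xi_scale[OF p(1)] cp by blast
  qed
  ultimately show ?thesis
    by (intro algebra_isomorphic_inverse[of ?B \<psi>] ring_wlpa[OF hair_wf hair_finite])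
qed

end


context finite_vwg begin

text \<open>\<open>nfhom\<close> controls a map on normal forms only. Its values on single words are
  extended linearly to the whole function space, which changes nothing on the model.\<close>

lemma plinear_extension:
  fixes f :: "(('v, 'e) word \<Rightarrow>\<^sub>0 'k::field) \<Rightarrow> (('v, 'e) word \<Rightarrow>\<^sub>0 'k)"
  assumes f: "nfhom f NF"
  shows "\<exists>f'. plinear f' \<and> nfhom f' NF \<and> (\<forall>x\<in>NF. f' x = f x)"
proof -
  define f' where "f' = pext (\<lambda>a. f (Poly_Mapping.single a 1))"
  have eq: "f' x = f x" if x: "x \<in> NF" for x
  proof -
    let ?s = "\<lambda>a. pscale (Poly_Mapping.lookup x a) (Poly_Mapping.single a 1)"
    have nw: "nw a" if "a \<in> Poly_Mapping.keys x" for a using that x by (auto simp: NF_def)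
    have s: "Poly_Mapping.single a 1 \<in> NF" if "a \<in> Poly_Mapping.keys x" for a
      using single_mem(1)[OF nw[OF that]] NFv_subset by blast
    have "f x = f (\<Sum>a\<in>Poly_Mapping.keys x. ?s a)"
      using arg_cong[OF poly_mapping_sum_singles[OF wf, where p = x], of f] by simp
    also have "\<dots> = (\<Sum>a\<in>Poly_Mapping.keys x. f (?s a))"
      by (rule nfhom_sum_apply[OF f]) (intro NF_closed s)
    also have "\<dots> = f' x"
      unfolding f'_def pext_def by (intro sum.cong refl nfhomD(3)[OF f s])
    finally show ?thesis by simp
  qed
  moreover have "nfhom f' NF"
    using f unfolding nfhom_iff_tau by (simp add: eq NF_closed tau_mem)
  ultimately show ?thesis using plinear_pext f'_def by blast
qed

lemma ext0_eq_act:
  assumes u: "u \<in> verts E" and y: "y \<in> NFv u" and z: "z \<in> NF" "ext0 u (bgen u 0) z = z"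
  shows "ext0 u y z = act tau (evp 0 z) y"
proof -
  have "ext0 u y z = ext0 u y (act tau (evp 0 z) (bgen u 0))" using act_evp_0[OF u z] by simp
  also have "\<dots> = act tau (evp 0 z) (ext0 u y (bgen u 0))"
    by (rule act_nfhom[OF ext0_nfhom[OF y] augmentation_subset[OF evp_mem[OF z(1)]] bgen_mem(2)[OF u]])
  finally show ?thesis by simp
qed

theorem progenerator_endomorphisms:
  fixes P :: "(('k::field, 'v, 'e) wlp, 'p) module"
  assumes "fin_gen_module (wlpa E w) P" "projective_module (wlpa E w) P" "generator_module (wlpa E w) P"
  shows "\<exists>n>0. \<exists>E' w'. hair_extension E w E' w' \<and>
    algebra_isomorphic (mat_algebra n (end_algebra (wlpa E w) P)) (wlpa E' w')"
proof -
  let ?A = "wlpa E w :: ('k, ('k, 'v, 'e) wlp) module"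
  obtain n :: nat and J Q h g \<gamma> where n: "0 < n"
    and JQ: "\<forall>i<n. J i \<in> left_hom ?A P nfmod \<and> Q i \<in> left_hom ?A nfmod P"
    and QJ: "\<forall>i<n. \<forall>l<n. \<forall>y\<in>carrier P. Q l (J i y) = (if l = i then y else \<zero>\<^bsub>P\<^esub>)"
    and h: "\<forall>v\<in>verts E. 0 < h v"
    and g: "\<forall>v\<in>verts E. \<forall>j<(h v :: nat). g v j \<in> NFv v \<and> nfhom (\<gamma> v j) NF \<and>
       (\<forall>v'\<in>verts E. \<forall>j'<h v'. \<gamma> v j (g v' j') = (if v = v' \<and> j = j' then bgen v 0 else 0)) \<and>
       (\<forall>x\<in>NF. ext0 v (bgen v 0) (\<gamma> v j x) = \<gamma> v j x)"
    and dec: "\<forall>x\<in>NF. (\<Sum>i<n. J i (Q i x)) = (\<Sum>v\<in>verts E. \<Sum>j<h v. ext0 v (g v j) (\<gamma> v j x))"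
    using progenerator_structure[OF assms] by (elim exE conjE) (rule that; assumption)
  \<comment> \<open>\<open>hair_model\<close> asks for linearity at every index, so the coordinates
    are replaced by globally linear ones and set to zero outside the hair graph.\<close>
  define \<gamma>' where "\<gamma>' c = (if c \<in> verts (hair_graph E h)
    then SOME f. plinear f \<and> nfhom f NF \<and> (\<forall>x\<in>NF. f x = \<gamma> (fst c) (snd c) x) else (\<lambda>_. 0))" for c
  have hv: "c \<in> verts (hair_graph E h) \<longleftrightarrow> fst c \<in> verts E \<and> snd c < h (fst c)" for c
    by (auto simp: hair_graph_def)
  have \<gamma>': "plinear (\<gamma>' c) \<and> nfhom (\<gamma>' c) NF \<and> (\<forall>x\<in>NF. \<gamma>' c x = \<gamma> (fst c) (snd c) x)"
    if "c \<in> verts (hair_graph E h)" for c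
  proof -
    have "nfhom (\<gamma> (fst c) (snd c)) NF" using g that by (simp add: hv)
    from someI_ex[OF plinear_extension[OF this]] that show ?thesis by (simp add: \<gamma>'_def)
  qed
  have gm: "g v j \<in> NFv v" "nfhom (\<gamma> v j) NF"
    "\<And>x. x \<in> NF \<Longrightarrow> ext0 v (bgen v 0) (\<gamma> v j x) = \<gamma> v j x" if "v \<in> verts E" "j < h v" for v j
    using g that by simp_all
  interpret hair_model E w h "\<lambda>c. g (fst c) (snd c)" \<gamma>'
  proof
    fix c d
    show "plinear (\<gamma>' c)"
      using \<gamma>'[of c] by (cases "c \<in> verts (hair_graph E h)") (simp_all add: \<gamma>'_def plinear_intros)
    assume c: "c \<in> verts (hair_graph E h)"
    show "g (fst c) (snd c) \<in> NFv (fst c)" using c by (simp add: hv gm)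
    show "nfhom (\<gamma>' c) NF" using \<gamma>'[OF c] by simp
    assume d: "d \<in> verts (hair_graph E h)"
    have "g (fst d) (snd d) \<in> NF" using d NFv_subset[OF gm(1)[of "fst d" "snd d"]] by (simp add: hv)
    then have "\<gamma>' c (g (fst d) (snd d)) = \<gamma> (fst c) (snd c) (g (fst d) (snd d))" using \<gamma>'[OF c] by simp
    then show "\<gamma>' c (g (fst d) (snd d)) = (if c = d then bgen (fst c) 0 else 0)"
      using g c d by (auto simp: hv prod_eq_iff)
  qed (use h in simp)
  have e: "(\<Sum>i<n. J i (Q i x)) = act hact hone x" if x: "x \<in> NF" for x
  proof -
    have "(\<Sum>i<n. J i (Q i x)) = (\<Sum>v\<in>verts E. \<Sum>j<h v. act tau (evp 0 (\<gamma>' (v, j) x)) (g v j))"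
      unfolding dec[rule_format, OF x]
    proof (intro sum.cong refl)
      fix v j assume "v \<in> verts E" "j \<in> {..<h v}"
      then have v: "v \<in> verts E" "j < h v" by simp_all
      then have "\<gamma>' (v, j) x = \<gamma> v j x" using \<gamma>'[of "(v, j)"] x by (simp add: hv)
      then show "ext0 v (g v j) (\<gamma> v j x) = act tau (evp 0 (\<gamma>' (v, j) x)) (g v j)"
        using ext0_eq_act[OF v(1) gm(1)[OF v] nfhomD(1)[OF gm(2)[OF v] x] gm(3)[OF v x]] by simp
    qed
    also have "\<dots> = (\<Sum>c\<in>Sigma (verts E) (\<lambda>v. {..<h v}). act tau (evp 0 (\<gamma>' c x)) (g (fst c) (snd c)))"
      by (simp add: sum.Sigma case_prod_beta)
    also have "Sigma (verts E) (\<lambda>v. {..<h v}) = verts (hair_graph E h)" by (auto simp: hair_graph_def)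
    finally show ?thesis by (simp add: act_hone[OF x])
  qed
  have "left_module ?A P" using assms(1) by (simp add: fin_gen_module_def)
  then have "algebra_isomorphic (mat_algebra n (end_algebra ?A P)) (wlpa (hair_graph E h) (hair_weight w))"
    using JQ QJ e by (intro matrix_iso[where J = J and Q = Q]) simp_all
  moreover have "hair_extension E w (hair_graph E h) (hair_weight w)"
    using h by (auto simp: hair_extension_def)
  ultimately show ?thesis using n by blast
qed

end

theorem theorem3p7:
  fixes E :: "('v, 'e) pre_digraph" and w :: "'e \<Rightarrow> nat"
    and P :: "(('k::field, 'v, 'e) wlp, 'p) module"
  assumes "fin_digraph E" and "vertex_weighted_graph E w"
    and "fin_gen_module (wlpa E w) P"
    and "projective_module (wlpa E w) P"
    and "generator_module (wlpa E w) P"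
  shows "\<exists>n>0. \<exists>E' w'. hair_extension E w E' w' \<and>
           algebra_isomorphic (mat_algebra n (end_algebra (wlpa E w) P)) (wlpa E' w')"
  by (rule finite_vwg.progenerator_endomorphisms[OF finite_vwg.intro[OF assms(1,2)] assms(3-5)])

end
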